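(* 1) There exist uniquely determined algebra automorphisms $\tau_1,\tau_2,\tau_3,\tau_4$ of $U_q'(\mathfrak k)$ such that for $x\in kT_\theta$ $$\tau_1(x)=T_1T_6(x),\quad \tau_2(x)=T_3T_5(x),\quad \tau_3(x)=T_4(x),\quad \tau_4(x)=T_2(x),$$ and such that on the generators $B_1,\dots,B_6$: - $\tau_1(B_1)=qK_6K_1^{-1}B_6$, $\tau_1(B_j)=B_j$ for $j=2,4$, $\tau_1(B_3)=q^{-1/2}[B_3,B_1]_q$, $\tau_1(B_5)=q^{-1/2}[B_5,B_6]_q$, $\tau_1(B_6)=qK_1K_6^{-1}B_1$; - $\tau_2(B_1)=q^{-1/2}[B_1,B_3]_q$, $\tau_2(B_2)=B_2$, $\tau_2(B_3)=qK_5K_3^{-1}B_5$, $\tau_2(B_4)=q^{-1}[[B_4,B_3]_q,B_5]_q+B_4K_3K_5^{-1}$, $\tau_2(B_5)=qK_3K_5^{-1}B_3$, $\tau_2(B_6)=q^{-1/2}[B_6,B_5]_q$; - $\tau_3(B_j)=B_j$ for $j=1,4,6$, $\tau_3(B_j)=[B_j,B_4]_q$ for $j=2,3,5$; - $\tau_4(B_j)=B_j$ for $j=1,2,3,5,6$, $\tau_4(B_4)=[B_4,B_2]_q$. 2) There exists a unique group homomorphism $Br(\mathfrak f_4)\to\mathrm{Aut}_{alg}(U_q'(\mathfrak k))$ such that $\overline s_i\mapsto\tau_i$ for all $i=1,\dots,4$.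
   Context: Let $k$ be a field containing $q\neq0$, not a root of unity, and a square root $q^{1/2}$ of $q$. Let $\mathfrak g=\mathfrak e_6$ with simple roots $\alpha_1,\dots,\alpha_6$ in Bourbaki ordering (edges of the Dynkin diagram: $1-3$, $3-4$, $4-5$, $5-6$, $2-4$) and Cartan matrix $(a_{ij})$. $U_q(\mathfrak g)$ is the $k$-algebra with generators $E_i,F_i,K_i^{\pm1}$ ($1\le i\le 6$) and relations $K_iK_i^{-1}=K_i^{-1}K_i=1$, $K_iK_j=K_jK_i$, $K_iE_jK_i^{-1}=q^{a_{ij}}E_j$, $K_iF_jK_i^{-1}=q^{-a_{ij}}F_j$, $E_iF_j-F_jE_i=\delta_{ij}(K_i-K_i^{-1})/(q-q^{-1})$, and quantum Serre relations ($X_iX_j=X_jX_i$ if $a_{ij}=0$; $X_i^2X_j-(q+q^{-1})X_iX_jX_i+X_jX_i^2=0$ if $a_{ij}=-1$; for $X=E$ and $X=F$). $U_q'(\mathfrak k)$ is the $k$-subalgebra of $U_q(\mathfrak g)$ generated by $B_1=F_1-K_1^{-1}E_6$, $B_2=F_2-K_2^{-1}E_2$, $B_3=F_3-K_3^{-1}E_5$, $B_4=F_4-K_4^{-1}E_4$, $B_5=F_5-K_5^{-1}E_3$, $B_6=F_6-K_6^{-1}E_1$, and $(K_1K_6^{-1})^{\pm1}$, $(K_3K_5^{-1})^{\pm1}$. $kT_\theta$ is the subalgebra generated by $(K_1K_6^{-1})^{\pm1}$, $(K_3K_5^{-1})^{\pm1}$. $T_i$ denotes the Lusztig automorphism of $U_q(\mathfrak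 g)$; on the $K_j$ it acts by $T_i(K_j)=K_jK_i^{-a_{ij}}$. Write $[a,b]_q=ab-qba$. $Br(\mathfrak f_4)$ is the braid group of type $F_4$: generators $\overline s_1,\dots,\overline s_4$, relations $\overline s_1\overline s_2\overline s_1=\overline s_2\overline s_1\overline s_2$, $\overline s_2\overline s_3\overline s_2\overline s_3=\overline s_3\overline s_2\overline s_3\overline s_2$, $\overline s_3\overline s_4\overline s_3=\overline s_4\overline s_3\overline s_4$, $\overline s_i\overline s_j=\overline s_j\overline s_i$ for $|i-j|>1$. $\mathrm{Aut}_{alg}$ denotes the group of $k$-algebra automorphisms. *)

theory Defs
  imports "HOL-Library.Poly_Mapping" "HOL-Algebra.QuotRing" "HOL-Algebra.Subrings" "HOL-Algebra.Bij"
begin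

section \<open>Associative algebras\<close>

text \<open>
  A \<open>k\<close>-algebra is a (not necessarily commutative) ring record extended by a scalar
  multiplication, i.e. a value of the record type \<open>('k, 'a) module\<close>. The locale \<open>algebra\<close> of
  \<open>HOL-Algebra\<close> is not used because it describes commutative algebras only.
\<close>

definition subalgebras :: "('k, 'a) module \<Rightarrow> 'a set set" where
  "subalgebras A = {V. subring V A \<and> (\<forall>c. \<forall>x\<in>V. c \<odot>\<^bsub>A\<^esub> x \<in> V)}"

definition subalgebra_generated :: "('k, 'a) module \<Rightarrow> 'a set \<Rightarrow> 'a set" where
  "subalgebra_generated A S = \<Inter>{V \<in> subalgebras A. S \<subseteq> V}"

text \<open>As for \<^const>\<open>BijGroup\<close>, automorphisms are extensional functions on the carrier.\<close>

definition algebra_auts :: "('k, 'a) module \<Rightarrow> ('a \<Rightarrow> 'a) set" where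
  "algebra_auts A =
     {f \<in> ring_hom A A \<inter> Bij (carrier A). \<forall>c. \<forall>x\<in>carrier A. f (c \<odot>\<^bsub>A\<^esub> x) = c \<odot>\<^bsub>A\<^esub> f x}"

definition Aut_alg :: "('k, 'a) module \<Rightarrow> ('a \<Rightarrow> 'a) monoid" where
  "Aut_alg A = (BijGroup (carrier A)) \<lparr>carrier := algebra_auts A\<rparr>"

definition q_commutator :: "('k, 'a) module \<Rightarrow> 'k \<Rightarrow> 'a \<Rightarrow> 'a \<Rightarrow> 'a" where
  "q_commutator A q a b = (a \<otimes>\<^bsub>A\<^esub> b) \<ominus>\<^bsub>A\<^esub> (q \<odot>\<^bsub>A\<^esub> (b \<otimes>\<^bsub>A\<^esub> a))"


section \<open>Algebras given by generators and relations\<close>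

text \<open>
  Words under concatenation form an additive monoid, so that finitely supported functions on
  words with the convolution product of \<^theory>\<open>HOL-Library.Poly_Mapping\<close> are the
  noncommutative polynomials.
\<close>

datatype 'g fmonoid = FMonoid "'g list"

instantiation fmonoid :: (type) monoid_add
begin

definition zero_fmonoid :: "'a fmonoid" where
  "zero_fmonoid = FMonoid []"

fun plus_fmonoid :: "'a fmonoid \<Rightarrow> 'a fmonoid \<Rightarrow> 'a fmonoid" where
  "plus_fmonoid (FMonoid u) (FMonoid v) = FMonoid (u @ v)"

instance
proof
  fix a b c :: "'a fmonoid"
  show "a + b + c = a + (b + c)"
    by (cases a; cases b; cases c) simp
  show "0 + a = a" "a + 0 = a"
    by (cases a; simp add: zero_fmonoid_def)+
qed

end

type_synonym ('k, 'g) ncpoly = "'g fmonoid \<Rightarrow>\<^sub>0 'k"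

definition ncvar :: "'g \<Rightarrow> ('k::field, 'g) ncpoly" where
  "ncvar g = Poly_Mapping.single (FMonoid [g]) 1"

definition ncconst :: "'k::field \<Rightarrow> ('k, 'g) ncpoly" where
  "ncconst c = Poly_Mapping.single 0 c"

definition free_algebra :: "('k::field, ('k, 'g) ncpoly) module" where
  "free_algebra =
     \<lparr>carrier = UNIV, mult = (*), one = 1, zero = 0, add = (+), smult = (\<lambda>c x. ncconst c * x)\<rparr>"

text \<open>
  The quotient of the free algebra by the two-sided ideal generated by \<open>R\<close>; its elements are
  cosets.
\<close>

definition presented_algebra ::
  "('k::field, 'g) ncpoly set \<Rightarrow> ('k, ('k, 'g) ncpoly set) module" where
  "presented_algebra R =
     (let I = Idl\<^bsub>free_algebra\<^esub> R; Q = free_algebra Quot I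
      in \<lparr>carrier = carrier Q, mult = mult Q, one = one Q, zero = zero Q, add = add Q,
          smult = (\<lambda>c X. \<Union>x\<in>X. I +>\<^bsub>free_algebra\<^esub> (c \<odot>\<^bsub>free_algebra\<^esub> x))\<rparr>)"

definition presented_gen ::
  "('k::field, 'g) ncpoly set \<Rightarrow> 'g \<Rightarrow> ('k, 'g) ncpoly set" where
  "presented_gen R g = (Idl\<^bsub>free_algebra\<^esub> R) +>\<^bsub>free_algebra\<^esub> (ncvar g)"


section \<open>Groups given by generators and relations\<close>

text \<open>
  Words in the letters \<open>(g, True)\<close> for a generator \<open>g\<close> and \<open>(g, False)\<close> for its inverse.
  A relation \<open>(u, v)\<close> stands for the equation \<open>u = v\<close>.
\<close>

inductive pres_cong ::
  "(('g \<times> bool) list \<times> ('g \<times> bool) list) set \<Rightarrow> ('g \<times> bool) list \<Rightarrow> ('g \<times> bool) list \<Rightarrow> bool"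
  for R where
  rel: "(u, v) \<in> R \<Longrightarrow> pres_cong R u v"
| cancel: "pres_cong R [(g, b), (g, \<not> b)] []"
| refl: "pres_cong R u u"
| sym: "pres_cong R u v \<Longrightarrow> pres_cong R v u"
| trans: "pres_cong R u v \<Longrightarrow> pres_cong R v w \<Longrightarrow> pres_cong R u w"
| append: "pres_cong R u v \<Longrightarrow> pres_cong R u' v' \<Longrightarrow> pres_cong R (u @ u') (v @ v')"

definition pres_class ::
  "(('g \<times> bool) list \<times> ('g \<times> bool) list) set \<Rightarrow> ('g \<times> bool) list \<Rightarrow> ('g \<times> bool) list set" where
  "pres_class R u = {v. pres_cong R u v}"

definition presented_group ::
  "(('g \<times> bool) list \<times> ('g \<times> bool) list) set \<Rightarrow> ('g \<times> bool) list set monoid" where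
  "presented_group R =
     \<lparr>carrier = range (pres_class R),
      mult = (\<lambda>X Y. \<Union>u\<in>X. \<Union>v\<in>Y. pres_class R (u @ v)),
      one = pres_class R []\<rparr>"


section \<open>The quantized enveloping algebra of type \<open>E6\<close>\<close>

datatype e6 = \<alpha>\<^sub>1 | \<alpha>\<^sub>2 | \<alpha>\<^sub>3 | \<alpha>\<^sub>4 | \<alpha>\<^sub>5 | \<alpha>\<^sub>6

definition e6_edges :: "(e6 \<times> e6) set" where
  "e6_edges = {(\<alpha>\<^sub>1, \<alpha>\<^sub>3), (\<alpha>\<^sub>3, \<alpha>\<^sub>4), (\<alpha>\<^sub>4, \<alpha>\<^sub>5), (\<alpha>\<^sub>5, \<alpha>\<^sub>6), (\<alpha>\<^sub>2, \<alpha>\<^sub>4)}"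

definition cartan :: "e6 \<Rightarrow> e6 \<Rightarrow> int" where
  "cartan i j = (if i = j then 2 else if (i, j) \<in> e6_edges \<or> (j, i) \<in> e6_edges then -1 else 0)"

datatype uq_gen = GE e6 | GF e6 | GK e6 | GKinv e6

abbreviation vE :: "e6 \<Rightarrow> ('k::field, uq_gen) ncpoly" where "vE i \<equiv> ncvar (GE i)"
abbreviation vF :: "e6 \<Rightarrow> ('k::field, uq_gen) ncpoly" where "vF i \<equiv> ncvar (GF i)"
abbreviation vK :: "e6 \<Rightarrow> ('k::field, uq_gen) ncpoly" where "vK i \<equiv> ncvar (GK i)"
abbreviation vKinv :: "e6 \<Rightarrow> ('k::field, uq_gen) ncpoly" where "vKinv i \<equiv> ncvar (GKinv i)"

definition serre_poly ::
  "'k::field \<Rightarrow> ('k, uq_gen) ncpoly \<Rightarrow> ('k, uq_gen) ncpoly \<Rightarrow> ('k, uq_gen) ncpoly" where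
  "serre_poly q x y = x * x * y - ncconst (q + inverse q) * x * y * x + y * x * x"

text \<open>Each element \<open>p\<close> of the following set stands for the relation \<open>p = 0\<close>.\<close>

inductive_set uq_relations :: "'k::field \<Rightarrow> ('k, uq_gen) ncpoly set" for q where
  "vK i * vKinv i - 1 \<in> uq_relations q"
| "vKinv i * vK i - 1 \<in> uq_relations q"
| "vK i * vK j - vK j * vK i \<in> uq_relations q"
| "vK i * vE j * vKinv i - ncconst (q powi cartan i j) * vE j \<in> uq_relations q"
| "vK i * vF j * vKinv i - ncconst (q powi (- cartan i j)) * vF j \<in> uq_relations q"
| "vE i * vF i - vF i * vE i - ncconst (inverse (q - inverse q)) * (vK i - vKinv i)
     \<in> uq_relations q"
| "i \<noteq> j \<Longrightarrow> vE i * vF j - vF j * vE i \<in> uq_relations q"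
| "cartan i j = 0 \<Longrightarrow> vE i * vE j - vE j * vE i \<in> uq_relations q"
| "cartan i j = 0 \<Longrightarrow> vF i * vF j - vF j * vF i \<in> uq_relations q"
| "cartan i j = -1 \<Longrightarrow> serre_poly q (vE i) (vE j) \<in> uq_relations q"
| "cartan i j = -1 \<Longrightarrow> serre_poly q (vF i) (vF j) \<in> uq_relations q"

type_synonym 'k uq = "('k, uq_gen) ncpoly set"

definition Uq :: "'k::field \<Rightarrow> ('k, 'k uq) module" where
  "Uq q = presented_algebra (uq_relations q)"

definition E :: "'k::field \<Rightarrow> e6 \<Rightarrow> 'k uq" where
  "E q i = presented_gen (uq_relations q) (GE i)"

definition F :: "'k::field \<Rightarrow> e6 \<Rightarrow> 'k uq" where
  "F q i = presented_gen (uq_relations q) (GF i)"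

definition K :: "'k::field \<Rightarrow> e6 \<Rightarrow> 'k uq" where
  "K q i = presented_gen (uq_relations q) (GK i)"

definition Kinv :: "'k::field \<Rightarrow> e6 \<Rightarrow> 'k uq" where
  "Kinv q i = presented_gen (uq_relations q) (GKinv i)"

text \<open>
  The Lusztig automorphism \<open>T\<^sub>i\<close> is \<open>T''\<^sub>i\<^sub>,\<^sub>1\<close> in Lusztig's notation, with the
  normalisation of Jantzen's \<^emph>\<open>Lectures on Quantum Groups\<close>, 8.14.
\<close>

definition lusztig_T :: "'k::field \<Rightarrow> e6 \<Rightarrow> 'k uq \<Rightarrow> 'k uq" where
  "lusztig_T q i = (THE T. T \<in> algebra_auts (Uq q) \<and>
     (\<forall>j. T (K q j) = K q j \<otimes>\<^bsub>Uq q\<^esub> (K q i [^]\<^bsub>Uq q\<^esub> (- cartan i j))) \<and>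
     T (E q i) = \<ominus>\<^bsub>Uq q\<^esub> (F q i \<otimes>\<^bsub>Uq q\<^esub> K q i) \<and>
     T (F q i) = \<ominus>\<^bsub>Uq q\<^esub> (Kinv q i \<otimes>\<^bsub>Uq q\<^esub> E q i) \<and>
     (\<forall>j. cartan i j = 0 \<longrightarrow> T (E q j) = E q j \<and> T (F q j) = F q j) \<and>
     (\<forall>j. cartan i j = -1 \<longrightarrow>
        T (E q j) = q_commutator (Uq q) (inverse q) (E q i) (E q j) \<and>
        T (F q j) = q_commutator (Uq q) q (F q j) (F q i)))"


section \<open>The quantum symmetric pair coideal subalgebra\<close>

fun diagram_aut :: "e6 \<Rightarrow> e6" where
  "diagram_aut \<alpha>\<^sub>1 = \<alpha>\<^sub>6"
| "diagram_aut \<alpha>\<^sub>2 = \<alpha>\<^sub>2"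
| "diagram_aut \<alpha>\<^sub>3 = \<alpha>\<^sub>5"
| "diagram_aut \<alpha>\<^sub>4 = \<alpha>\<^sub>4"
| "diagram_aut \<alpha>\<^sub>5 = \<alpha>\<^sub>3"
| "diagram_aut \<alpha>\<^sub>6 = \<alpha>\<^sub>1"

definition B :: "'k::field \<Rightarrow> e6 \<Rightarrow> 'k uq" where
  "B q i = F q i \<ominus>\<^bsub>Uq q\<^esub> (Kinv q i \<otimes>\<^bsub>Uq q\<^esub> E q (diagram_aut i))"

definition KK :: "'k::field \<Rightarrow> e6 \<Rightarrow> e6 \<Rightarrow> 'k uq" where
  "KK q i j = K q i \<otimes>\<^bsub>Uq q\<^esub> Kinv q j"

text \<open>
  Since the \<open>K\<^sub>i\<close> commute, \<open>K\<^sub>6 K\<^sub>1\<^sup>-\<^sup>1\<close> and \<open>K\<^sub>5 K\<^sub>3\<^sup>-\<^sup>1\<close> are the inverses of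
  \<open>K\<^sub>1 K\<^sub>6\<^sup>-\<^sup>1\<close> and \<open>K\<^sub>3 K\<^sub>5\<^sup>-\<^sup>1\<close>.
\<close>

definition torus_gens :: "'k::field \<Rightarrow> 'k uq set" where
  "torus_gens q = {KK q \<alpha>\<^sub>1 \<alpha>\<^sub>6, KK q \<alpha>\<^sub>6 \<alpha>\<^sub>1, KK q \<alpha>\<^sub>3 \<alpha>\<^sub>5, KK q \<alpha>\<^sub>5 \<alpha>\<^sub>3}"

definition kT\<theta> :: "'k::field \<Rightarrow> 'k uq set" where
  "kT\<theta> q = subalgebra_generated (Uq q) (torus_gens q)"

definition Uqk :: "'k::field \<Rightarrow> ('k, 'k uq) module" where
  "Uqk q = (Uq q) \<lparr>carrier := subalgebra_generated (Uq q) (range (B q) \<union> torus_gens q)\<rparr>"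


section \<open>The braid group of type \<open>F4\<close> and the prescribed values of the automorphisms\<close>

datatype f4 = \<sigma>\<^sub>1 | \<sigma>\<^sub>2 | \<sigma>\<^sub>3 | \<sigma>\<^sub>4

abbreviation pos_word :: "'g list \<Rightarrow> ('g \<times> bool) list" where
  "pos_word gs \<equiv> map (\<lambda>g. (g, True)) gs"

definition f4_relations :: "((f4 \<times> bool) list \<times> (f4 \<times> bool) list) set" where
  "f4_relations =
    {(pos_word [\<sigma>\<^sub>1, \<sigma>\<^sub>2, \<sigma>\<^sub>1], pos_word [\<sigma>\<^sub>2, \<sigma>\<^sub>1, \<sigma>\<^sub>2]),
     (pos_word [\<sigma>\<^sub>2, \<sigma>\<^sub>3, \<sigma>\<^sub>2, \<sigma>\<^sub>3], pos_word [\<sigma>\<^sub>3, \<sigma>\<^sub>2, \<sigma>\<^sub>3, \<sigma>\<^sub>2]),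
     (pos_word [\<sigma>\<^sub>3, \<sigma>\<^sub>4, \<sigma>\<^sub>3], pos_word [\<sigma>\<^sub>4, \<sigma>\<^sub>3, \<sigma>\<^sub>4]),
     (pos_word [\<sigma>\<^sub>1, \<sigma>\<^sub>3], pos_word [\<sigma>\<^sub>3, \<sigma>\<^sub>1]),
     (pos_word [\<sigma>\<^sub>1, \<sigma>\<^sub>4], pos_word [\<sigma>\<^sub>4, \<sigma>\<^sub>1]),
     (pos_word [\<sigma>\<^sub>2, \<sigma>\<^sub>4], pos_word [\<sigma>\<^sub>4, \<sigma>\<^sub>2])}"

definition Br_f4 :: "(f4 \<times> bool) list set monoid" where
  "Br_f4 = presented_group f4_relations"

definition s_bar :: "f4 \<Rightarrow> (f4 \<times> bool) list set" where
  "s_bar i = pres_class f4_relations [(i, True)]"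

fun tau_torus :: "'k::field \<Rightarrow> f4 \<Rightarrow> 'k uq \<Rightarrow> 'k uq" where
  "tau_torus q \<sigma>\<^sub>1 x = lusztig_T q \<alpha>\<^sub>1 (lusztig_T q \<alpha>\<^sub>6 x)"
| "tau_torus q \<sigma>\<^sub>2 x = lusztig_T q \<alpha>\<^sub>3 (lusztig_T q \<alpha>\<^sub>5 x)"
| "tau_torus q \<sigma>\<^sub>3 x = lusztig_T q \<alpha>\<^sub>4 x"
| "tau_torus q \<sigma>\<^sub>4 x = lusztig_T q \<alpha>\<^sub>2 x"

text \<open>The parameter \<open>r\<close> is the chosen square root of \<open>q\<close>.\<close>

fun tau_B :: "'k::field \<Rightarrow> 'k \<Rightarrow> f4 \<Rightarrow> e6 \<Rightarrow> 'k uq" where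
  "tau_B q r \<sigma>\<^sub>1 \<alpha>\<^sub>1 = q \<odot>\<^bsub>Uq q\<^esub> (KK q \<alpha>\<^sub>6 \<alpha>\<^sub>1 \<otimes>\<^bsub>Uq q\<^esub> B q \<alpha>\<^sub>6)"
| "tau_B q r \<sigma>\<^sub>1 \<alpha>\<^sub>2 = B q \<alpha>\<^sub>2"
| "tau_B q r \<sigma>\<^sub>1 \<alpha>\<^sub>3 = inverse r \<odot>\<^bsub>Uq q\<^esub> q_commutator (Uq q) q (B q \<alpha>\<^sub>3) (B q \<alpha>\<^sub>1)"
| "tau_B q r \<sigma>\<^sub>1 \<alpha>\<^sub>4 = B q \<alpha>\<^sub>4"
| "tau_B q r \<sigma>\<^sub>1 \<alpha>\<^sub>5 = inverse r \<odot>\<^bsub>Uq q\<^esub> q_commutator (Uq q) q (B q \<alpha>\<^sub>5) (B q \<alpha>\<^sub>6)"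
| "tau_B q r \<sigma>\<^sub>1 \<alpha>\<^sub>6 = q \<odot>\<^bsub>Uq q\<^esub> (KK q \<alpha>\<^sub>1 \<alpha>\<^sub>6 \<otimes>\<^bsub>Uq q\<^esub> B q \<alpha>\<^sub>1)"

| "tau_B q r \<sigma>\<^sub>2 \<alpha>\<^sub>1 = inverse r \<odot>\<^bsub>Uq q\<^esub> q_commutator (Uq q) q (B q \<alpha>\<^sub>1) (B q \<alpha>\<^sub>3)"
| "tau_B q r \<sigma>\<^sub>2 \<alpha>\<^sub>2 = B q \<alpha>\<^sub>2"
| "tau_B q r \<sigma>\<^sub>2 \<alpha>\<^sub>3 = q \<odot>\<^bsub>Uq q\<^esub> (KK q \<alpha>\<^sub>5 \<alpha>\<^sub>3 \<otimes>\<^bsub>Uq q\<^esub> B q \<alpha>\<^sub>5)"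
| "tau_B q r \<sigma>\<^sub>2 \<alpha>\<^sub>4 =
     (inverse q \<odot>\<^bsub>Uq q\<^esub>
       q_commutator (Uq q) q (q_commutator (Uq q) q (B q \<alpha>\<^sub>4) (B q \<alpha>\<^sub>3)) (B q \<alpha>\<^sub>5))
     \<oplus>\<^bsub>Uq q\<^esub> (B q \<alpha>\<^sub>4 \<otimes>\<^bsub>Uq q\<^esub> KK q \<alpha>\<^sub>3 \<alpha>\<^sub>5)"
| "tau_B q r \<sigma>\<^sub>2 \<alpha>\<^sub>5 = q \<odot>\<^bsub>Uq q\<^esub> (KK q \<alpha>\<^sub>3 \<alpha>\<^sub>5 \<otimes>\<^bsub>Uq q\<^esub> B q \<alpha>\<^sub>3)"
| "tau_B q r \<sigma>\<^sub>2 \<alpha>\<^sub>6 = inverse r \<odot>\<^bsub>Uq q\<^esub> q_commutator (Uq q) q (B q \<alpha>\<^sub>6) (B q \<alpha>\<^sub>5)"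

| "tau_B q r \<sigma>\<^sub>3 \<alpha>\<^sub>1 = B q \<alpha>\<^sub>1"
| "tau_B q r \<sigma>\<^sub>3 \<alpha>\<^sub>2 = q_commutator (Uq q) q (B q \<alpha>\<^sub>2) (B q \<alpha>\<^sub>4)"
| "tau_B q r \<sigma>\<^sub>3 \<alpha>\<^sub>3 = q_commutator (Uq q) q (B q \<alpha>\<^sub>3) (B q \<alpha>\<^sub>4)"
| "tau_B q r \<sigma>\<^sub>3 \<alpha>\<^sub>4 = B q \<alpha>\<^sub>4"
| "tau_B q r \<sigma>\<^sub>3 \<alpha>\<^sub>5 = q_commutator (Uq q) q (B q \<alpha>\<^sub>5) (B q \<alpha>\<^sub>4)"
| "tau_B q r \<sigma>\<^sub>3 \<alpha>\<^sub>6 = B q \<alpha>\<^sub>6"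

| "tau_B q r \<sigma>\<^sub>4 \<alpha>\<^sub>1 = B q \<alpha>\<^sub>1"
| "tau_B q r \<sigma>\<^sub>4 \<alpha>\<^sub>2 = B q \<alpha>\<^sub>2"
| "tau_B q r \<sigma>\<^sub>4 \<alpha>\<^sub>3 = B q \<alpha>\<^sub>3"
| "tau_B q r \<sigma>\<^sub>4 \<alpha>\<^sub>4 = q_commutator (Uq q) q (B q \<alpha>\<^sub>4) (B q \<alpha>\<^sub>2)"
| "tau_B q r \<sigma>\<^sub>4 \<alpha>\<^sub>5 = B q \<alpha>\<^sub>5"
| "tau_B q r \<sigma>\<^sub>4 \<alpha>\<^sub>6 = B q \<alpha>\<^sub>6"

definition is_tau :: "'k::field \<Rightarrow> 'k \<Rightarrow> f4 \<Rightarrow> ('k uq \<Rightarrow> 'k uq) \<Rightarrow> bool" where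
  "is_tau q r i t \<longleftrightarrow>
     t \<in> carrier (Aut_alg (Uqk q)) \<and>
     (\<forall>x\<in>kT\<theta> q. t x = tau_torus q i x) \<and>
     (\<forall>j. t (B q j) = tau_B q r i j)"

end

theory Submission imports Defs begin

text \<open>
  The coideal subalgebra is presented by the \<open>B\<^sub>i\<close> and the \<open>K\<^sub>i K\<^sub>\<tau>\<^sub>(\<^sub>i\<^sub>)\<^sup>-\<^sup>1\<close> with inhomogeneous Serre
  relations. To see that these relations suffice, let \<open>U\<^sub>q\<close> act from the right on functions on the
  universal Verma module. In top degree the product \<open>B\<^sub>w\<close> of the \<open>B\<^sub>i\<close> along a word \<open>w\<close> acts like \<open>F\<^sub>w\<close>,
  and modulo terms of lower degree the assignment \<open>F\<^sub>w \<mapsto> B\<^sub>w\<close> respects the Serre relations; hence an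
  element of the presented algebra that vanishes in \<open>U\<^sub>q\<close> can be rewritten in lower and lower degree.

  The presentation reduces everything to identities between noncommutative polynomials: the images
  of the generators satisfy the relations, conjugation by the anti-involution that fixes all \<open>B\<^sub>i\<close>
  turns \<open>\<tau>\<^sub>i\<close> into its inverse, and the braid relations hold on generators. These identities follow by
  rewriting with part of a noncommutative Groebner basis, carried out by a normalisation function
  that is proved sound. Replacing \<open>B\<^sub>i\<close> by \<open>h B\<^sub>i\<close> with \<open>h = q - q\<^sup>-\<^sup>1\<close> keeps all coefficients Laurent
  polynomials in \<open>r\<close> with integer coefficients. The same method shows that Lusztig's automorphisms exist,
  so that their description in \<open>lusztig_T\<close> is not vacuous.
\<close>

section \<open>Noncommutative polynomials\<close>

text \<open>That the relations of the presentation hold is a computation; the obstacle is that they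
  generate the whole kernel, which would usually rest on a PBW basis. It is avoided by letting the
  functions on the Verma basis take values in the presented algebra itself: the tautological
  function sending F_w to B_w, cut off in one degree, factors through the Verma module up to lower
  degree, because the inhomogeneous terms of the relations lose degree. Applied to a lift of a
  kernel element x and evaluated at the highest weight vector, it gives 0 on the one hand and x on
  the other, modulo lower degree. Rewriting serves only to certify that an element lies in an ideal
  or that two elements are congruent. Hence soundness of each rule is all that matters, and neither
  termination nor confluence is claimed. New rules may be divided only by plus or minus a power of
  r, possibly times 1 + q^2, and this is invertible because q is not a root of unity. Since the
  coefficients are integral, one evaluation serves all fields. Only one of the two composites of tau
  with its candidate inverse is computed; conjugation by the anti-involution yields the
  other.\<close>

definition ncmon :: "'g list \<Rightarrow> ('k::field, 'g) ncpoly" where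
  "ncmon w = Poly_Mapping.single (FMonoid w) 1"

fun letters :: "'g fmonoid \<Rightarrow> 'g list" where
  "letters (FMonoid w) = w"

lemma ncconst_mult_ncmon: "ncconst c * ncmon w = Poly_Mapping.single (FMonoid w) c"
  by (simp add: ncconst_def ncmon_def mult_single)

lemma nc_induct [case_names zero mon add]:
  fixes p :: "('k::field, 'g) ncpoly"
  assumes "P 0" "\<And>c w. P (ncconst c * ncmon w)" "\<And>p q. P p \<Longrightarrow> P q \<Longrightarrow> P (p + q)"
  shows "P p"
proof -
  have sum: "P (\<Sum>k\<in>A. Poly_Mapping.single k (f k))" if "finite A" for A and f :: "'g fmonoid \<Rightarrow> 'k"
    using that
  proof (induction A rule: finite_induct)
    case empty
    show ?case using assms(1) by simp
  next
    case (insert x A)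
    have "P (Poly_Mapping.single x (f x))"
      using assms(2)[of "f x" "letters x"] by (cases x) (simp add: ncconst_mult_ncmon)
    then show ?case using insert assms(3) by simp
  qed
  have "p = (\<Sum>k\<in>Poly_Mapping.keys p. Poly_Mapping.single k (Poly_Mapping.lookup p k))"
    by (rule poly_mapping_eqI)
      (auto simp: lookup_sum lookup_single when_def in_keys_iff sum.delta[OF finite_keys])
  then show ?thesis using sum[OF finite_keys] by metis
qed

lemma ncmon_append: "ncmon (u @ v) = ncmon u * ncmon v"
  by (simp add: ncmon_def mult_single)

lemma ncmon_Nil: "ncmon [] = 1"
  unfolding ncmon_def zero_fmonoid_def[symmetric] by simp

lemma ncmon_Cons: "ncmon (g # w) = ncvar g * ncmon w"
  by (simp add: ncmon_def ncvar_def mult_single)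

lemma ncconst_add: "ncconst (a + b) = ncconst a + ncconst b"
  by (simp add: ncconst_def single_add)

lemma ncconst_mult: "ncconst (a * b) = ncconst a * ncconst b"
  by (simp add: ncconst_def mult_single)

lemma ncconst_0 [simp]: "ncconst 0 = 0"
  by (simp add: ncconst_def)

lemma ncconst_1 [simp]: "ncconst 1 = 1"
  by (simp add: ncconst_def)

lemma ncconst_uminus: "ncconst (- a) = - ncconst a"
  using ncconst_add[of a "- a"] by (simp add: eq_neg_iff_add_eq_0 add.commute)

lemma ncconst_diff: "ncconst (a - b) = ncconst a - ncconst b"
  using ncconst_add[of a "- b"] by (simp add: ncconst_uminus)

lemma ncconst_central: "p * ncconst c = ncconst c * p"
proof (induction p rule: nc_induct)
  case (mon d w)
  show ?case
    by (simp add: ncconst_def ncmon_def mult_single mult.commute zero_fmonoid_def)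
qed (simp_all add: algebra_simps)

lemma ncconst_left_commute: "p * (ncconst c * r) = ncconst c * (p * r)"
  by (metis mult.assoc ncconst_central)

text \<open>Substitutions, anti-substitutions and the action on functions are all instances, so that
  multiplicativity has to be checked on words only.\<close>

definition lin_ext :: "('g list \<Rightarrow> ('k::field, 'h) ncpoly) \<Rightarrow> ('k, 'g) ncpoly \<Rightarrow> ('k, 'h) ncpoly" where
  "lin_ext h p = (\<Sum>w\<in>Poly_Mapping.keys p. ncconst (Poly_Mapping.lookup p w) * h (letters w))"

lemma lin_ext_superset:
  assumes "finite A" "Poly_Mapping.keys p \<subseteq> A"
  shows "lin_ext h p = (\<Sum>w\<in>A. ncconst (Poly_Mapping.lookup p w) * h (letters w))"
  unfolding lin_ext_def
  by (rule sum.mono_neutral_left) (use assms in \<open>auto simp: in_keys_iff\<close>)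

lemma lin_ext_add: "lin_ext h (p + q) = lin_ext h p + lin_ext h q"
proof -
  have "finite (Poly_Mapping.keys p \<union> Poly_Mapping.keys q)" "Poly_Mapping.keys (p + q) \<subseteq> Poly_Mapping.keys p \<union> Poly_Mapping.keys q"
    using keys_add[of p q] by auto
  then show ?thesis
    by (simp add: lin_ext_superset[of "Poly_Mapping.keys p \<union> Poly_Mapping.keys q"] lookup_add ncconst_add distrib_right sum.distrib)
qed

lemma lin_ext_0 [simp]: "lin_ext h 0 = 0"
  by (simp add: lin_ext_def)

lemma lin_ext_mon: "lin_ext h (ncconst c * ncmon w) = ncconst c * h w"
  by (cases "c = 0") (simp_all add: lin_ext_def ncconst_mult_ncmon)

lemma lin_ext_ncmon: "lin_ext h (ncmon w) = h w"
  using lin_ext_mon[of h 1 w] by simp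

lemma lin_ext_const: "lin_ext h (ncconst c * p) = ncconst c * lin_ext h p"
proof (induction p rule: nc_induct)
  case (mon d w)
  then show ?case
    by (simp add: mult.assoc[symmetric] ncconst_mult[symmetric] lin_ext_mon)
qed (simp_all add: lin_ext_add distrib_left)

lemma lin_ext_uminus: "lin_ext h (- p) = - lin_ext h p"
  using lin_ext_const[of h "- 1" p] by (simp add: ncconst_uminus)

lemma lin_ext_diff: "lin_ext h (p - q) = lin_ext h p - lin_ext h q"
  using lin_ext_add[of h p "- q"] by (simp add: lin_ext_uminus)

lemma lin_ext_mult:
  assumes "\<And>u v. h (u @ v) = h u * h v"
  shows "lin_ext h (p * q) = lin_ext h p * lin_ext h q"
proof (induction p rule: nc_induct)
  case (mon c u)
  show ?case
  proof (induction q rule: nc_induct)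
    case (mon d v)
    show ?case
      by (simp add: mult.assoc ncconst_left_commute[of "ncmon u"] ncconst_left_commute[of "h u"]
          lin_ext_const lin_ext_ncmon ncmon_append[symmetric] assms)
  qed (simp_all add: distrib_left lin_ext_add)
qed (simp_all add: distrib_right lin_ext_add)

lemma lin_ext_antimult:
  assumes "\<And>u v. h (u @ v) = h v * h u"
  shows "lin_ext h (p * q) = lin_ext h q * lin_ext h p"
proof (induction p rule: nc_induct)
  case (mon c u)
  show ?case
  proof (induction q rule: nc_induct)
    case (mon d v)
    show ?case
      by (simp add: mult.assoc ncconst_left_commute[of "ncmon u"] ncconst_left_commute[of "h v"]
          lin_ext_const lin_ext_ncmon ncmon_append[symmetric] assms) 
        (simp add: mult.assoc[symmetric] ncconst_mult[symmetric] mult.commute)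
  qed (simp_all add: distrib_left distrib_right lin_ext_add)
qed (simp_all add: distrib_left distrib_right lin_ext_add)

definition nc_subst :: "('g \<Rightarrow> ('k::field, 'h) ncpoly) \<Rightarrow> ('k, 'g) ncpoly \<Rightarrow> ('k, 'h) ncpoly" where
  "nc_subst f = lin_ext (\<lambda>w. prod_list (map f w))"

definition nc_antisubst :: "('g \<Rightarrow> ('k::field, 'h) ncpoly) \<Rightarrow> ('k, 'g) ncpoly \<Rightarrow> ('k, 'h) ncpoly" where
  "nc_antisubst f = lin_ext (\<lambda>w. prod_list (map f (rev w)))"

lemma nc_subst_mult: "nc_subst f (p * q) = nc_subst f p * nc_subst f q"
  unfolding nc_subst_def by (rule lin_ext_mult) simp

lemma nc_antisubst_mult: "nc_antisubst f (p * q) = nc_antisubst f q * nc_antisubst f p"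
  unfolding nc_antisubst_def by (rule lin_ext_antimult) simp

lemma ncvar_ncmon: "ncvar g = ncmon [g]"
  by (simp add: ncvar_def ncmon_def)

lemma ncconst_ncmon: "ncconst c = ncconst c * ncmon []"
  by (simp add: ncmon_Nil)

lemma nc_subst_var [simp]: "nc_subst f (ncvar g) = f g"
  by (simp add: nc_subst_def ncvar_ncmon lin_ext_ncmon)

lemma nc_antisubst_var [simp]: "nc_antisubst f (ncvar g) = f g"
  by (simp add: nc_antisubst_def ncvar_ncmon lin_ext_ncmon)

lemma nc_subst_const [simp]: "nc_subst f (ncconst c) = ncconst c"
  unfolding nc_subst_def by (subst ncconst_ncmon) (simp add: lin_ext_mon del: ncconst_ncmon[symmetric])

lemma nc_antisubst_const [simp]: "nc_antisubst f (ncconst c) = ncconst c"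
  unfolding nc_antisubst_def by (subst ncconst_ncmon) (simp add: lin_ext_mon)

lemma nc_subst_1 [simp]: "nc_subst f 1 = 1"
  using nc_subst_const[of f 1] by simp

lemma nc_antisubst_1 [simp]: "nc_antisubst f 1 = 1"
  using nc_antisubst_const[of f 1] by simp

lemma nc_subst_0 [simp]: "nc_subst f 0 = 0" "nc_antisubst f 0 = 0"
  by (simp_all add: nc_subst_def nc_antisubst_def)

lemmas nc_subst_hom =
  nc_subst_mult
  lin_ext_add[of "\<lambda>w. prod_list (map f w)" for f, folded nc_subst_def]
  lin_ext_diff[of "\<lambda>w. prod_list (map f w)" for f, folded nc_subst_def]
  lin_ext_uminus[of "\<lambda>w. prod_list (map f w)" for f, folded nc_subst_def]

lemmas nc_antisubst_hom =
  nc_antisubst_mult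
  lin_ext_add[of "\<lambda>w. prod_list (map f (rev w))" for f, folded nc_antisubst_def]
  lin_ext_diff[of "\<lambda>w. prod_list (map f (rev w))" for f, folded nc_antisubst_def]
  lin_ext_uminus[of "\<lambda>w. prod_list (map f (rev w))" for f, folded nc_antisubst_def]

lemma ncpoly_induct [case_names const var add mult]:
  fixes p :: "('k::field, 'g) ncpoly"
  assumes "\<And>c. P (ncconst c)" "\<And>g. P (ncvar g)"
    and "\<And>p q. P p \<Longrightarrow> P q \<Longrightarrow> P (p + q)" "\<And>p q. P p \<Longrightarrow> P q \<Longrightarrow> P (p * q)"
  shows "P p"
proof (induction p rule: nc_induct)
  case zero
  show ?case using assms(1)[of 0] by simp
next
  case (mon c w)
  have "P (ncmon w)"
    using assms(1)[of 1] assms(2,4) by (induction w) (simp_all add: ncmon_Nil ncmon_Cons)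
  then show ?case using assms(1,4) by simp
qed (fact assms(3))

section \<open>Two-sided ideals and presented algebras\<close>

text \<open>Ideals are treated in the type class of rings, where the simplifier works best;
  \<open>ideal_free_algebra_iff\<close> is the bridge to the record-based ideals of the
  definitions.\<close>

locale two_sided =
  fixes I :: "'a::ring_1 set"
  assumes zero_mem: "0 \<in> I"
    and add_mem: "x \<in> I \<Longrightarrow> y \<in> I \<Longrightarrow> x + y \<in> I"
    and left_mem: "x \<in> I \<Longrightarrow> a * x \<in> I"
    and right_mem: "x \<in> I \<Longrightarrow> x * a \<in> I"
begin

definition cong :: "'a \<Rightarrow> 'a \<Rightarrow> bool" (infix "\<bumpeq>" 50) where
  "x \<bumpeq> y \<longleftrightarrow> x - y \<in> I"

lemma minus_mem: "x \<in> I \<Longrightarrow> - x \<in> I"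
  using left_mem[of x "- 1"] by simp

lemma diff_mem: "x \<in> I \<Longrightarrow> y \<in> I \<Longrightarrow> x - y \<in> I"
  using add_mem[of x "- y"] minus_mem by simp

lemma cong_refl [simp, intro!]: "x \<bumpeq> x"
  by (simp add: cong_def zero_mem)

lemma cong_sym: "x \<bumpeq> y \<Longrightarrow> y \<bumpeq> x"
  unfolding cong_def using minus_mem by fastforce

lemma cong_trans [trans]: "x \<bumpeq> y \<Longrightarrow> y \<bumpeq> z \<Longrightarrow> x \<bumpeq> z"
  unfolding cong_def using add_mem by fastforce

lemma cong_add: "x \<bumpeq> y \<Longrightarrow> u \<bumpeq> v \<Longrightarrow> x + u \<bumpeq> y + v"
  unfolding cong_def using add_mem by (metis add_diff_add)

lemma cong_diff: "x \<bumpeq> y \<Longrightarrow> u \<bumpeq> v \<Longrightarrow> x - u \<bumpeq> y - v"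
  unfolding cong_def using diff_mem[of "x - y" "u - v"] by (simp add: algebra_simps)

lemma cong_uminus: "x \<bumpeq> y \<Longrightarrow> - x \<bumpeq> - y"
  using cong_diff[of 0 0 x y] by simp

lemma cong_mult: "x \<bumpeq> y \<Longrightarrow> u \<bumpeq> v \<Longrightarrow> x * u \<bumpeq> y * v"
  unfolding cong_def using add_mem[OF right_mem[of "x - y" u] left_mem[of "u - v" y]]
  by (simp add: algebra_simps)

lemma cong_mult_left: "u \<bumpeq> v \<Longrightarrow> x * u \<bumpeq> x * v"
  by (rule cong_mult) auto

lemma cong_mult_right: "x \<bumpeq> y \<Longrightarrow> x * u \<bumpeq> y * u"
  by (rule cong_mult) auto

lemma cong_mem: "x \<bumpeq> y \<Longrightarrow> x \<in> I \<longleftrightarrow> y \<in> I"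
  using cong_sym[of x y] add_mem[of "x - y" y] add_mem[of "y - x" x] unfolding cong_def by auto

lemma cong_0: "x \<bumpeq> 0 \<longleftrightarrow> x \<in> I"
  by (simp add: cong_def)

end

text \<open>This is how a check on the defining relations extends to the ideal they generate: the
  preimage is an ideal, so \<open>rel_ideal_least\<close> applies to it.\<close>

lemma two_sided_preimage:
  assumes "two_sided J"
    and "\<And>x y. f (x + y) = f x + f y" "\<And>x y. f (x * y) = f x * f y"
  shows "two_sided {x. f x \<in> J}"
proof -
  interpret two_sided J by fact
  have "f 0 = 0" using assms(2)[of 0 0] by simp
  then show ?thesis
    by unfold_locales (simp_all add: assms(2,3) zero_mem add_mem left_mem right_mem)
qed

lemma two_sided_antipreimage:
  assumes "two_sided J"
    and "\<And>x y. f (x + y) = f x + f y" "\<And>x y. f (x * y) = f y * f x"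
  shows "two_sided {x. f x \<in> J}"
proof -
  interpret two_sided J by fact
  have "f 0 = 0" using assms(2)[of 0 0] by simp
  then show ?thesis
    by unfold_locales (simp_all add: assms(2,3) zero_mem add_mem left_mem right_mem)
qed

lemma free_algebra_simps [simp]:
  "carrier free_algebra = UNIV" "mult free_algebra = (*)" "one free_algebra = 1"
  "zero free_algebra = 0" "add free_algebra = (+)" "smult free_algebra c x = ncconst c * x"
  by (simp_all add: free_algebra_def)

interpretation free: ring "free_algebra :: ('k::field, ('k, 'g) ncpoly) module"
proof (rule ringI)
  show "abelian_group (free_algebra :: ('k, ('k, 'g) ncpoly) module)"
  proof (rule abelian_groupI)
    fix x :: "('k, 'g) ncpoly"
    have "- x + x = 0" by simp
    then show "\<exists>y\<in>carrier free_algebra. y \<oplus>\<^bsub>free_algebra\<^esub> x = \<zero>\<^bsub>free_algebra\<^esub>"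
      by (metis UNIV_I free_algebra_simps(1,4,5))
  qed (simp_all add: algebra_simps)
  show "Group.monoid (free_algebra :: ('k, ('k, 'g) ncpoly) module)"
    by unfold_locales (simp_all add: mult.assoc)
qed (simp_all add: algebra_simps)

lemma free_uminus [simp]: "\<ominus>\<^bsub>free_algebra\<^esub> x = - x"
  by (rule free.minus_equality) simp_all

lemma ideal_free_algebra_iff: "ideal I free_algebra \<longleftrightarrow> two_sided I"
proof
  assume "ideal I free_algebra"
  then interpret ideal I free_algebra .
  show "two_sided I"
    using zero_closed a_closed I_l_closed I_r_closed by unfold_locales simp_all
next
  assume "two_sided I"
  then interpret two_sided I .
  show "ideal I free_algebra"
  proof (rule idealI)
    show "subgroup I (add_monoid free_algebra)"
    proof
      fix x assume "x \<in> I"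
      then show "inv\<^bsub>add_monoid free_algebra\<^esub> x \<in> I"
        using free_uminus[of x] minus_mem by (simp add: a_inv_def)
    qed (simp_all add: zero_mem add_mem)
  qed (simp_all add: left_mem right_mem free.ring_axioms)
qed

abbreviation rel_ideal :: "('k::field, 'g) ncpoly set \<Rightarrow> ('k, 'g) ncpoly set" where
  "rel_ideal R \<equiv> Idl\<^bsub>free_algebra\<^esub> R"

lemma two_sided_rel_ideal: "two_sided (rel_ideal R)"
  unfolding ideal_free_algebra_iff[symmetric] by (rule free.genideal_ideal) simp

lemma rel_ideal_contains: "R \<subseteq> rel_ideal R"
  by (rule free.genideal_self) simp

lemma rel_ideal_least: "two_sided J \<Longrightarrow> R \<subseteq> J \<Longrightarrow> rel_ideal R \<subseteq> J"
  unfolding ideal_free_algebra_iff[symmetric] by (rule free.genideal_minimal)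

text \<open>The canonical map onto the presented algebra. All later arguments use representatives
  and congruences instead of cosets.\<close>

definition cls :: "('k::field, 'g) ncpoly set \<Rightarrow> ('k, 'g) ncpoly \<Rightarrow> ('k, 'g) ncpoly set" where
  "cls R x = rel_ideal R +>\<^bsub>free_algebra\<^esub> x"

context
  fixes R :: "('k::field, 'g) ncpoly set"
begin

interpretation two_sided "rel_ideal R" by (rule two_sided_rel_ideal)
interpretation id: ideal "rel_ideal R" free_algebra
  by (simp add: ideal_free_algebra_iff two_sided_rel_ideal)

lemma cls_eq_set: "cls R x = {y. y - x \<in> rel_ideal R}"
proof -
  have "y \<in> cls R x \<longleftrightarrow> y - x \<in> rel_ideal R" for y
    unfolding cls_def a_r_coset_def' by (auto simp: algebra_simps intro!: bexI[of _ "y - x"])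
  then show ?thesis by blast
qed

lemma cls_eq_iff: "cls R x = cls R y \<longleftrightarrow> x - y \<in> rel_ideal R"
proof
  assume "cls R x = cls R y"
  moreover have "x \<in> cls R x" by (simp add: cls_eq_set zero_mem)
  ultimately show "x - y \<in> rel_ideal R" by (simp add: cls_eq_set)
next
  assume *: "x - y \<in> rel_ideal R"
  have "z - x \<in> rel_ideal R \<longleftrightarrow> z - y \<in> rel_ideal R" for z
    using cong_mem[of "z - x" "z - y"] minus_mem[OF *] by (simp add: cong_def)
  then show "cls R x = cls R y" by (simp add: cls_eq_set)
qed

lemma presented_carrier: "carrier (presented_algebra R) = range (cls R)"
  by (auto simp: presented_algebra_def Let_def FactRing_def A_RCOSETS_def' cls_def)

lemma cls_in_carrier [simp]: "cls R x \<in> carrier (presented_algebra R)"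
  by (simp add: presented_carrier)

lemma cls_mult [simp]: "cls R x \<otimes>\<^bsub>presented_algebra R\<^esub> cls R y = cls R (x * y)"
  using id.rcoset_mult_add[of x y]
  by (simp add: presented_algebra_def Let_def FactRing_def cls_def)

lemma cls_add [simp]: "cls R x \<oplus>\<^bsub>presented_algebra R\<^esub> cls R y = cls R (x + y)"
  using id.a_rcos_sum[of x y]
  by (simp add: presented_algebra_def Let_def FactRing_def cls_def)

lemma cls_one: "\<one>\<^bsub>presented_algebra R\<^esub> = cls R 1"
  by (simp add: presented_algebra_def Let_def FactRing_def cls_def)

lemma cls_zero: "\<zero>\<^bsub>presented_algebra R\<^esub> = cls R 0"
  using id.a_rcos_const[OF zero_mem]
  by (simp add: presented_algebra_def Let_def FactRing_def cls_def)

text \<open>The union in the definition of scalar multiplication runs over equal cosets, because the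
  ideal absorbs constants.\<close>

lemma cls_smult [simp]: "c \<odot>\<^bsub>presented_algebra R\<^esub> cls R x = cls R (ncconst c * x)"
proof -
  have "(\<Union>y\<in>cls R x. cls R (ncconst c * y)) = cls R (ncconst c * x)"
  proof -
    have "cls R (ncconst c * y) = cls R (ncconst c * x)" if "y \<in> cls R x" for y
      using that left_mem[of "y - x" "ncconst c"] by (simp add: cls_eq_iff right_diff_distrib) (simp add: cls_eq_set)
    moreover have "x \<in> cls R x" by (simp add: cls_eq_set zero_mem)
    ultimately show ?thesis by blast
  qed
  then show ?thesis by (simp add: presented_algebra_def Let_def cls_def)
qed

lemma presented_ring: "ring (presented_algebra R)"
proof (rule ringI)
  show "abelian_group (presented_algebra R)"
  proof (rule abelian_groupI)
    fix X assume "X \<in> carrier (presented_algebra R)"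
    then obtain x where "X = cls R x" by (auto simp: presented_carrier)
    then have "cls R (- x) \<oplus>\<^bsub>presented_algebra R\<^esub> X = \<zero>\<^bsub>presented_algebra R\<^esub>"
      by (simp add: cls_zero)
    then show "\<exists>Y\<in>carrier (presented_algebra R). Y \<oplus>\<^bsub>presented_algebra R\<^esub> X = \<zero>\<^bsub>presented_algebra R\<^esub>"
      by (metis cls_in_carrier)
  qed (auto simp: presented_carrier cls_zero algebra_simps)
  show "Group.monoid (presented_algebra R)"
    by unfold_locales (auto simp: presented_carrier cls_one algebra_simps)
qed (auto simp: presented_carrier algebra_simps)

lemma cls_uminus [simp]: "\<ominus>\<^bsub>presented_algebra R\<^esub> cls R x = cls R (- x)"
proof -
  interpret ring "presented_algebra R" by (rule presented_ring)
  show ?thesis by (rule minus_equality) (simp_all add: cls_zero)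
qed

lemma cls_minus [simp]: "cls R x \<ominus>\<^bsub>presented_algebra R\<^esub> cls R y = cls R (x - y)"
  by (simp add: a_minus_def)

lemma cls_q_commutator [simp]:
  "q_commutator (presented_algebra R) q (cls R x) (cls R y) = cls R (x * y - ncconst q * (y * x))"
  by (simp add: q_commutator_def)

end

lemma presented_gen_cls: "presented_gen R g = cls R (ncvar g)"
  by (simp add: presented_gen_def cls_def)

section \<open>Verified computation modulo an ideal\<close>

text \<open>
  A Laurent polynomial in \<open>r\<close> is a list of pairs (exponent, coefficient). A monomial consists of a
  word in numbered letters and the exponents of a torus element standing to the right of the word.
\<close>

type_synonym laurent = "(int \<times> int) list"
type_synonym tor = "int \<times> int \<times> int"
type_synonym mono = "int list \<times> tor"
type_synonym ncp = "(mono \<times> laurent) list"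

text \<open>Lists are merged by increasing exponent and cancelling coefficients are dropped, so that
  zero becomes the empty list. Soundness holds for arbitrary lists, sorted or not.\<close>

fun ladd :: "laurent \<Rightarrow> laurent \<Rightarrow> laurent" where
  "ladd [] b = b"
| "ladd (x # a) [] = x # a"
| "ladd ((e, m) # a) ((f, n) # b) =
     (if e = f then (if m + n = 0 then ladd a b else (e, m + n) # ladd a b)
      else if e < f then (e, m) # ladd a ((f, n) # b)
      else (f, n) # ladd ((e, m) # a) b)"

fun lshift :: "int \<Rightarrow> int \<Rightarrow> laurent \<Rightarrow> laurent" where
  "lshift e m [] = []"
| "lshift e m ((f, n) # b) = (e + f, m * n) # lshift e m b"

fun lmul :: "laurent \<Rightarrow> laurent \<Rightarrow> laurent" where
  "lmul [] b = []"
| "lmul [(e, m)] b = lshift e m b"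
| "lmul ((e, m) # x # a) b = ladd (lshift e m b) (lmul (x # a) b)"

text \<open>The number h = q - 1/q; exponents count powers of r, whose square is q.\<close>

definition hl :: laurent where "hl = [(- 2, - 1), (2, 1)]"

fun hpow :: "nat \<Rightarrow> laurent" where
  "hpow 0 = [(0, 1)]"
| "hpow (Suc n) = lmul hl (hpow n)"

fun tadd :: "tor \<Rightarrow> tor \<Rightarrow> tor" where
  "tadd (a, b, c) (a', b', c') = (a + a', b + b', c + c')"

fun tdot :: "tor \<Rightarrow> tor \<Rightarrow> int" where
  "tdot (a, b, c) (a', b', c') = a * a' + b * b' + c * c'"

fun assoc :: "'b \<Rightarrow> (int \<times> 'b) list \<Rightarrow> int \<Rightarrow> 'b" where
  "assoc d [] x = d"
| "assoc d ((y, v) # t) x = (if x = y then v else assoc d t x)"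

type_synonym weights = "(int \<times> tor) list"

text \<open>The exponent of r that appears when the torus element t is moved from the left to the
  right of the word.\<close>

fun wt :: "weights \<Rightarrow> int list \<Rightarrow> tor \<Rightarrow> int" where
  "wt \<chi> [] t = 0"
| "wt \<chi> (x # w) t = tdot (assoc (0, 0, 0) \<chi> x) t + wt \<chi> w t"

datatype comparison = Less | Equal | Greater

definition icmp :: "int \<Rightarrow> int \<Rightarrow> comparison" where
  "icmp x y = (if x = y then Equal else if x < y then Less else Greater)"

text \<open>The last argument is the verdict for words of equal length. Carrying it along lets
  \<open>wcmp\<close> decide in a single pass.\<close>

fun lencmp :: "int list \<Rightarrow> int list \<Rightarrow> comparison \<Rightarrow> comparison" where
  "lencmp [] [] c = c"
| "lencmp [] (y # v) c = Less"
| "lencmp (x # u) [] c = Greater"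
| "lencmp (x # u) (y # v) c = lencmp u v c"

text \<open>Words are compared by length first and lexicographically second.\<close>

fun wcmp :: "int list \<Rightarrow> int list \<Rightarrow> comparison \<Rightarrow> comparison" where
  "wcmp [] [] c = c"
| "wcmp [] (y # v) c = Less"
| "wcmp (x # u) [] c = Greater"
| "wcmp (x # u) (y # v) c = (if x = y then wcmp u v c else lencmp u v (icmp x y))"

definition cmp_then :: "comparison \<Rightarrow> comparison \<Rightarrow> comparison" where
  "cmp_then c d = (if c = Equal then d else c)"

fun tcmp :: "tor \<Rightarrow> tor \<Rightarrow> comparison" where
  "tcmp (a, b, c) (a', b', c') = cmp_then (icmp a a') (cmp_then (icmp b b') (icmp c c'))"

fun mcmp :: "mono \<Rightarrow> mono \<Rightarrow> comparison" where
  "mcmp (u, s) (v, t) = wcmp u v (tcmp s t)"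

lemma icmp_Equal [simp]: "icmp x y = Equal \<longleftrightarrow> x = y"
  by (simp add: icmp_def)

lemma lencmp_Equal: "c \<noteq> Equal \<Longrightarrow> lencmp u v c \<noteq> Equal"
  by (induction u v c rule: lencmp.induct) auto

lemma wcmp_Equal: "wcmp u v c = Equal \<longleftrightarrow> u = v \<and> c = Equal"
  by (induction u v c rule: wcmp.induct) (auto simp: lencmp_Equal)

lemma mcmp_Equal [simp]: "mcmp m n = Equal \<longleftrightarrow> m = n"
  by (cases "(m, n)" rule: mcmp.cases) (auto simp: wcmp_Equal cmp_then_def split: if_splits)

lemma mcmp_refl [simp]: "mcmp m m = Equal"
  by simp

text \<open>Terms are kept in decreasing order, so the leading term stands at the head;
  \<open>lead_rule\<close> relies on this.\<close>

fun padd :: "ncp \<Rightarrow> ncp \<Rightarrow> ncp" where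
  "padd [] q = q"
| "padd (x # p) [] = x # p"
| "padd ((m, c) # p) ((n, d) # q) =
     (if mcmp m n = Equal then (case ladd c d of [] \<Rightarrow> padd p q | x # s \<Rightarrow> (m, x # s) # padd p q)
      else if mcmp m n = Greater then (m, c) # padd p ((n, d) # q)
      else (n, d) # padd ((m, c) # p) q)"

fun pscale :: "laurent \<Rightarrow> ncp \<Rightarrow> ncp" where
  "pscale c [] = []"
| "pscale c ((m, d) # p) = (m, lmul c d) # pscale c p"

text \<open>The polynomial c u p v t. The torus factors of p must pass the word v, which shifts the
  exponents of r.\<close>

fun ctx :: "weights \<Rightarrow> int list \<Rightarrow> laurent \<Rightarrow> int list \<Rightarrow> tor \<Rightarrow> ncp \<Rightarrow> ncp" where
  "ctx \<chi> u c v t [] = []"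
| "ctx \<chi> u c v t (((w, s), d) # p) =
     ((u @ w @ v, tadd s t), lshift (wt \<chi> v s) 1 (lmul c d)) # ctx \<chi> u c v t p"

fun lmono :: "weights \<Rightarrow> int list \<Rightarrow> tor \<Rightarrow> laurent \<Rightarrow> ncp \<Rightarrow> ncp" where
  "lmono \<chi> u t c [] = []"
| "lmono \<chi> u t c (((w, s), d) # p) =
     ((u @ w, tadd t s), lshift (wt \<chi> w t) 1 (lmul c d)) # lmono \<chi> u t c p"

fun pmul :: "weights \<Rightarrow> ncp \<Rightarrow> ncp \<Rightarrow> ncp" where
  "pmul \<chi> [] q = []"
| "pmul \<chi> (((w, t), c) # p) q = padd (lmono \<chi> w t c q) (pmul \<chi> p q)"

section \<open>Rewriting with a table of rules\<close>

type_synonym rules = "(int list \<times> ncp) list"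
type_synonym rule_table = "(int \<times> rules) list"

fun rules_from :: "int \<Rightarrow> rules \<Rightarrow> rules" where
  "rules_from x [] = []"
| "rules_from x (([], p) # rs) = rules_from x rs"
| "rules_from x ((y # u, p) # rs) =
     (if x = y then (u, p) # rules_from x rs else rules_from x rs)"

text \<open>Rules are indexed by the initial letter of their left-hand side, of which only the
  remainder is stored.\<close>

fun mk_table :: "int list \<Rightarrow> rules \<Rightarrow> rule_table" where
  "mk_table [] rs = []"
| "mk_table (x # xs) rs = (x, rules_from x rs) # mk_table xs rs"

fun strip :: "int list \<Rightarrow> int list \<Rightarrow> int list option" where
  "strip [] w = Some w"
| "strip (x # u) [] = None"
| "strip (x # u) (y # w) = (if x = y then strip u w else None)"

fun match_head :: "rules \<Rightarrow> int list \<Rightarrow> (ncp \<times> int list) option" where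
  "match_head [] w = None"
| "match_head ((u, p) # rs) w =
     (case strip u w of None \<Rightarrow> match_head rs w | Some v \<Rightarrow> Some (p, v))"

text \<open>The second argument is the prefix already scanned, in reverse; the leftmost redex is
  found.\<close>

fun find_redex :: "rule_table \<Rightarrow> int list \<Rightarrow> int list \<Rightarrow> (int list \<times> ncp \<times> int list) option" where
  "find_redex t u [] = None"
| "find_redex t u (x # w) =
     (case match_head (assoc [] t x) w of
        None \<Rightarrow> find_redex t (x # u) w
      | Some (p, v) \<Rightarrow> Some (rev u, p, v))"

text \<open>A state consists of the terms still to be reduced, largest ahead, and the irreducible
  terms found so far in reverse order.\<close>

fun step :: "weights \<Rightarrow> rule_table \<Rightarrow> ncp \<times> ncp \<Rightarrow> ncp \<times> ncp" where
  "step \<chi> tb ([], q) = ([], q)"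
| "step \<chi> tb (((w, t), c) # p, q) =
     (case find_redex tb [] w of
        None \<Rightarrow> (p, ((w, t), c) # q)
      | Some (u, r, v) \<Rightarrow> (padd (ctx \<chi> u c v t r) p, q))"

text \<open>Doubling: depth n allows 2^n single steps, so \<open>nform\<close> allows 1024. A run
  that is cut off remains sound, because \<open>unstate\<close> also returns the pending
  terms.\<close>

fun steps :: "weights \<Rightarrow> rule_table \<Rightarrow> nat \<Rightarrow> ncp \<times> ncp \<Rightarrow> ncp \<times> ncp" where
  "steps \<chi> tb n ([], q) = ([], q)"
| "steps \<chi> tb 0 (x # p, q) = step \<chi> tb (x # p, q)"
| "steps \<chi> tb (Suc n) (x # p, q) = steps \<chi> tb n (steps \<chi> tb n (x # p, q))"

fun unstate :: "ncp \<times> ncp \<Rightarrow> ncp" where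
  "unstate (p, q) = padd p (rev q)"

definition nform :: "weights \<Rightarrow> rule_table \<Rightarrow> ncp \<Rightarrow> ncp" where
  "nform \<chi> tb p = unstate (steps \<chi> tb 10 (p, []))"

text \<open>\<open>Qc c a b\<close> stands for ab - c ba. As a constructor of its own it lets both
  arguments be normalised just once, also in nested commutators.\<close>

datatype ex = Lt int | Tr tor | Sc laurent | Add ex ex | Sub ex ex | Mul ex ex | Qc laurent ex ex

text \<open>
  An entry \<open>(n, p)\<close> for a letter means that \<open>p\<close> represents \<open>h\<^sup>n\<close> times the image of that letter,
  where \<open>h = q - q\<^sup>-\<^sup>1\<close>: this keeps all coefficients Laurent polynomials.
\<close>

type_synonym hom_table = "(int \<times> nat \<times> ncp) list \<times> tor \<times> tor \<times> tor"

text \<open>The matrix is given by the images of the three unit vectors.\<close>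

fun tmap :: "tor \<times> tor \<times> tor \<Rightarrow> tor \<Rightarrow> tor" where
  "tmap ((a1, a2, a3), (b1, b2, b3), (c1, c2, c3)) (x, y, z) =
     (a1 * x + b1 * y + c1 * z, a2 * x + b2 * y + c2 * z, a3 * x + b3 * y + c3 * z)"

text \<open>A pair (n, p) represents the x with h^n x = p, see \<open>represents\<close>. Summands
  are brought to a common power of h.\<close>

fun hadd :: "nat \<times> ncp \<Rightarrow> nat \<times> ncp \<Rightarrow> nat \<times> ncp" where
  "hadd (m, p) (n, q) =
     (if m = n then (m, padd p q)
      else if m < n then (n, padd (pscale (hpow (n - m)) p) q)
      else (m, padd p (pscale (hpow (m - n)) q)))"

fun hneg :: "nat \<times> ncp \<Rightarrow> nat \<times> ncp" where
  "hneg (m, p) = (m, pscale [(0, - 1)] p)"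

fun hmul :: "weights \<Rightarrow> rule_table \<Rightarrow> nat \<times> ncp \<Rightarrow> nat \<times> ncp \<Rightarrow> nat \<times> ncp" where
  "hmul \<chi> tb (m, p) (n, q) = (m + n, nform \<chi> tb (pmul \<chi> p q))"

fun hqc :: "weights \<Rightarrow> rule_table \<Rightarrow> laurent \<Rightarrow> nat \<times> ncp \<Rightarrow> nat \<times> ncp \<Rightarrow> nat \<times> ncp" where
  "hqc \<chi> tb c a b =
     hadd (hmul \<chi> tb a b) (hneg (hmul \<chi> tb (0, [(([], 0, 0, 0), c)]) (hmul \<chi> tb b a)))"

fun nrm :: "weights \<Rightarrow> rule_table \<Rightarrow> hom_table \<Rightarrow> ex \<Rightarrow> nat \<times> ncp" where
  "nrm \<chi> tb (H, M) (Lt x) = assoc (0, [(([x], 0, 0, 0), [(0, 1)])]) H x"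
| "nrm \<chi> tb (H, M) (Tr t) = (0, [(([], tmap M t), [(0, 1)])])"
| "nrm \<chi> tb H (Sc c) = (0, if c = [] then [] else [(([], 0, 0, 0), c)])"
| "nrm \<chi> tb H (Add a b) = hadd (nrm \<chi> tb H a) (nrm \<chi> tb H b)"
| "nrm \<chi> tb H (Sub a b) = hadd (nrm \<chi> tb H a) (hneg (nrm \<chi> tb H b))"
| "nrm \<chi> tb H (Mul a b) = hmul \<chi> tb (nrm \<chi> tb H a) (nrm \<chi> tb H b)"
| "nrm \<chi> tb H (Qc c a b) = hqc \<chi> tb c (nrm \<chi> tb H a) (nrm \<chi> tb H b)"

definition id_hom :: hom_table where
  "id_hom = ([], (1, 0, 0), (0, 1, 0), (0, 0, 1))"

text \<open>Rules whose first letter is not in \<open>xs\<close> are ignored.\<close>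

fun vanish_all :: "weights \<Rightarrow> rule_table \<Rightarrow> hom_table \<Rightarrow> ex list \<Rightarrow> bool" where
  "vanish_all \<chi> tb H [] = True"
| "vanish_all \<chi> tb H (e # es) = (snd (nrm \<chi> tb H e) = [] \<and> vanish_all \<chi> tb H es)"

definition vanishes :: "weights \<Rightarrow> int list \<Rightarrow> rules \<Rightarrow> hom_table \<Rightarrow> ex list \<Rightarrow> bool" where
  "vanishes \<chi> xs rs H es = vanish_all \<chi> (mk_table xs rs) H es"

text \<open>
  The simplifier traverses the selected branch of an \<open>if\<close> or \<open>case\<close> once more. The following code
  equations avoid this for branches that contain large data.
\<close>

definition ladd_sel where
  "ladd_sel k e m a f n b =
     (case k of
        Equal \<Rightarrow> (if m + n = 0 then ladd a b else (e, m + n) # ladd a b)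
      | Less \<Rightarrow> (e, m) # ladd a ((f, n) # b)
      | Greater \<Rightarrow> (f, n) # ladd ((e, m) # a) b)"

definition ladd_cons where
  "ladd_cons k e m a = (if k then a else (e, m) # a)"

definition padd_sel where
  "padd_sel k m c p n d q =
     (case k of
        Equal \<Rightarrow> (case ladd c d of [] \<Rightarrow> padd p q | x # s \<Rightarrow> (m, x # s) # padd p q)
      | Greater \<Rightarrow> (m, c) # padd p ((n, d) # q)
      | Less \<Rightarrow> (n, d) # padd ((m, c) # p) q)"

fun padd_cons where
  "padd_cons m [] p = p"
| "padd_cons m (x # s) p = (m, x # s) # p"

definition assoc_sel where
  "assoc_sel k d v t x = (if k then v else assoc d t x)"

definition strip_sel where
  "strip_sel k u w = (if k then strip u w else None)"

definition match_sel where
  "match_sel k p rs w = (case k of None \<Rightarrow> match_head rs w | Some v \<Rightarrow> Some (p, v))"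

definition find_sel where
  "find_sel k t x u w =
     (case k of None \<Rightarrow> find_redex t (x # u) w | Some (p, v) \<Rightarrow> Some (rev u, p, v))"

definition step_sel where
  "step_sel k \<chi> w t c p q =
     (case k of
        None \<Rightarrow> (p, ((w, t), c) # q)
      | Some (u, r, v) \<Rightarrow> (padd (ctx \<chi> u c v t r) p, q))"

definition hadd_sel where
  "hadd_sel k m p n q =
     (case k of
        Equal \<Rightarrow> (m, padd p q)
      | Less \<Rightarrow> (n, padd (pscale (hpow (n - m)) p) q)
      | Greater \<Rightarrow> (m, padd p (pscale (hpow (m - n)) q)))"

lemma selection_code [code]:
  "ladd_sel Equal e m a f n b = ladd_cons (m + n = 0) e (m + n) (ladd a b)"
  "ladd_sel Less e m a f n b = (e, m) # ladd a ((f, n) # b)"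
  "ladd_sel Greater e m a f n b = (f, n) # ladd ((e, m) # a) b"
  "ladd_cons True e m a = a"
  "ladd_cons False e m a = (e, m) # a"
  "padd_sel Equal m' c p n' d q = padd_cons m' (ladd c d) (padd p q)"
  "padd_sel Greater m' c p n' d q = (m', c) # padd p ((n', d) # q)"
  "padd_sel Less m' c p n' d q = (n', d) # padd ((m', c) # p) q"
  "assoc_sel True z v t x = v"
  "assoc_sel False z v t x = assoc z t x"
  "strip_sel True u w = strip u w"
  "strip_sel False u w = None"
  "match_sel None p rs w = match_head rs w"
  "match_sel (Some v') p rs w = Some (p, v')"
  "find_sel None tb x u w = find_redex tb (x # u) w"
  "find_sel (Some (p, v')) tb x u w = Some (rev u, p, v')"
  "step_sel None \<chi> w s c p q = (p, ((w, s), c) # q)"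
  "step_sel (Some (u', p', v')) \<chi> w s c p q = (padd (ctx \<chi> u' c v' s p') p, q)"
  "hadd_sel Equal i p j q = (i, padd p q)"
  "hadd_sel Less i p j q = (j, padd (pscale (hpow (j - i)) p) q)"
  "hadd_sel Greater i p j q = (i, padd p (pscale (hpow (i - j)) q))"
  by (simp_all add: ladd_sel_def ladd_cons_def padd_sel_def assoc_sel_def strip_sel_def
      match_sel_def find_sel_def step_sel_def hadd_sel_def split: list.split)

lemma engine_code [code]:
  "ladd [] b = b"
  "ladd (x # a) [] = x # a"
  "ladd ((e, m) # a) ((f, n) # b) = ladd_sel (icmp e f) e m a f n b"
  "padd [] q = q"
  "padd (y # p) [] = y # p"
  "padd ((m', c) # p) ((n', d) # q) = padd_sel (mcmp m' n') m' c p n' d q"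
  "assoc z [] k = z"
  "assoc z ((k', v) # t) k = assoc_sel (k = k') z v t k"
  "strip [] w = Some w"
  "strip (k # u) [] = None"
  "strip (k # u) (k' # w) = strip_sel (k = k') u w"
  "match_head [] w = None"
  "match_head ((u, p) # rs) w = match_sel (strip u w) p rs w"
  "find_redex tb u [] = None"
  "find_redex tb u (k # w) = find_sel (match_head (assoc [] tb k) w) tb k u w"
  "step \<chi> tb ([], q) = ([], q)"
  "step \<chi> tb (((w, s), c) # p, q) = step_sel (find_redex tb [] w) \<chi> w s c p q"
  "hadd (i, p) (j, q) = hadd_sel (icmp (int i) (int j)) i p j q"
  by (simp_all add: ladd_sel_def padd_sel_def assoc_sel_def strip_sel_def match_sel_def find_sel_def
      step_sel_def hadd_sel_def icmp_def split: comparison.split)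

section \<open>Composition of homomorphisms, and certificates for new rules\<close>

fun word_ex :: "int list \<Rightarrow> tor \<Rightarrow> ex" where
  "word_ex [] t = Tr t"
| "word_ex (x # w) t = Mul (Lt x) (word_ex w t)"

text \<open>Reading a polynomial back as an expression allows \<open>nrm\<close> to apply a
  homomorphism to it.\<close>

fun ncp_ex :: "ncp \<Rightarrow> ex" where
  "ncp_ex [] = Sc []"
| "ncp_ex (((w, t), c) # p) = Add (Mul (Sc c) (word_ex w t)) (ncp_ex p)"

fun hadd_deg :: "nat \<Rightarrow> nat \<times> ncp \<Rightarrow> nat \<times> ncp" where
  "hadd_deg n (m, p) = (n + m, p)"

fun comp_entry :: "weights \<Rightarrow> rule_table \<Rightarrow> hom_table \<Rightarrow> nat \<times> ncp \<Rightarrow> nat \<times> ncp" where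
  "comp_entry \<chi> tb H (n, p) = hadd_deg n (nrm \<chi> tb H (ncp_ex p))"

text \<open>The table of H after G. With an empty rule table, \<open>nrm\<close> merely looks up the
  entry of a letter.\<close>

definition hcomp :: "weights \<Rightarrow> rule_table \<Rightarrow> int list \<Rightarrow> hom_table \<Rightarrow> hom_table \<Rightarrow> hom_table" where
  "hcomp \<chi> tb xs H G =
     (map (\<lambda>x. (x, comp_entry \<chi> tb H (nrm \<chi> [] G (Lt x)))) xs,
      tmap (snd H) (tmap (snd G) (1, 0, 0)), tmap (snd H) (tmap (snd G) (0, 1, 0)),
      tmap (snd H) (tmap (snd G) (0, 0, 1)))"

text \<open>Fractions with denominators h^m and h^n are compared literally after extending the
  smaller denominator.\<close>

fun entry_eq :: "nat \<times> ncp \<Rightarrow> nat \<times> ncp \<Rightarrow> bool" where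
  "entry_eq (m, p) (n, p') \<longleftrightarrow>
     (if m = n then p = p'
      else if m < n then pscale (hpow (n - m)) p = p' else p = pscale (hpow (m - n)) p')"

definition hom_eq :: "weights \<Rightarrow> int list \<Rightarrow> hom_table \<Rightarrow> hom_table \<Rightarrow> bool" where
  "hom_eq \<chi> xs H G \<longleftrightarrow> snd H = snd G \<and>
     list_all (\<lambda>x. entry_eq (nrm \<chi> [] H (Lt x)) (nrm \<chi> [] G (Lt x))) xs"

fun agree_all :: "weights \<Rightarrow> rule_table \<Rightarrow> hom_table \<Rightarrow> (ex \<times> ex) list \<Rightarrow> bool" where
  "agree_all \<chi> tb H [] = True"
| "agree_all \<chi> tb H ((e, e') # es) =
     (entry_eq (nrm \<chi> tb H e) (nrm \<chi> tb id_hom e') \<and> agree_all \<chi> tb H es)"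

definition agrees :: "weights \<Rightarrow> int list \<Rightarrow> rules \<Rightarrow> hom_table \<Rightarrow> (ex \<times> ex) list \<Rightarrow> bool" where
  "agrees \<chi> xs rs H es = agree_all \<chi> (mk_table xs rs) H es"

fun rule_for :: "rules \<Rightarrow> int list \<Rightarrow> ncp option" where
  "rule_for [] u = None"
| "rule_for ((v, p) # rs) u = (if u = v then Some p else rule_for rs u)"

text \<open>Up to sign these are r^e and r^e (1 + q^2), the step 4 being q^2 = r^4.\<close>

fun unit_content :: "laurent \<Rightarrow> bool" where
  "unit_content [(e, n)] = (n = 1 \<or> n = - 1)"
| "unit_content [(e, n), (e', n')] = ((n = 1 \<or> n = - 1) \<and> n' = n \<and> e' = e + 4)"
| "unit_content _ = False"

text \<open>
  The entry \<open>(x, t, s, y, c, u, p)\<close> describes an overlap \<open>x t = s y\<close> of the left-hand sides \<open>x\<close> and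
  \<open>y\<close> of two rules. The difference of its two reductions is \<open>c (u - p)\<close>, whence the rule \<open>(u, p)\<close>.
\<close>

type_synonym overlap = "int list \<times> int list \<times> int list \<times> int list \<times> laurent \<times> int list \<times> ncp"

fun overlap_ok :: "weights \<Rightarrow> int list \<Rightarrow> rules \<Rightarrow> overlap \<Rightarrow> bool" where
  "overlap_ok \<chi> xs rs (x, t, s, y, c, u, p) =
     (case rule_for rs x of None \<Rightarrow> False | Some p1 \<Rightarrow>
      (case rule_for rs y of None \<Rightarrow> False | Some p2 \<Rightarrow>
        x @ t = s @ y \<and> unit_content c \<and>
        snd (nrm \<chi> (mk_table xs rs) id_hom
          (Sub (Mul (ncp_ex p1) (word_ex t (0, 0, 0))) (Mul (word_ex s (0, 0, 0)) (ncp_ex p2))))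
        = padd [((u, 0, 0, 0), c)] (pscale (lmul [(0, - 1)] c) p)))"

text \<open>Every certified rule is available for the certificates of the later ones.\<close>

fun overlaps_ok :: "weights \<Rightarrow> int list \<Rightarrow> rules \<Rightarrow> overlap list \<Rightarrow> bool" where
  "overlaps_ok \<chi> xs rs [] = True"
| "overlaps_ok \<chi> xs rs ((x, t, s, y, c, u, p) # os) \<longleftrightarrow>
     overlap_ok \<chi> xs rs (x, t, s, y, c, u, p) \<and> overlaps_ok \<chi> xs ((u, p) # rs) os"

fun new_rules :: "overlap list \<Rightarrow> rules \<Rightarrow> rules" where
  "new_rules [] rs = rs"
| "new_rules ((x, t, s, y, c, u, p) # os) rs = new_rules os ((u, p) # rs)"

lemma tmap_comp:
  "tmap (tmap M (tmap N (1, 0, 0)), tmap M (tmap N (0, 1, 0)), tmap M (tmap N (0, 0, 1))) t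
   = tmap M (tmap N t)"
proof -
  obtain a1 a2 a3 b1 b2 b3 c1 c2 c3 where M: "M = ((a1, a2, a3), (b1, b2, b3), (c1, c2, c3))"
    by (metis surj_pair)
  obtain d1 d2 d3 e1 e2 e3 f1 f2 f3 where N: "N = ((d1, d2, d3), (e1, e2, e3), (f1, f2, f3))"
    by (metis surj_pair)
  obtain x y z where t: "t = (x, y, z)"
    by (metis surj_pair)
  show ?thesis
    unfolding M N t tmap.simps prod.inject by (simp add: algebra_simps)
qed

section \<open>Evaluation in the field and soundness of the normalisation\<close>

locale q_param =
  fixes q r :: "'k::field"
  assumes q_nz: "q \<noteq> 0" and not_root: "\<And>n::nat. n > 0 \<Longrightarrow> q ^ n \<noteq> 1" and r_sq: "r ^ 2 = q"
begin

lemma r_nz: "r \<noteq> 0"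
  using q_nz r_sq by auto

definition evl :: "laurent \<Rightarrow> 'k" where
  "evl c = (\<Sum>(e, n)\<leftarrow>c. of_int n * r powi e)"

lemma evl_Nil [simp]: "evl [] = 0"
  and evl_Cons [simp]: "evl ((e, n) # c) = of_int n * r powi e + evl c"
  by (simp_all add: evl_def)

lemma evl_ladd: "evl (ladd a b) = evl a + evl b"
proof (induction a b rule: ladd.induct)
  case (3 e m a f n b)
  have "of_int m * r powi e + of_int n * r powi e = 0" if "m + n = 0"
    using that by (metis distrib_right mult_zero_left of_int_0 of_int_add)
  with 3 show ?case
    by (auto simp: algebra_simps)
qed simp_all

lemma evl_lshift: "evl (lshift e m b) = of_int m * r powi e * evl b"
  by (induction e m b rule: lshift.induct) (simp_all add: algebra_simps power_int_add r_nz)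

lemma evl_lmul: "evl (lmul a b) = evl a * evl b"
  by (induction a b rule: lmul.induct) (auto simp: evl_lshift evl_ladd algebra_simps)

lemma r_powi_two: "r powi (2 * n) = q powi n"
  by (simp add: power_int_mult r_sq[symmetric])

definition h :: 'k where "h = q - inverse q"

lemma evl_hl: "evl hl = h"
proof -
  have "r powi (- 2) = inverse q"
    using r_powi_two[of "- 1"] by simp
  then show ?thesis
    by (simp add: hl_def h_def r_sq)
qed

lemma h_nz: "h \<noteq> 0"
proof
  assume "h = 0"
  then have "q ^ 2 = 1"
    using q_nz by (simp add: h_def power2_eq_square field_simps)
  then show False using not_root[of 2] by simp
qed

lemma evl_hpow: "evl (hpow n) = h ^ n"
  by (induction n) (simp_all add: evl_lmul evl_hl)

end

text \<open>An interpretation of letters by \<phi> and of torus elements by \<kappa>, valid modulo I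
  only. The same computation is thus available modulo the relations of \<open>Uq\<close>, modulo the
  annihilator of the Verma functions, and in the presented algebra.\<close>

locale nc_model = q_param q r + two_sided I
  for q r :: "'k::field" and I :: "('k, 'g) ncpoly set" +
  fixes \<phi> :: "int \<Rightarrow> ('k, 'g) ncpoly" and \<kappa> :: "tor \<Rightarrow> ('k, 'g) ncpoly" and \<chi> :: weights
  assumes \<kappa>_add: "\<kappa> s * \<kappa> t \<bumpeq> \<kappa> (tadd s t)"
    and \<kappa>_0: "\<kappa> (0, 0, 0) \<bumpeq> 1"
    and \<kappa>_\<phi>: "\<kappa> t * \<phi> x \<bumpeq> ncconst (r powi tdot (assoc (0, 0, 0) \<chi> x) t) * (\<phi> x * \<kappa> t)"
begin

definition evw :: "int list \<Rightarrow> ('k, 'g) ncpoly" where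
  "evw w = prod_list (map \<phi> w)"

definition evm :: "mono \<Rightarrow> ('k, 'g) ncpoly" where
  "evm m = evw (fst m) * \<kappa> (snd m)"

definition evp :: "ncp \<Rightarrow> ('k, 'g) ncpoly" where
  "evp p = (\<Sum>(m, c)\<leftarrow>p. ncconst (evl c) * evm m)"

fun ev :: "ex \<Rightarrow> ('k, 'g) ncpoly" where
  "ev (Lt x) = \<phi> x"
| "ev (Tr t) = \<kappa> t"
| "ev (Sc c) = ncconst (evl c)"
| "ev (Add a b) = ev a + ev b"
| "ev (Sub a b) = ev a - ev b"
| "ev (Mul a b) = ev a * ev b"
| "ev (Qc c a b) = ev a * ev b - ncconst (evl c) * (ev b * ev a)"

lemma evw_simps [simp]: "evw [] = 1" "evw (x # w) = \<phi> x * evw w" "evw (u @ v) = evw u * evw v"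
  by (simp_all add: evw_def)

lemma evp_simps [simp]: "evp [] = 0" "evp ((m, c) # p) = ncconst (evl c) * evm m + evp p"
  by (simp_all add: evp_def)

lemma evp_append: "evp (p @ p') = evp p + evp p'"
  by (simp add: evp_def)

lemma evp_rev: "evp (rev p) = evp p"
  by (induction p) (auto simp: evp_append)

lemma evp_padd: "evp (padd p p') = evp p + evp p'"
proof (induction p p' rule: padd.induct)
  case (3 m c p n d p')
  show ?case
  proof (cases "m = n")
    case True
    show ?thesis
    proof (cases "ladd c d")
      case Nil
      then have "evl c + evl d = 0" using evl_ladd[of c d] by simp
      then have "ncconst (evl c) * evm n + ncconst (evl d) * evm n = 0"
        by (metis distrib_right mult_zero_left ncconst_0 ncconst_add)
      then show ?thesis using True Nil 3(1)
        by (simp add: algebra_simps)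
    next
      case (Cons x s)
      then have "evl (x # s) = evl c + evl d" using evl_ladd[of c d] by simp
      then show ?thesis using True Cons 3(2)
        by (simp add: ncconst_add algebra_simps)
    qed
  qed (use 3 in \<open>auto simp: algebra_simps\<close>)
qed simp_all

lemma evp_pscale: "evp (pscale c p) = ncconst (evl c) * evp p"
  by (induction c p rule: pscale.induct) (simp_all add: evl_lmul ncconst_mult distrib_left mult.assoc)

lemma \<kappa>_evw: "\<kappa> t * evw w \<bumpeq> ncconst (r powi wt \<chi> w t) * (evw w * \<kappa> t)"
proof (induction w)
  case (Cons x w)
  let ?c = "ncconst (r powi tdot (assoc (0, 0, 0) \<chi> x) t)" and ?d = "ncconst (r powi wt \<chi> w t)"
  have "\<kappa> t * \<phi> x * evw w \<bumpeq> ?c * (\<phi> x * \<kappa> t) * evw w"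
    by (intro cong_mult_right \<kappa>_\<phi>)
  also have "\<dots> = ?c * \<phi> x * (\<kappa> t * evw w)"
    by (simp add: mult.assoc)
  also have "\<dots> \<bumpeq> ?c * \<phi> x * (?d * (evw w * \<kappa> t))"
    by (intro cong_mult_left Cons)
  also have "\<dots> = ncconst (r powi wt \<chi> (x # w) t) * (evw (x # w) * \<kappa> t)"
    by (simp add: power_int_add r_nz ncconst_mult mult.assoc ncconst_left_commute[of "\<phi> x"])
  finally show ?case by (simp add: mult.assoc)
qed simp

lemma evp_ctx: "evp (ctx \<chi> u c v t p) \<bumpeq> ncconst (evl c) * (evw u * evp p * evw v * \<kappa> t)"
proof (induction \<chi>' \<equiv> \<chi> u c v t p rule: ctx.induct)
  case (2 u c v t w s d p)
  have "\<kappa> s * evw v * \<kappa> t \<bumpeq> ncconst (r powi wt \<chi> v s) * (evw v * \<kappa> s) * \<kappa> t"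
    by (intro cong_mult_right \<kappa>_evw)
  also have "\<dots> = ncconst (r powi wt \<chi> v s) * evw v * (\<kappa> s * \<kappa> t)"
    by (simp add: mult.assoc)
  also have "\<dots> \<bumpeq> ncconst (r powi wt \<chi> v s) * evw v * \<kappa> (tadd s t)"
    by (intro cong_mult_left \<kappa>_add)
  finally have "ncconst (evl c) * evw u * ncconst (evl d) * evw w * (\<kappa> s * evw v * \<kappa> t)
      \<bumpeq> ncconst (evl c) * evw u * ncconst (evl d) * evw w * (ncconst (r powi wt \<chi> v s) * evw v * \<kappa> (tadd s t))"
    by (rule cong_mult_left)
  from cong_add[OF cong_sym[OF this] 2(1)]
  show ?case
    by (simp add: evm_def evl_lshift evl_lmul ncconst_mult distrib_left distrib_right mult.assoc
        ncconst_left_commute[of "evw _"] ncconst_left_commute[of "ncconst (r powi _)"])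
qed simp

lemma evp_lmono: "evp (lmono \<chi> u t c p) \<bumpeq> ncconst (evl c) * evm (u, t) * evp p"
proof (induction \<chi>' \<equiv> \<chi> u t c p rule: lmono.induct)
  case (2 u t c w s d p)
  have "\<kappa> t * evw w * \<kappa> s \<bumpeq> ncconst (r powi wt \<chi> w t) * (evw w * \<kappa> t) * \<kappa> s"
    by (intro cong_mult_right \<kappa>_evw)
  also have "\<dots> = ncconst (r powi wt \<chi> w t) * evw w * (\<kappa> t * \<kappa> s)"
    by (simp add: mult.assoc)
  also have "\<dots> \<bumpeq> ncconst (r powi wt \<chi> w t) * evw w * \<kappa> (tadd t s)"
    by (intro cong_mult_left \<kappa>_add)
  finally have "ncconst (evl c) * ncconst (evl d) * evw u * (\<kappa> t * evw w * \<kappa> s)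
      \<bumpeq> ncconst (evl c) * ncconst (evl d) * evw u * (ncconst (r powi wt \<chi> w t) * evw w * \<kappa> (tadd t s))"
    by (rule cong_mult_left)
  from cong_add[OF cong_sym[OF this] 2(1)]
  show ?case
    by (simp add: evm_def evl_lshift evl_lmul ncconst_mult distrib_left mult.assoc
        ncconst_left_commute[of "evw _"] ncconst_left_commute[of "\<kappa> _"]
        ncconst_left_commute[of "ncconst (r powi _)"])
qed simp

lemma evp_pmul: "evp (pmul \<chi> p p') \<bumpeq> evp p * evp p'"
proof (induction \<chi>' \<equiv> \<chi> p p' rule: pmul.induct)
  case (2 w t c p p')
  from cong_add[OF evp_lmono[of w t c p'] 2] show ?case
    by (simp add: evp_padd distrib_right)
qed simp

definition sound :: "rules \<Rightarrow> bool" where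
  "sound rs \<longleftrightarrow> (\<forall>(u, p)\<in>set rs. evw u \<bumpeq> evp p)"

definition sound_table :: "rule_table \<Rightarrow> bool" where
  "sound_table tb \<longleftrightarrow> (\<forall>(x, rs)\<in>set tb. \<forall>(u, p)\<in>set rs. \<phi> x * evw u \<bumpeq> evp p)"

lemma sound_append: "sound (rs @ rs') \<longleftrightarrow> sound rs \<and> sound rs'"
  by (auto simp: sound_def)

lemma rules_from_mem: "(u, p) \<in> set (rules_from x rs) \<Longrightarrow> (x # u, p) \<in> set rs"
  by (induction x rs rule: rules_from.induct) (auto split: if_splits)

lemma sound_mk_table: "sound rs \<Longrightarrow> sound_table (mk_table xs rs)"
  by (induction xs rs rule: mk_table.induct)
    (fastforce simp: sound_table_def sound_def dest: rules_from_mem)+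

lemma assoc_mem: "assoc d t x = d \<or> (x, assoc d t x) \<in> set t"
  by (induction d t x rule: assoc.induct) auto

lemma strip_eq: "strip u w = Some v \<Longrightarrow> w = u @ v"
  by (induction u w rule: strip.induct) (auto split: if_splits)

lemma match_head_mem: "match_head rs w = Some (p, v) \<Longrightarrow> \<exists>u. (u, p) \<in> set rs \<and> w = u @ v"
  by (induction rs w rule: match_head.induct) (auto split: option.splits dest: strip_eq)

lemma find_redex_sound:
  assumes "sound_table tb" "find_redex tb u0 w = Some (u, p, v)"
  shows "\<exists>m. rev u0 @ w = u @ m @ v \<and> evw m \<bumpeq> evp p"
  using assms
proof (induction tb u0 w rule: find_redex.induct)
  case (2 t u0 x w)
  show ?case
  proof (cases "match_head (assoc [] t x) w")
    case None
    with 2 show ?thesis by simp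
  next
    case (Some a)
    obtain p' v' where a: "a = (p', v')" by (cases a)
    with Some 2(3) have eq: "u = rev u0" "p = p'" "v = v'" by simp_all
    obtain m where m: "(m, p) \<in> set (assoc [] t x)" "w = m @ v"
      using match_head_mem Some a eq by blast
    have "(x, assoc [] t x) \<in> set t"
      using assoc_mem[of "[]" t x] m(1) by auto
    then have "\<phi> x * evw m \<bumpeq> evp p"
      using 2(2) m(1) unfolding sound_table_def by fast
    then show ?thesis using eq m(2) by (intro exI[of _ "x # m"]) simp
  qed
qed simp

definition ev_state :: "ncp \<times> ncp \<Rightarrow> ('k, 'g) ncpoly" where
  "ev_state s = evp (fst s) + evp (snd s)"

lemma step_sound:
  assumes "sound_table tb"
  shows "ev_state (step \<chi> tb s) \<bumpeq> ev_state s"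
proof (cases "(\<chi>, tb, s)" rule: step.cases)
  case (2 \<chi>' tb' w t c p p')
  show ?thesis
  proof (cases "find_redex tb [] w")
    case None
    with 2 show ?thesis by (simp add: ev_state_def add.assoc add.left_commute)
  next
    case (Some a)
    obtain u rl v where a: "a = (u, rl, v)" by (cases a)
    obtain m where m: "w = u @ m @ v" "evw m \<bumpeq> evp rl"
      using find_redex_sound[OF assms, of "[]" w u rl v] Some a by auto
    have "ncconst (evl c) * (evw u * evp rl * evw v * \<kappa> t) \<bumpeq> ncconst (evl c) * (evw u * evw m * evw v * \<kappa> t)"
      by (intro cong_mult cong_refl cong_sym[OF m(2)])
    with evp_ctx[of u c v t rl] have "evp (ctx \<chi> u c v t rl) \<bumpeq> ncconst (evl c) * evm (w, t)"
      unfolding m(1) evm_def by (simp add: mult.assoc) (rule cong_trans)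
    from cong_add[OF cong_add[OF this cong_refl[of "evp p"]] cong_refl[of "evp p'"]] show ?thesis
      using 2 Some a by (simp add: ev_state_def evp_padd)
  qed
qed simp

lemma steps_sound: "sound_table tb \<Longrightarrow> ev_state (steps \<chi> tb n s) \<bumpeq> ev_state s"
proof (induction \<chi>' \<equiv> \<chi> tb n s rule: steps.induct)
  case (2 tb x p p')
  then show ?case using step_sound by simp
next
  case (3 tb n x p p')
  then show ?case by simp (meson cong_trans)
qed simp

lemma nform_sound: "sound_table tb \<Longrightarrow> evp (nform \<chi> tb p) \<bumpeq> evp p"
  using steps_sound[of tb 10 "(p, [])"]
  by (cases "steps \<chi> tb 10 (p, [])") (simp add: nform_def ev_state_def evp_padd evp_rev)

lemma const_cong: "x \<bumpeq> y \<Longrightarrow> ncconst c * x \<bumpeq> ncconst c * y"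
  by (rule cong_mult_left)

text \<open>The map f is not assumed to preserve I: \<open>vanishes_hom\<close> serves to prove that
  it does. Only its values on letters and torus elements are compared with the table.\<close>

definition hom_sound :: "(('k, 'g) ncpoly \<Rightarrow> ('k, 'g) ncpoly) \<Rightarrow> hom_table \<Rightarrow> bool" where
  "hom_sound f H \<longleftrightarrow>
     (\<forall>x y. f (x + y) = f x + f y) \<and> (\<forall>x y. f (x * y) = f x * f y) \<and> (\<forall>c. f (ncconst c) = ncconst c) \<and>
     (\<forall>x. ncconst (h ^ fst (nrm \<chi> [] H (Lt x))) * f (\<phi> x) \<bumpeq> evp (snd (nrm \<chi> [] H (Lt x)))) \<and>
     (\<forall>t. f (\<kappa> t) \<bumpeq> \<kappa> (tmap (snd H) t))"

definition represents :: "nat \<times> ncp \<Rightarrow> ('k, 'g) ncpoly \<Rightarrow> bool" where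
  "represents a x \<longleftrightarrow> ncconst (h ^ fst a) * x \<bumpeq> evp (snd a)"

lemma represents_hadd:
  assumes "represents a x" "represents b y"
  shows "represents (hadd a b) (x + y)"
proof -
  obtain m p n p' where ab: "a = (m, p)" "b = (n, p')" by (cases a; cases b)
  have *: "ncconst (h ^ k) * z \<bumpeq> ncconst (evl (hpow (k - l))) * evp p''"
    if "ncconst (h ^ l) * z \<bumpeq> evp p''" "l < k" for k l z p''
  proof -
    have "h ^ k = h ^ (k - l) * h ^ l"
      using that(2) by (simp add: power_add[symmetric])
    then show ?thesis
      using const_cong[OF that(1), of "h ^ (k - l)"] by (simp add: evl_hpow ncconst_mult mult.assoc)
  qed
  show ?thesis
    using assms *[of m x p n] *[of n y p' m]
    by (auto simp: ab represents_def evp_padd evp_pscale distrib_left intro!: cong_add)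
qed

lemma represents_hneg:
  assumes "represents a x"
  shows "represents (hneg a) (- x)"
  using cong_uminus[OF assms[unfolded represents_def]]
  by (cases a) (simp add: represents_def evp_pscale ncconst_uminus)

lemma represents_hmul:
  assumes "sound_table tb" "represents a x" "represents b y"
  shows "represents (hmul \<chi> tb a b) (x * y)"
proof -
  obtain m p n p' where ab: "a = (m, p)" "b = (n, p')" by (cases a; cases b)
  have "ncconst (h ^ (m + n)) * (x * y) = (ncconst (h ^ m) * x) * (ncconst (h ^ n) * y)"
    by (simp add: power_add ncconst_mult mult.assoc ncconst_left_commute[of x])
  also have "\<dots> \<bumpeq> evp p * evp p'"
    using assms(2,3) ab by (intro cong_mult) (simp_all add: represents_def)
  also have "\<dots> \<bumpeq> evp (nform \<chi> tb (pmul \<chi> p p'))"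
    by (meson assms(1) cong_sym cong_trans evp_pmul nform_sound)
  finally show ?thesis by (simp add: ab represents_def)
qed

lemma represents_const: "represents (0, [(([], 0, 0, 0), c)]) (ncconst (evl c))"
  using const_cong[OF cong_sym[OF \<kappa>_0], of "evl c"] by (simp add: represents_def evm_def)

lemma hom_sound_diff:
  assumes "hom_sound f H"
  shows "f (x - y) = f x - f y"
proof -
  have "f (- y) = f (ncconst (- 1) * y)" by (simp add: ncconst_uminus)
  also have "\<dots> = ncconst (- 1) * f y" using assms by (simp add: hom_sound_def)
  finally have "f (- y) = - f y" by (simp add: ncconst_uminus)
  moreover have "f (x + - y) = f x + f (- y)" using assms unfolding hom_sound_def by blast
  ultimately show ?thesis by simp
qed

lemma represents_nrm:
  assumes "sound_table tb" "hom_sound f H"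
  shows "represents (nrm \<chi> tb H e) (f (ev e))"
  using assms
proof (induction e)
  case (Lt x)
  then show ?case by (cases H) (simp add: hom_sound_def represents_def)
next
  case (Tr t)
  then show ?case by (cases H; cases t) (simp add: hom_sound_def represents_def evm_def)
next
  case (Sc c)
  then show ?case
    using represents_const[of c] by (cases H) (auto simp: hom_sound_def represents_def)
next
  case (Add a b)
  then show ?case
    using represents_hadd by (cases H) (simp add: hom_sound_def)
next
  case (Sub a b)
  then show ?case
    using represents_hadd[OF Sub(1)[OF Sub(3,4)] represents_hneg[OF Sub(2)[OF Sub(3,4)]]]
    by (cases H) (simp add: hom_sound_diff)
next
  case (Mul a b)
  then show ?case
    using represents_hmul by (cases H) (simp add: hom_sound_def)
next
  case (Qc c a b)
  note a = Qc(1)[OF Qc(3,4)] and b = Qc(2)[OF Qc(3,4)]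
  have "f (ev (Qc c a b)) = f (ev a) * f (ev b) + - (ncconst (evl c) * (f (ev b) * f (ev a)))"
    using Qc(4) unfolding ev.simps hom_sound_diff[OF Qc(4)] hom_sound_def by simp
  then show ?case
    using represents_hadd[OF represents_hmul[OF Qc(3) a b]
        represents_hneg[OF represents_hmul[OF Qc(3) represents_const represents_hmul[OF Qc(3) b a]]]]
    by (cases H) simp
qed

lemma represents_0: "represents (n, []) x \<Longrightarrow> x \<in> I"
  using left_mem[of "ncconst (h ^ n) * x" "ncconst (inverse (h ^ n))"] h_nz
  by (simp add: represents_def cong_def mult.assoc[symmetric] ncconst_mult[symmetric])

lemma vanishes_hom:
  assumes "vanishes \<chi> xs rs H es" "sound rs" "hom_sound f H" "e \<in> set es"
  shows "f (ev e) \<in> I"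
proof -
  have "snd (nrm \<chi> tb H e) = []" if "vanish_all \<chi> tb H es" for tb
    using that assms(4) by (induction es) auto
  then have "snd (nrm \<chi> (mk_table xs rs) H e) = []"
    using assms(1) by (simp add: vanishes_def)
  then show ?thesis
    using represents_0[of "fst (nrm \<chi> (mk_table xs rs) H e)"]
      represents_nrm[OF sound_mk_table[OF assms(2)] assms(3)] by (metis prod.collapse)
qed

lemma hom_sound_id: "hom_sound (\<lambda>x. x) id_hom"
proof -
  have "\<phi> x * 1 \<bumpeq> \<phi> x * \<kappa> (0, 0, 0)" for x
    by (rule cong_mult_left[OF cong_sym[OF \<kappa>_0]])
  then show ?thesis
    by (auto simp: hom_sound_def id_hom_def evm_def)
qed

lemma vanishes_mem:
  assumes "vanishes \<chi> xs rs id_hom es" "sound rs" "e \<in> set es"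
  shows "ev e \<in> I"
  using vanishes_hom[OF assms(1,2) hom_sound_id assms(3)] .

lemma represents_entry_eq:
  assumes "represents a x" "represents b y" "entry_eq a b"
  shows "x \<bumpeq> y"
proof -
  obtain m p n p' where ab: "a = (m, p)" "b = (n, p')" by (cases a; cases b)
  have cancel: "z \<bumpeq> z'" if "ncconst (h ^ k) * z \<bumpeq> ncconst (h ^ k) * z'" for k z z'
    using const_cong[OF that, of "inverse (h ^ k)"] h_nz
    by (simp add: mult.assoc[symmetric] ncconst_mult[symmetric])
  have scale: "ncconst (h ^ k) * z \<bumpeq> evp (pscale (hpow (k - l)) p'')"
    if "ncconst (h ^ l) * z \<bumpeq> evp p''" "l < k" for k l z p''
  proof -
    have "h ^ k = h ^ (k - l) * h ^ l"
      using that(2) by (simp add: power_add[symmetric])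
    then show ?thesis
      using const_cong[OF that(1), of "h ^ (k - l)"]
      by (simp add: evl_hpow evp_pscale ncconst_mult mult.assoc)
  qed
  have x: "ncconst (h ^ m) * x \<bumpeq> evp p" and y: "ncconst (h ^ n) * y \<bumpeq> evp p'"
    using assms(1,2) by (simp_all add: ab represents_def)
  consider "m = n" "p = p'" | "m < n" "pscale (hpow (n - m)) p = p'"
    | "n < m" "p = pscale (hpow (m - n)) p'"
    using assms(3) by (auto simp: ab split: if_splits)
  then show ?thesis
  proof cases
    case 1
    with x y show ?thesis by (metis cancel cong_sym cong_trans)
  next
    case 2
    with scale[OF x, of n] y show ?thesis by (metis cancel cong_sym cong_trans)
  next
    case 3
    with scale[OF y, of m] x show ?thesis by (metis cancel cong_sym cong_trans)
  qed
qed

lemma agrees_hom: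
  assumes "agrees \<chi> xs rs H es" "sound rs" "hom_sound f H" "(e, e') \<in> set es"
  shows "f (ev e) \<bumpeq> ev e'"
proof -
  have "entry_eq (nrm \<chi> tb H e) (nrm \<chi> tb id_hom e')" if "agree_all \<chi> tb H es" for tb
    using that assms(4) by (induction es) auto
  then have "entry_eq (nrm \<chi> (mk_table xs rs) H e) (nrm \<chi> (mk_table xs rs) id_hom e')"
    using assms(1) by (simp add: agrees_def)
  then show ?thesis
    using represents_entry_eq represents_nrm[OF sound_mk_table[OF assms(2)]] assms(3) hom_sound_id
    by blast
qed

lemma ev_word_ex: "ev (word_ex w t) = evw w * \<kappa> t"
  by (induction w) (simp_all add: mult.assoc)

lemma ev_ncp_ex: "ev (ncp_ex p) = evp p"
  by (induction p rule: ncp_ex.induct) (simp_all add: ev_word_ex evm_def)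

lemma rule_for_sound: "sound rs \<Longrightarrow> rule_for rs u = Some p \<Longrightarrow> evw u \<bumpeq> evp p"
  by (induction rs u rule: rule_for.induct) (auto simp: sound_def split: if_splits)

text \<open>If 1 + q^2 vanished, then q^4 = 1.\<close>

lemma unit_content_nz: "unit_content c \<Longrightarrow> evl c \<noteq> 0"
proof (induction c rule: unit_content.induct)
  case (1 e n)
  then show ?case using r_nz by auto
next
  case (2 e n e' n')
  have "r ^ 4 = q ^ 2"
    by (simp add: r_sq[symmetric] power_mult[symmetric])
  moreover have "1 + q ^ 2 \<noteq> 0"
  proof
    assume "1 + q ^ 2 = 0"
    moreover have "q ^ 4 - 1 = (q ^ 2 - 1) * (1 + q ^ 2)"
      by (simp add: algebra_simps power_add[symmetric])
    ultimately have "q ^ 4 = 1" by simp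
    then show False using not_root[of 4] by simp
  qed
  ultimately have "r powi e * (1 + r ^ 4) \<noteq> 0" using r_nz by simp
  moreover have "evl [(e, n), (e', n')] = of_int n * (r powi e * (1 + r ^ 4))"
    using 2 by (simp add: power_int_add r_nz algebra_simps)
  ultimately show ?case using 2 by auto
qed simp_all

text \<open>Both reductions are congruent to the overlap word, so their difference lies in I; it is
  h-multiple-wise equal to c (u - p), and c is invertible.\<close>

lemma overlap_sound:
  assumes "sound rs" "overlap_ok \<chi> xs rs (x, t, s, y, c, u, p)"
  shows "evw u \<bumpeq> evp p"
proof -
  obtain p1 p2 where p: "rule_for rs x = Some p1" "rule_for rs y = Some p2"
    and eq: "x @ t = s @ y" "unit_content c"
    and nf: "snd (nrm \<chi> (mk_table xs rs) id_hom
          (Sub (Mul (ncp_ex p1) (word_ex t (0, 0, 0))) (Mul (word_ex s (0, 0, 0)) (ncp_ex p2))))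
        = padd [((u, 0, 0, 0), c)] (pscale (lmul [(0, - 1)] c) p)"
    using assms(2) by (auto split: option.splits)
  let ?z = "(0, 0, 0) :: tor"
  let ?e = "Sub (Mul (ncp_ex p1) (word_ex t ?z)) (Mul (word_ex s ?z) (ncp_ex p2))"
  have w: "ev (word_ex w ?z) \<bumpeq> evw w" for w
    using cong_mult_left[OF \<kappa>_0, of "evw w"] by (simp add: ev_word_ex)
  have p1: "evw x \<bumpeq> evp p1" and p2: "evw y \<bumpeq> evp p2"
    using rule_for_sound[OF assms(1)] p by auto
  have "ev ?e \<bumpeq> evw x * evw t - evw s * evw y"
    unfolding ev.simps ev_ncp_ex
    by (intro cong_diff cong_mult w cong_sym[OF p1] cong_sym[OF p2])
  also have "\<dots> = 0" using eq(1) by (metis evw_simps(3) right_minus_eq)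
  finally have mem: "ev ?e \<in> I" by (simp add: cong_0)
  have "evp (padd [((u, 0, 0, 0), c)] (pscale (lmul [(0, - 1)] c) p))
      = ncconst (evl c) * (evw u * \<kappa> ?z - evp p)"
    by (simp add: evp_padd evp_pscale evl_lshift evm_def ncconst_uminus algebra_simps)
  moreover have "ncconst (h ^ fst (nrm \<chi> (mk_table xs rs) id_hom ?e)) * ev ?e
      \<bumpeq> evp (padd [((u, 0, 0, 0), c)] (pscale (lmul [(0, - 1)] c) p))"
    using represents_nrm[OF sound_mk_table[OF assms(1), of xs] hom_sound_id, of ?e]
    unfolding represents_def nf .
  ultimately have "ncconst (evl c) * (evw u * \<kappa> ?z - evp p) \<in> I"
    using left_mem[OF mem] cong_mem by metis
  then have "ncconst (inverse (evl c)) * (ncconst (evl c) * (evw u * \<kappa> ?z - evp p)) \<in> I"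
    by (rule left_mem)
  then have "evw u * \<kappa> ?z \<bumpeq> evp p"
    using unit_content_nz[OF eq(2)]
    by (simp add: mult.assoc[symmetric] ncconst_mult[symmetric] cong_def)
  with cong_sym[OF w[of u]] show ?thesis
    unfolding ev_word_ex by (rule cong_trans)
qed

lemma overlaps_sound: "sound rs \<Longrightarrow> overlaps_ok \<chi> xs rs os \<Longrightarrow> sound (new_rules os rs)"
proof (induction os arbitrary: rs)
  case (Cons d os)
  obtain x t s y c u p where d: "d = (x, t, s, y, c, u, p)" by (metis surj_pair)
  have ok: "overlap_ok \<chi> xs rs (x, t, s, y, c, u, p)" "overlaps_ok \<chi> xs ((u, p) # rs) os"
    using Cons(3) unfolding d overlaps_ok.simps by blast+
  have "sound ((u, p) # rs)"
    using overlap_sound[OF Cons(2) ok(1)] Cons(2) by (simp add: sound_def)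
  from Cons(1)[OF this ok(2)] show ?case by (simp add: d)
qed simp

text \<open>Unlike in \<open>represents_nrm\<close>, f must respect congruence here, since the value
  of the inner map is known only modulo I.\<close>

lemma comp_entry_sound:
  assumes "sound_table tb" "hom_sound f H" "represents a x"
    and "\<And>x y. x \<bumpeq> y \<Longrightarrow> f x \<bumpeq> f y"
  shows "represents (comp_entry \<chi> tb H a) (f x)"
proof -
  obtain n p where a: "a = (n, p)" by (cases a)
  obtain m p' where m: "nrm \<chi> tb H (ncp_ex p) = (m, p')" by (cases "nrm \<chi> tb H (ncp_ex p)")
  have "f (ncconst (h ^ n) * x) = ncconst (h ^ n) * f x"
    using assms(2) by (simp add: hom_sound_def)
  moreover have "f (ncconst (h ^ n) * x) \<bumpeq> f (evp p)"
    using assms(3) a by (intro assms(4)) (simp add: represents_def)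
  ultimately have "ncconst (h ^ n) * f x \<bumpeq> f (evp p)"
    by simp
  from const_cong[OF this, of "h ^ m"]
  have "ncconst (h ^ (n + m)) * f x \<bumpeq> ncconst (h ^ m) * f (evp p)"
    by (simp add: power_add ncconst_mult mult.assoc[symmetric] ncconst_central[of "ncconst (h ^ m)" "h ^ n"])
  also have "\<dots> \<bumpeq> evp p'"
    using represents_nrm[OF assms(1,2), of "ncp_ex p"] m by (simp add: represents_def ev_ncp_ex)
  finally show ?thesis by (simp add: a m represents_def)
qed

lemma assoc_map: "assoc d (map (\<lambda>x. (x, g x)) xs) x = (if x \<in> set xs then g x else d)"
  by (induction xs) auto

lemma nrm_Lt: "nrm \<chi> tb H (Lt x) = assoc (0, [(([x], 0, 0, 0), [(0, 1)])]) (fst H) x"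
  by (cases H) simp

lemma hom_sound_hcomp:
  assumes "sound_table tb" "hom_sound f H" "hom_sound g G"
    and "\<And>x y. x \<bumpeq> y \<Longrightarrow> f x \<bumpeq> f y"
    and "\<And>x. x \<notin> set xs \<Longrightarrow> f (g (\<phi> x)) \<bumpeq> \<phi> x"
  shows "hom_sound (\<lambda>x. f (g x)) (hcomp \<chi> tb xs H G)"
proof -
  have 1: "represents (comp_entry \<chi> tb H (nrm \<chi> [] G (Lt x))) (f (g (\<phi> x)))" for x
    using assms(3) by (intro comp_entry_sound assms(1,2,4)) (simp add: hom_sound_def represents_def)
  have 2: "ncconst (h ^ 0) * f (g (\<phi> x)) \<bumpeq> evp [(([x], 0, 0, 0), [(0, 1)])]" if "x \<notin> set xs" for x
    using cong_trans[OF assms(5)[OF that] cong_sym[OF cong_mult_left[OF \<kappa>_0, of "\<phi> x"], simplified]]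
    by (simp add: evm_def)
  have 3: "f (g (\<kappa> t)) \<bumpeq> \<kappa> (tmap (snd H) (tmap (snd G) t))" for t
    using assms(2,3,4) unfolding hom_sound_def by (meson cong_trans)
  show ?thesis
    unfolding hom_sound_def
    using 1 2 3 assms(2,3)
    by (simp add: hom_sound_def tmap_comp nrm_Lt represents_def hcomp_def assoc_map del: split_paired_All)
qed

lemma hom_eq_sound:
  assumes "hom_sound f H" "hom_sound g G" "hom_eq \<chi> xs H G"
  shows "x \<in> set xs \<Longrightarrow> f (\<phi> x) \<bumpeq> g (\<phi> x)" "f (\<kappa> t) \<bumpeq> g (\<kappa> t)"
proof -
  show "f (\<phi> x) \<bumpeq> g (\<phi> x)" if "x \<in> set xs"
    using assms(1,2,3) that
    by (intro represents_entry_eq[of "nrm \<chi> [] H (Lt x)" _ "nrm \<chi> [] G (Lt x)"])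
      (auto simp: hom_sound_def hom_eq_def list_all_iff represents_def)
  show "f (\<kappa> t) \<bumpeq> g (\<kappa> t)"
    using assms unfolding hom_sound_def hom_eq_def by (metis cong_sym cong_trans)
qed

end

section \<open>Integer powers modulo an ideal\<close>

text \<open>The element y plays the role of the inverse of x, which exists only modulo an
  ideal.\<close>

definition zpow :: "'a::monoid_mult \<Rightarrow> 'a \<Rightarrow> int \<Rightarrow> 'a" where
  "zpow x y n = (if n \<ge> 0 then x ^ nat n else y ^ nat (- n))"

lemma zpow_0 [simp]: "zpow x y 0 = 1" and zpow_1 [simp]: "zpow x y 1 = x"
  and zpow_m1 [simp]: "zpow x y (- 1) = y"
  by (simp_all add: zpow_def)

lemma zpow_swap: "zpow x y (- n) = zpow y x n"
  by (auto simp: zpow_def)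

lemma zpow_hom:
  assumes "f 1 = 1" "\<And>a b. f (a * b) = f a * f b"
  shows "f (zpow x y n) = zpow (f x) (f y) n"
proof -
  have "f (a ^ m) = f a ^ m" for a m
    by (induction m) (simp_all add: assms)
  then show ?thesis by (simp add: zpow_def)
qed

lemma zpow_antihom:
  assumes "f 1 = 1" "\<And>a b. f (a * b) = f b * f a"
  shows "f (zpow x y n) = zpow (f x) (f y) n"
proof -
  have "f (a ^ m) = f a ^ m" for a m
    by (induction m) (simp_all add: assms power_commutes)
  then show ?thesis by (simp add: zpow_def)
qed

context two_sided
begin

lemma zpow_step_up:
  assumes "x * y \<bumpeq> 1"
  shows "x * zpow x y n \<bumpeq> zpow x y (n + 1)"
proof (cases "n \<ge> 0")
  case True
  then have "nat (n + 1) = Suc (nat n)" by simp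
  with True show ?thesis by (simp add: zpow_def)
next
  case False
  define m where "m = nat (- n - 1)"
  with False have m: "n = - int (Suc m)" by simp
  have "x * zpow x y n = x * y * y ^ m"
    unfolding m zpow_swap by (simp add: zpow_def mult.assoc nat_add_distrib)
  also have "\<dots> \<bumpeq> 1 * y ^ m"
    by (intro cong_mult_right assms)
  also have "1 * y ^ m = zpow x y (n + 1)"
    using zpow_swap[of x y "int m"] by (simp add: m zpow_def)
  finally show ?thesis .
qed

lemma zpow_step_down:
  assumes "y * x \<bumpeq> 1"
  shows "y * zpow x y n \<bumpeq> zpow x y (n - 1)"
  using zpow_step_up[OF assms, of "- n"] zpow_swap[of y x n] zpow_swap[of y x "n - 1"] by simp

text \<open>A recursion in both directions characterises integer powers; products of powers,
  iterated powers and images of torus elements are identified this way.\<close>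

lemma zpow_unique:
  assumes "X * Y \<bumpeq> 1" "Y * X \<bumpeq> 1"
    and "g 0 \<bumpeq> 1" "\<And>n. g (n + 1) \<bumpeq> X * g n" "\<And>n. g (n - 1) \<bumpeq> Y * g n"
  shows "g n \<bumpeq> zpow X Y n"
proof (induction n rule: int_induct[of _ 0])
  case (step1 i)
  have "g (i + 1) \<bumpeq> X * zpow X Y i"
    by (rule cong_trans[OF assms(4) cong_mult_left[OF step1(2)]])
  then show ?case by (rule cong_trans[OF _ zpow_step_up[OF assms(1)]])
next
  case (step2 i)
  have "g (i - 1) \<bumpeq> Y * zpow X Y i"
    by (rule cong_trans[OF assms(5) cong_mult_left[OF step2(2)]])
  then show ?case by (rule cong_trans[OF _ zpow_step_down[OF assms(2)]])
qed (use assms(3) in simp)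

lemma zpow_add:
  assumes "x * y \<bumpeq> 1" "y * x \<bumpeq> 1"
  shows "zpow x y m * zpow x y n \<bumpeq> zpow x y (m + n)"
proof (induction m rule: int_induct[of _ 0])
  case (step1 i)
  have "zpow x y (i + 1) * zpow x y n \<bumpeq> x * zpow x y i * zpow x y n"
    by (intro cong_mult_right cong_sym[OF zpow_step_up] assms)
  also have "\<dots> = x * (zpow x y i * zpow x y n)" by (simp add: mult.assoc)
  also have "\<dots> \<bumpeq> x * zpow x y (i + n)" by (rule cong_mult_left[OF step1(2)])
  also have "\<dots> \<bumpeq> zpow x y (i + n + 1)" by (rule zpow_step_up[OF assms(1)])
  finally show ?case by (simp add: algebra_simps)
next
  case (step2 i)
  have "zpow x y (i - 1) * zpow x y n \<bumpeq> y * zpow x y i * zpow x y n"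
    by (intro cong_mult_right cong_sym[OF zpow_step_down] assms)
  also have "\<dots> = y * (zpow x y i * zpow x y n)" by (simp add: mult.assoc)
  also have "\<dots> \<bumpeq> y * zpow x y (i + n)" by (rule cong_mult_left[OF step2(2)])
  also have "\<dots> \<bumpeq> zpow x y (i + n - 1)" by (rule zpow_step_down[OF assms(2)])
  finally show ?case by (simp add: algebra_simps)
qed simp

end

locale nc_ideal = two_sided I for I :: "('k::field, 'g) ncpoly set"
begin

lemma scal_cong: "x \<bumpeq> y \<Longrightarrow> ncconst c * x \<bumpeq> ncconst c * y"
  by (rule cong_mult_left)

lemma q_commute_inverse:
  assumes "x * y \<bumpeq> 1" "y * x \<bumpeq> 1" "x * z \<bumpeq> ncconst c * (z * x)" "c \<noteq> 0"
  shows "y * z \<bumpeq> ncconst (inverse c) * (z * y)"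
proof -
  have "ncconst c * (y * z) \<bumpeq> ncconst c * (y * z * (x * y))"
    using cong_mult_left[OF cong_sym[OF assms(1)], of "ncconst c * (y * z)"] by (simp add: mult.assoc)
  also have "\<dots> = y * (ncconst c * (z * x)) * y"
    by (simp add: mult.assoc ncconst_left_commute)
  also have "\<dots> \<bumpeq> y * (x * z) * y"
    by (intro cong_mult_right cong_mult_left cong_sym[OF assms(3)])
  also have "\<dots> = y * x * (z * y)" by (simp add: mult.assoc)
  also have "\<dots> \<bumpeq> z * y"
    using cong_mult_right[OF assms(2)] by simp
  finally have "ncconst (inverse c) * (ncconst c * (y * z)) \<bumpeq> ncconst (inverse c) * (z * y)"
    by (rule scal_cong)
  then show ?thesis
    using assms(4) by (simp add: mult.assoc[symmetric] ncconst_mult[symmetric])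
qed

lemma zpow_q_commute:
  assumes "x * y \<bumpeq> 1" "y * x \<bumpeq> 1" "x * z \<bumpeq> ncconst c * (z * x)" "c \<noteq> 0"
  shows "zpow x y n * z \<bumpeq> ncconst (c powi n) * (z * zpow x y n)"
proof (induction n rule: int_induct[of _ 0])
  case (step1 i)
  have "zpow x y (i + 1) * z \<bumpeq> x * zpow x y i * z"
    by (intro cong_mult_right cong_sym[OF zpow_step_up] assms)
  also have "\<dots> = x * (zpow x y i * z)" by (simp add: mult.assoc)
  also have "\<dots> \<bumpeq> x * (ncconst (c powi i) * (z * zpow x y i))"
    by (rule cong_mult_left[OF step1(2)])
  also have "\<dots> = ncconst (c powi i) * (x * z * zpow x y i)"
    by (simp add: mult.assoc ncconst_left_commute)
  also have "\<dots> \<bumpeq> ncconst (c powi i) * (ncconst c * (z * x) * zpow x y i)"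
    by (intro cong_mult_left cong_mult_right assms)
  also have "\<dots> = ncconst (c powi (i + 1)) * (z * (x * zpow x y i))"
    using assms(4) by (simp add: power_int_add ncconst_mult mult.assoc)
  also have "\<dots> \<bumpeq> ncconst (c powi (i + 1)) * (z * zpow x y (i + 1))"
    by (intro cong_mult_left zpow_step_up assms)
  finally show ?case .
next
  case (step2 i)
  have "zpow x y (i - 1) * z \<bumpeq> y * zpow x y i * z"
    by (intro cong_mult_right cong_sym[OF zpow_step_down] assms)
  also have "\<dots> = y * (zpow x y i * z)" by (simp add: mult.assoc)
  also have "\<dots> \<bumpeq> y * (ncconst (c powi i) * (z * zpow x y i))"
    by (rule cong_mult_left[OF step2(2)])
  also have "\<dots> = ncconst (c powi i) * (y * z * zpow x y i)"
    by (simp add: mult.assoc ncconst_left_commute)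
  also have "\<dots> \<bumpeq> ncconst (c powi i) * (ncconst (inverse c) * (z * y) * zpow x y i)"
    by (intro cong_mult_left cong_mult_right q_commute_inverse[OF assms])
  also have "\<dots> = ncconst (c powi (i - 1)) * (z * (y * zpow x y i))"
    using assms(4) by (simp add: power_int_diff ncconst_mult mult.assoc divide_inverse)
  also have "\<dots> \<bumpeq> ncconst (c powi (i - 1)) * (z * zpow x y (i - 1))"
    by (intro cong_mult_left zpow_step_down assms)
  finally show ?case .
qed simp

lemma zpow_commute:
  assumes "x * y \<bumpeq> 1" "y * x \<bumpeq> 1" "x * z \<bumpeq> z * x"
  shows "zpow x y n * z \<bumpeq> z * zpow x y n"
  using zpow_q_commute[of x y z 1 n] assms by simp

lemma zpow_zpow_commute:
  assumes "x * y \<bumpeq> 1" "y * x \<bumpeq> 1" "z * w \<bumpeq> 1" "w * z \<bumpeq> 1" "x * z \<bumpeq> z * x"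
  shows "zpow x y m * zpow z w n \<bumpeq> zpow z w n * zpow x y m"
  by (rule cong_sym, rule zpow_commute[OF assms(3,4)], rule cong_sym, rule zpow_commute[OF assms(1,2,5)])

lemma zpow_mult:
  assumes "x * y \<bumpeq> 1" "y * x \<bumpeq> 1" "z * w \<bumpeq> 1" "w * z \<bumpeq> 1" "x * z \<bumpeq> z * x"
  shows "zpow x y n * zpow z w n \<bumpeq> zpow (x * z) (y * w) n"
proof (rule zpow_unique)
  have yz: "y * z \<bumpeq> z * y"
    using q_commute_inverse[of x y z 1] assms by simp
  have yw: "y * w \<bumpeq> w * y"
    using zpow_zpow_commute[OF assms(1-5), of "- 1" "- 1"] by simp
  have zy: "x * w \<bumpeq> w * x"
    using zpow_zpow_commute[OF assms(1-5), of 1 "- 1"] by simp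
  have "x * z * (y * w) = x * (z * y) * w" by (simp add: mult.assoc)
  also have "\<dots> \<bumpeq> x * (y * z) * w" by (intro cong_mult_right cong_mult_left cong_sym[OF yz])
  also have "\<dots> = (x * y) * (z * w)" by (simp add: mult.assoc)
  also have "\<dots> \<bumpeq> 1 * 1" by (intro cong_mult assms)
  finally show "x * z * (y * w) \<bumpeq> 1" by simp
  have "y * w * (x * z) = y * (w * x) * z" by (simp add: mult.assoc)
  also have "\<dots> \<bumpeq> y * (x * w) * z" by (intro cong_mult_right cong_mult_left cong_sym[OF zy])
  also have "\<dots> = (y * x) * (w * z)" by (simp add: mult.assoc)
  also have "\<dots> \<bumpeq> 1 * 1" by (intro cong_mult assms)
  finally show "y * w * (x * z) \<bumpeq> 1" by simp
  show "zpow x y (n + 1) * zpow z w (n + 1) \<bumpeq> x * z * (zpow x y n * zpow z w n)" for n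
  proof -
    have "zpow x y (n + 1) * zpow z w (n + 1) \<bumpeq> (x * zpow x y n) * (z * zpow z w n)"
      by (intro cong_mult cong_sym[OF zpow_step_up] assms)
    also have "\<dots> = x * (zpow x y n * z) * zpow z w n" by (simp add: mult.assoc)
    also have "\<dots> \<bumpeq> x * (z * zpow x y n) * zpow z w n"
      by (intro cong_mult_right cong_mult_left zpow_commute assms)
    finally show ?thesis by (simp add: mult.assoc)
  qed
  show "zpow x y (n - 1) * zpow z w (n - 1) \<bumpeq> y * w * (zpow x y n * zpow z w n)" for n
  proof -
    have "zpow x y (n - 1) * zpow z w (n - 1) \<bumpeq> (y * zpow x y n) * (w * zpow z w n)"
      by (intro cong_mult cong_sym[OF zpow_step_down] assms)
    also have "\<dots> = y * (zpow x y n * w) * zpow z w n" by (simp add: mult.assoc)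
    also have "\<dots> \<bumpeq> y * (w * zpow x y n) * zpow z w n"
      by (intro cong_mult_right cong_mult_left zpow_commute assms zy)
    finally show ?thesis by (simp add: mult.assoc)
  qed
qed simp

lemma zpow_zpow:
  assumes "x * y \<bumpeq> 1" "y * x \<bumpeq> 1"
  shows "zpow x y (a * n) \<bumpeq> zpow (zpow x y a) (zpow x y (- a)) n"
proof (rule zpow_unique)
  show "zpow x y a * zpow x y (- a) \<bumpeq> 1" "zpow x y (- a) * zpow x y a \<bumpeq> 1"
    using zpow_add[OF assms, of a "- a"] zpow_add[OF assms, of "- a" a] by simp_all
  show "zpow x y (a * (n + 1)) \<bumpeq> zpow x y a * zpow x y (a * n)" for n
    using cong_sym[OF zpow_add[OF assms, of a "a * n"]] by (simp add: algebra_simps)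
  show "zpow x y (a * (n - 1)) \<bumpeq> zpow x y (- a) * zpow x y (a * n)" for n
    using cong_sym[OF zpow_add[OF assms, of "- a" "a * n"]] by (simp add: algebra_simps)
qed simp

end

fun zpow3 :: "(int \<Rightarrow> 'a::monoid_mult) \<Rightarrow> (int \<Rightarrow> 'a) \<Rightarrow> (int \<Rightarrow> 'a) \<Rightarrow> tor \<Rightarrow> 'a" where
  "zpow3 f g k (a, b, c) = f a * g b * k c"

lemma nc_modelI:
  fixes I :: "('k::field, 'g) ncpoly set"
  assumes "q_param q r" "nc_ideal I"
  defines "cg \<equiv> two_sided.cong I"
  assumes inv: "cg (x1 * y1) 1" "cg (y1 * x1) 1" "cg (x2 * y2) 1" "cg (y2 * x2) 1"
      "cg (x3 * y3) 1" "cg (y3 * x3) 1"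
    and com: "cg (x1 * x2) (x2 * x1)" "cg (x1 * x3) (x3 * x1)" "cg (x2 * x3) (x3 * x2)"
    and wt: "\<And>l. cg (x1 * \<phi> l) (ncconst (r powi fst (assoc (0, 0, 0) \<chi> l)) * (\<phi> l * x1))"
      "\<And>l. cg (x2 * \<phi> l) (ncconst (r powi fst (snd (assoc (0, 0, 0) \<chi> l))) * (\<phi> l * x2))"
      "\<And>l. cg (x3 * \<phi> l) (ncconst (r powi snd (snd (assoc (0, 0, 0) \<chi> l))) * (\<phi> l * x3))"
  shows "nc_model q r I \<phi> (zpow3 (zpow x1 y1) (zpow x2 y2) (zpow x3 y3)) \<chi>"
proof -
  interpret q_param q r by fact
  interpret nc_ideal I by fact
  note inv = inv[unfolded cg_def] and com = com[unfolded cg_def] and wt = wt[unfolded cg_def]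
  let ?A = "zpow x1 y1" and ?B = "zpow x2 y2" and ?C = "zpow x3 y3"
  have BA: "?B b * ?A a \<bumpeq> ?A a * ?B b" for a :: int and b :: int
    by (rule cong_sym, rule zpow_zpow_commute) (use inv com in auto)
  have CA: "?C c * ?A a \<bumpeq> ?A a * ?C c" for a :: int and c :: int
    by (rule cong_sym, rule zpow_zpow_commute) (use inv com in auto)
  have CB: "?C c * ?B b \<bumpeq> ?B b * ?C c" for b :: int and c :: int
    by (rule cong_sym, rule zpow_zpow_commute) (use inv com in auto)
  show ?thesis
  proof
    fix s t :: tor
    obtain a b c a' b' c' where st: "s = (a, b, c)" "t = (a', b', c')" by (metis surj_pair)
    have "?A a * ?B b * ?C c * (?A a' * ?B b' * ?C c') = ?A a * ?B b * (?C c * ?A a') * ?B b' * ?C c'"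
      by (simp add: mult.assoc)
    also have "\<dots> \<bumpeq> ?A a * ?B b * (?A a' * ?C c) * ?B b' * ?C c'"
      by (intro cong_mult_right cong_mult_left CA)
    also have "\<dots> = ?A a * (?B b * ?A a') * (?C c * ?B b') * ?C c'"
      by (simp add: mult.assoc)
    also have "\<dots> \<bumpeq> ?A a * (?A a' * ?B b) * (?B b' * ?C c) * ?C c'"
      by (intro cong_mult_right cong_mult cong_refl BA CB)
    also have "\<dots> = (?A a * ?A a') * (?B b * ?B b') * (?C c * ?C c')"
      by (simp add: mult.assoc)
    also have "\<dots> \<bumpeq> ?A (a + a') * ?B (b + b') * ?C (c + c')"
      by (intro cong_mult zpow_add inv)
    finally show "zpow3 ?A ?B ?C s * zpow3 ?A ?B ?C t \<bumpeq> zpow3 ?A ?B ?C (tadd s t)"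
      by (simp add: st)
  next
    fix t :: tor and l
    obtain a b c where t: "t = (a, b, c)" by (metis surj_pair)
    obtain u v w where u: "assoc (0, 0, 0) \<chi> l = (u, v, w)" by (metis surj_pair)
    have A: "?A a * \<phi> l \<bumpeq> ncconst (r powi (u * a)) * (\<phi> l * ?A a)"
      using zpow_q_commute[OF inv(1,2) wt(1)[of l], of a] r_nz by (simp add: u power_int_mult)
    have B: "?B b * \<phi> l \<bumpeq> ncconst (r powi (v * b)) * (\<phi> l * ?B b)"
      using zpow_q_commute[OF inv(3,4) wt(2)[of l], of b] r_nz by (simp add: u power_int_mult)
    have C: "?C c * \<phi> l \<bumpeq> ncconst (r powi (w * c)) * (\<phi> l * ?C c)"
      using zpow_q_commute[OF inv(5,6) wt(3)[of l], of c] r_nz by (simp add: u power_int_mult)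
    have "?A a * ?B b * ?C c * \<phi> l = ?A a * ?B b * (?C c * \<phi> l)" by (simp add: mult.assoc)
    also have "\<dots> \<bumpeq> ?A a * ?B b * (ncconst (r powi (w * c)) * (\<phi> l * ?C c))"
      by (intro cong_mult_left C)
    also have "\<dots> = ncconst (r powi (w * c)) * (?A a * (?B b * \<phi> l) * ?C c)"
      by (simp add: mult.assoc ncconst_left_commute)
    also have "\<dots> \<bumpeq> ncconst (r powi (w * c)) * (?A a * (ncconst (r powi (v * b)) * (\<phi> l * ?B b)) * ?C c)"
      by (intro cong_mult_left cong_mult_right B)
    also have "\<dots> = ncconst (r powi (w * c) * r powi (v * b)) * (?A a * \<phi> l * ?B b * ?C c)"
      by (simp add: mult.assoc ncconst_left_commute[of "?A a"] ncconst_mult)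
    also have "\<dots> \<bumpeq> ncconst (r powi (w * c) * r powi (v * b)) * (ncconst (r powi (u * a)) * (\<phi> l * ?A a) * ?B b * ?C c)"
      by (intro cong_mult_left cong_mult_right A)
    also have "\<dots> = ncconst (r powi (w * c) * r powi (v * b) * r powi (u * a)) * (\<phi> l * (?A a * ?B b * ?C c))"
      by (simp add: mult.assoc ncconst_mult)
    also have "r powi (w * c) * r powi (v * b) * r powi (u * a) = r powi (u * a + v * b + w * c)"
      by (simp add: power_int_add r_nz)
    finally show "zpow3 ?A ?B ?C t * \<phi> l
        \<bumpeq> ncconst (r powi tdot (assoc (0, 0, 0) \<chi> l) t) * (\<phi> l * zpow3 ?A ?B ?C t)"
      by (simp add: t u)
  qed simp
qed

section \<open>Lusztig automorphisms\<close>

lemma cartan_sym: "cartan i j = cartan j i"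
  by (auto simp: cartan_def)

lemma cartan_cases: "cartan i j = 2 \<and> i = j \<or> cartan i j = 0 \<and> i \<noteq> j \<or> cartan i j = - 1 \<and> i \<noteq> j"
  by (auto simp: cartan_def)

lemma cartan_diag [simp]: "cartan i i = 2"
  by (simp add: cartan_def)

text \<open>The relations without the Serre relations. This weaker setting also covers the
  annihilator of the Verma functions, where the Serre relations of the F_i fail.\<close>

locale uq_pre = q_param q r + nc_ideal I for q r :: "'k::field" and I :: "('k, uq_gen) ncpoly set" +
  assumes K_Kinv: "vK i * vKinv i \<bumpeq> 1" and Kinv_K: "vKinv i * vK i \<bumpeq> 1"
    and K_K: "vK i * vK j \<bumpeq> vK j * vK i"
    and K_E: "vK i * vE j \<bumpeq> ncconst (q powi cartan i j) * (vE j * vK i)"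
    and K_F: "vK i * vF j \<bumpeq> ncconst (q powi (- cartan i j)) * (vF j * vK i)"
    and E_F: "vE i * vF i - vF i * vE i \<bumpeq> ncconst (inverse h) * (vK i - vKinv i)"
    and E_F_distinct: "i \<noteq> j \<Longrightarrow> vE i * vF j \<bumpeq> vF j * vE i"

locale uq = uq_pre q r "rel_ideal (uq_relations q)" for q r :: "'k::field"
begin

notation cong (infix "\<bumpeq>" 50)

lemma relation_mem: "p \<in> uq_relations q \<Longrightarrow> p \<in> rel_ideal (uq_relations q)"
  using rel_ideal_contains by blast

lemma E_E: "cartan i j = 0 \<Longrightarrow> vE i * vE j \<bumpeq> vE j * vE i"
  and F_F: "cartan i j = 0 \<Longrightarrow> vF i * vF j \<bumpeq> vF j * vF i"
  and serre_E: "cartan i j = - 1 \<Longrightarrow> serre_poly q (vE i) (vE j) \<bumpeq> 0"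
  and serre_F: "cartan i j = - 1 \<Longrightarrow> serre_poly q (vF i) (vF j) \<bumpeq> 0"
  unfolding cong_def diff_0_right by (intro relation_mem uq_relations.intros; assumption)+

end

lemma (in nc_ideal) q_commute_of_conj:
  assumes "x * y \<bumpeq> 1" "y * x \<bumpeq> 1" "x * z * y \<bumpeq> ncconst c * z"
  shows "x * z \<bumpeq> ncconst c * (z * x)"
proof -
  have "x * z \<bumpeq> x * z * (y * x)"
    using cong_mult_left[OF cong_sym[OF assms(2)], of "x * z"] by simp
  also have "\<dots> = x * z * y * x" by (simp add: mult.assoc)
  also have "\<dots> \<bumpeq> ncconst c * z * x" by (rule cong_mult_right[OF assms(3)])
  finally show ?thesis by (simp add: mult.assoc)
qed

lemma uq_intro:
  assumes "q_param q r"
  shows "uq q r"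
proof -
  interpret q_param q r by fact
  interpret nc_ideal "rel_ideal (uq_relations q)"
    by (simp add: nc_ideal_def two_sided_rel_ideal)
  note mem = subsetD[OF rel_ideal_contains]
  have K: "cong (vK i * vKinv i) 1" "cong (vKinv i * vK i) 1" for i
    unfolding cong_def by (intro mem uq_relations.intros)+
  show ?thesis
  proof
    fix i j
    show "cong (vK i * vKinv i) 1" "cong (vKinv i * vK i) 1" by (fact K)+
    show "cong (vK i * vK j) (vK j * vK i)"
      unfolding cong_def by (intro mem uq_relations.intros)
    show "cong (vK i * vE j) (ncconst (q powi cartan i j) * (vE j * vK i))"
      by (rule q_commute_of_conj[OF K]) (unfold cong_def, intro mem uq_relations.intros)
    show "cong (vK i * vF j) (ncconst (q powi - cartan i j) * (vF j * vK i))"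
      by (rule q_commute_of_conj[OF K]) (unfold cong_def, intro mem uq_relations.intros)
    show "cong (vE i * vF i - vF i * vE i) (ncconst (inverse h) * (vK i - vKinv i))"
      unfolding cong_def h_def by (intro mem uq_relations.intros)
    show "i \<noteq> j \<Longrightarrow> cong (vE i * vF j) (vF j * vE i)"
      unfolding cong_def by (intro mem uq_relations.intros)
  qed
qed

section \<open>Models of the computation inside \<open>Uq\<close>\<close>

definition letter_map :: "'k::field \<Rightarrow> (int \<times> uq_gen) list \<Rightarrow> int \<Rightarrow> ('k, uq_gen) ncpoly" where
  "letter_map c L = assoc 0 (map (\<lambda>(x, g). (x, ncconst c * ncvar g)) L)"

text \<open>Weights are doubled because they count powers of r rather than q. Numbers without a
  letter are interpreted by 0, for which every commutation law holds.\<close>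

fun gen_wt :: "e6 \<Rightarrow> uq_gen \<Rightarrow> int" where
  "gen_wt m (GE j) = 2 * cartan m j"
| "gen_wt m (GF j) = - 2 * cartan m j"
| "gen_wt m _ = 0"

definition letter_wts :: "e6 \<Rightarrow> e6 \<Rightarrow> e6 \<Rightarrow> (int \<times> uq_gen) list \<Rightarrow> weights" where
  "letter_wts i l m L = map (\<lambda>(x, g). (x, gen_wt i g, gen_wt l g, gen_wt m g)) L"

definition K_torus :: "e6 \<Rightarrow> e6 \<Rightarrow> e6 \<Rightarrow> tor \<Rightarrow> ('k::field, uq_gen) ncpoly" where
  "K_torus i l m = zpow3 (zpow (vK i) (vKinv i)) (zpow (vK l) (vKinv l)) (zpow (vK m) (vKinv m))"

context uq_pre
begin

lemma K_gen:
  assumes "\<exists>j. g = GE j \<or> g = GF j"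
  shows "vK m * ncvar g \<bumpeq> ncconst (r powi gen_wt m g) * (ncvar g * vK m)"
  using assms
proof (elim exE disjE)
  fix j assume "g = GE j"
  then show ?thesis using K_E[of m j] by (simp add: r_powi_two)
next
  fix j assume "g = GF j"
  then show ?thesis using K_F[of m j] r_powi_two[of "- cartan m j"] by simp
qed

lemma uq_model:
  assumes "\<forall>(x, g)\<in>set L. \<exists>j. g = GE j \<or> g = GF j"
  shows "nc_model q r I (letter_map h L) (K_torus i l m) (letter_wts i l m L)"
proof -
  have "vK n * letter_map h L x \<bumpeq>
      ncconst (r powi (assoc 0 (map (\<lambda>(x, g). (x, gen_wt n g)) L) x)) * (letter_map h L x * vK n)" for n x
    using assms
  proof (induction L)
    case (Cons a L)
    obtain y g where a: "a = (y, g)" by (cases a)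
    have "ncconst h * (vK n * ncvar g) \<bumpeq> ncconst h * (ncconst (r powi gen_wt n g) * (ncvar g * vK n))"
      using Cons(2) a by (intro scal_cong K_gen) auto
    then have "vK n * (ncconst h * ncvar g) \<bumpeq> ncconst (r powi gen_wt n g) * (ncconst h * ncvar g * vK n)"
      by (simp add: mult.assoc ncconst_left_commute[of "vK n"]
          ncconst_left_commute[of "ncconst h" "r powi gen_wt n g"])
    then show ?case using Cons a by (simp add: letter_map_def)
  qed (simp add: letter_map_def)
  moreover have "assoc (0, 0, 0) (letter_wts i l m L) x =
      (assoc 0 (map (\<lambda>(x, g). (x, gen_wt i g)) L) x, assoc 0 (map (\<lambda>(x, g). (x, gen_wt l g)) L) x,
       assoc 0 (map (\<lambda>(x, g). (x, gen_wt m g)) L) x)" for x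
    by (induction L) (auto simp: letter_wts_def)
  ultimately show ?thesis
    unfolding K_torus_def
    by (intro nc_modelI) (simp_all add: K_Kinv Kinv_K K_K q_param_axioms nc_ideal_axioms)
qed

end

text \<open>
  Computations with three nodes \<open>i, l, m\<close> whose Cartan integers are \<open>a = a\<^sub>i\<^sub>l\<close>, \<open>b = a\<^sub>i\<^sub>m\<close> and
  \<open>c = a\<^sub>l\<^sub>m\<close>. The letters 1, 2, 3 stand for \<open>h F\<close> and 4, 5, 6 for \<open>h E\<close>.
\<close>

definition letters3 :: "e6 \<Rightarrow> e6 \<Rightarrow> e6 \<Rightarrow> (int \<times> uq_gen) list" where
  "letters3 i l m = [(1, GF i), (2, GF l), (3, GF m), (4, GE i), (5, GE l), (6, GE m)]"

definition wts3 :: "int \<Rightarrow> int \<Rightarrow> int \<Rightarrow> weights" where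
  "wts3 a b c =
     [(1, - 4, - 2 * a, - 2 * b), (2, - 2 * a, - 4, - 2 * c), (3, - 2 * b, - 2 * c, - 4),
      (4, 4, 2 * a, 2 * b), (5, 2 * a, 4, 2 * c), (6, 2 * b, 2 * c, 4)]"

definition unit_tor :: "int \<Rightarrow> int \<Rightarrow> tor" where
  "unit_tor x n = (if x = 1 then (n, 0, 0) else if x = 2 then (0, n, 0) else (0, 0, n))"

text \<open>The torus elements \<open>t\<close> and \<open>t'\<close> stand for \<open>K\<close> and \<open>K\<^sup>-\<^sup>1\<close>.\<close>

fun cross_rule :: "int \<Rightarrow> int \<Rightarrow> (tor \<times> tor) option \<Rightarrow> int list \<times> ncp" where
  "cross_rule e f None = ([e, f], [(([f, e], 0, 0, 0), [(0, 1)])])"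
| "cross_rule e f (Some (t, t')) =
     ([e, f], [(([f, e], 0, 0, 0), [(0, 1)]), (([], t), hl), (([], t'), [(- 2, 1), (2, - 1)])])"

text \<open>Here x is the larger letter. For adjacent nodes both Serre relations are solved for
  their largest word, xxy and xyy.\<close>

definition pair_rules :: "int \<Rightarrow> int \<Rightarrow> int \<Rightarrow> rules" where
  "pair_rules x y a =
     (if a = 0 then [([x, y], [(([y, x], 0, 0, 0), [(0, 1)])])]
      else [([x, x, y], [(([x, y, x], 0, 0, 0), [(- 2, 1), (2, 1)]), (([y, x, x], 0, 0, 0), [(0, - 1)])]),
            ([x, y, y], [(([y, x, y], 0, 0, 0), [(- 2, 1), (2, 1)]), (([y, y, x], 0, 0, 0), [(0, - 1)])])])"

definition cross_rules :: rules where
  "cross_rules = concat (map (\<lambda>x. map (\<lambda>y.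
     cross_rule (x + 3) y (if x = y then Some (unit_tor x 1, unit_tor x (- 1)) else None)) [1, 2, 3]) [1, 2, 3])"

definition rules3 :: "int \<Rightarrow> int \<Rightarrow> int \<Rightarrow> rules" where
  "rules3 a b c =
     cross_rules @ pair_rules 2 1 a @ pair_rules 3 1 b @ pair_rules 3 2 c @
     pair_rules 5 4 a @ pair_rules 6 4 b @ pair_rules 6 5 c"

definition cross_ex :: "int \<Rightarrow> int \<Rightarrow> ex" where
  "cross_ex x y =
     Sub (Qc [(0, 1)] (Lt (x + 3)) (Lt y))
       (if x = y then Mul (Sc hl) (Sub (Tr (unit_tor x 1)) (Tr (unit_tor x (- 1)))) else Sc [])"

text \<open>The Serre element is the nested commutator of x with [x, y]_q, where the outer parameter
  is 1/q.\<close>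

definition pair_ex :: "int \<Rightarrow> int \<Rightarrow> int \<Rightarrow> ex" where
  "pair_ex x y a =
     (if a = 0 then Qc [(0, 1)] (Lt x) (Lt y) else Qc [(- 2, 1)] (Lt x) (Qc [(2, 1)] (Lt x) (Lt y)))"

text \<open>Two distinct indices among 1, 2, 3 are determined by their sum.\<close>

fun cartan3 :: "int \<Rightarrow> int \<Rightarrow> int \<Rightarrow> int \<Rightarrow> int \<Rightarrow> int" where
  "cartan3 a b c x y =
     (if x = y then 2 else if x + y = 3 then a else if x + y = 4 then b else c)"

definition exs3 :: "int \<Rightarrow> int \<Rightarrow> int \<Rightarrow> ex list" where
  "exs3 a b c = concat (map (\<lambda>x. concat (map (\<lambda>y.
     cross_ex x y # (if x = y then []
       else [pair_ex x y (cartan3 a b c x y), pair_ex (x + 3) (y + 3) (cartan3 a b c x y)]))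
     [1, 2, 3])) [1, 2, 3])"

text \<open>The only further reduction rule that is needed belongs to the subdiagrams of type \<open>A\<^sub>3\<close>.\<close>

definition overlap_A3 :: "int \<Rightarrow> int \<Rightarrow> int \<Rightarrow> overlap" where
  "overlap_A3 z y x =
     (if y < x
      then ([z, x, x], [y], [z], [x, x, y], [(- 2, - 1), (2, - 1)], [z, x, y, x],
        [(([x, z, x, y], 0, 0, 0), [(0, 1)]), (([x, y, x, z], 0, 0, 0), [(0, - 1)]),
         (([y, x, z, x], 0, 0, 0), [(0, 1)])])
      else ([z, y], [x, x], [z], [y, x, x], [(- 2, - 1), (2, - 1)], [z, x, y, x],
        [(([y, x, z, x], 0, 0, 0), [(0, 1)]), (([x, z, x, y], 0, 0, 0), [(0, 1)]),
         (([x, y, x, z], 0, 0, 0), [(0, - 1)])]))"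

text \<open>Torus elements stand on the right, whence -K^-1 E becomes -q^-2 E K^-1, and q^-2 is
  r^-4. A commutator with F_i or E_i carries one power of h; nodes not adjacent to i are left to the
  default, the identity.\<close>

definition T_table :: "int \<Rightarrow> int \<Rightarrow> hom_table" where
  "T_table a b =
     ([(1, 0, [(([4], - 1, 0, 0), [(- 4, - 1)])]), (4, 0, [(([1], 1, 0, 0), [(0, - 1)])])] @
      concat (map (\<lambda>(x, a). if a = 0 then [] else
        [(x, 1, [(([x, 1], 0, 0, 0), [(0, 1)]), (([1, x], 0, 0, 0), [(2, - 1)])]),
         (x + 3, 1, [(([x + 3, 4], 0, 0, 0), [(- 2, - 1)]), (([4, x + 3], 0, 0, 0), [(0, 1)])])])
        [(2, a), (3, b)]),
      (- 1, 0, 0), (- a, 1, 0), (- b, 0, 1))"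

definition T_inv_table :: "int \<Rightarrow> int \<Rightarrow> hom_table" where
  "T_inv_table a b =
     ([(1, 0, [(([4], 1, 0, 0), [(0, - 1)])]), (4, 0, [(([1], - 1, 0, 0), [(4, - 1)])])] @
      concat (map (\<lambda>(x, a). if a = 0 then [] else
        [(x, 1, [(([x, 1], 0, 0, 0), [(2, - 1)]), (([1, x], 0, 0, 0), [(0, 1)])]),
         (x + 3, 1, [(([x + 3, 4], 0, 0, 0), [(0, 1)]), (([4, x + 3], 0, 0, 0), [(- 2, - 1)])])])
        [(2, a), (3, b)]),
      (- 1, 0, 0), (- a, 1, 0), (- b, 0, 1))"

text \<open>The left components are scalar multiples of the images of the generators under
  \<open>T_hat\<close>, so agreement under \<open>T_inv\<close> means that T_inv T is the identity
  on them.\<close>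

definition T_ex :: "int \<Rightarrow> int \<Rightarrow> (ex \<times> ex) list" where
  "T_ex a b =
     [(Mul (Sc [(0, - 1)]) (Mul (Tr (- 1, 0, 0)) (Lt 4)), Lt 1),
      (Mul (Sc [(0, - 1)]) (Mul (Lt 1) (Tr (1, 0, 0))), Lt 4)] @
     concat (map (\<lambda>(x, a). if a = 0 then [] else
       [(Qc [(2, 1)] (Lt x) (Lt 1), Mul (Sc hl) (Lt x)),
        (Qc [(- 2, 1)] (Lt 4) (Lt (x + 3)), Mul (Sc hl) (Lt (x + 3)))]) [(2, a), (3, b)])"

definition overlaps3 :: "int \<Rightarrow> int \<Rightarrow> int \<Rightarrow> overlap list" where
  "overlaps3 a b c =
     (if (a, b, c) = (- 1, - 1, 0) then [overlap_A3 3 2 1, overlap_A3 6 5 4]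
      else if (a, b, c) = (- 1, 0, - 1) then [overlap_A3 3 1 2, overlap_A3 6 4 5] else [])"

definition check3 :: "int \<times> int \<times> int \<Rightarrow> bool" where
  "check3 = (\<lambda>(a, b, c).
     overlaps_ok (wts3 a b c) [2, 3, 5, 6] (rules3 a b c) (overlaps3 a b c) \<and>
     vanishes (wts3 a b c) [2, 3, 4, 5, 6] (new_rules (overlaps3 a b c) (rules3 a b c)) (T_table a b) (exs3 a b c) \<and>
     agrees (wts3 a b c) [2, 3, 4, 5, 6] (new_rules (overlaps3 a b c) (rules3 a b c)) (T_inv_table a b) (T_ex a b))"

text \<open>By \<open>ex_triple\<close>, any two nodes fit together with i into three nodes of one
  of these shapes.\<close>

definition triples :: "(int \<times> int \<times> int) list" where
  "triples = [(0, 0, 0), (0, 0, - 1), (- 1, 0, 0), (- 1, - 1, 0), (- 1, 0, - 1)]"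

lemma check_triples: "list_all check3 triples"
  by code_simp

lemma K_torus_0 [simp]: "K_torus i l m (0, 0, 0) = 1"
  by (simp add: K_torus_def)

lemma ncvar_scal: "ncvar g * (ncconst c * x) = ncconst c * (ncvar g * x)"
    "ncvar g * ncconst c = ncconst c * ncvar g"
  by (fact ncconst_left_commute ncconst_central)+

lemma zpow_scal: "zpow x y n * (ncconst c * z) = ncconst c * (zpow x y n * z)"
    "zpow x y n * ncconst c = ncconst c * zpow x y n"
  by (fact ncconst_left_commute ncconst_central)+

lemma scal_scal: "ncconst c * (ncconst d * x) = ncconst (c * d) * x"
    "ncconst c * ncconst d = ncconst (c * d)"
  by (simp_all add: ncconst_mult mult.assoc)

lemmas scal_simps = mult.assoc mult.commute mult.left_commute ncvar_scal scal_scal zpow_scal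
  ncconst_add ncconst_diff ncconst_uminus distrib_left distrib_right left_diff_distrib right_diff_distrib

context q_param
begin

lemma r_powi_simps [simp]:
  "r powi (- 2) = inverse q" "r powi (- 4) = inverse q * inverse q" "r ^ 4 = q * q" "r\<^sup>2 = q"
proof -
  show "r\<^sup>2 = q" by (fact r_sq)
  show "r powi (- 2) = inverse q" "r powi (- 4) = inverse q * inverse q"
    using r_powi_two[of "- 1"] r_powi_two[of "- 2"] q_nz
    by (simp_all add: power_int_def power2_eq_square power_inverse)
  show "r ^ 4 = q * q"
    using power_mult[of r 2 2] unfolding r_sq by (simp add: power2_eq_square)
qed

end

context nc_ideal
begin

lemma scal_mem_cancel: "ncconst c * x \<in> I \<Longrightarrow> c \<noteq> 0 \<Longrightarrow> x \<in> I"
  using left_mem[of "ncconst c * x" "ncconst (inverse c)"] by (simp add: scal_scal)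

end

section \<open>Lifts of the Lusztig automorphisms and of their inverses\<close>

fun T_gen :: "'k::field \<Rightarrow> e6 \<Rightarrow> uq_gen \<Rightarrow> ('k, uq_gen) ncpoly" where
  "T_gen q i (GK j) = vK j * zpow (vK i) (vKinv i) (- cartan i j)"
| "T_gen q i (GKinv j) = vKinv j * zpow (vK i) (vKinv i) (cartan i j)"
| "T_gen q i (GE j) =
     (if j = i then - (vF i * vK i) else if cartan i j = 0 then vE j
      else vE i * vE j - ncconst (inverse q) * (vE j * vE i))"
| "T_gen q i (GF j) =
     (if j = i then - (vKinv i * vE i) else if cartan i j = 0 then vF j
      else vF j * vF i - ncconst q * (vF i * vF j))"

text \<open>The anti-involution that fixes E_j and F_j and inverts K_j. Conjugating a Lusztig
  automorphism by it gives the inverse automorphism.\<close>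

fun sigma_gen :: "uq_gen \<Rightarrow> ('k::field, uq_gen) ncpoly" where
  "sigma_gen (GK j) = vKinv j"
| "sigma_gen (GKinv j) = vK j"
| "sigma_gen (GE j) = vE j"
| "sigma_gen (GF j) = vF j"

abbreviation T_hat :: "'k::field \<Rightarrow> e6 \<Rightarrow> ('k, uq_gen) ncpoly \<Rightarrow> ('k, uq_gen) ncpoly" where
  "T_hat q i \<equiv> nc_subst (T_gen q i)"

abbreviation sigma :: "('k::field, uq_gen) ncpoly \<Rightarrow> ('k, uq_gen) ncpoly" where
  "sigma \<equiv> nc_antisubst sigma_gen"

definition T_inv :: "'k::field \<Rightarrow> e6 \<Rightarrow> ('k, uq_gen) ncpoly \<Rightarrow> ('k, uq_gen) ncpoly" where
  "T_inv q i x = sigma (T_hat q i (sigma x))"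

lemma T_inv_hom:
  "T_inv q i (x + y) = T_inv q i x + T_inv q i y" "T_inv q i (x * y) = T_inv q i x * T_inv q i y"
  "T_inv q i (ncconst c) = ncconst c"
  by (simp_all add: T_inv_def nc_subst_hom nc_antisubst_hom)

definition node3 :: "e6 \<Rightarrow> e6 \<Rightarrow> e6 \<Rightarrow> int \<Rightarrow> e6" where
  "node3 i l m x = (if x = 1 then i else if x = 2 then l else m)"

context uq_pre
begin

abbreviation Kp :: "e6 \<Rightarrow> int \<Rightarrow> ('k, uq_gen) ncpoly" where
  "Kp j \<equiv> zpow (vK j) (vKinv j)"

text \<open>The scaling by h removes the denominator: h^2 (EF - FE) = h (K - K^-1).\<close>

lemma cross_sound:
  assumes "nc_model q r I \<phi> \<kappa> \<chi>"
    and "\<phi> e = ncconst h * vE i" "\<phi> f = ncconst h * vF j" "\<kappa> (0, 0, 0) = 1"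
    and "s = None \<and> i \<noteq> j \<or> s = Some (t, t') \<and> i = j \<and> \<kappa> t = vK i \<and> \<kappa> t' = vKinv i"
  shows "nc_model.sound r I \<phi> \<kappa> [cross_rule e f s]"
proof -
  interpret M: nc_model q r I \<phi> \<kappa> \<chi> by fact
  show ?thesis
  proof (cases "i = j")
    case True
    have "ncconst (h * h) * (vE i * vF i - vF i * vE i)
        \<bumpeq> ncconst (h * h) * (ncconst (inverse h) * (vK i - vKinv i))"
      by (rule scal_cong[OF E_F])
    moreover have "h * h * inverse h = h" using h_nz by simp
    ultimately have "ncconst (h * h) * (vE i * vF i) - (ncconst (h * h) * (vF i * vE i)
        + (ncconst h * vK i + - (ncconst h * vKinv i))) \<in> I"
      by (simp add: cong_def scal_scal right_diff_distrib diff_diff_eq[symmetric])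
    moreover have "evl [(- 2, 1), (2, - 1)] = - h" "evl [(0, 1)] = 1"
      by (simp_all add: h_def)
    ultimately show ?thesis
      using True assms(2-5)
      by (auto simp: M.sound_def cong_def M.evm_def evl_hl ncconst_uminus
          ncvar_scal scal_scal mult.assoc simp del: evl_Cons)
  next
    case False
    have "ncconst (h * h) * (vE i * vF j) \<bumpeq> ncconst (h * h) * (vF j * vE i)"
      using False by (intro scal_cong E_F_distinct)
    then show ?thesis
      using False assms(2-5) by (auto simp: M.sound_def M.evm_def scal_simps)
  qed
qed

lemma pair_sound:
  assumes "nc_model q r I \<phi> \<kappa> \<chi>" "\<kappa> (0, 0, 0) = 1"
    and "\<phi> x = ncconst h * X" "\<phi> y = ncconst h * Y"
    and "a = 0 \<Longrightarrow> X * Y \<bumpeq> Y * X"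
    and "a \<noteq> 0 \<Longrightarrow> serre_poly q X Y \<bumpeq> 0" "a \<noteq> 0 \<Longrightarrow> serre_poly q Y X \<bumpeq> 0"
  shows "nc_model.sound r I \<phi> \<kappa> (pair_rules x y a)"
proof -
  interpret M: nc_model q r I \<phi> \<kappa> \<chi> by fact
  have X: "X * (ncconst c * z) = ncconst c * (X * z)" "Y * (ncconst c * z) = ncconst c * (Y * z)"
      "X * ncconst c = ncconst c * X" "Y * ncconst c = ncconst c * Y" for c z
    by (fact ncconst_left_commute ncconst_central)+
  show ?thesis
  proof (cases "a = 0")
    case True
    have "ncconst (h * h) * (X * Y) \<bumpeq> ncconst (h * h) * (Y * X)"
      using True assms(5) by (intro scal_cong)
    then show ?thesis
      using True assms(2-4)
      by (simp add: M.sound_def pair_rules_def M.evm_def scal_simps X)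
  next
    case False
    have "ncconst (h * h * h) * serre_poly q X Y \<bumpeq> ncconst (h * h * h) * 0"
         "ncconst (h * h * h) * serre_poly q Y X \<bumpeq> ncconst (h * h * h) * 0"
      using False assms(6,7) by (intro scal_cong; blast)+
    then show ?thesis
      using False assms(2-4)
      by (simp add: M.sound_def pair_rules_def M.evm_def cong_def serre_poly_def scal_simps X)
        (simp add: algebra_simps)
  qed
qed

end

context uq
begin

text \<open>Each relation is fixed up to sign, except that commutators of the K_i turn into
  commutators of their inverses.\<close>

lemma sigma_ideal: "x \<in> rel_ideal (uq_relations q) \<Longrightarrow> sigma x \<in> rel_ideal (uq_relations q)"
proof -
  have "rel_ideal (uq_relations q) \<subseteq> {x. sigma x \<in> rel_ideal (uq_relations q)}"
  proof (rule rel_ideal_least)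
    show "two_sided {x. sigma x \<in> rel_ideal (uq_relations q)}"
      by (rule two_sided_antipreimage) (simp_all add: nc_antisubst_hom two_sided_axioms)
    have EF: "sigma (vE i * vF i - vF i * vE i - ncconst c * (vK i - vKinv i))
        = - (vE i * vF i - vF i * vE i - ncconst c * (vK i - vKinv i))" for i c
      by (simp add: nc_antisubst_hom ncconst_central algebra_simps)
    have serre: "sigma (serre_poly q x y) = serre_poly q x y" if "sigma x = x" "sigma y = y" for x y
      using that
      by (simp add: serre_poly_def nc_antisubst_hom ncconst_left_commute[of x] ncconst_left_commute[of y] mult.assoc)
        (simp add: ncconst_central ncconst_left_commute[of x] ncconst_left_commute[of y] mult.assoc)
    have com: "sigma (x * y - y * x) = - (sigma x * sigma y - sigma y * sigma x)" for x y
      by (simp add: nc_antisubst_hom)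
    have comm_K: "vKinv i * vKinv j - vKinv j * vKinv i \<in> rel_ideal (uq_relations q)" for i j
      using zpow_zpow_commute[OF K_Kinv Kinv_K K_Kinv Kinv_K K_K, of i "- 1" j "- 1"]
      by (simp add: cong_def)
    have "sigma p \<in> rel_ideal (uq_relations q)" if "p \<in> uq_relations q" for p
      using that
    proof cases
      case (3 i j)
      then show ?thesis using comm_K minus_mem com by (metis nc_antisubst_var sigma_gen.simps(1))
    next
      case (4 i j)
      then have "sigma p = p"
        by (simp add: nc_antisubst_hom ncconst_central mult.assoc)
      then show ?thesis using that relation_mem by simp
    next
      case (5 i j)
      then have "sigma p = p"
        by (simp add: nc_antisubst_hom ncconst_central mult.assoc)
      then show ?thesis using that relation_mem by simp
    next
      case (6 i)
      then have "sigma p = - p" using EF by simp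
      then show ?thesis using that relation_mem minus_mem by simp
    next
      case (10 i j)
      then have "sigma p = p" using serre by simp
      then show ?thesis using that relation_mem by simp
    next
      case (11 i j)
      then have "sigma p = p" using serre by simp
      then show ?thesis using that relation_mem by simp
    next
      case (7 i j)
      then have "sigma p = - p" by (simp add: nc_antisubst_hom)
      then show ?thesis using that relation_mem minus_mem by simp
    next
      case (8 i j)
      then have "sigma p = - p" by (simp add: nc_antisubst_hom)
      then show ?thesis using that relation_mem minus_mem by simp
    next
      case (9 i j)
      then have "sigma p = - p" by (simp add: nc_antisubst_hom)
      then show ?thesis using that relation_mem minus_mem by simp
    next
      case (1 i)
      then have "sigma p = p" by (simp add: nc_antisubst_hom)
      then show ?thesis using that relation_mem by simp
    next
      case (2 i)
      then have "sigma p = p" by (simp add: nc_antisubst_hom)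
      then show ?thesis using that relation_mem by simp
    qed
    then show "uq_relations q \<subseteq> {x. sigma x \<in> rel_ideal (uq_relations q)}" by blast
  qed
  then show "x \<in> rel_ideal (uq_relations q) \<Longrightarrow> sigma x \<in> rel_ideal (uq_relations q)" by blast
qed

lemma sigma_cong: "x \<bumpeq> y \<Longrightarrow> sigma x \<bumpeq> sigma y"
  using sigma_ideal[of "x - y"] by (simp add: cong_def nc_antisubst_hom)

lemma sigma_sigma: "sigma (sigma x) = x"
proof (induction x rule: ncpoly_induct)
  case (var g)
  then show ?case by (cases g) simp_all
qed (simp_all add: nc_antisubst_hom)

lemma sigma_Kp: "sigma (Kp j n) = Kp j (- n)"
  by (subst zpow_antihom) (simp_all add: nc_antisubst_hom zpow_swap)

lemma T_hat_Kp: "T_hat q i (Kp j n) \<bumpeq> Kp j n * Kp i (- cartan i j * n)"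
proof -
  let ?a = "- cartan i j"
  have inv: "Kp i ?a * Kp i (- ?a) \<bumpeq> 1" "Kp i (- ?a) * Kp i ?a \<bumpeq> 1"
    using zpow_add[OF K_Kinv[of i] Kinv_K, of ?a "- ?a"] zpow_add[OF K_Kinv[of i] Kinv_K, of "- ?a" ?a]
    by simp_all
  have com: "vK j * Kp i ?a \<bumpeq> Kp i ?a * vK j"
    by (rule cong_sym, rule zpow_commute[OF K_Kinv Kinv_K K_K])
  have "T_hat q i (Kp j n) = zpow (vK j * Kp i ?a) (vKinv j * Kp i (- ?a)) n"
    by (subst zpow_hom) (simp_all add: nc_subst_hom)
  also have "\<dots> \<bumpeq> Kp j n * zpow (Kp i ?a) (Kp i (- ?a)) n"
    by (rule cong_sym, rule zpow_mult[OF K_Kinv Kinv_K inv com])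
  also have "\<dots> \<bumpeq> Kp j n * Kp i (?a * n)"
    by (rule cong_mult_left, rule cong_sym, rule zpow_zpow[OF K_Kinv Kinv_K])
  finally show ?thesis .
qed

lemma T_inv_Kp: "T_inv q i (Kp j n) \<bumpeq> Kp j n * Kp i (- cartan i j * n)"
proof -
  have "T_inv q i (Kp j n) \<bumpeq> sigma (Kp j (- n) * Kp i (cartan i j * n))"
    unfolding T_inv_def sigma_Kp using sigma_cong[OF T_hat_Kp[of i j "- n"]] by simp
  also have "\<dots> = Kp i (- cartan i j * n) * Kp j n"
    by (simp add: nc_antisubst_hom sigma_Kp)
  also have "\<dots> \<bumpeq> Kp j n * Kp i (- cartan i j * n)"
    by (rule zpow_zpow_commute[OF K_Kinv Kinv_K K_Kinv Kinv_K K_K])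
  finally show ?thesis .
qed

end

text \<open>Together with \<open>pair_rel\<close> this treats equal and distinct, adjacent and
  distant nodes uniformly, as the loops in \<open>exs3\<close> do.\<close>

definition cross_rel :: "'k::field \<Rightarrow> e6 \<Rightarrow> e6 \<Rightarrow> ('k, uq_gen) ncpoly" where
  "cross_rel c j n =
     vE j * vF n - vF n * vE j - (if j = n then ncconst (inverse c) * (vK j - vKinv j) else 0)"

definition pair_rel :: "'k::field \<Rightarrow> int \<Rightarrow> ('k, uq_gen) ncpoly \<Rightarrow> ('k, uq_gen) ncpoly \<Rightarrow> ('k, uq_gen) ncpoly" where
  "pair_rel q a x y = (if a = 0 then x * y - y * x else serre_poly q x y)"

lemma ev_pair:
  fixes I :: "('k::field, uq_gen) ncpoly set"
  assumes "nc_model q r I \<phi> \<kappa> \<chi>" "\<phi> x = ncconst c * X" "\<phi> y = ncconst c * Y"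
  shows "nc_model.ev r \<phi> \<kappa> (pair_ex x y d) = ncconst (if d = 0 then c * c else c * c * c) * pair_rel q d X Y"
proof -
  interpret nc_model q r I \<phi> \<kappa> \<chi> by fact
  have X: "X * (ncconst c * z) = ncconst c * (X * z)" "Y * (ncconst c * z) = ncconst c * (Y * z)" for c z
    by (fact ncconst_left_commute)+
  have qq: "q * (inverse q * z) = z" "q * inverse q = 1" for z using q_nz by simp_all
  show ?thesis
    using assms(2,3)
    by (simp add: pair_ex_def pair_rel_def serre_poly_def scal_simps X qq)
qed

lemma cartan3:
  assumes "x \<in> {1, 2, 3}" "y \<in> {1, 2, 3}" "x \<noteq> y"
  shows "cartan3 (cartan i l) (cartan i m) (cartan l m) x y = cartan (node3 i l m x) (node3 i l m y)"
  using assms by (auto simp: node3_def cartan_sym)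

context uq
begin

lemma Kinv_E: "vKinv i * vE j \<bumpeq> ncconst (q powi (- cartan i j)) * (vE j * vKinv i)"
  using q_commute_inverse[OF K_Kinv Kinv_K K_E] q_nz by (simp add: power_int_minus)

lemma Kinv_F: "vKinv i * vF j \<bumpeq> ncconst (q powi cartan i j) * (vF j * vKinv i)"
  using q_commute_inverse[OF K_Kinv Kinv_K K_F] q_nz by (simp add: power_int_minus)

lemma letter_map3: "letter_map h (letters3 i l m) x =
   (if x \<in> {1, 2, 3} then ncconst h * vF (node3 i l m x)
    else if x \<in> {4, 5, 6} then ncconst h * vE (node3 i l m (x - 3)) else 0)"
  by (simp add: letter_map_def letters3_def node3_def)

lemma model3:
  assumes "distinct [i, l, m]"
  shows "nc_model q r (rel_ideal (uq_relations q)) (letter_map h (letters3 i l m)) (K_torus i l m)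
           (wts3 (cartan i l) (cartan i m) (cartan l m))"
proof -
  have "letter_wts i l m (letters3 i l m) = wts3 (cartan i l) (cartan i m) (cartan l m)"
    using cartan_sym[of l i] cartan_sym[of m i] cartan_sym[of m l]
    by (simp add: letter_wts_def letters3_def wts3_def)
  then show ?thesis
    using uq_model[of "letters3 i l m" i l m] by (simp add: letters3_def)
qed

lemma pair_rel_sound:
  assumes "nc_model q r (rel_ideal (uq_relations q)) \<phi> \<kappa> \<chi>" "\<kappa> (0, 0, 0) = 1" "j \<noteq> n" "a = cartan j n"
    and "\<phi> x = ncconst h * vE j \<and> \<phi> y = ncconst h * vE n \<or> \<phi> x = ncconst h * vF j \<and> \<phi> y = ncconst h * vF n"
  shows "nc_model.sound r (rel_ideal (uq_relations q)) \<phi> \<kappa> (pair_rules x y a)"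
proof -
  have a: "a = 0 \<or> a = - 1" "cartan n j = a"
    using assms(3,4) cartan_cases[of j n] cartan_sym[of j n] by auto
  from assms(5) show ?thesis
  proof
    assume *: "\<phi> x = ncconst h * vE j \<and> \<phi> y = ncconst h * vE n"
    show ?thesis
      by (rule pair_sound[OF assms(1,2), of _ "vE j" _ "vE n"])
        (use * a assms(4) E_E serre_E in auto)
  next
    assume *: "\<phi> x = ncconst h * vF j \<and> \<phi> y = ncconst h * vF n"
    show ?thesis
      by (rule pair_sound[OF assms(1,2), of _ "vF j" _ "vF n"])
        (use * a assms(4) F_F serre_F in auto)
  qed
qed

section \<open>Verification in rank three\<close>

context
  fixes i l m :: e6 and a b c :: int
  assumes dist: "distinct [i, l, m]"
    and abc: "a = cartan i l" "b = cartan i m" "c = cartan l m"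
begin

interpretation M: nc_model q r "rel_ideal (uq_relations q)" "letter_map h (letters3 i l m)"
  "K_torus i l m" "wts3 a b c"
  using model3[OF dist] by (simp add: abc)

lemma rules3_sound: "M.sound (rules3 a b c)"
proof -
  have cr: "M.sound [cross_rule (x + 3) y (if x = y then Some (unit_tor x 1, unit_tor x (- 1)) else None)]"
    if "x \<in> {1, 2, 3}" "y \<in> {1, 2, 3}" for x y
    by (rule cross_sound[OF M.nc_model_axioms, of _ "node3 i l m x" _ "node3 i l m y" _ "unit_tor x 1" "unit_tor x (- 1)"])
      (use that dist in \<open>auto simp: letter_map3 node3_def K_torus_def unit_tor_def\<close>)
  have "M.sound cross_rules"
    using cr[of 1 1] cr[of 1 2] cr[of 1 3] cr[of 2 1] cr[of 2 2] cr[of 2 3] cr[of 3 1] cr[of 3 2] cr[of 3 3]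
    unfolding cross_rules_def by (simp add: M.sound_def del: cross_rule.simps split del: if_split)
  moreover have "M.sound (pair_rules x y (cartan j n))"
    if "j \<noteq> n" "letter_map h (letters3 i l m) x = ncconst h * vE j \<and> letter_map h (letters3 i l m) y = ncconst h * vE n
      \<or> letter_map h (letters3 i l m) x = ncconst h * vF j \<and> letter_map h (letters3 i l m) y = ncconst h * vF n" for x y j n
    using pair_rel_sound[OF M.nc_model_axioms K_torus_0 that(1) HOL.refl that(2)] .
  from this[of l i 2 1] this[of m i 3 1] this[of m l 3 2] this[of l i 5 4] this[of m i 6 4] this[of m l 6 5]
  have "M.sound (pair_rules 2 1 a)" "M.sound (pair_rules 3 1 b)" "M.sound (pair_rules 3 2 c)"
      "M.sound (pair_rules 5 4 a)" "M.sound (pair_rules 6 4 b)" "M.sound (pair_rules 6 5 c)"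
    using dist cartan_sym[of l i] cartan_sym[of m i] cartan_sym[of m l]
    by (auto simp: letter_map3 node3_def abc)
  ultimately show ?thesis
    by (simp add: rules3_def M.sound_append)
qed

lemma ev_cross: "x \<in> {1, 2, 3} \<Longrightarrow> y \<in> {1, 2, 3} \<Longrightarrow>
  M.ev (cross_ex x y) = ncconst (h * h) * cross_rel h (node3 i l m x) (node3 i l m y)"
proof -
  assume x: "x \<in> {1, 2, 3}" and y: "y \<in> {1, 2, 3}"
  have eq: "x = y \<longleftrightarrow> node3 i l m x = node3 i l m y"
    using dist x y by (auto simp: node3_def)
  have tor: "K_torus i l m (unit_tor x n) = Kp (node3 i l m x) n" for n
    using x by (auto simp: K_torus_def unit_tor_def node3_def)
  have hh: "h * (h * inverse h) = h" using h_nz by simp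
  have one: "evl [(0, 1)] = 1" by simp
  have x3: "x + 3 \<notin> {1, 2, 3}" "x + 3 \<in> {4, 5, 6}" using x by auto
  show ?thesis
    using x y x3 eq one
    by (simp add: cross_ex_def cross_rel_def letter_map3 tor evl_hl mult.assoc ncvar_scal scal_scal
        right_diff_distrib hh del: evl_Cons)
qed

lemma T_torus: "T_hat q i (K_torus i l m t) \<bumpeq> K_torus i l m (tmap (snd (T_table a b)) t)"
  "T_inv q i (K_torus i l m t) \<bumpeq> K_torus i l m (tmap (snd (T_inv_table a b)) t)"
proof -
  obtain u v w where t: "t = (u, v, w)" by (metis surj_pair)
  let ?K = "K_torus i l m"
  have K: "?K (n, 0, 0) = Kp i n" "?K (0, n, 0) = Kp l n" "?K (0, 0, n) = Kp m n" for n
    by (simp_all add: K_torus_def)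
  have parts: "f (?K t) \<bumpeq> ?K (- u - a * v - b * w, v, w)"
    if "\<And>j n. f (Kp j n) \<bumpeq> Kp j n * Kp i (- cartan i j * n)" "\<And>x y. f (x * y) = f x * f y" for f
  proof -
    have "f (?K t) = f (Kp i u) * f (Kp l v) * f (Kp m w)"
      by (simp add: t K_torus_def that(2))
    also have "\<dots> \<bumpeq> (?K (u, 0, 0) * ?K (- 2 * u, 0, 0)) * (?K (0, v, 0) * ?K (- a * v, 0, 0))
        * (?K (0, 0, w) * ?K (- b * w, 0, 0))"
      using that(1)[of i u] that(1)[of l v] that(1)[of m w] unfolding K abc
      by (intro cong_mult) simp_all
    also have "\<dots> \<bumpeq> ?K (- u, 0, 0) * ?K (- a * v, v, 0) * ?K (- b * w, 0, w)"
      using M.\<kappa>_add[of "(u, 0, 0)" "(- 2 * u, 0, 0)"] M.\<kappa>_add[of "(0, v, 0)" "(- a * v, 0, 0)"]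
        M.\<kappa>_add[of "(0, 0, w)" "(- b * w, 0, 0)"]
      by (intro cong_mult) simp_all
    also have "\<dots> \<bumpeq> ?K (- u - a * v, v, 0) * ?K (- b * w, 0, w)"
      using M.\<kappa>_add[of "(- u, 0, 0)" "(- a * v, v, 0)"] by (intro cong_mult_right) simp
    also have "\<dots> \<bumpeq> ?K (- u - a * v - b * w, v, w)"
      using M.\<kappa>_add[of "(- u - a * v, v, 0)" "(- b * w, 0, w)"] by simp
    finally show ?thesis .
  qed
  show "T_hat q i (?K t) \<bumpeq> ?K (tmap (snd (T_table a b)) t)"
    using parts[of "T_hat q i"] T_hat_Kp by (simp add: nc_subst_hom T_table_def t)
  show "T_inv q i (?K t) \<bumpeq> ?K (tmap (snd (T_inv_table a b)) t)"
    using parts[of "T_inv q i"] T_inv_Kp by (simp add: T_inv_hom T_inv_table_def t)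
qed

lemma T_letters:
  assumes ab: "a \<in> {0, - 1}" "b \<in> {0, - 1}"
  shows "M.represents (nrm (wts3 a b c) [] (T_table a b) (Lt x)) (T_hat q i (letter_map h (letters3 i l m) x))"
    "M.represents (nrm (wts3 a b c) [] (T_inv_table a b) (Lt x)) (T_inv q i (letter_map h (letters3 i l m) x))"
proof -
  have d: "i \<noteq> l" "i \<noteq> m" "l \<noteq> m" "l \<noteq> i" "m \<noteq> i" "m \<noteq> l" using dist by auto
  have tor: "K_torus i l m (1, 0, 0) = vK i" "K_torus i l m (- 1, 0, 0) = vKinv i"
    by (simp_all add: K_torus_def)
  have E: "ncconst (- h) * (vKinv i * vE i) \<bumpeq> ncconst (- h * (inverse q * inverse q)) * (vE i * vKinv i)"
    using scal_cong[OF Kinv_E[of i i], of "- h"] q_nz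
    by (simp add: scal_scal power_int_def power2_eq_square power_inverse)
  have F: "ncconst (- h) * (vKinv i * vF i) \<bumpeq> ncconst (- h * (q * q)) * (vF i * vKinv i)"
    using scal_cong[OF Kinv_F[of i i], of "- h"] by (simp add: scal_scal power2_eq_square)
  consider "x = 1" | "x = 4" | "x = 2" | "x = 3" | "x = 5" | "x = 6" | "x \<notin> {1, 2, 3, 4, 5, 6}"
    by blast
  then have "M.represents (nrm (wts3 a b c) [] (T_table a b) (Lt x)) (T_hat q i (letter_map h (letters3 i l m) x))
    \<and> M.represents (nrm (wts3 a b c) [] (T_inv_table a b) (Lt x)) (T_inv q i (letter_map h (letters3 i l m) x))"
  proof cases
    case 1
    then show ?thesis using E
      by (simp add: M.nrm_Lt T_table_def T_inv_table_def M.represents_def M.evm_def T_inv_def letter_map3 node3_def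
          nc_subst_hom nc_antisubst_hom tor scal_simps)
  next
    case 2
    then show ?thesis using F
      by (simp add: M.nrm_Lt T_table_def T_inv_table_def M.represents_def M.evm_def T_inv_def letter_map3 node3_def
          nc_subst_hom nc_antisubst_hom tor scal_simps)
  qed (use ab d in \<open>auto simp: M.nrm_Lt T_table_def T_inv_table_def M.represents_def M.evm_def T_inv_def letter_map3
        node3_def nc_subst_hom nc_antisubst_hom scal_simps abc[symmetric]\<close>)
  then show "M.represents (nrm (wts3 a b c) [] (T_table a b) (Lt x)) (T_hat q i (letter_map h (letters3 i l m) x))"
    "M.represents (nrm (wts3 a b c) [] (T_inv_table a b) (Lt x)) (T_inv q i (letter_map h (letters3 i l m) x))"
    by auto
qed

lemma T_hom_sound:
  assumes "a \<in> {0, - 1}" "b \<in> {0, - 1}"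
  shows "M.hom_sound (T_hat q i) (T_table a b)" "M.hom_sound (T_inv q i) (T_inv_table a b)"
  using T_letters[OF assms] T_torus
  by (simp_all add: M.hom_sound_def M.represents_def nc_subst_hom T_inv_hom del: split_paired_All)

context
  assumes triple: "(a, b, c) \<in> set triples"
begin

lemma ab: "a \<in> {0, - 1}" "b \<in> {0, - 1}"
  using triple by (auto simp: triples_def)

lemma T_vanishes: "e \<in> set (exs3 a b c) \<Longrightarrow> T_hat q i (M.ev e) \<in> rel_ideal (uq_relations q)"
  and T_agrees: "(e, e') \<in> set (T_ex a b) \<Longrightarrow> T_inv q i (M.ev e) \<bumpeq> M.ev e'"
proof -
  have "check3 (a, b, c)"
    using check_triples triple by (auto simp: list_all_iff)
  then have ov: "overlaps_ok (wts3 a b c) [2, 3, 5, 6] (rules3 a b c) (overlaps3 a b c)"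
    and van: "vanishes (wts3 a b c) [2, 3, 4, 5, 6] (new_rules (overlaps3 a b c) (rules3 a b c)) (T_table a b) (exs3 a b c)"
    and agr: "agrees (wts3 a b c) [2, 3, 4, 5, 6] (new_rules (overlaps3 a b c) (rules3 a b c)) (T_inv_table a b) (T_ex a b)"
    unfolding check3_def by blast+
  have rs: "M.sound (new_rules (overlaps3 a b c) (rules3 a b c))"
    by (rule M.overlaps_sound[OF rules3_sound ov])
  show "e \<in> set (exs3 a b c) \<Longrightarrow> T_hat q i (M.ev e) \<in> rel_ideal (uq_relations q)"
    by (rule M.vanishes_hom[OF van rs T_hom_sound(1)[OF ab]])
  show "(e, e') \<in> set (T_ex a b) \<Longrightarrow> T_inv q i (M.ev e) \<bumpeq> M.ev e'"
    by (rule M.agrees_hom[OF agr rs T_hom_sound(2)[OF ab]])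
qed

lemma T_cross_rel3:
  assumes "j \<in> {i, l, m}" "n \<in> {i, l, m}"
  shows "T_hat q i (cross_rel h j n) \<in> rel_ideal (uq_relations q)"
proof -
  have idx: "\<exists>x\<in>{1, 2, 3}. node3 i l m x = j'" if "j' \<in> {i, l, m}" for j'
    using that by (auto simp: node3_def)
  obtain x y where xy: "x \<in> {1, 2, 3}" "y \<in> {1, 2, 3}" "node3 i l m x = j" "node3 i l m y = n"
    using idx assms by metis
  have "cross_ex x y \<in> set (exs3 a b c)"
    using xy(1,2) by (auto simp: exs3_def)
  from T_vanishes[OF this] have "ncconst (h * h) * T_hat q i (cross_rel h j n) \<in> rel_ideal (uq_relations q)"
    by (simp only: ev_cross[OF xy(1,2)] xy(3,4) nc_subst_hom nc_subst_const)
  then show ?thesis by (rule scal_mem_cancel) (use h_nz in simp)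
qed

lemma T_pair_rel3:
  assumes "j \<in> {i, l, m}" "n \<in> {i, l, m}" "j \<noteq> n"
  shows "T_hat q i (pair_rel q (cartan j n) (vE j) (vE n)) \<in> rel_ideal (uq_relations q)"
    "T_hat q i (pair_rel q (cartan j n) (vF j) (vF n)) \<in> rel_ideal (uq_relations q)"
proof -
  have idx: "\<exists>x\<in>{1, 2, 3}. node3 i l m x = j'" if "j' \<in> {i, l, m}" for j'
    using that by (auto simp: node3_def)
  obtain x y where xy: "x \<in> {1, 2, 3}" "y \<in> {1, 2, 3}" "node3 i l m x = j" "node3 i l m y = n"
    using idx assms by metis
  then have ne: "x \<noteq> y" using assms(3) by auto
  let ?d = "cartan3 a b c x y"
  have d: "?d = cartan j n"
    using cartan3[OF xy(1,2) ne] xy(3,4) by (simp add: abc)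
  have "pair_ex x y ?d \<in> set (exs3 a b c)" "pair_ex (x + 3) (y + 3) ?d \<in> set (exs3 a b c)"
    using xy(1,2) ne by (auto simp: exs3_def)
  note mem = T_vanishes[OF this(1)] T_vanishes[OF this(2)]
  have L: "letter_map h (letters3 i l m) x = ncconst h * vF j" "letter_map h (letters3 i l m) y = ncconst h * vF n"
     "letter_map h (letters3 i l m) (x + 3) = ncconst h * vE j" "letter_map h (letters3 i l m) (y + 3) = ncconst h * vE n"
    using xy by (auto simp: letter_map3)
  let ?s = "if ?d = 0 then h * h else h * h * h"
  have s: "?s \<noteq> 0" using h_nz by simp
  from mem(2) have "ncconst ?s * T_hat q i (pair_rel q ?d (vE j) (vE n)) \<in> rel_ideal (uq_relations q)"
    by (simp only: ev_pair[OF M.nc_model_axioms L(3,4)] nc_subst_hom nc_subst_const)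
  from scal_mem_cancel[OF this s]
  show "T_hat q i (pair_rel q (cartan j n) (vE j) (vE n)) \<in> rel_ideal (uq_relations q)" by (simp only: d)
  from mem(1) have "ncconst ?s * T_hat q i (pair_rel q ?d (vF j) (vF n)) \<in> rel_ideal (uq_relations q)"
    by (simp only: ev_pair[OF M.nc_model_axioms L(1,2)] nc_subst_hom nc_subst_const)
  from scal_mem_cancel[OF this s]
  show "T_hat q i (pair_rel q (cartan j n) (vF j) (vF n)) \<in> rel_ideal (uq_relations q)" by (simp only: d)
qed

lemma T_inv_T3:
  assumes "j \<in> {i, l, m}"
  shows "T_inv q i (T_hat q i (vE j)) \<bumpeq> vE j" "T_inv q i (T_hat q i (vF j)) \<bumpeq> vF j"
proof -
  have tor: "K_torus i l m (1, 0, 0) = vK i" "K_torus i l m (- 1, 0, 0) = vKinv i"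
    by (simp_all add: K_torus_def)
  have d: "i \<noteq> l" "i \<noteq> m" "l \<noteq> m" "l \<noteq> i" "m \<noteq> i" "m \<noteq> l" using dist by auto
  have cancel: "x \<bumpeq> y" if "ncconst d * x \<bumpeq> ncconst d * y" "d \<noteq> 0" for d x y
    using scal_mem_cancel[of d "x - y"] that by (simp add: cong_def right_diff_distrib)
  have hc: "T_inv q i (ncconst d * x) = ncconst d * T_inv q i x" for d x
    by (simp add: T_inv_hom)
  have Ei: "T_inv q i (T_hat q i (vE i)) \<bumpeq> vE i"
  proof (rule cancel[OF _ h_nz])
    have "T_inv q i (M.ev (Mul (Sc [(0, - 1)]) (Mul (Lt 1) (Tr (1, 0, 0))))) \<bumpeq> M.ev (Lt 4)"
      by (rule T_agrees) (simp add: T_ex_def)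
    moreover have "M.ev (Mul (Sc [(0, - 1)]) (Mul (Lt 1) (Tr (1, 0, 0)))) = ncconst h * T_hat q i (vE i)"
      by (simp add: letter_map3 node3_def tor ncconst_uminus mult.assoc)
    moreover have "M.ev (Lt 4) = ncconst h * vE i"
      by (simp add: letter_map3 node3_def)
    ultimately show "ncconst h * T_inv q i (T_hat q i (vE i)) \<bumpeq> ncconst h * vE i"
      by (simp only: hc)
  qed
  have Fi: "T_inv q i (T_hat q i (vF i)) \<bumpeq> vF i"
  proof (rule cancel[OF _ h_nz])
    have "T_inv q i (M.ev (Mul (Sc [(0, - 1)]) (Mul (Tr (- 1, 0, 0)) (Lt 4)))) \<bumpeq> M.ev (Lt 1)"
      by (rule T_agrees) (simp add: T_ex_def)
    moreover have "M.ev (Mul (Sc [(0, - 1)]) (Mul (Tr (- 1, 0, 0)) (Lt 4))) = ncconst h * T_hat q i (vF i)"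
      by (simp add: letter_map3 node3_def tor ncconst_uminus mult.assoc ncvar_scal)
    moreover have "M.ev (Lt 1) = ncconst h * vF i"
      by (simp add: letter_map3 node3_def)
    ultimately show "ncconst h * T_inv q i (T_hat q i (vF i)) \<bumpeq> ncconst h * vF i"
      by (simp only: hc)
  qed
  have adj: "T_inv q i (T_hat q i (vE j)) \<bumpeq> vE j \<and> T_inv q i (T_hat q i (vF j)) \<bumpeq> vF j"
    if x: "x \<in> {2, 3}" "j = node3 i l m x" for x j
  proof (cases "cartan i j = 0")
    case True
    then show ?thesis using x d by (auto simp: T_inv_def node3_def nc_subst_hom)
  next
    case False
    have hh: "h * h \<noteq> 0" using h_nz by simp
    have ji: "j \<noteq> i" using x d by (auto simp: node3_def)
    have mem: "(Qc [(2, 1)] (Lt x) (Lt 1), Mul (Sc hl) (Lt x)) \<in> set (T_ex a b)"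
       "(Qc [(- 2, 1)] (Lt 4) (Lt (x + 3)), Mul (Sc hl) (Lt (x + 3))) \<in> set (T_ex a b)"
      using x False by (auto simp: T_ex_def node3_def abc)
    have L: "letter_map h (letters3 i l m) x = ncconst h * vF j" "letter_map h (letters3 i l m) 1 = ncconst h * vF i"
      "letter_map h (letters3 i l m) (x + 3) = ncconst h * vE j" "letter_map h (letters3 i l m) 4 = ncconst h * vE i"
      using x by (auto simp: letter_map3 node3_def)
    have "M.ev (Qc [(2, 1)] (Lt x) (Lt 1)) = ncconst (h * h) * T_hat q i (vF j)"
         "M.ev (Qc [(- 2, 1)] (Lt 4) (Lt (x + 3))) = ncconst (h * h) * T_hat q i (vE j)"
      using False ji by (simp_all add: L scal_simps)
    moreover have "M.ev (Mul (Sc hl) (Lt x)) = ncconst (h * h) * vF j"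
        "M.ev (Mul (Sc hl) (Lt (x + 3))) = ncconst (h * h) * vE j"
      by (simp_all only: M.ev.simps L evl_hl scal_scal)
    ultimately have "ncconst (h * h) * T_inv q i (T_hat q i (vF j)) \<bumpeq> ncconst (h * h) * vF j"
       "ncconst (h * h) * T_inv q i (T_hat q i (vE j)) \<bumpeq> ncconst (h * h) * vE j"
      using T_agrees[OF mem(1)] T_agrees[OF mem(2)] by (simp_all only: hc)
    then show ?thesis using cancel hh by blast
  qed
  have "j = i \<or> j = node3 i l m 2 \<or> j = node3 i l m 3"
    using assms by (auto simp: node3_def)
  then show "T_inv q i (T_hat q i (vE j)) \<bumpeq> vE j" "T_inv q i (T_hat q i (vF j)) \<bumpeq> vF j"
    using Ei Fi adj[of 2] adj[of 3] by auto
qed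

end

end

end

section \<open>Automorphisms of quotients of the free algebra\<close>

text \<open>A surjection from the free algebra with kernel I. It is instantiated by
  \<open>Uq\<close> with the canonical map, and by the coideal subalgebra with the map
  \<open>pk\<close> from its presentation.\<close>

locale nc_quotient = nc_ideal I for I :: "('k::field, 'g) ncpoly set" +
  fixes A :: "('k, 'a) module" and \<pi> :: "('k, 'g) ncpoly \<Rightarrow> 'a"
  assumes carrier: "carrier A = range \<pi>"
    and mult: "\<pi> (x * y) = \<pi> x \<otimes>\<^bsub>A\<^esub> \<pi> y"
    and add: "\<pi> (x + y) = \<pi> x \<oplus>\<^bsub>A\<^esub> \<pi> y"
    and one: "\<pi> 1 = \<one>\<^bsub>A\<^esub>"
    and smult: "\<pi> (ncconst c * x) = c \<odot>\<^bsub>A\<^esub> \<pi> x"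
    and eq_iff: "\<pi> x = \<pi> y \<longleftrightarrow> x - y \<in> I"
begin

text \<open>Both maps descend to the quotient, and there g inverts f; since only bijectivity is
  drawn from g, additivity is all that is asked of it.\<close>

lemma ex_aut:
  assumes f: "\<And>x y. f (x + y) = f x + f y" "\<And>x y. f (x * y) = f x * f y" "\<And>c. f (ncconst c) = ncconst c"
    and g: "\<And>x y. g (x + y) = g x + g y"
    and mem: "\<And>x. x \<in> I \<Longrightarrow> f x \<in> I" "\<And>x. x \<in> I \<Longrightarrow> g x \<in> I"
    and inv: "\<And>x. f (g x) - x \<in> I" "\<And>x. g (f x) - x \<in> I"
  shows "\<exists>t\<in>algebra_auts A. \<forall>x. t (\<pi> x) = \<pi> (f x)"
proof -
  have diff: "u (x - y) = u x - u y" if "\<And>x y. u (x + y) = u x + u y" for u :: "('k, 'g) ncpoly \<Rightarrow> ('k, 'g) ncpoly" and x y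
    using that[of "x - y" y] by simp
  define t where "t = restrict (\<lambda>X. \<pi> (f (SOME x. \<pi> x = X))) (carrier A)"
  have t: "t (\<pi> x) = \<pi> (f x)" for x
  proof -
    have "\<pi> (SOME y. \<pi> y = \<pi> x) = \<pi> x" by (rule someI) (rule HOL.refl)
    then have "f ((SOME y. \<pi> y = \<pi> x) - x) \<in> I" by (intro mem) (simp add: eq_iff)
    moreover have "\<pi> x \<in> carrier A" unfolding carrier by blast
    ultimately show ?thesis by (simp add: t_def eq_iff diff[OF f(1)])
  qed
  have "t \<in> ring_hom A A"
    by (rule ring_hom_memI) (auto simp: carrier t mult[symmetric] add[symmetric] one[symmetric] f f(3)[of 1, simplified])
  moreover have "bij_betw t (carrier A) (carrier A)"
  proof (rule bij_betwI')
    fix X Y assume "X \<in> carrier A" "Y \<in> carrier A"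
    then obtain x y where xy: "X = \<pi> x" "Y = \<pi> y" by (auto simp: carrier)
    have "x - y \<in> I" if "f x - f y \<in> I"
    proof -
      have "g (f x) - g (f y) \<in> I" using mem(2)[OF that] by (simp add: diff[OF g])
      then have "cong (g (f x)) (g (f y))" by (simp add: cong_def)
      moreover have "cong (g (f x)) x" "cong (g (f y)) y" using inv by (simp_all add: cong_def)
      ultimately have "cong x y" by (meson cong_sym cong_trans)
      then show ?thesis by (simp add: cong_def)
    qed
    then show "t X = t Y \<longleftrightarrow> X = Y"
      using xy mem(1)[of "x - y"] by (auto simp: t eq_iff diff[OF f(1)])
  next
    fix X assume "X \<in> carrier A"
    then show "t X \<in> carrier A" by (auto simp: carrier t)
  next
    fix Y assume "Y \<in> carrier A"
    then obtain y where "Y = \<pi> y" by (auto simp: carrier)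
    then have "Y = t (\<pi> (g y))" using inv(1)[of y] by (simp add: t eq_iff) (metis minus_diff_eq minus_mem)
    then show "\<exists>X\<in>carrier A. Y = t X" by (auto simp: carrier)
  qed
  moreover have "t \<in> extensional (carrier A)" by (simp add: t_def)
  moreover have "\<forall>c. \<forall>x\<in>carrier A. t (c \<odot>\<^bsub>A\<^esub> x) = c \<odot>\<^bsub>A\<^esub> t x"
    by (auto simp: carrier t smult[symmetric] f)
  ultimately have "t \<in> algebra_auts A" by (simp add: algebra_auts_def Bij_def)
  with t show ?thesis by blast
qed

lemma aut_simps:
  assumes "t \<in> algebra_auts A"
  shows "t (\<pi> x \<otimes>\<^bsub>A\<^esub> \<pi> y) = t (\<pi> x) \<otimes>\<^bsub>A\<^esub> t (\<pi> y)" "t (\<pi> x \<oplus>\<^bsub>A\<^esub> \<pi> y) = t (\<pi> x) \<oplus>\<^bsub>A\<^esub> t (\<pi> y)"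
    "t (c \<odot>\<^bsub>A\<^esub> \<pi> x) = c \<odot>\<^bsub>A\<^esub> t (\<pi> x)" "t \<one>\<^bsub>A\<^esub> = \<one>\<^bsub>A\<^esub>"
  using assms carrier by (auto simp: algebra_auts_def ring_hom_mult ring_hom_add ring_hom_one)

lemma aut_determined:
  assumes "t \<in> algebra_auts A" "\<And>g. t (\<pi> (ncvar g)) = \<pi> (f g)"
  shows "t (\<pi> x) = \<pi> (nc_subst f x)"
proof (induction x rule: ncpoly_induct)
  case (const c)
  have "\<pi> (ncconst c) = c \<odot>\<^bsub>A\<^esub> \<one>\<^bsub>A\<^esub>" using smult[of c 1] one by simp
  then show ?case using aut_simps(3)[OF assms(1), of c 1] aut_simps(4)[OF assms(1)] one by simp
qed (simp_all add: assms nc_subst_hom mult add aut_simps)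

lemma aut_eqI:
  assumes "t \<in> algebra_auts A" "u \<in> algebra_auts A" "\<And>x. t (\<pi> x) = u (\<pi> x)"
  shows "t = u"
  using assms by (intro extensionalityI[of t "carrier A" u]) (auto simp: algebra_auts_def Bij_def carrier)

end

lemma presented_quotient: "nc_quotient (rel_ideal R) (presented_algebra R) (cls R)"
  by (intro nc_quotient.intro nc_ideal.intro nc_quotient_axioms.intro two_sided_rel_ideal)
    (simp_all add: presented_carrier cls_one cls_eq_iff)

section \<open>Existence and uniqueness of the Lusztig automorphisms\<close>

definition e6_nodes :: "e6 list" where
  "e6_nodes = [\<alpha>\<^sub>1, \<alpha>\<^sub>2, \<alpha>\<^sub>3, \<alpha>\<^sub>4, \<alpha>\<^sub>5, \<alpha>\<^sub>6]"

lemma set_e6_nodes: "x \<in> set e6_nodes"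
  by (cases x) (simp_all add: e6_nodes_def)

definition in_triple :: "e6 \<Rightarrow> e6 \<Rightarrow> e6 \<Rightarrow> e6 \<Rightarrow> e6 \<Rightarrow> bool" where
  "in_triple i j n l m \<longleftrightarrow>
     distinct [i, l, m] \<and> list_ex (\<lambda>t. t = (cartan i l, cartan i m, cartan l m)) triples \<and>
     (j = i \<or> j = l \<or> j = m) \<and> (n = i \<or> n = l \<or> n = m)"

text \<open>The relations involving E and F concern at most two nodes j and n. An inspection of all
  i, j, n shows that the rank three computations therefore cover them all.\<close>

lemma ex_triple: "\<exists>l m. distinct [i, l, m] \<and> (cartan i l, cartan i m, cartan l m) \<in> set triples
    \<and> j \<in> {i, l, m} \<and> n \<in> {i, l, m}"
proof -
  have "list_all (\<lambda>i. list_all (\<lambda>j. list_all (\<lambda>n. list_ex (\<lambda>l. list_ex (\<lambda>m. in_triple i j n l m)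
      e6_nodes) e6_nodes) e6_nodes) e6_nodes) e6_nodes"
    by code_simp
  then have "\<exists>l m. in_triple i j n l m"
    using set_e6_nodes unfolding list_all_iff list_ex_iff by meson
  then show ?thesis by (auto simp: in_triple_def list_ex_iff)
qed

section \<open>Weights, and descent of the lifts to the quotient\<close>

context uq_pre
begin

definition has_wt :: "('k, uq_gen) ncpoly \<Rightarrow> (e6 \<Rightarrow> int) \<Rightarrow> bool" where
  "has_wt z \<beta> \<longleftrightarrow> (\<forall>n. vK n * z \<bumpeq> ncconst (q powi \<beta> n) * (z * vK n))"

lemma has_wt_mult:
  assumes "has_wt x \<beta>" "has_wt y \<gamma>"
  shows "has_wt (x * y) (\<lambda>n. \<beta> n + \<gamma> n)"
proof -
  have "vK n * (x * y) \<bumpeq> ncconst (q powi (\<beta> n + \<gamma> n)) * (x * y * vK n)" for n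
  proof -
    have "vK n * x * y \<bumpeq> ncconst (q powi \<beta> n) * (x * vK n) * y"
      using assms(1) by (intro cong_mult_right) (simp add: has_wt_def)
    also have "\<dots> = ncconst (q powi \<beta> n) * x * (vK n * y)" by (simp add: mult.assoc)
    also have "\<dots> \<bumpeq> ncconst (q powi \<beta> n) * x * (ncconst (q powi \<gamma> n) * (y * vK n))"
      using assms(2) by (intro cong_mult_left) (simp add: has_wt_def)
    finally show ?thesis
      using q_nz by (simp add: mult.assoc ncconst_left_commute[of x] scal_scal power_int_add)
  qed
  then show ?thesis by (simp add: has_wt_def)
qed

lemma has_wt_add:
  assumes "has_wt x \<beta>" "has_wt y \<beta>"
  shows "has_wt (x + y) \<beta>"
  using assms unfolding has_wt_def distrib_left distrib_right by (blast intro: cong_add)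

lemma has_wt_scal: "has_wt x \<beta> \<Longrightarrow> has_wt (ncconst c * x) \<beta>"
  unfolding has_wt_def
proof
  fix n assume "\<forall>n. vK n * x \<bumpeq> ncconst (q powi \<beta> n) * (x * vK n)"
  then have "ncconst c * (vK n * x) \<bumpeq> ncconst c * (ncconst (q powi \<beta> n) * (x * vK n))"
    by (intro scal_cong) blast
  then show "vK n * (ncconst c * x) \<bumpeq> ncconst (q powi \<beta> n) * (ncconst c * x * vK n)"
    by (simp add: mult.assoc ncvar_scal scal_scal mult.commute)
qed

lemma has_wt_uminus: "has_wt x \<beta> \<Longrightarrow> has_wt (- x) \<beta>"
  using has_wt_scal[of x \<beta> "- 1"] by (simp add: ncconst_uminus)

lemma has_wt_gens:
  "has_wt (vE j) (\<lambda>n. cartan n j)" "has_wt (vF j) (\<lambda>n. - cartan n j)"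
  "has_wt (vK j) (\<lambda>n. 0)" "has_wt (vKinv j) (\<lambda>n. 0)"
  using K_E K_F K_K zpow_zpow_commute[OF K_Kinv Kinv_K K_Kinv Kinv_K K_K, of _ 1 j "- 1"]
  by (simp_all add: has_wt_def)

end

context uq
begin

text \<open>The weight of the image is the reflected root s_i(alpha_j), paired here with
  alpha_n.\<close>

lemma has_wt_T:
  "has_wt (T_hat q i (vE j)) (\<lambda>n. cartan n j - cartan i j * cartan n i)"
  "has_wt (T_hat q i (vF j)) (\<lambda>n. - (cartan n j - cartan i j * cartan n i))"
proof -
  have w: "has_wt z \<beta> \<Longrightarrow> \<beta> = \<gamma> \<Longrightarrow> has_wt z \<gamma>" for z \<beta> \<gamma> by simp
  have 1: "has_wt (vF i * vK i) (\<lambda>n. - cartan n i)" "has_wt (vKinv i * vE i) (\<lambda>n. cartan n i)"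
    using has_wt_mult[OF has_wt_gens(2,3)] has_wt_mult[OF has_wt_gens(4,1)] by auto
  have 2: "has_wt (x * y - ncconst c * (y * x)) (\<lambda>n. \<beta> n + \<gamma> n)"
    if "has_wt x \<beta>" "has_wt y \<gamma>" for x y c \<beta> \<gamma>
  proof -
    have "has_wt (x * y + ncconst (- c) * (y * x)) (\<lambda>n. \<beta> n + \<gamma> n)"
      using has_wt_mult[OF that] has_wt_mult[OF that(2,1)]
      by (intro has_wt_add has_wt_scal) (simp_all add: add.commute)
    then show ?thesis by (simp add: ncconst_uminus)
  qed
  consider "i = j" | "i \<noteq> j" "cartan i j = 0" | "i \<noteq> j" "cartan i j = - 1"
    using cartan_cases[of i j] by auto
  then show "has_wt (T_hat q i (vE j)) (\<lambda>n. cartan n j - cartan i j * cartan n i)"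
  proof cases
    case 1
    then show ?thesis using has_wt_uminus[OF \<open>has_wt (vF i * vK i) (\<lambda>n. - cartan n i)\<close>] by simp
  next
    case 3
    then show ?thesis using 2[OF has_wt_gens(1)[of i] has_wt_gens(1)[of j], of "inverse q"] by (simp add: add.commute)
  qed (simp add: has_wt_gens)
  consider "i = j" | "i \<noteq> j" "cartan i j = 0" | "i \<noteq> j" "cartan i j = - 1"
    using cartan_cases[of i j] by auto
  then show "has_wt (T_hat q i (vF j)) (\<lambda>n. - (cartan n j - cartan i j * cartan n i))"
  proof cases
    case 1
    then show ?thesis using has_wt_uminus[OF \<open>has_wt (vKinv i * vE i) (\<lambda>n. cartan n i)\<close>] by simp
  next
    case 3
    then show ?thesis using 2[OF has_wt_gens(2)[of j] has_wt_gens(2)[of i], of q] by simp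
  qed (simp add: has_wt_gens)
qed

text \<open>T(K_j) belongs to s_i(alpha_j), and z has weight plus or minus s_i(alpha_l) when s is 1
  or -1. The claim expresses that the form is invariant under s_i.\<close>

lemma T_conj:
  assumes "has_wt z (\<lambda>n. s * (cartan n l - cartan i l * cartan n i))"
  shows "T_hat q i (vK j) * z * T_hat q i (vKinv j) \<bumpeq> ncconst (q powi (s * cartan j l)) * z"
proof -
  let ?a = "- cartan i j"
  let ?K = "K_torus j i i"
  interpret M: nc_model q r "rel_ideal (uq_relations q)" "letter_map h []" ?K "letter_wts j i i []"
    by (rule uq_model) simp
  let ?\<beta> = "\<lambda>n. s * (cartan n l - cartan i l * cartan n i)"
  have T: "T_hat q i (vK j) = ?K (1, ?a, 0)" "T_hat q i (vKinv j) = ?K (- 1, - ?a, 0)"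
    by (simp_all add: K_torus_def)
  have "Kp i ?a * z \<bumpeq> ncconst ((q powi ?\<beta> i) powi ?a) * (z * Kp i ?a)"
    by (rule zpow_q_commute[OF K_Kinv Kinv_K assms[unfolded has_wt_def, rule_format]]) (simp add: q_nz)
  then have "vK j * (Kp i ?a * z) \<bumpeq> vK j * (ncconst (q powi (?\<beta> i * ?a)) * (z * Kp i ?a))"
    unfolding power_int_mult by (rule cong_mult_left)
  also have "\<dots> = ncconst (q powi (?\<beta> i * ?a)) * (vK j * z * Kp i ?a)"
    by (simp add: mult.assoc ncvar_scal)
  also have "\<dots> \<bumpeq> ncconst (q powi (?\<beta> i * ?a)) * (ncconst (q powi ?\<beta> j) * (z * vK j) * Kp i ?a)"
    by (intro cong_mult_left cong_mult_right assms[unfolded has_wt_def, rule_format])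
  also have "\<dots> = ncconst (q powi (?\<beta> i * ?a + ?\<beta> j)) * (z * ?K (1, ?a, 0))"
    using q_nz by (simp add: mult.assoc scal_scal power_int_add K_torus_def)
  also have "?\<beta> i * ?a + ?\<beta> j = s * cartan j l"
    using cartan_sym[of i j] by (simp add: algebra_simps)
  finally have "T_hat q i (vK j) * z \<bumpeq> ncconst (q powi (s * cartan j l)) * (z * ?K (1, ?a, 0))"
    by (simp add: mult.assoc)
  from cong_mult_right[OF this, of "?K (- 1, - ?a, 0)"]
  have "T_hat q i (vK j) * z * T_hat q i (vKinv j)
      \<bumpeq> ncconst (q powi (s * cartan j l)) * (z * (?K (1, ?a, 0) * ?K (- 1, - ?a, 0)))"
    unfolding T by (simp add: mult.assoc)
  also have "\<dots> \<bumpeq> ncconst (q powi (s * cartan j l)) * (z * ?K (0, 0, 0))"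
    using M.\<kappa>_add[of "(1, ?a, 0)" "(- 1, - ?a, 0)"] by (intro cong_mult_left) simp
  finally show ?thesis by simp
qed

lemma T_ideal:
  assumes "x \<in> rel_ideal (uq_relations q)"
  shows "T_hat q i x \<in> rel_ideal (uq_relations q)"
proof -
  have "rel_ideal (uq_relations q) \<subseteq> {x. T_hat q i x \<in> rel_ideal (uq_relations q)}"
  proof (rule rel_ideal_least)
    show "two_sided {x. T_hat q i x \<in> rel_ideal (uq_relations q)}"
      by (rule two_sided_preimage) (simp_all add: nc_subst_hom two_sided_axioms)
    have cross: "T_hat q i (cross_rel h j n) \<in> rel_ideal (uq_relations q)" for j n
      using ex_triple[of i j n] T_cross_rel3 by blast
    have pair: "T_hat q i (pair_rel q (cartan j n) (vE j) (vE n)) \<in> rel_ideal (uq_relations q)"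
       "T_hat q i (pair_rel q (cartan j n) (vF j) (vF n)) \<in> rel_ideal (uq_relations q)" if "cartan j n \<noteq> 2" for j n
      using ex_triple[of i j n] T_pair_rel3 that by (metis cartan_diag)+
    have K: "T_hat q i (vK j) = K_torus j l i (1, 0, - cartan i j)"
      "T_hat q i (vKinv j) = K_torus j l i (- 1, 0, cartan i j)"
      "T_hat q i (vK l) = K_torus j l i (0, 1, - cartan i l)" for j l
      by (simp_all add: K_torus_def)
    \<comment> \<open>A model without letters exists for arbitrary, possibly equal nodes, and it
      already supplies the law of the torus.\<close>
    have \<kappa>: "K_torus j l m s * K_torus j l m t \<bumpeq> K_torus j l m (tadd s t)" for j l m s t
    proof -
      interpret M: nc_model q r "rel_ideal (uq_relations q)" "letter_map h []" "K_torus j l m" "letter_wts j l m []"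
        by (rule uq_model) simp
      show ?thesis by (rule M.\<kappa>_add)
    qed
    show "uq_relations q \<subseteq> {x. T_hat q i x \<in> rel_ideal (uq_relations q)}"
    proof
      fix p assume p: "p \<in> uq_relations q"
      from p show "p \<in> {x. T_hat q i x \<in> rel_ideal (uq_relations q)}"
      proof cases
        case (1 j)
        have "T_hat q i (vK j) * T_hat q i (vKinv j) \<bumpeq> K_torus j j i (0, 0, 0)"
          unfolding K(1,2)[of j j] using \<kappa>[of j j i "(1, 0, - cartan i j)" "(- 1, 0, cartan i j)"] by simp
        then show ?thesis using 1 by (simp add: nc_subst_hom cong_def del: nc_subst_var)
      next
        case (2 j)
        have "T_hat q i (vKinv j) * T_hat q i (vK j) \<bumpeq> K_torus j j i (0, 0, 0)"
          unfolding K(1,2)[of j j] using \<kappa>[of j j i "(- 1, 0, cartan i j)" "(1, 0, - cartan i j)"] by simp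
        then show ?thesis using 2 by (simp add: nc_subst_hom cong_def del: nc_subst_var)
      next
        case (3 j l)
        have "T_hat q i (vK j) * T_hat q i (vK l) \<bumpeq> T_hat q i (vK l) * T_hat q i (vK j)"
          unfolding K(1)[of j l] K(3)[of l j]
        proof (rule cong_trans[OF \<kappa> cong_sym])
          show "K_torus j l i (0, 1, - cartan i l) * K_torus j l i (1, 0, - cartan i j)
              \<bumpeq> K_torus j l i (tadd (1, 0, - cartan i j) (0, 1, - cartan i l))"
            using \<kappa>[of j l i "(0, 1, - cartan i l)" "(1, 0, - cartan i j)"] by (simp add: add.commute)
        qed
        then show ?thesis using 3 by (simp add: nc_subst_hom cong_def del: nc_subst_var)
      next
        case (4 j l)
        then show ?thesis
          using T_conj[of "T_hat q i (vE l)" 1 l i j] has_wt_T(1)[of i l]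
          by (simp add: nc_subst_hom cong_def del: nc_subst_var)
      next
        case (5 j l)
        then show ?thesis
          using T_conj[of "T_hat q i (vF l)" "- 1" l i j] has_wt_T(2)[of i l]
          by (simp add: nc_subst_hom cong_def del: nc_subst_var)
      next
        case (6 j)
        then show ?thesis using cross[of j j] by (simp add: cross_rel_def h_def)
      next
        case (7 j n)
        then show ?thesis using cross[of j n] by (simp add: cross_rel_def)
      next
        case (8 j n)
        then show ?thesis using pair[of j n] by (simp add: pair_rel_def)
      next
        case (9 j n)
        then show ?thesis using pair[of j n] by (simp add: pair_rel_def)
      next
        case (10 j n)
        then show ?thesis using pair[of j n] by (simp add: pair_rel_def)
      next
        case (11 j n)
        then show ?thesis using pair[of j n] by (simp add: pair_rel_def)
      qed
    qed
  qed
  then show ?thesis using assms by blast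
qed

lemma T_inv_ideal: "x \<in> rel_ideal (uq_relations q) \<Longrightarrow> T_inv q i x \<in> rel_ideal (uq_relations q)"
  by (simp add: T_inv_def T_ideal sigma_ideal)

lemma T_inv_T: "T_inv q i (T_hat q i x) \<bumpeq> x"
proof (induction x rule: ncpoly_induct)
  case (const c)
  then show ?case by (simp add: T_inv_hom)
next
  case (var g)
  have K: "T_inv q i (T_hat q i (Kp j n)) \<bumpeq> Kp j n" for j n
  proof -
    let ?a = "- cartan i j * n"
    have "T_inv q i (T_hat q i (Kp j n)) \<bumpeq> T_inv q i (Kp j n * Kp i ?a)"
      using T_inv_ideal[of "T_hat q i (Kp j n) - Kp j n * Kp i ?a" i] T_hat_Kp[of i j n]
      by (simp add: cong_def T_inv_def nc_subst_hom nc_antisubst_hom)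
    also have "\<dots> \<bumpeq> (Kp j n * Kp i ?a) * (Kp i ?a * Kp i (- 2 * ?a))"
      unfolding T_inv_hom using T_inv_Kp[of i j n] T_inv_Kp[of i i ?a] by (intro cong_mult) simp_all
    also have "\<dots> \<bumpeq> (Kp j n * Kp i ?a) * Kp i (- ?a)"
      using zpow_add[OF K_Kinv Kinv_K, of i ?a "- 2 * ?a"]
      by (intro cong_mult_left) (simp add: mult.commute[of n])
    also have "\<dots> = Kp j n * (Kp i ?a * Kp i (- ?a))" by (simp add: mult.assoc)
    also have "\<dots> \<bumpeq> Kp j n * 1"
      using zpow_add[OF K_Kinv Kinv_K, of i ?a "- ?a"] by (intro cong_mult_left) simp
    finally show ?thesis by simp
  qed
  show ?case
  proof (cases g)
    case (GE j)
    then show ?thesis using ex_triple[of i j j] T_inv_T3(1) by blast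
  next
    case (GF j)
    then show ?thesis using ex_triple[of i j j] T_inv_T3(2) by blast
  next
    case (GK j)
    then show ?thesis using K[of j 1] by (simp del: nc_subst_var)
  next
    case (GKinv j)
    then show ?thesis using K[of j "- 1"] by (simp del: nc_subst_var)
  qed
next
  case (add x y)
  then show ?case by (simp add: nc_subst_hom T_inv_hom cong_add)
next
  case (mult x y)
  then show ?case by (simp add: nc_subst_hom T_inv_hom cong_mult)
qed

text \<open>Since \<open>T_inv\<close> is the conjugate of \<open>T_hat\<close> by an involution,
  this is the conjugate of \<open>T_inv_T\<close>.\<close>

lemma T_T_inv: "T_hat q i (T_inv q i x) \<bumpeq> x"
  using sigma_cong[OF T_inv_T[of i "sigma x"]] by (simp add: T_inv_def sigma_sigma)

section \<open>The automorphisms of the quotient\<close>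

abbreviation ucls :: "('k, uq_gen) ncpoly \<Rightarrow> 'k uq" where
  "ucls \<equiv> cls (uq_relations q)"

lemma gens_cls: "E q j = ucls (vE j)" "F q j = ucls (vF j)" "K q j = ucls (vK j)" "Kinv q j = ucls (vKinv j)"
  by (simp_all add: E_def F_def K_def Kinv_def presented_gen_cls)

sublocale Uq: nc_quotient "rel_ideal (uq_relations q)" "Uq q" ucls
  unfolding Uq_def by (rule presented_quotient)

lemma Uq_ring: "ring (Uq q)"
  unfolding Uq_def by (rule presented_ring)

lemma K_int_pow: "K q i [^]\<^bsub>Uq q\<^esub> (n :: int) = ucls (Kp i n)"
proof -
  interpret ring "Uq q" by (rule Uq_ring)
  have pow: "ucls x [^]\<^bsub>Uq q\<^esub> m = ucls (x ^ m)" for x and m :: nat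
    by (induction m) (simp_all add: Uq.one Uq.mult power_commutes[symmetric])
  show ?thesis
  proof (cases "n < 0")
    case False
    then show ?thesis by (simp add: int_pow_def2 gens_cls pow zpow_def)
  next
    case True
    define m where "m = nat (- n)"
    have "Kp i (int m) * Kp i (- int m) \<bumpeq> 1" "Kp i (- int m) * Kp i (int m) \<bumpeq> 1"
      using zpow_add[OF K_Kinv Kinv_K, of i "int m" "- int m"] zpow_add[OF K_Kinv Kinv_K, of i "- int m" "int m"]
      by simp_all
    then have "ucls (Kp i (int m)) \<otimes>\<^bsub>Uq q\<^esub> ucls (Kp i (- int m)) = \<one>\<^bsub>Uq q\<^esub>"
       "ucls (Kp i (- int m)) \<otimes>\<^bsub>Uq q\<^esub> ucls (Kp i (int m)) = \<one>\<^bsub>Uq q\<^esub>"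
      by (simp_all add: Uq.mult[symmetric] Uq.one[symmetric] Uq.eq_iff cong_def)
    then have "inv\<^bsub>Uq q\<^esub> (ucls (Kp i (int m))) = ucls (Kp i (- int m))"
      by (intro inv_char) (auto simp: Uq.carrier)
    then show ?thesis
      using True by (simp add: int_pow_def2 gens_cls pow m_def zpow_def)
  qed
qed

lemma q_commutator_cls: "q_commutator (Uq q) c (ucls x) (ucls y) = ucls (x * y - ncconst c * (y * x))"
  unfolding Uq_def by simp

lemma uminus_cls: "\<ominus>\<^bsub>Uq q\<^esub> ucls x = ucls (- x)"
  unfolding Uq_def by simp

lemma lusztig_T_cls: "lusztig_T q i (ucls x) = ucls (T_hat q i x)"
  and lusztig_T_aut: "lusztig_T q i \<in> algebra_auts (Uq q)"
proof -
  interpret ring "Uq q" by (rule Uq_ring)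
  let ?P = "\<lambda>T. T \<in> algebra_auts (Uq q) \<and>
     (\<forall>j. T (K q j) = K q j \<otimes>\<^bsub>Uq q\<^esub> (K q i [^]\<^bsub>Uq q\<^esub> (- cartan i j))) \<and>
     T (E q i) = \<ominus>\<^bsub>Uq q\<^esub> (F q i \<otimes>\<^bsub>Uq q\<^esub> K q i) \<and>
     T (F q i) = \<ominus>\<^bsub>Uq q\<^esub> (Kinv q i \<otimes>\<^bsub>Uq q\<^esub> E q i) \<and>
     (\<forall>j. cartan i j = 0 \<longrightarrow> T (E q j) = E q j \<and> T (F q j) = F q j) \<and>
     (\<forall>j. cartan i j = -1 \<longrightarrow>
        T (E q j) = q_commutator (Uq q) (inverse q) (E q i) (E q j) \<and>
        T (F q j) = q_commutator (Uq q) q (F q j) (F q i))"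
  obtain t where t: "t \<in> algebra_auts (Uq q)" "\<And>x. t (ucls x) = ucls (T_hat q i x)"
  proof -
    have "\<exists>t\<in>algebra_auts (Uq q). \<forall>x. t (ucls x) = ucls (T_hat q i x)"
      by (rule Uq.ex_aut[of "T_hat q i" "T_inv q i"])
        (use T_T_inv T_inv_T in \<open>auto simp: nc_subst_hom T_inv_hom T_ideal T_inv_ideal cong_def\<close>)
    then show ?thesis using that by blast
  qed
  have Pt: "?P t"
    using t by (auto simp: gens_cls K_int_pow[unfolded gens_cls] Uq.mult[symmetric] uminus_cls q_commutator_cls)
  have "u = t" if u: "?P u" for u
  proof (rule Uq.aut_eqI)
    show "u \<in> algebra_auts (Uq q)" "t \<in> algebra_auts (Uq q)" using u t by blast+
    then have car: "u (ucls x) \<in> carrier (Uq q)" for x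
      by (auto simp: algebra_auts_def ring_hom_def Uq.carrier)
    note mult = Uq.aut_simps(1)[OF \<open>u \<in> algebra_auts (Uq q)\<close>] and one = Uq.aut_simps(4)[OF \<open>u \<in> algebra_auts (Uq q)\<close>]
    have gen: "u (ucls (ncvar g)) = ucls (T_gen q i g)" for g
    proof (cases g)
      case (GK j)
      then show ?thesis using u by (simp add: gens_cls K_int_pow[unfolded gens_cls] Uq.mult[symmetric])
    next
      case (GE j)
      consider "i = j" | "i \<noteq> j" "cartan i j = 0" | "i \<noteq> j" "cartan i j = - 1"
        using cartan_cases[of i j] by auto
      then show ?thesis using GE u
        by cases (auto simp: gens_cls Uq.mult[symmetric] uminus_cls q_commutator_cls)
    next
      case (GF j)
      consider "i = j" | "i \<noteq> j" "cartan i j = 0" | "i \<noteq> j" "cartan i j = - 1"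
        using cartan_cases[of i j] by auto
      then show ?thesis using GF u
        by cases (auto simp: gens_cls Uq.mult[symmetric] uminus_cls q_commutator_cls)
    next
      case (GKinv j)
      \<comment> \<open>The description does not mention K_j^-1; its image is forced as the inverse
        of the image of K_j.\<close>
      have K: "u (ucls (vK j)) = t (ucls (vK j))"
        using u Pt by (simp add: gens_cls)
      have inv: "w (ucls (vKinv j)) \<otimes>\<^bsub>Uq q\<^esub> w (ucls (vK j)) = \<one>\<^bsub>Uq q\<^esub>"
         "w (ucls (vK j)) \<otimes>\<^bsub>Uq q\<^esub> w (ucls (vKinv j)) = \<one>\<^bsub>Uq q\<^esub>"
        if "w \<in> algebra_auts (Uq q)" for w
      proof -
        have "ucls (vKinv j) \<otimes>\<^bsub>Uq q\<^esub> ucls (vK j) = \<one>\<^bsub>Uq q\<^esub>" "ucls (vK j) \<otimes>\<^bsub>Uq q\<^esub> ucls (vKinv j) = \<one>\<^bsub>Uq q\<^esub>"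
          using K_Kinv[of j] Kinv_K[of j]
          by (simp_all add: Uq.mult[symmetric] Uq.one[symmetric] Uq.eq_iff cong_def)
        then show "w (ucls (vKinv j)) \<otimes>\<^bsub>Uq q\<^esub> w (ucls (vK j)) = \<one>\<^bsub>Uq q\<^esub>"
         "w (ucls (vK j)) \<otimes>\<^bsub>Uq q\<^esub> w (ucls (vKinv j)) = \<one>\<^bsub>Uq q\<^esub>"
          using Uq.aut_simps(1,4)[OF that] by metis+
      qed
      have "u (ucls (vKinv j)) = t (ucls (vKinv j))"
        by (rule inv_unique[of _ "t (ucls (vK j))"])
          (use inv[OF \<open>u \<in> algebra_auts (Uq q)\<close>] inv[OF t(1)] K car in \<open>auto simp: t(2) Uq.carrier\<close>)
      then show ?thesis using GKinv by (simp add: t(2))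
    qed
    then show "u (ucls x) = t (ucls x)" for x
      using Uq.aut_determined[OF \<open>u \<in> algebra_auts (Uq q)\<close> gen] t(2) by simp
  qed
  then have "lusztig_T q i = t"
    unfolding lusztig_T_def using Pt by (intro the_equality) blast+
  then show "lusztig_T q i (ucls x) = ucls (T_hat q i x)" "lusztig_T q i \<in> algebra_auts (Uq q)"
    using t by auto
qed

end

section \<open>A presentation of the coideal subalgebra\<close>

text \<open>\<open>GL i\<close> stands for \<open>K\<^sub>i K\<^sub>\<tau>\<^sub>(\<^sub>i\<^sub>)\<^sup>-\<^sup>1\<close>, where \<open>\<tau>\<close> is the diagram automorphism.\<close>

datatype ik_gen = GB e6 | GL e6

abbreviation vB :: "e6 \<Rightarrow> ('k::field, ik_gen) ncpoly" where "vB i \<equiv> ncvar (GB i)"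
abbreviation vL :: "e6 \<Rightarrow> ('k::field, ik_gen) ncpoly" where "vL i \<equiv> ncvar (GL i)"

text \<open>The exponent of q when \<open>GL i\<close> passes F_j. It is the same for the other
  summand of B_j, because the diagram automorphism exchanges the two Cartan integers and the root
  changes sign.\<close>

definition ik_wt :: "e6 \<Rightarrow> e6 \<Rightarrow> int" where
  "ik_wt i j = cartan (diagram_aut i) j - cartan i j"

definition ik_comm :: "'k::field \<Rightarrow> e6 \<Rightarrow> e6 \<Rightarrow> ('k, ik_gen) ncpoly" where
  "ik_comm q i j = vB i * vB j - vB j * vB i -
     (if j = diagram_aut i then ncconst (inverse (q - inverse q)) * (vL i - vL j) else 0)"

text \<open>The linear term stems from commuting E_tau(i) with F_i, so it occurs only if tau fixes
  i; adjacent nodes are never exchanged by tau.\<close>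

definition ik_serre :: "'k::field \<Rightarrow> e6 \<Rightarrow> e6 \<Rightarrow> ('k, ik_gen) ncpoly" where
  "ik_serre q i j =
     vB i * vB i * vB j - ncconst (q + inverse q) * vB i * vB j * vB i + vB j * vB i * vB i
     + (if diagram_aut i = i then ncconst (inverse q) * vB j else 0)"

text \<open>\<open>GL\<close> is available for every node to keep the relations uniform; at the
  nodes fixed by tau it is forced to be 1.\<close>

inductive_set ik_relations :: "'k::field \<Rightarrow> ('k, ik_gen) ncpoly set" for q where
  "vL i * vL (diagram_aut i) - 1 \<in> ik_relations q"
| "diagram_aut i = i \<Longrightarrow> vL i - 1 \<in> ik_relations q"
| "vL i * vL j - vL j * vL i \<in> ik_relations q"
| "vL i * vB j - ncconst (q powi ik_wt i j) * (vB j * vL i) \<in> ik_relations q"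
| "cartan i j = 0 \<Longrightarrow> ik_comm q i j \<in> ik_relations q"
| "cartan i j = - 1 \<Longrightarrow> ik_serre q i j \<in> ik_relations q"

fun Phi_gen :: "ik_gen \<Rightarrow> ('k::field, uq_gen) ncpoly" where
  "Phi_gen (GB i) = vF i - vKinv i * vE (diagram_aut i)"
| "Phi_gen (GL i) = vK i * vKinv (diagram_aut i)"

abbreviation Phi :: "('k::field, ik_gen) ncpoly \<Rightarrow> ('k, uq_gen) ncpoly" where
  "Phi \<equiv> nc_subst Phi_gen"

lemma diagram_aut_involution [simp]: "diagram_aut (diagram_aut i) = i"
  by (cases i) simp_all

lemma cartan_diagram_aut [simp]: "cartan (diagram_aut i) (diagram_aut j) = cartan i j"
  by (cases i; cases j) (simp_all add: cartan_def e6_edges_def)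

subsection \<open>The relations hold in the quantized enveloping algebra\<close>

text \<open>The letters 1, 2, 3, 4 stand for \<open>h\<close> times \<open>F\<^sub>i, F\<^sub>j, E\<^sub>\<tau>\<^sub>(\<^sub>i\<^sub>), E\<^sub>\<tau>\<^sub>(\<^sub>j\<^sub>)\<close>.\<close>

definition ik_letters :: "e6 \<Rightarrow> e6 \<Rightarrow> (int \<times> uq_gen) list" where
  "ik_letters i j = [(1, GF i), (2, GF j), (3, GE (diagram_aut i)), (4, GE (diagram_aut j))]"

definition ik_cross :: "e6 \<Rightarrow> e6 \<Rightarrow> int \<Rightarrow> int \<Rightarrow> int list \<times> ncp" where
  "ik_cross i j x y =
     cross_rule (x + 2) y
       (if diagram_aut (if x = 1 then i else j) = (if y = 1 then i else j)
        then Some (unit_tor y 1, unit_tor y (- 1)) else None)"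

definition ik_rules :: "e6 \<Rightarrow> e6 \<Rightarrow> rules" where
  "ik_rules i j =
     [ik_cross i j 1 1, ik_cross i j 1 2, ik_cross i j 2 1, ik_cross i j 2 2] @
     pair_rules 2 1 (cartan i j) @ pair_rules 4 3 (cartan i j)"

definition B_ex :: "int \<Rightarrow> ex" where
  "B_ex x = Sub (Lt x) (Mul (Tr (unit_tor x (- 1))) (Lt (x + 2)))"

text \<open>The cubic terms carry h^3 and the linear term only one h. The missing h^2/q is q^-3 - 2
  q^-1 + q, the constant of the last line.\<close>

definition ik_ex :: "e6 \<Rightarrow> e6 \<Rightarrow> ex" where
  "ik_ex i j =
     (if cartan i j = 0
      then Sub (Qc [(0, 1)] (B_ex 1) (B_ex 2))
        (if j = diagram_aut i then Mul (Sc hl) (Sub (Tr (1, - 1, 0)) (Tr (- 1, 1, 0))) else Sc [])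
      else Add (Qc [(- 2, 1)] (B_ex 1) (Qc [(2, 1)] (B_ex 1) (B_ex 2)))
        (if diagram_aut i = i then Mul (Sc [(- 6, 1), (- 2, - 2), (2, 1)]) (B_ex 2) else Sc []))"

definition ik_check :: "e6 \<Rightarrow> e6 \<Rightarrow> bool" where
  "ik_check i j \<longleftrightarrow> i = j \<or>
     vanishes (letter_wts i j j (ik_letters i j)) [2, 3, 4] (ik_rules i j) id_hom [ik_ex i j]"

lemma ik_checks: "list_all (\<lambda>i. list_all (ik_check i) e6_nodes) e6_nodes"
  by code_simp

context uq
begin

lemma Phi_pair:
  assumes "i \<noteq> j"
  shows "(cartan i j = 0 \<longrightarrow> Phi (ik_comm q i j) \<in> rel_ideal (uq_relations q)) \<and>
    (cartan i j = - 1 \<longrightarrow> Phi (ik_serre q i j) \<in> rel_ideal (uq_relations q))"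
proof -
  let ?L = "ik_letters i j" and ?\<phi> = "letter_map h (ik_letters i j)" and ?\<kappa> = "K_torus i j j"
  interpret M: nc_model q r "rel_ideal (uq_relations q)" ?\<phi> ?\<kappa> "letter_wts i j j ?L"
    by (rule uq_model) (simp add: ik_letters_def)
  have L: "?\<phi> 1 = ncconst h * vF i" "?\<phi> 2 = ncconst h * vF j"
    "?\<phi> 3 = ncconst h * vE (diagram_aut i)" "?\<phi> 4 = ncconst h * vE (diagram_aut j)"
    by (simp_all add: letter_map_def ik_letters_def)
  have tor: "?\<kappa> (1, - 1, 0) = vK i * vKinv j" "?\<kappa> (- 1, 1, 0) = vKinv i * vK j"
    "?\<kappa> (unit_tor 1 1) = vK i" "?\<kappa> (unit_tor 1 (- 1)) = vKinv i"
    "?\<kappa> (unit_tor 2 1) = vK j" "?\<kappa> (unit_tor 2 (- 1)) = vKinv j"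
    by (simp_all add: K_torus_def unit_tor_def)
  have cr: "M.sound [ik_cross i j x y]" if "x \<in> {1, 2}" "y \<in> {1, 2}" for x y
    unfolding ik_cross_def
    by (rule cross_sound[OF M.nc_model_axioms, of _ "diagram_aut (if x = 1 then i else j)" _ "if y = 1 then i else j"
          _ "unit_tor y 1" "unit_tor y (- 1)"])
      (use that L tor in \<open>auto\<close>)
  have "M.sound (pair_rules 2 1 (cartan j i))"
    by (rule pair_rel_sound[OF M.nc_model_axioms K_torus_0]) (use assms L in auto)
  moreover have "M.sound (pair_rules 4 3 (cartan (diagram_aut j) (diagram_aut i)))"
  proof (rule pair_rel_sound[OF M.nc_model_axioms K_torus_0])
    show "diagram_aut j \<noteq> diagram_aut i"
      using assms diagram_aut_involution by metis
  qed (use L in simp_all)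
  ultimately have rules: "M.sound (ik_rules i j)"
    using cr[of 1 1] cr[of 1 2] cr[of 2 1] cr[of 2 2] cartan_sym[of i j]
    by (auto simp: ik_rules_def M.sound_def)
  have "vanishes (letter_wts i j j ?L) [2, 3, 4] (ik_rules i j) id_hom [ik_ex i j]"
    using ik_checks set_e6_nodes assms unfolding list_all_iff ik_check_def by blast
  from M.vanishes_mem[OF this rules] have mem: "M.ev (ik_ex i j) \<in> rel_ideal (uq_relations q)"
    by simp
  have B: "M.ev (B_ex 1) = ncconst h * Phi (vB i)" "M.ev (B_ex 2) = ncconst h * Phi (vB j)"
    by (simp_all add: B_ex_def L tor ncvar_scal right_diff_distrib)
  have X: "Phi x * (ncconst c * z) = ncconst c * (Phi x * z)" for c x z
    by (fact ncconst_left_commute)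
  have hh: "h * (h * inverse h) = h" using h_nz by simp
  have hq: "evl [(- 6, 1), (- 2, - 2), (2, 1)] = inverse q * (h * h)"
  proof -
    have "r powi (- 6) = inverse q * inverse q * inverse q"
      using r_powi_two[of "- 3"] q_nz by (simp add: power_int_def power3_eq_cube power_inverse)
    then show ?thesis using q_nz by (simp add: h_def field_simps)
  qed
  show ?thesis
  proof (intro conjI impI)
    assume c: "cartan i j = 0"
    have "vKinv i * vK j \<bumpeq> vK j * vKinv i"
      using zpow_zpow_commute[OF K_Kinv Kinv_K K_Kinv Kinv_K K_K, of i "- 1" j 1] by simp
    then have "ncconst h * (vK i * vKinv j - vKinv i * vK j) \<bumpeq> ncconst h * (vK i * vKinv j - vK j * vKinv i)"
      by (intro scal_cong cong_diff cong_refl)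
    moreover have "ncconst (h * h) * Phi (ik_comm q i j) =
      ncconst h * Phi (vB i) * (ncconst h * Phi (vB j)) - ncconst h * Phi (vB j) * (ncconst h * Phi (vB i))
      - (if j = diagram_aut i then ncconst h * (vK i * vKinv j - vK j * vKinv i) else 0)"
      by (simp add: ik_comm_def h_def[symmetric] nc_subst_hom mult.assoc X[of "vB i"] X[of "vB j"] scal_scal
          right_diff_distrib hh del: nc_subst_var)
        (auto simp: right_diff_distrib hh)
    moreover have "M.ev (ik_ex i j) =
      ncconst h * Phi (vB i) * (ncconst h * Phi (vB j)) - ncconst h * Phi (vB j) * (ncconst h * Phi (vB i))
      - (if j = diagram_aut i then ncconst h * (vK i * vKinv j - vKinv i * vK j) else 0)"
    proof (cases "j = diagram_aut i")
      case True
      then have "ik_ex i j = Sub (Qc [(0, 1)] (B_ex 1) (B_ex 2)) (Mul (Sc hl) (Sub (Tr (1, - 1, 0)) (Tr (- 1, 1, 0))))"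
        using c by (simp add: ik_ex_def)
      moreover have "ncconst (evl [(0, 1)]) = (1 :: ('k, uq_gen) ncpoly)" by simp
      ultimately show ?thesis by (simp only: M.ev.simps B tor evl_hl if_P[OF True] mult_1_left)
    next
      case False
      then show ?thesis using c by (simp add: ik_ex_def B del: nc_subst_var)
    qed
    ultimately have "ncconst (h * h) * Phi (ik_comm q i j) \<bumpeq> M.ev (ik_ex i j)"
      by (simp only:) (intro cong_diff cong_refl, auto intro: cong_sym)
    then have "ncconst (h * h) * Phi (ik_comm q i j) \<in> rel_ideal (uq_relations q)"
      using cong_mem mem by blast
    then show "Phi (ik_comm q i j) \<in> rel_ideal (uq_relations q)"
      by (rule scal_mem_cancel) (use h_nz in simp)
  next
    assume c: "cartan i j = - 1"
    have qq: "q * (inverse q * z) = z" for z using q_nz by simp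
    have "ncconst (h * h * h) * Phi (ik_serre q i j) = M.ev (ik_ex i j)"
      using c by (simp add: ik_ex_def B hq ik_serre_def nc_subst_hom X[of "vB i"] X[of "vB j"] scal_simps qq
          del: nc_subst_var evl_Cons)
        (simp add: scal_simps qq)
    then have "ncconst (h * h * h) * Phi (ik_serre q i j) \<in> rel_ideal (uq_relations q)"
      using mem by simp
    then show "Phi (ik_serre q i j) \<in> rel_ideal (uq_relations q)"
      by (rule scal_mem_cancel) (use h_nz in simp)
  qed
qed

lemma KK_inverse: "vK i * vKinv j * (vK j * vKinv i) \<bumpeq> 1"
  and KK_commute: "vK i * vKinv j * (vK l * vKinv m) \<bumpeq> vK l * vKinv m * (vK i * vKinv j)"
proof -
  have KK: "Kp a x * Kp b y \<bumpeq> Kp b y * Kp a x" for a b x y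
    by (rule zpow_zpow_commute[OF K_Kinv Kinv_K K_Kinv Kinv_K K_K])
  have "vK i * vKinv j * (vK j * vKinv i) = vK i * (vKinv j * vK j) * vKinv i" by (simp add: mult.assoc)
  also have "\<dots> \<bumpeq> vK i * 1 * vKinv i" by (intro cong_mult_right cong_mult_left Kinv_K)
  also have "\<dots> = vK i * vKinv i" by simp
  also have "\<dots> \<bumpeq> 1" by (rule K_Kinv)
  finally show "vK i * vKinv j * (vK j * vKinv i) \<bumpeq> 1" .
  have c: "vKinv j * x \<bumpeq> x * vKinv j" if "vK j * x \<bumpeq> x * vK j" for x
    using zpow_commute[OF K_Kinv Kinv_K that, of "- 1"] by simp
  have "vK i * (vK l * vKinv m) \<bumpeq> (vK l * vKinv m) * vK i" for i
  proof -
    have "vK i * vK l * vKinv m \<bumpeq> vK l * vK i * vKinv m" by (intro cong_mult_right K_K)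
    also have "\<dots> = vK l * (vK i * vKinv m)" by (simp add: mult.assoc)
    also have "\<dots> \<bumpeq> vK l * (vKinv m * vK i)" using KK[of i 1 m "- 1"] by (intro cong_mult_left) simp
    finally show ?thesis by (simp add: mult.assoc)
  qed
  note 1 = this[of i] and 2 = c[OF this[of j]]
  have "vK i * vKinv j * (vK l * vKinv m) = vK i * (vKinv j * (vK l * vKinv m))" by (simp add: mult.assoc)
  also have "\<dots> \<bumpeq> vK i * (vK l * vKinv m * vKinv j)" by (rule cong_mult_left[OF 2])
  also have "\<dots> = vK i * (vK l * vKinv m) * vKinv j" by (simp add: mult.assoc)
  also have "\<dots> \<bumpeq> vK l * vKinv m * vK i * vKinv j" by (rule cong_mult_right[OF 1])
  finally show "vK i * vKinv j * (vK l * vKinv m) \<bumpeq> vK l * vKinv m * (vK i * vKinv j)"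
    by (simp add: mult.assoc)
qed

lemma KK_B:
  "vK i * vKinv (diagram_aut i) * Phi (vB j) \<bumpeq> ncconst (q powi ik_wt i j) * (Phi (vB j) * (vK i * vKinv (diagram_aut i)))"
proof -
  let ?i = "diagram_aut i" and ?j = "diagram_aut j"
  have hw: "has_wt (vKinv j * vE ?j) (\<lambda>n. cartan n ?j)"
    using has_wt_mult[OF has_wt_gens(4)[of j] has_wt_gens(1)[of ?j]] by simp
  have KX: "vK i * vKinv ?i * z \<bumpeq> ncconst (q powi (\<beta> i - \<beta> ?i)) * (z * (vK i * vKinv ?i))"
    if "has_wt z \<beta>" for z \<beta>
  proof -
    have "vKinv ?i * z \<bumpeq> ncconst (inverse (q powi \<beta> ?i)) * (z * vKinv ?i)"
      by (rule q_commute_inverse[OF K_Kinv Kinv_K that[unfolded has_wt_def, rule_format]]) (simp add: q_nz)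
    then have "vK i * (vKinv ?i * z) \<bumpeq> vK i * (ncconst (inverse (q powi \<beta> ?i)) * (z * vKinv ?i))"
      by (rule cong_mult_left)
    also have "\<dots> = ncconst (inverse (q powi \<beta> ?i)) * (vK i * z * vKinv ?i)"
      by (simp add: mult.assoc ncvar_scal)
    also have "\<dots> \<bumpeq> ncconst (inverse (q powi \<beta> ?i)) * (ncconst (q powi \<beta> i) * (z * vK i) * vKinv ?i)"
      by (intro cong_mult_left cong_mult_right that[unfolded has_wt_def, rule_format])
    finally show ?thesis
      using q_nz by (simp add: mult.assoc scal_scal power_int_diff divide_inverse mult.commute)
  qed
  have "cartan i ?j = cartan ?i j" "cartan ?i ?j = cartan i j"
    using cartan_diagram_aut[of i ?j] cartan_diagram_aut[of i j] by simp_all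
  then have "vK i * vKinv ?i * (vKinv j * vE ?j) \<bumpeq> ncconst (q powi ik_wt i j) * (vKinv j * vE ?j * (vK i * vKinv ?i))"
    using KX[OF hw] by (simp add: ik_wt_def)
  moreover have "vK i * vKinv ?i * vF j \<bumpeq> ncconst (q powi ik_wt i j) * (vF j * (vK i * vKinv ?i))"
    using KX[OF has_wt_gens(2)[of j]] by (simp add: ik_wt_def)
  ultimately show ?thesis
    by (simp add: right_diff_distrib left_diff_distrib) (rule cong_diff)
qed

lemma Phi_ideal:
  assumes "x \<in> rel_ideal (ik_relations q)"
  shows "Phi x \<in> rel_ideal (uq_relations q)"
proof -
  have "rel_ideal (ik_relations q) \<subseteq> {x. Phi x \<in> rel_ideal (uq_relations q)}"
  proof (rule rel_ideal_least)
    show "two_sided {x. Phi x \<in> rel_ideal (uq_relations q)}"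
      by (rule two_sided_preimage) (simp_all add: nc_subst_hom two_sided_axioms)
    show "ik_relations q \<subseteq> {x. Phi x \<in> rel_ideal (uq_relations q)}"
    proof
      fix p assume "p \<in> ik_relations q"
      then show "p \<in> {x. Phi x \<in> rel_ideal (uq_relations q)}"
      proof cases
        case (1 i)
        then show ?thesis using KK_inverse[of i "diagram_aut i"] by (simp add: nc_subst_hom cong_def)
      next
        case (2 i)
        then show ?thesis using K_Kinv[of i] by (simp add: nc_subst_hom cong_def)
      next
        case (3 i j)
        then show ?thesis using KK_commute[of i "diagram_aut i" j "diagram_aut j"] by (simp add: nc_subst_hom cong_def)
      next
        case (4 i j)
        then show ?thesis using KK_B[of i j] by (simp add: nc_subst_hom cong_def)
      next
        case (5 i j)
        then show ?thesis using Phi_pair[of i j] by (cases "i = j") auto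
      next
        case (6 i j)
        then show ?thesis using Phi_pair[of i j] by (cases "i = j") auto
      qed
    qed
  qed
  then show ?thesis using assms by blast
qed

end

subsection \<open>The right action on functions on a Verma module\<close>

text \<open>
  The universal Verma module is spanned by the vectors \<open>F\<^sub>w x\<^sup>a y\<^sup>b v\<close>, where \<open>K\<^sub>1 v = x v\<close>,
  \<open>K\<^sub>3 v = y v\<close>, the other \<open>K\<^sub>i\<close> fix \<open>v\<close> and the \<open>E\<^sub>i\<close> annihilate it. The algebra acts from the
  right on functions on this basis with values in an arbitrary vector space.
\<close>

type_synonym verma = "e6 list \<times> int \<times> int"
type_synonym 'k vfun = "verma \<Rightarrow> ('k, ik_gen) ncpoly"

text \<open>The right action is (f.x)(m) = f(x m). Words in the F_i are not yet subject to any
  relation.\<close>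

definition op_F :: "e6 \<Rightarrow> 'k::field vfun \<Rightarrow> 'k vfun" where
  "op_F i f = (\<lambda>(w, a, b). f (i # w, a, b))"

text \<open>Since K_5 and K_6 fix the highest weight vector, K_1 K_6^-1 and K_3 K_5^-1 shift one
  exponent each there; this separates the monomials \<open>Lmon a b\<close>.\<close>

definition op_K :: "'k::field \<Rightarrow> e6 \<Rightarrow> int \<Rightarrow> 'k vfun \<Rightarrow> 'k vfun" where
  "op_K q i s f = (\<lambda>(w, a, b). ncconst (q powi (- s * (\<Sum>j\<leftarrow>w. cartan i j))) *
     f (w, a + (if i = \<alpha>\<^sub>1 then s else 0), b + (if i = \<alpha>\<^sub>3 then s else 0)))"

text \<open>E_i is moved to the right through the word: each F_i on the way leaves (K_i - K_i^-1)/(q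
  - q^-1), and the highest weight vector is annihilated.\<close>

fun op_E_word :: "'k::field \<Rightarrow> e6 \<Rightarrow> e6 list \<Rightarrow> int \<Rightarrow> int \<Rightarrow> 'k vfun \<Rightarrow> ('k, ik_gen) ncpoly" where
  "op_E_word q i [] a b f = 0"
| "op_E_word q i (j # w) a b f = op_E_word q i w a b (op_F j f) +
     (if i = j then ncconst (inverse (q - inverse q)) * (op_K q i 1 f (w, a, b) - op_K q i (- 1) f (w, a, b))
      else 0)"

definition op_E :: "'k::field \<Rightarrow> e6 \<Rightarrow> 'k vfun \<Rightarrow> 'k vfun" where
  "op_E q i f = (\<lambda>(w, a, b). op_E_word q i w a b f)"

fun op :: "'k::field \<Rightarrow> uq_gen \<Rightarrow> 'k vfun \<Rightarrow> 'k vfun" where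
  "op q (GF i) f = op_F i f"
| "op q (GE i) f = op_E q i f"
| "op q (GK i) f = op_K q i 1 f"
| "op q (GKinv i) f = op_K q i (- 1) f"

fun act_word :: "'k::field \<Rightarrow> 'k vfun \<Rightarrow> uq_gen list \<Rightarrow> 'k vfun" where
  "act_word q f [] = f"
| "act_word q f (g # w) = act_word q (op q g f) w"

definition act :: "'k::field \<Rightarrow> 'k vfun \<Rightarrow> ('k, uq_gen) ncpoly \<Rightarrow> 'k vfun" where
  "act q f x = (\<lambda>b. lin_ext (\<lambda>w. act_word q f w b) x)"

lemma op_E_step:
  "op_E q i f (j # w, a, b) = op_E q i (op_F j f) (w, a, b) +
     (if i = j then ncconst (inverse (q - inverse q)) * (op_K q i 1 f (w, a, b) - op_K q i (- 1) f (w, a, b)) else 0)"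
  by (simp add: op_E_def)

lemma op_E_Nil: "op_E q i f ([], a, b) = 0"
  by (simp add: op_E_def)

lemma op_E_word_add: "op_E_word q i w a b (\<lambda>m. f m + g m) = op_E_word q i w a b f + op_E_word q i w a b g"
proof (induction w arbitrary: f g)
  case (Cons j w)
  have F: "op_F j (\<lambda>m. f m + g m) = (\<lambda>m. op_F j f m + op_F j g m)"
    by (auto simp: op_F_def)
  show ?case unfolding op_E_word.simps F Cons by (simp add: op_K_def algebra_simps)
qed simp

lemma op_add: "op q g (\<lambda>m. f m + f' m) = (\<lambda>m. op q g f m + op q g f' m)"
  by (cases g) (auto simp: op_F_def op_K_def op_E_def op_E_word_add distrib_left)

lemma op_E_word_scal: "op_E_word q i w a b (\<lambda>m. ncconst c * f m) = ncconst c * op_E_word q i w a b f"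
proof (induction w arbitrary: f)
  case (Cons j w)
  have F: "op_F j (\<lambda>m. ncconst c * f m) = (\<lambda>m. ncconst c * op_F j f m)"
    by (auto simp: op_F_def)
  show ?case unfolding op_E_word.simps F Cons by (simp add: op_K_def scal_simps)
qed simp

lemma op_scal: "op q g (\<lambda>m. ncconst c * f m) = (\<lambda>m. ncconst c * op q g f m)"
  by (cases g) (auto simp: op_F_def op_K_def op_E_def op_E_word_scal scal_scal mult.commute)

lemma act_word_add: "act_word q (\<lambda>m. f m + f' m) w = (\<lambda>m. act_word q f w m + act_word q f' w m)"
  by (induction w arbitrary: f f') (simp_all add: op_add)

lemma act_word_scal: "act_word q (\<lambda>m. ncconst c * f m) w = (\<lambda>m. ncconst c * act_word q f w m)"
  by (induction w arbitrary: f) (simp_all add: op_scal)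

lemma act_word_append: "act_word q f (u @ v) = act_word q (act_word q f u) v"
  by (induction u arbitrary: f) simp_all

lemma act_simps:
  "act q f (x + y) b = act q f x b + act q f y b" "act q f (x - y) b = act q f x b - act q f y b"
  "act q f (ncconst c * x) b = ncconst c * act q f x b" "act q f 0 b = 0"
  by (simp_all add: act_def lin_ext_add lin_ext_diff lin_ext_const)

lemma act_mon: "act q f (ncmon w) = act_word q f w"
  by (simp add: act_def lin_ext_ncmon)

lemma act_var: "act q f (ncvar g) = op q g f"
  by (simp add: ncvar_ncmon act_mon)

lemma act_1: "act q f 1 = f"
  using act_mon[of q f "[]"] by (simp add: ncmon_Nil)

lemma act_fun_add: "act q (\<lambda>m. f m + f' m) x b = act q f x b + act q f' x b"
  by (induction x rule: nc_induct) (simp_all add: act_simps act_mon act_word_add algebra_simps)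

lemma act_fun_scal: "act q (\<lambda>m. ncconst c * f m) x b = ncconst c * act q f x b"
proof (induction x rule: nc_induct)
  case (mon d w)
  then show ?case by (simp add: act_simps act_mon act_word_scal scal_scal mult.commute)
qed (simp_all add: act_simps distrib_left)

lemma act_mult: "act q f (x * y) b = act q (act q f x) y b"
proof (induction x rule: nc_induct)
  case zero
  have "act q (\<lambda>m. ncconst 0 * f m) y b = 0" by (simp only: act_fun_scal) simp
  moreover have "act q f 0 = (\<lambda>m. ncconst 0 * f m)" by (simp add: fun_eq_iff act_simps)
  ultimately show ?case by (simp add: act_simps)
next
  case (mon c u)
  have "act q f (ncmon u * y) b = act q (act_word q f u) y b"
  proof (induction y rule: nc_induct)
    case (mon d v)
    have "ncmon u * (ncconst d * ncmon v) = ncconst d * ncmon (u @ v)"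
      by (simp add: ncconst_left_commute ncmon_append)
    then show ?case by (simp add: act_simps act_mon act_word_append)
  qed (simp_all add: act_simps distrib_left)
  moreover have "act q f (ncconst c * ncmon u) = (\<lambda>m. ncconst c * act_word q f u m)"
    by (simp add: fun_eq_iff act_simps act_mon)
  ultimately show ?case by (simp add: mult.assoc act_simps act_fun_scal)
next
  case (add x x')
  have "act q f (x + x') = (\<lambda>m. act q f x m + act q f x' m)"
    by (simp add: fun_eq_iff act_simps)
  with add show ?case by (simp add: distrib_right act_simps act_fun_add)
qed

text \<open>Equality of operators becomes congruence modulo this ideal, so the calculus of
  \<open>uq_pre\<close> applies to the action as well.\<close>

definition annihilator :: "'k::field \<Rightarrow> ('k, uq_gen) ncpoly set" where
  "annihilator q = {x. \<forall>f b. act q f x b = 0}"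

lemma annihilator_two_sided: "two_sided (annihilator q)"
proof
  have zero: "act q (\<lambda>m. 0) x b = 0" for x b
    using act_fun_scal[of q 0 "\<lambda>m. 0" x b] by simp
  fix x a assume "x \<in> annihilator q"
  then have "act q f x = (\<lambda>m. 0)" for f by (auto simp: annihilator_def)
  then show "a * x \<in> annihilator q" "x * a \<in> annihilator q"
    by (auto simp: annihilator_def act_mult zero)
qed (auto simp: annihilator_def act_simps)

section \<open>Serre elements commute with the generators of opposite sign\<close>

definition wts2 :: "int \<Rightarrow> weights" where
  "wts2 a = [(1, - 4, - 2 * a, - 2 * a), (2, - 2 * a, - 4, - 4), (4, 4, 2 * a, 2 * a), (5, 2 * a, 4, 4)]"

definition cross_rules2 :: rules where
  "cross_rules2 = concat (map (\<lambda>x. map (\<lambda>y.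
     cross_rule (x + 3) y (if x = y then Some (unit_tor x 1, unit_tor x (- 1)) else None)) [1, 2]) [1, 2])"

definition exs2 :: "int \<Rightarrow> ex list" where
  "exs2 a =
     [Qc [(0, 1)] (pair_ex 1 2 a) (Lt 4), Qc [(0, 1)] (pair_ex 1 2 a) (Lt 5),
      Qc [(0, 1)] (pair_ex 4 5 a) (Lt 1), Qc [(0, 1)] (pair_ex 4 5 a) (Lt 2)]"

lemma check2: "list_all (\<lambda>a. vanishes (wts2 a) [4, 5] cross_rules2 id_hom (exs2 a)) [0, - 1]"
  by code_simp

context uq_pre
begin

lemma pair_rel_commute:
  assumes "x * z \<bumpeq> z * x" "y * z \<bumpeq> z * y"
  shows "pair_rel q a x y * z \<bumpeq> z * pair_rel q a x y"
proof -
  have 2: "u * v * z \<bumpeq> z * (u * v)" if "u * z \<bumpeq> z * u" "v * z \<bumpeq> z * v" for u v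
  proof -
    have "u * v * z = u * (v * z)" by (simp add: mult.assoc)
    also have "\<dots> \<bumpeq> u * (z * v)" by (rule cong_mult_left[OF that(2)])
    also have "\<dots> = u * z * v" by (simp add: mult.assoc)
    also have "\<dots> \<bumpeq> z * u * v" by (rule cong_mult_right[OF that(1)])
    finally show ?thesis by (simp add: mult.assoc)
  qed
  have c: "ncconst c * z \<bumpeq> z * ncconst c" for c by (simp add: ncconst_central)
  show ?thesis
    unfolding pair_rel_def serre_poly_def
    by (auto simp: left_diff_distrib right_diff_distrib distrib_left distrib_right
        intro!: cong_diff cong_add 2 assms c)
qed

text \<open>This is the classical reason why Serre elements yield singular vectors, and it holds
  before any Serre relation is imposed. For m among i and j it is computed; other generators commute
  with each factor separately.\<close>

lemma pair_rel_cross: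
  assumes "i \<noteq> j"
  shows "pair_rel q (cartan i j) (vF i) (vF j) * vE m \<bumpeq> vE m * pair_rel q (cartan i j) (vF i) (vF j)"
    "pair_rel q (cartan i j) (vE i) (vE j) * vF m \<bumpeq> vF m * pair_rel q (cartan i j) (vE i) (vE j)"
proof -
  let ?L = "[(1, GF i), (2, GF j), (4, GE i), (5, GE j)]" and ?\<kappa> = "K_torus i j j" and ?a = "cartan i j"
  let ?\<phi> = "letter_map h ?L" and ?F = "pair_rel q ?a (vF i) (vF j)" and ?E = "pair_rel q ?a (vE i) (vE j)"
  interpret M: nc_model q r I ?\<phi> ?\<kappa> "letter_wts i j j ?L"
    by (rule uq_model) simp
  have w: "letter_wts i j j ?L = wts2 ?a"
    using cartan_sym[of j i] by (simp add: letter_wts_def wts2_def)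
  have a: "?a = 0 \<or> ?a = - 1"
    using assms cartan_cases[of i j] by auto
  have L: "?\<phi> 1 = ncconst h * vF i" "?\<phi> 2 = ncconst h * vF j" "?\<phi> 4 = ncconst h * vE i" "?\<phi> 5 = ncconst h * vE j"
    by (simp_all add: letter_map_def)
  have cr: "M.sound [cross_rule (x + 3) y (if x = y then Some (unit_tor x 1, unit_tor x (- 1)) else None)]"
    if "x \<in> {1, 2}" "y \<in> {1, 2}" for x y
    by (rule cross_sound[OF M.nc_model_axioms, of _ "if x = 1 then i else j" _ "if y = 1 then i else j"
          _ "unit_tor x 1" "unit_tor x (- 1)"])
      (use that assms L in \<open>auto simp: K_torus_def unit_tor_def\<close>)
  have rules: "M.sound cross_rules2"
    using cr[of 1 1] cr[of 1 2] cr[of 2 1] cr[of 2 2]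
    unfolding cross_rules2_def by (simp add: M.sound_def del: cross_rule.simps split del: if_split)
  have "vanishes (letter_wts i j j ?L) [4, 5] cross_rules2 id_hom (exs2 ?a)"
    using check2 a unfolding w by auto
  note mem = M.vanishes_mem[OF this rules]
  let ?s = "if ?a = 0 then h * h else h * h * h"
  note ev = ev_pair[OF M.nc_model_axioms L(1,2), of ?a] ev_pair[OF M.nc_model_axioms L(3,4), of ?a]
  have s: "?s * h \<noteq> 0" using h_nz by simp
  have com: "x * z \<bumpeq> z * x"
    if "M.ev (Qc [(0, 1)] p (Lt y)) \<in> I" "M.ev p = ncconst ?s * x" "?\<phi> y = ncconst h * z" for p x y z
  proof -
    have "M.ev (Qc [(0, 1)] p (Lt y)) = ncconst (?s * h) * (x * z - z * x)"
      unfolding M.ev.simps that(2,3)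
      by (simp add: mult.assoc ncconst_left_commute[of x] ncconst_left_commute[of z] right_diff_distrib
          ncconst_mult ncconst_left_commute[of "ncconst h"] split del: if_split)
    then show ?thesis
      using that(1) scal_mem_cancel[OF _ s] by (simp add: cong_def)
  qed
  have F: "?F * vE n \<bumpeq> vE n * ?F" and E: "?E * vF n \<bumpeq> vF n * ?E" if "n \<in> {i, j}" for n
  proof -
    have "?F * vE i \<bumpeq> vE i * ?F" "?F * vE j \<bumpeq> vE j * ?F" "?E * vF i \<bumpeq> vF i * ?E" "?E * vF j \<bumpeq> vF j * ?E"
      by (rule com[OF mem ev(1) L(3)] com[OF mem ev(1) L(4)] com[OF mem ev(2) L(1)] com[OF mem ev(2) L(2)];
          simp add: exs2_def)+
    then show "?F * vE n \<bumpeq> vE n * ?F" "?E * vF n \<bumpeq> vF n * ?E" using that by auto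
  qed
  show "?F * vE m \<bumpeq> vE m * ?F"
  proof (cases "m \<in> {i, j}")
    case False
    then show ?thesis by (intro pair_rel_commute cong_sym[OF E_F_distinct]) auto
  qed (rule F)
  show "?E * vF m \<bumpeq> vF m * ?E"
  proof (cases "m \<in> {i, j}")
    case False
    then show ?thesis by (intro pair_rel_commute E_F_distinct) auto
  qed (rule E)
qed

lemma ex_wt_pair_rel:
  assumes "has_wt x \<beta>" "has_wt y \<gamma>"
  shows "\<exists>\<delta>. has_wt (pair_rel q a x y) \<delta>"
proof -
  have d: "has_wt (u - v) \<delta>" if "has_wt u \<delta>" "has_wt v \<delta>" for u v \<delta>
    using has_wt_add[OF that(1) has_wt_uminus[OF that(2)]] by simp
  have w: "has_wt z \<delta> \<Longrightarrow> \<delta> = \<delta>' \<Longrightarrow> has_wt z \<delta>'" for z \<delta> \<delta>' by simp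
  show ?thesis
  proof (cases "a = 0")
    case True
    have "has_wt (x * y - y * x) (\<lambda>n. \<beta> n + \<gamma> n)"
      by (intro d has_wt_mult[OF assms] w[OF has_wt_mult[OF assms(2,1)]]) (auto simp: add.commute)
    then show ?thesis using True by (auto simp: pair_rel_def)
  next
    case False
    have "has_wt (x * x * y - ncconst (q + inverse q) * (x * y * x) + y * x * x) (\<lambda>n. \<beta> n + \<beta> n + \<gamma> n)"
      by (intro d has_wt_add has_wt_scal has_wt_mult[OF has_wt_mult[OF assms(1,1)] assms(2)]
          w[OF has_wt_mult[OF has_wt_mult[OF assms] assms(1)]] w[OF has_wt_mult[OF has_wt_mult[OF assms(2,1)] assms(1)]])
        (auto simp: algebra_simps)
    then show ?thesis using False by (auto simp: pair_rel_def serre_poly_def mult.assoc)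
  qed
qed

lemma ex_wt_F_word: "\<exists>\<delta>. has_wt (ncmon (map GF u)) \<delta>"
proof (induction u)
  case Nil
  have "has_wt 1 (\<lambda>n. 0)" by (simp add: has_wt_def)
  then show ?case by (auto simp: ncmon_Nil)
next
  case (Cons j u)
  then show ?case using has_wt_mult[OF has_wt_gens(2)] by (auto simp: ncmon_Cons)
qed

end

section \<open>The action satisfies all relations except the Serre relations of the F_i\<close>

locale verma_action = q_param q r for q r :: "'k::field"
begin

lemma op_K_op_K:
  "op_K q j t (op_K q i s f) (w, a, b) =
   ncconst (q powi (- t * (\<Sum>l\<leftarrow>w. cartan j l) - s * (\<Sum>l\<leftarrow>w. cartan i l))) *
     f (w, a + (if i = \<alpha>\<^sub>1 then s else 0) + (if j = \<alpha>\<^sub>1 then t else 0),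
        b + (if i = \<alpha>\<^sub>3 then s else 0) + (if j = \<alpha>\<^sub>3 then t else 0))"
  using q_nz by (simp add: op_K_def scal_scal power_int_diff power_int_minus divide_inverse add.assoc
      add.commute[of "if i = _ then s else 0"])

lemma op_F_op_K: "op_F m (op_K q i s f) = (\<lambda>n. ncconst (q powi (- s * cartan i m)) * op_K q i s (op_F m f) n)"
proof
  fix n :: verma
  obtain w a b where n: "n = (w, a, b)" by (metis surj_pair)
  have "q powi (- s * (cartan i m + (\<Sum>l\<leftarrow>w. cartan i l))) = q powi (- s * cartan i m) * q powi (- s * (\<Sum>l\<leftarrow>w. cartan i l))"
    using q_nz by (simp add: power_int_add[symmetric] algebra_simps)
  then show "op_F m (op_K q i s f) n = ncconst (q powi (- s * cartan i m)) * op_K q i s (op_F m f) n"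
    by (simp add: n op_F_def op_K_def scal_scal)
qed

lemma op_E_op_K:
  "op_E q j (op_K q i s f) (w, a, b) = ncconst (q powi (s * cartan i j)) * op_K q i s (op_E q j f) (w, a, b)"
proof (induction w arbitrary: f)
  case Nil
  then show ?case by (simp add: op_E_Nil op_K_def)
next
  case (Cons m w)
  let ?a = "a + (if i = \<alpha>\<^sub>1 then s else 0)" and ?b = "b + (if i = \<alpha>\<^sub>3 then s else 0)"
  let ?W = "\<Sum>l\<leftarrow>w. cartan i l"
  let ?D = "\<lambda>f. ncconst (inverse (q - inverse q)) * (op_K q j 1 f (w, a, b) - op_K q j (- 1) f (w, a, b))"
  let ?D' = "ncconst (inverse (q - inverse q)) * (op_K q j 1 f (w, ?a, ?b) - op_K q j (- 1) f (w, ?a, ?b))"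
  have KK: "op_K q j t (op_K q i s f) (w, a, b) = ncconst (q powi (- s * ?W)) * op_K q j t f (w, ?a, ?b)" for t
    using q_nz by (simp add: op_K_op_K) (simp add: op_K_def scal_scal power_int_diff power_int_minus divide_inverse mult.commute)
  have D: "?D (op_K q i s f) = ncconst (q powi (- s * ?W)) * ?D'"
    unfolding KK by (simp add: right_diff_distrib scal_scal mult.commute)
  have "op_E q j (op_F m (op_K q i s f)) (w, a, b) =
      ncconst (q powi (- s * cartan i m)) * op_E q j (op_K q i s (op_F m f)) (w, a, b)"
    unfolding op_F_op_K using op_scal[of q "GE j"] by (simp add: fun_eq_iff)
  also have "\<dots> = ncconst (q powi (- s * cartan i m) * q powi (s * cartan i j) * q powi (- s * ?W)) * op_E q j (op_F m f) (w, ?a, ?b)"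
    by (simp add: Cons scal_scal mult.assoc) (simp add: op_K_def scal_scal mult.assoc)
  finally have 1: "op_E q j (op_F m (op_K q i s f)) (w, a, b) =
      ncconst (q powi (s * cartan i j) * q powi (- s * (cartan i m + ?W))) * op_E q j (op_F m f) (w, ?a, ?b)"
    using q_nz by (simp add: power_int_add[symmetric] algebra_simps)
  have 2: "q powi (- s * ?W) = q powi (s * cartan i j) * q powi (- s * (cartan i m + ?W))" if "j = m"
    using q_nz that by (simp add: power_int_add[symmetric] algebra_simps)
  define X where "X = op_E q j (op_F m f) (w, ?a, ?b)"
  define Y where "Y = ?D'"
  have R: "op_K q i s (op_E q j f) (m # w, a, b) =
      ncconst (q powi (- s * (cartan i m + ?W))) * (X + (if j = m then Y else 0))"
    by (simp add: op_K_def[of q i] op_E_step X_def Y_def)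
  show ?case
    unfolding op_E_step 1 D R X_def[symmetric] Y_def[symmetric]
    using 2 by (cases "j = m") (simp_all only: distrib_left scal_scal if_True if_False simp_thms mult_zero_right add_0_right)
qed

lemma annihilator_iff: "x - y \<in> annihilator q \<longleftrightarrow> (\<forall>f b. act q f x b = act q f y b)"
  by (simp add: annihilator_def act_simps)

sublocale Z: uq_pre q r "annihilator q"
proof -
  interpret Z: nc_ideal "annihilator q" by (simp add: nc_ideal_def annihilator_two_sided)
  have *: "Z.cong x y" if "\<And>f w a b. act q f x (w, a, b) = act q f y (w, a, b)" for x y
    using that by (auto simp: Z.cong_def annihilator_iff)
  show "uq_pre q r (annihilator q)"
  proof
    fix i j
    show "Z.cong (vK i * vKinv i) 1" "Z.cong (vKinv i * vK i) 1"
      by (rule *, simp add: act_mult act_var act_1 op_K_op_K)+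
    show "Z.cong (vK i * vK j) (vK j * vK i)"
      by (rule *) (simp add: act_mult act_var op_K_op_K minus_diff_commute ac_simps)
    show "Z.cong (vK i * vE j) (ncconst (q powi cartan i j) * (vE j * vK i))"
      by (rule *) (simp only: act_simps(3), simp add: act_mult act_var op_E_op_K)
    show "Z.cong (vK i * vF j) (ncconst (q powi (- cartan i j)) * (vF j * vK i))"
      by (rule *) (simp only: act_simps(3), simp add: act_mult act_var op_F_op_K)
    show "Z.cong (vE i * vF i - vF i * vE i) (ncconst (inverse h) * (vK i - vKinv i))"
      by (rule *) (simp only: act_simps(2,3), simp add: act_mult act_var op_F_def[of _ "op_E q i _"] op_E_step h_def)
    show "Z.cong (vE i * vF j) (vF j * vE i)" if "i \<noteq> j"
      using that by (intro *) (simp add: act_mult act_var op_F_def[of _ "op_E q i _"] op_E_step)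
  qed
qed

lemma act_cong: "Z.cong x y \<Longrightarrow> act q f x b = act q f y b"
  unfolding Z.cong_def annihilator_iff by blast

text \<open>The Serre element moves past every letter F_m of the word and finally meets the highest
  weight vector, where each of its terms ends in some E.\<close>

lemma pair_rel_E_annihilator:
  assumes "i \<noteq> j"
  shows "pair_rel q (cartan i j) (vE i) (vE j) \<in> annihilator q"
proof -
  let ?p = "pair_rel q (cartan i j) (vE i) (vE j)"
  have Nil_E: "act q f (x * vE k) ([], a, b) = 0" for f x k a b
    by (simp add: act_mult act_var op_E_Nil)
  have "act q f ?p (w, a, b) = 0" for f w a b
  proof (induction w arbitrary: f)
    case Nil
    then show ?case
      by (simp add: pair_rel_def serre_poly_def act_simps Nil_E)
  next
    case (Cons m w)
    have "act q f ?p (m # w, a, b) = act q f (?p * vF m) (w, a, b)"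
      by (simp add: act_mult act_var op_F_def)
    also have "\<dots> = act q f (vF m * ?p) (w, a, b)"
      by (rule act_cong[OF Z.pair_rel_cross(2)[OF assms]])
    also have "\<dots> = 0" by (simp add: act_mult act_var Cons)
    finally show ?case .
  qed
  then show ?thesis by (auto simp: annihilator_def)
qed

end
declare split_paired_All [simp del]

text \<open>
  A function \<open>f\<close> satisfies \<open>vmod q N f\<close> if, modulo the subspace \<open>N\<close>, it factors through the Verma
  module, where the Serre relations between the \<open>F\<^sub>i\<close> hold.
\<close>

definition F_rel :: "'k::field \<Rightarrow> e6 \<Rightarrow> e6 \<Rightarrow> ('k, uq_gen) ncpoly" where
  "F_rel q i j = pair_rel q (cartan i j) (vF i) (vF j)"

definition vmod :: "'k::field \<Rightarrow> ('k, ik_gen) ncpoly set \<Rightarrow> 'k vfun \<Rightarrow> bool" where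
  "vmod q N f \<longleftrightarrow> (\<forall>u i j b. i \<noteq> j \<longrightarrow> act q f (ncmon (map GF u) * F_rel q i j) b \<in> N)"

section \<open>Functions that factor through the Verma module modulo a subspace of values\<close>

locale verma_subspace = verma_action q r for q r :: "'k::field" +
  fixes N :: "('k, ik_gen) ncpoly set"
  assumes N_0: "0 \<in> N" and N_add: "x \<in> N \<Longrightarrow> y \<in> N \<Longrightarrow> x + y \<in> N"
    and N_scal: "x \<in> N \<Longrightarrow> ncconst c * x \<in> N"
begin

lemma N_uminus: "x \<in> N \<Longrightarrow> - x \<in> N"
  using N_scal[of x "- 1"] by (simp add: ncconst_uminus)

lemma N_diff: "x \<in> N \<Longrightarrow> y \<in> N \<Longrightarrow> x - y \<in> N"
  using N_add[OF _ N_uminus, of x y] by simp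

lemma op_E_word_N: "(\<And>b. f b \<in> N) \<Longrightarrow> op_E_word q i w a b f \<in> N"
proof (induction w arbitrary: f)
  case (Cons j w)
  have "op_E_word q i w a b (op_F j f) \<in> N"
    by (rule Cons.IH) (use Cons.prems in \<open>auto simp: op_F_def\<close>)
  then show ?case using Cons.prems by (auto simp: op_K_def intro!: N_add N_scal N_diff)
qed (simp add: N_0)

lemma op_N: "(\<And>b. f b \<in> N) \<Longrightarrow> op q g f b \<in> N"
  by (cases g; cases b) (auto simp: op_F_def op_K_def op_E_def intro: N_scal op_E_word_N)

lemma act_N:
  assumes "\<And>b. f b \<in> N"
  shows "act q f x b \<in> N"
proof (induction x rule: nc_induct)
  case (mon c w)
  have "act_word q f w b \<in> N"
    using assms by (induction w arbitrary: f) (simp_all add: op_N)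
  then show ?case by (simp add: act_simps act_mon N_scal)
qed (simp_all add: act_simps N_0 N_add)

text \<open>The product of an F-word and a Serre element is a weight vector, so K_m passes to its
  right at the cost of a scalar.\<close>

lemma vmod_K:
  assumes "vmod q N f" "i \<noteq> j" "g \<in> {GK m, GKinv m}"
  shows "act q f (ncvar g * (ncmon (map GF u) * F_rel q i j)) b \<in> N"
proof -
  let ?Y = "ncmon (map GF u) * F_rel q i j"
  obtain \<delta> where "Z.has_wt ?Y \<delta>"
    using Z.has_wt_mult Z.ex_wt_F_word[of u] Z.ex_wt_pair_rel[OF Z.has_wt_gens(2) Z.has_wt_gens(2)]
    unfolding F_rel_def by meson
  then have wt: "Z.cong (vK m * ?Y) (ncconst (q powi \<delta> m) * (?Y * vK m))"
    by (simp add: Z.has_wt_def)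
  have "\<exists>c. Z.cong (ncvar g * ?Y) (ncconst c * (?Y * ncvar g))"
    using assms(3) wt Z.q_commute_inverse[OF Z.K_Kinv Z.Kinv_K wt] q_nz by auto
  then obtain c where "act q f (ncvar g * ?Y) b = act q f (ncconst c * (?Y * ncvar g)) b"
    using act_cong by blast
  also have "\<dots> = ncconst c * op q g (act q f ?Y) b"
    unfolding act_simps(3) act_mult[of q f ?Y] act_var ..
  also have "\<dots> \<in> N"
    using assms(1,2) by (intro N_scal op_N) (simp add: vmod_def)
  finally show ?thesis .
qed

lemma vmod_F:
  assumes "vmod q N f"
  shows "vmod q N (op_F m f)"
  unfolding vmod_def
proof (intro allI impI)
  fix u i j b assume "i \<noteq> (j :: e6)"
  then have "act q f (ncmon (map GF (m # u)) * F_rel q i j) b \<in> N"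
    using assms unfolding vmod_def by blast
  then show "act q (op_F m f) (ncmon (map GF u) * F_rel q i j) b \<in> N"
    by (simp add: ncmon_Cons mult.assoc act_mult[of q f "vF m"] act_var)
qed

text \<open>Moving E_m through the word leaves terms with K_m, covered by \<open>vmod_K\<close>; at
  the end E_m commutes with the Serre element.\<close>

lemma vmod_E:
  assumes "vmod q N f" "i \<noteq> j"
  shows "act q f (vE m * (ncmon (map GF u) * F_rel q i j)) b \<in> N"
  using assms(1)
proof (induction u arbitrary: f)
  case Nil
  have "act q f (vE m * (ncmon (map GF []) * F_rel q i j)) b = act q f (F_rel q i j * vE m) b"
    by (rule act_cong) (use Z.pair_rel_cross(1)[OF assms(2)] in \<open>simp add: ncmon_Nil F_rel_def Z.cong_sym\<close>)
  also have "\<dots> = op q (GE m) (act q f (F_rel q i j)) b" by (simp only: act_mult act_var)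
  also have "\<dots> \<in> N"
  proof (rule op_N)
    fix b show "act q f (F_rel q i j) b \<in> N"
      using Nil assms(2) unfolding vmod_def by (metis list.simps(8) mult_1_left ncmon_Nil)
  qed
  finally show ?case .
next
  case (Cons l u)
  let ?Y = "ncmon (map GF u) * F_rel q i j"
  have F: "act q f (vF l * (vE m * ?Y)) b \<in> N"
    using Cons.IH[OF vmod_F[OF Cons.prems]] by (simp add: act_mult[of q f "vF l"] act_var)
  show ?case
  proof (cases "m = l")
    case True
    have "Z.cong (vE m * vF l * ?Y) ((vF l * vE m + ncconst (inverse h) * (vK m - vKinv m)) * ?Y)"
      using Z.E_F[of m] True by (intro Z.cong_mult_right) (simp add: Z.cong_def algebra_simps)
    then have "act q f (vE m * (ncmon (map GF (l # u)) * F_rel q i j)) b =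
        act q f ((vF l * vE m + ncconst (inverse h) * (vK m - vKinv m)) * ?Y) b"
      by (intro act_cong) (simp add: ncmon_Cons mult.assoc)
    also have "\<dots> = act q f (vF l * (vE m * ?Y)) b +
        ncconst (inverse h) * (act q f (vK m * ?Y) b - act q f (vKinv m * ?Y) b)"
      by (simp only: distrib_right left_diff_distrib right_diff_distrib mult.assoc act_simps)
    also have "\<dots> \<in> N"
      by (intro N_add N_scal N_diff F vmod_K[OF Cons.prems assms(2), of _ m]) auto
    finally show ?thesis .
  next
    case False
    have "act q f (vE m * (ncmon (map GF (l # u)) * F_rel q i j)) b = act q f (vF l * (vE m * ?Y)) b"
      using Z.cong_mult_right[OF Z.E_F_distinct[OF False], of ?Y]
      by (intro act_cong) (simp add: ncmon_Cons mult.assoc)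
    then show ?thesis using F by simp
  qed
qed

lemma vmod_op:
  assumes "vmod q N f"
  shows "vmod q N (op q g f)"
proof (cases g)
  case (GF m)
  then show ?thesis using vmod_F[OF assms] by simp
next
  case (GE m)
  then show ?thesis using vmod_E[OF assms] unfolding vmod_def act_var[symmetric] act_mult[symmetric] by simp
next
  case (GK m)
  then show ?thesis using vmod_K[OF assms] unfolding vmod_def act_var[symmetric] act_mult[symmetric] by simp
next
  case (GKinv m)
  then show ?thesis using vmod_K[OF assms] unfolding vmod_def act_var[symmetric] act_mult[symmetric] by simp
qed

lemma vmod_act:
  assumes "vmod q N f"
  shows "vmod q N (act q f x)"
proof -
  have "act q f (x * Y) b \<in> N" if Y: "\<And>f. vmod q N f \<Longrightarrow> act q f Y b \<in> N" for Y b
  proof (induction x rule: nc_induct)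
    case (mon c w)
    have "vmod q N (act_word q f w)"
      using assms by (induction w arbitrary: f) (simp_all add: vmod_op)
    then have "act q f (ncmon w * Y) b \<in> N" by (simp add: act_mult[of q f "ncmon w"] act_mon Y)
    then show ?case by (simp only: mult.assoc act_simps) (rule N_scal)
  qed (simp_all add: act_simps distrib_right N_0 N_add)
  then show ?thesis unfolding vmod_def act_mult[symmetric] by blast
qed

text \<open>The elements sending all such functions into N form a two-sided ideal by
  \<open>vmod_act\<close> and \<open>act_N\<close>. Of the relations, only the Serre relations of
  the F_i depend on the condition on f; the others act as zero.\<close>

lemma vmod_ideal:
  assumes "x \<in> rel_ideal (uq_relations q)" "vmod q N f"
  shows "act q f x b \<in> N"
proof -
  let ?J = "{x. \<forall>f. vmod q N f \<longrightarrow> (\<forall>b. act q f x b \<in> N)}"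
  have ann: "x \<in> ?J" if "x \<in> annihilator q" for x
    using that by (simp add: annihilator_def N_0)
  have "rel_ideal (uq_relations q) \<subseteq> ?J"
  proof (rule rel_ideal_least)
    show "two_sided ?J"
      by unfold_locales (auto simp: act_simps N_0 N_add act_mult vmod_act act_N)
    have KXK: "vK i * X * vKinv i - ncconst c * X \<in> annihilator q"
      if "Z.cong (vK i * X) (ncconst c * (X * vK i))" for i X c
    proof -
      have "Z.cong (vK i * X * vKinv i) (ncconst c * (X * vK i) * vKinv i)"
        by (rule Z.cong_mult_right[OF that])
      also have "ncconst c * (X * vK i) * vKinv i = ncconst c * X * (vK i * vKinv i)" by (simp add: mult.assoc)
      also have "Z.cong \<dots> (ncconst c * X * 1)" by (intro Z.cong_mult_left Z.K_Kinv)
      finally show ?thesis by (simp add: Z.cong_def)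
    qed
    have c0: "i \<noteq> j" if "cartan i j \<noteq> 2" for i j using that by (auto simp: cartan_def)
    have Fr: "F_rel q i j \<in> ?J" if "i \<noteq> j" for i j
      using that by (auto simp: vmod_def ncmon_Nil dest: spec[of _ "[]"])
    show "uq_relations q \<subseteq> ?J"
    proof
      fix p assume "p \<in> uq_relations q"
      then show "p \<in> ?J"
      proof cases
        case (1 i) show ?thesis by (rule ann) (use Z.K_Kinv[of i] 1 in \<open>simp add: Z.cong_def\<close>)
      next
        case (2 i) show ?thesis by (rule ann) (use Z.Kinv_K[of i] 2 in \<open>simp add: Z.cong_def\<close>)
      next
        case (3 i j) show ?thesis by (rule ann) (use Z.K_K[of i j] 3 in \<open>simp add: Z.cong_def\<close>)
      next
        case (4 i j) show ?thesis by (rule ann) (use KXK[OF Z.K_E] 4 in simp)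
      next
        case (5 i j) show ?thesis by (rule ann) (use KXK[OF Z.K_F] 5 in simp)
      next
        case (6 i) show ?thesis by (rule ann) (use Z.E_F[of i] 6 in \<open>simp add: Z.cong_def h_def\<close>)
      next
        case (7 i j) show ?thesis by (rule ann) (use Z.E_F_distinct[of i j] 7 in \<open>simp add: Z.cong_def\<close>)
      next
        case (8 i j) show ?thesis
          by (rule ann) (use pair_rel_E_annihilator[of i j] c0[of i j] 8 in \<open>simp add: pair_rel_def\<close>)
      next
        case (9 i j) show ?thesis
          using Fr[of i j] c0[of i j] 9 by (simp add: F_rel_def pair_rel_def)
      next
        case (10 i j) show ?thesis
          by (rule ann) (use pair_rel_E_annihilator[of i j] c0[of i j] 10 in \<open>simp add: pair_rel_def\<close>)
      next
        case (11 i j) show ?thesis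
          using Fr[of i j] c0[of i j] 11 by (simp add: F_rel_def pair_rel_def)
      qed
    qed
  qed
  then show ?thesis using assms by blast
qed

end

subsection \<open>The presentation is faithful\<close>

locale ik = verma_action q r for q r :: "'k::field"
begin

sublocale nc_ideal "rel_ideal (ik_relations q)"
  by (simp add: nc_ideal_def two_sided_rel_ideal)

notation cong (infix "\<bumpeq>" 50)

lemma ik_mem: "p \<in> ik_relations q \<Longrightarrow> p \<in> rel_ideal (ik_relations q)"
  using rel_ideal_contains by blast

lemma L_inv: "vL i * vL (diagram_aut i) \<bumpeq> 1"
  and L_fixed: "diagram_aut i = i \<Longrightarrow> vL i \<bumpeq> 1"
  and L_L: "vL i * vL j \<bumpeq> vL j * vL i"
  and L_B: "vL i * vB j \<bumpeq> ncconst (q powi ik_wt i j) * (vB j * vL i)"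
  unfolding cong_def by (intro ik_mem ik_relations.intros; assumption?)+

text \<open>With the torus on the right, the products \<open>Bmon w * Lmon a b\<close> span the
  presented algebra, see \<open>ex_filt\<close>.\<close>

definition Lmon :: "int \<Rightarrow> int \<Rightarrow> ('k, ik_gen) ncpoly" where
  "Lmon a b = zpow (vL \<alpha>\<^sub>1) (vL \<alpha>\<^sub>6) a * zpow (vL \<alpha>\<^sub>3) (vL \<alpha>\<^sub>5) b"

lemma L_16: "vL \<alpha>\<^sub>1 * vL \<alpha>\<^sub>6 \<bumpeq> 1" "vL \<alpha>\<^sub>6 * vL \<alpha>\<^sub>1 \<bumpeq> 1" "vL \<alpha>\<^sub>3 * vL \<alpha>\<^sub>5 \<bumpeq> 1" "vL \<alpha>\<^sub>5 * vL \<alpha>\<^sub>3 \<bumpeq> 1"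
  using L_inv[of \<alpha>\<^sub>1] L_inv[of \<alpha>\<^sub>6] L_inv[of \<alpha>\<^sub>3] L_inv[of \<alpha>\<^sub>5] by simp_all

lemma L_Lmon: "\<exists>a' b'. vL i * Lmon a b \<bumpeq> Lmon a' b'"
proof -
  let ?x = "zpow (vL \<alpha>\<^sub>1) (vL \<alpha>\<^sub>6) a" and ?y = "zpow (vL \<alpha>\<^sub>3) (vL \<alpha>\<^sub>5) b"
  have 1: "vL j * ?x * ?y \<bumpeq> zpow (vL \<alpha>\<^sub>1) (vL \<alpha>\<^sub>6) c * ?y" if "vL j * ?x \<bumpeq> zpow (vL \<alpha>\<^sub>1) (vL \<alpha>\<^sub>6) c" for j c
    by (rule cong_mult_right[OF that])
  have 3: "vL j * ?x * ?y \<bumpeq> ?x * zpow (vL \<alpha>\<^sub>3) (vL \<alpha>\<^sub>5) c" if "vL j * ?y \<bumpeq> zpow (vL \<alpha>\<^sub>3) (vL \<alpha>\<^sub>5) c" for j c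
  proof -
    have "vL j * ?x * ?y \<bumpeq> ?x * vL j * ?y"
      by (intro cong_mult_right cong_sym[OF zpow_commute] L_16 L_L)
    also have "\<dots> = ?x * (vL j * ?y)" by (simp add: mult.assoc)
    also have "\<dots> \<bumpeq> ?x * zpow (vL \<alpha>\<^sub>3) (vL \<alpha>\<^sub>5) c" by (rule cong_mult_left[OF that])
    finally show ?thesis .
  qed
  have 2: "vL j * (?x * ?y) \<bumpeq> 1 * (?x * ?y)" if "vL j \<bumpeq> 1" for j
    by (rule cong_mult_right[OF that])
  show ?thesis
    using 1[OF zpow_step_up[OF L_16(1)]] 1[OF zpow_step_down[OF L_16(2)]]
      3[OF zpow_step_up[OF L_16(3)]] 3[OF zpow_step_down[OF L_16(4)]]
      2[OF L_fixed, of \<alpha>\<^sub>2] 2[OF L_fixed, of \<alpha>\<^sub>4]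
    unfolding Lmon_def by (cases i) (auto simp: mult.assoc)
qed

definition Bmon :: "e6 list \<Rightarrow> ('k, ik_gen) ncpoly" where
  "Bmon w = ncmon (map GB w)"

lemma Bmon_simps: "Bmon [] = 1" "Bmon (i # w) = vB i * Bmon w" "Bmon (u @ v) = Bmon u * Bmon v"
  by (simp_all add: Bmon_def ncmon_Nil ncmon_Cons ncmon_append)

lemma L_Bmon: "\<exists>c. vL i * Bmon w \<bumpeq> ncconst c * (Bmon w * vL i)"
proof (induction w)
  case Nil
  have "vL i * Bmon [] \<bumpeq> ncconst 1 * (Bmon [] * vL i)" by (simp add: Bmon_simps)
  then show ?case by blast
next
  case (Cons j w)
  then obtain c where c: "vL i * Bmon w \<bumpeq> ncconst c * (Bmon w * vL i)" by blast
  have "vL i * Bmon (j # w) = vL i * vB j * Bmon w" by (simp add: Bmon_simps mult.assoc)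
  also have "\<dots> \<bumpeq> ncconst (q powi ik_wt i j) * (vB j * vL i) * Bmon w" by (intro cong_mult_right L_B)
  also have "\<dots> = ncconst (q powi ik_wt i j) * vB j * (vL i * Bmon w)" by (simp add: mult.assoc)
  also have "\<dots> \<bumpeq> ncconst (q powi ik_wt i j) * vB j * (ncconst c * (Bmon w * vL i))" by (rule cong_mult_left[OF c])
  also have "\<dots> = ncconst (q powi ik_wt i j * c) * (Bmon (j # w) * vL i)"
    by (simp add: Bmon_simps mult.assoc ncvar_scal scal_scal)
  finally show ?case by blast
qed

text \<open>Filtration by degree in the B_i. The bound on the length is strict, so that
  \<open>filt 0\<close> is the ideal itself.\<close>

inductive_set filt :: "nat \<Rightarrow> ('k, ik_gen) ncpoly set" for n where
  ideal: "x \<in> rel_ideal (ik_relations q) \<Longrightarrow> x \<in> filt n"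
| mon: "length w < n \<Longrightarrow> Bmon w * Lmon a b \<in> filt n"
| add: "x \<in> filt n \<Longrightarrow> y \<in> filt n \<Longrightarrow> x + y \<in> filt n"
| scal: "x \<in> filt n \<Longrightarrow> ncconst c * x \<in> filt n"

lemma filt_subspace: "verma_subspace q r (filt n)"
  by unfold_locales (auto intro: filt.intros zero_mem)

lemma filt_cong: "x \<bumpeq> y \<Longrightarrow> y \<in> filt n \<Longrightarrow> x \<in> filt n"
  using filt.add[of "x - y" n y] by (simp add: cong_def filt.ideal)

lemma filt_mono: "x \<in> filt m \<Longrightarrow> m \<le> n \<Longrightarrow> x \<in> filt n"
  by (induction rule: filt.induct) (auto intro: filt.intros)

lemma filt_L: "length u + length w < n \<Longrightarrow> Bmon u * vL i * (Bmon w * Lmon a b) \<in> filt n"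
proof -
  assume n: "length u + length w < n"
  obtain c where c: "vL i * Bmon w \<bumpeq> ncconst c * (Bmon w * vL i)" using L_Bmon by blast
  obtain a' b' where ab: "vL i * Lmon a b \<bumpeq> Lmon a' b'" using L_Lmon by blast
  have "Bmon u * vL i * (Bmon w * Lmon a b) = Bmon u * (vL i * Bmon w) * Lmon a b" by (simp add: mult.assoc)
  also have "\<dots> \<bumpeq> Bmon u * (ncconst c * (Bmon w * vL i)) * Lmon a b"
    by (intro cong_mult_left cong_mult_right c)
  also have "\<dots> = ncconst c * Bmon u * Bmon w * (vL i * Lmon a b)"
    by (simp add: mult.assoc ncconst_left_commute[of "Bmon u"])
  also have "\<dots> \<bumpeq> ncconst c * Bmon u * Bmon w * Lmon a' b'" by (intro cong_mult_left ab)
  also have "\<dots> = ncconst c * (Bmon (u @ w) * Lmon a' b')" by (simp add: Bmon_simps mult.assoc)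
  finally show ?thesis
    by (rule filt_cong, intro filt.scal filt.mon) (use n in simp)
qed

lemma ex_filt: "\<exists>n. x \<in> filt n"
proof (induction x rule: nc_induct)
  case zero
  show ?case using filt.ideal[OF zero_mem] by blast
next
  case (mon c w)
  have B: "vB i * x \<in> filt (Suc n)" if "x \<in> filt n" for i x n
    using that
  proof induction
    case (mon w a b)
    have "vB i * (Bmon w * Lmon a b) = Bmon (i # w) * Lmon a b" by (simp add: Bmon_simps mult.assoc)
    then show ?case using mon filt.mon[of "i # w"] by auto
  qed (auto intro: filt.intros left_mem simp: distrib_left ncvar_scal)
  have L: "vL i * x \<in> filt n" if "x \<in> filt n" for i x n
    using that
  proof induction
    case (mon w a b)
    then show ?case using filt_L[of "[]" w n i a b] by (simp add: Bmon_simps)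
  qed (auto intro: filt.intros left_mem simp: distrib_left ncvar_scal)
  have "\<exists>n. ncmon w \<in> filt n"
  proof (induction w)
    case Nil
    have "1 \<in> filt 1" using filt.mon[of "[]" 1 0 0] by (simp add: Bmon_simps Lmon_def)
    then show ?case by (auto simp: ncmon_Nil)
  next
    case (Cons g w)
    then obtain n where "ncmon w \<in> filt n" by blast
    then show ?case using B[of "ncmon w" n] L[of "ncmon w" n] by (cases g) (auto simp: ncmon_Cons)
  qed
  then show ?case using filt.scal by blast
next
  case (add x y)
  then show ?case by (meson filt.add filt_mono max.cobounded1 max.cobounded2)
qed

section \<open>The tautological function on words of length n\<close>

definition top_part :: "nat \<Rightarrow> 'k vfun" where
  "top_part n = (\<lambda>(w, a, b). if length w = n then Bmon w * Lmon a b else 0)"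

lemma act_F_word: "act q f (ncmon (map GF u) * x) (w, a, b) = act q (\<lambda>(w, a, b). f (u @ w, a, b)) x (w, a, b)"
proof (induction u arbitrary: f)
  case (Cons i u)
  have "act q f (ncmon (map GF (i # u)) * x) (w, a, b) = act q (op_F i f) (ncmon (map GF u) * x) (w, a, b)"
    by (simp add: ncmon_Cons mult.assoc act_mult[of q f "vF i"] act_var)
  also have "\<dots> = act q (\<lambda>(w, a, b). f (i # u @ w, a, b)) x (w, a, b)"
    unfolding Cons by (rule arg_cong[of _ _ "\<lambda>f. act q f x (w, a, b)"]) (auto simp: op_F_def fun_eq_iff)
  finally show ?case by (simp only: append_Cons)
qed (simp add: ncmon_Nil)

text \<open>The function turns a Serre element in the F_i into the same expression in the B_i. The
  relations replace it by terms with two factors fewer: torus elements instead of two B's, or one B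
  instead of three.\<close>

lemma vmod_top_part: "vmod q (filt n) (top_part n)"
  unfolding vmod_def
proof (intro allI impI)
  fix u :: "e6 list" and i j :: e6 and m :: verma assume "i \<noteq> j"
  obtain w a b where m: "m = (w, a, b)" by (metis surj_pair)
  interpret verma_subspace q r "filt n" by (rule filt_subspace)
  let ?f = "\<lambda>(w, a, b). top_part n (u @ w, a, b)"
  let ?W = "Bmon w * Lmon a b"
  consider "cartan i j = 0" | "cartan i j = - 1" using cartan_cases[of i j] \<open>i \<noteq> j\<close> by blast
  then show "act q (top_part n) (ncmon (map GF u) * F_rel q i j) m \<in> filt n"
  proof cases
    case 1
    have "act q (top_part n) (ncmon (map GF u) * F_rel q i j) m =
        (if length u + length w + 2 = n then Bmon u * (vB i * vB j - vB j * vB i) * ?W else 0)"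
      unfolding m act_F_word F_rel_def pair_rel_def using 1
      by (simp add: act_simps act_mult act_var op_F_def top_part_def Bmon_simps algebra_simps)
    moreover have "Bmon u * (vB i * vB j - vB j * vB i) * ?W \<in> filt n" if n: "length u + length w + 2 = n"
    proof -
      let ?c = "if j = diagram_aut i then ncconst (inverse (q - inverse q)) * (vL i - vL j) else 0"
      have "vB i * vB j - vB j * vB i \<bumpeq> ?c"
        using ik_mem[OF ik_relations.intros(5)[OF 1, of q]] unfolding cong_def ik_comm_def .
      then have "Bmon u * (vB i * vB j - vB j * vB i) * ?W \<bumpeq> Bmon u * ?c * ?W"
        by (intro cong_mult_right cong_mult_left)
      moreover have "Bmon u * ?c * ?W \<in> filt n"
      proof (cases "j = diagram_aut i")
        case True
        have "Bmon u * ?c * ?W = ncconst (inverse (q - inverse q)) * (Bmon u * vL i * ?W - Bmon u * vL j * ?W)"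
          unfolding if_P[OF True] ncconst_left_commute[of "Bmon u"]
          by (simp add: mult.assoc right_diff_distrib left_diff_distrib)
        also have "\<dots> \<in> filt n" using n by (intro N_scal N_diff filt_L) auto
        finally show ?thesis .
      qed (simp add: N_0)
      ultimately show ?thesis by (rule filt_cong)
    qed
    ultimately show ?thesis by (simp add: N_0)
  next
    case 2
    let ?s = "vB i * vB i * vB j - ncconst (q + inverse q) * vB i * vB j * vB i + vB j * vB i * vB i"
    have "act q (top_part n) (ncmon (map GF u) * F_rel q i j) m =
        (if length u + length w + 3 = n then Bmon u * ?s * ?W else 0)"
      unfolding m act_F_word F_rel_def pair_rel_def using 2
      by (simp add: serre_poly_def mult.assoc act_simps)
        (simp add: act_mult act_var op_F_def top_part_def Bmon_simps distrib_left distrib_right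
          right_diff_distrib left_diff_distrib mult.assoc ncconst_left_commute[of "Bmon u"])
    moreover have "Bmon u * ?s * ?W \<in> filt n" if n: "length u + length w + 3 = n"
    proof -
      let ?c = "if diagram_aut i = i then ncconst (inverse q) * vB j else 0"
      have "?s + ?c \<bumpeq> 0"
        using ik_mem[OF ik_relations.intros(6)[OF 2, of q]] unfolding cong_def ik_serre_def by simp
      then have "?s \<bumpeq> - ?c" by (simp add: cong_def)
      then have "Bmon u * ?s * ?W \<bumpeq> Bmon u * (- ?c) * ?W"
        by (intro cong_mult_right cong_mult_left)
      moreover have "Bmon u * (- ?c) * ?W \<in> filt n"
      proof (cases "diagram_aut i = i")
        case True
        have "Bmon u * (- ?c) * ?W = - (ncconst (inverse q) * (Bmon (u @ j # w) * Lmon a b))"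
          unfolding if_P[OF True] by (simp add: mult.assoc Bmon_simps ncconst_left_commute[of "Bmon u"])
        also have "\<dots> \<in> filt n" using n by (intro N_uminus N_scal filt.mon) auto
        finally show ?thesis .
      qed (simp add: N_0)
      ultimately show ?thesis by (rule filt_cong)
    qed
    ultimately show ?thesis by (simp add: N_0)
  qed
qed

text \<open>E_i shortens words by one letter, so vanishing below length n extends to length
  n.\<close>

lemma op_E_support:
  assumes "\<And>w a b. length w < n \<Longrightarrow> f (w, a, b) = 0"
  shows "length w \<le> n \<Longrightarrow> op_E q i f (w, a, b) = 0"
  using assms
proof (induction w arbitrary: f n)
  case (Cons j w)
  then obtain n' where n: "n = Suc n'" "length w \<le> n'" by (cases n) auto
  have "op_E q i (op_F j f) (w, a, b) = 0"
    by (rule Cons.IH[OF n(2)]) (use Cons.prems(2) n in \<open>simp add: op_F_def\<close>)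
  moreover have "op_K q i s f (w, a, b) = 0" for s
    using Cons.prems(2) n by (simp add: op_K_def)
  ultimately show ?case by (cases "i = j") (auto simp: op_E_step)
qed (simp add: op_E_Nil)

text \<open>The summand of B_i containing E only meets words so short that f vanishes on them; hence
  B_w acts like F_w.\<close>

lemma act_Phi_Bmon:
  assumes "\<And>w a b. length w < n \<Longrightarrow> f (w, a, b) = 0" "length w + length v \<le> n"
  shows "act q f (Phi (Bmon w)) (v, a, b) = f (w @ v, a, b)"
  using assms
proof (induction w arbitrary: f n)
  case (Cons i w)
  then obtain n' where n: "n = Suc n'" by (cases n) auto
  let ?g = "act q f (Phi (vB i))"
  have g: "?g (x, c, d) = f (i # x, c, d)" if "length x \<le> n" for x c d
  proof -
    have "?g (x, c, d) = f (i # x, c, d) - op_E q (diagram_aut i) (op_K q i (- 1) f) (x, c, d)"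
      by (simp add: act_simps act_mult act_var) (simp add: op_F_def)
    moreover have "op_E q (diagram_aut i) (op_K q i (- 1) f) (x, c, d) = 0"
      by (rule op_E_support[OF _ that]) (use Cons.prems(1) in \<open>simp add: op_K_def\<close>)
    ultimately show ?thesis by simp
  qed
  have "act q f (Phi (Bmon (i # w))) (v, a, b) = act q ?g (Phi (Bmon w)) (v, a, b)"
    by (simp add: Bmon_simps nc_subst_hom act_mult del: nc_subst_var)
  also have "\<dots> = ?g (w @ v, a, b)"
    by (rule Cons.IH[of n']) (use g Cons.prems n in auto)
  also have "\<dots> = f (i # w @ v, a, b)"
    by (rule g) (use Cons.prems(2) in simp)
  finally show ?case by simp
qed (simp add: Bmon_simps act_1)

lemma act_Phi_Lmon: "act q f (Phi (Lmon a b)) ([], c, d) = f ([], c + a, d + b)"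
proof -
  have L: "act q f (Phi (vL \<alpha>\<^sub>1)) ([], c, d) = f ([], c + 1, d)"
    "act q f (Phi (vL \<alpha>\<^sub>6)) ([], c, d) = f ([], c - 1, d)"
    "act q f (Phi (vL \<alpha>\<^sub>3)) ([], c, d) = f ([], c, d + 1)"
    "act q f (Phi (vL \<alpha>\<^sub>5)) ([], c, d) = f ([], c, d - 1)" for f c d
    by (simp_all add: act_mult act_var op_K_def)
  have P: "act q f (x ^ m) ([], c, d) = f ([], c + int m * s, d + int m * t)"
    if "\<And>f c d. act q f x ([], c, d) = f ([], c + s, d + t)" for m x s t f c d
    by (induction m arbitrary: f) (simp_all add: act_1 act_mult that algebra_simps)
  have Z: "Phi (zpow x y m) = zpow (Phi x) (Phi y) m" for x y m
    by (rule zpow_hom) (simp_all add: nc_subst_hom)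
  have 1: "act q f (Phi (zpow (vL \<alpha>\<^sub>1) (vL \<alpha>\<^sub>6) a)) ([], c, d) = f ([], c + a, d)" for f c d
    unfolding Z using P[of "Phi (vL \<alpha>\<^sub>1)" 1 0 f "nat a" c d] P[of "Phi (vL \<alpha>\<^sub>6)" "- 1" 0 f "nat (- a)" c d] L
    by (simp add: zpow_def)
  have 3: "act q f (Phi (zpow (vL \<alpha>\<^sub>3) (vL \<alpha>\<^sub>5) b)) ([], c, d) = f ([], c, d + b)" for f c d
    unfolding Z using P[of "Phi (vL \<alpha>\<^sub>3)" 0 1 f "nat b" c d] P[of "Phi (vL \<alpha>\<^sub>5)" 0 "- 1" f "nat (- b)" c d] L
    by (simp add: zpow_def)
  show ?thesis
    unfolding Lmon_def nc_subst_mult act_mult 3 1 by simp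
qed

text \<open>Evaluation at the highest weight vector returns the part of degree n, and the rest of p
  lies in \<open>filt n\<close>.\<close>

lemma top_part_cong:
  assumes "p \<in> filt (Suc n)"
  shows "act q (top_part n) (Phi p) ([], 0, 0) - p \<in> filt n"
proof -
  interpret verma_subspace q r "filt n" by (rule filt_subspace)
  interpret U: uq q r by (rule uq_intro) (rule q_param_axioms)
  show ?thesis
    using assms
  proof induction
    case (ideal x)
    show ?case
      by (rule N_diff[OF vmod_ideal[OF U.Phi_ideal[OF ideal] vmod_top_part] filt.ideal[OF ideal]])
  next
    case (mon w a b)
    have "act q (top_part n) (Phi (Bmon w * Lmon a b)) ([], 0, 0) = top_part n (w, a, b)"
      unfolding nc_subst_mult act_mult act_Phi_Lmon
      by (subst act_Phi_Bmon[of n]) (use mon in \<open>auto simp: top_part_def\<close>)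
    then show ?case using mon by (auto simp: top_part_def N_0 intro!: N_uminus filt.mon)
  next
    case (add x y)
    have "act q (top_part n) (Phi (x + y)) ([], 0, 0) - (x + y) =
        (act q (top_part n) (Phi x) ([], 0, 0) - x) + (act q (top_part n) (Phi y) ([], 0, 0) - y)"
      by (simp add: nc_subst_hom act_simps)
    then show ?case using N_add[OF add.IH] by (simp only:)
  next
    case (scal x c)
    have "act q (top_part n) (Phi (ncconst c * x)) ([], 0, 0) - ncconst c * x =
        ncconst c * (act q (top_part n) (Phi x) ([], 0, 0) - x)"
      by (simp add: nc_subst_hom act_simps right_diff_distrib)
    then show ?case using N_scal[OF scal.IH] by simp
  qed
qed

text \<open>An element of the kernel is also sent into \<open>filt n\<close>, so its degree can be
  lowered until only the ideal remains.\<close>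

theorem Phi_kernel:
  assumes "Phi x \<in> rel_ideal (uq_relations q)"
  shows "x \<in> rel_ideal (ik_relations q)"
proof -
  obtain n where "x \<in> filt n" using ex_filt by blast
  then have "x \<in> filt 0"
  proof (induction n)
    case (Suc n)
    interpret verma_subspace q r "filt n" by (rule filt_subspace)
    have "act q (top_part n) (Phi x) ([], 0, 0) \<in> filt n"
      by (rule vmod_ideal[OF assms vmod_top_part])
    from N_diff[OF this top_part_cong[OF Suc.prems]] have "x \<in> filt n" by simp
    then show ?case by (rule Suc.IH)
  qed
  then show ?thesis by induction (auto intro: add_mem left_mem)
qed

end

section \<open>The braid group operators on the presented algebra\<close>

text \<open>The letters 1 to 6 stand for \<open>h\<close> times \<open>B\<^sub>1, \<dots>, B\<^sub>6\<close>.\<close>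

fun node_no :: "e6 \<Rightarrow> int" where
  "node_no \<alpha>\<^sub>1 = 1" | "node_no \<alpha>\<^sub>2 = 2" | "node_no \<alpha>\<^sub>3 = 3"
| "node_no \<alpha>\<^sub>4 = 4" | "node_no \<alpha>\<^sub>5 = 5" | "node_no \<alpha>\<^sub>6 = 6"

fun tor_of :: "e6 \<Rightarrow> tor" where
  "tor_of \<alpha>\<^sub>1 = (1, 0, 0)" | "tor_of \<alpha>\<^sub>2 = (0, 0, 0)" | "tor_of \<alpha>\<^sub>3 = (0, 1, 0)"
| "tor_of \<alpha>\<^sub>4 = (0, 0, 0)" | "tor_of \<alpha>\<^sub>5 = (0, - 1, 0)" | "tor_of \<alpha>\<^sub>6 = (- 1, 0, 0)"

definition ik_wts :: weights where
  "ik_wts = [(1, - 4, 2, 0), (2, 0, 0, 0), (3, 2, - 4, 0), (4, 0, 0, 0), (5, - 2, 4, 0), (6, 4, - 2, 0)]"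

definition ik_rel_ex :: "e6 \<Rightarrow> e6 \<Rightarrow> ex" where
  "ik_rel_ex i j =
     (if cartan i j = 0
      then Sub (Qc [(0, 1)] (Lt (node_no i)) (Lt (node_no j)))
        (if j = diagram_aut i then Mul (Sc hl) (Sub (Tr (tor_of i)) (Tr (tor_of j))) else Sc [])
      else Add (Qc [(- 2, 1)] (Lt (node_no i)) (Qc [(2, 1)] (Lt (node_no i)) (Lt (node_no j))))
        (if diagram_aut i = i then Mul (Sc [(- 6, 1), (- 2, - 2), (2, 1)]) (Lt (node_no j)) else Sc []))"

text \<open>\<open>ik_comm\<close> is antisymmetric, so one order of two distant nodes suffices,
  whereas the Serre relations are distinct for the two orders.\<close>

definition ik_pairs :: "(e6 \<times> e6) list" where
  "ik_pairs = filter (\<lambda>(i, j). cartan i j = - 1 \<or> cartan i j = 0 \<and> node_no i < node_no j)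
     (concat (map (\<lambda>i. map (Pair i) e6_nodes) e6_nodes))"

definition ik_exs :: "ex list" where
  "ik_exs = map (\<lambda>(i, j). ik_rel_ex i j) ik_pairs"

text \<open>A relation becomes a rule for its largest word, provided that the leading coefficient is
  1 or -1 and no torus factor is attached; otherwise no rule is produced.\<close>

fun lead_rule :: "ncp \<Rightarrow> rules" where
  "lead_rule [] = []"
| "lead_rule (((u, t), c) # p) =
     (if t = (0, 0, 0) \<and> (c = [(0, 1)] \<or> c = [(0, - 1)]) then [(u, pscale (lmul [(0, - 1)] c) p)] else [])"

definition ik_base :: rules where
  "ik_base = concat (map (\<lambda>e. lead_rule (snd (nrm ik_wts [] id_hom e))) ik_exs)"

text \<open>Elements of a noncommutative Groebner basis by increasing length of the leading word.
  The shorter words with torus factors descend from the inhomogeneous terms of the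
  relations.\<close>

definition ik_overlaps :: "overlap list" where
  "ik_overlaps =
    [([3, 2], [1], [3], [2, 1], [(0, - 1)], [3, 1, 2],
      [(([2, 3, 1], 0, 0, 0), [(0, 1)])]),
     ([4, 3, 3], [2], [4, 3], [3, 2], [(0, - 1)], [4, 2, 3, 3],
      [(([3, 4, 2, 3], 0, 0, 0), [(- 2, 1), (2, 1)]), (([3, 3, 4, 2], 0, 0, 0), [(0, - 1)])]),
     ([4, 3, 3], [1], [4], [3, 3, 1], [(- 2, - 1), (2, - 1)], [4, 3, 1, 3],
      [(([3, 4, 3, 1], 0, 0, 0), [(0, 1)]), (([3, 1, 3, 4], 0, 0, 0), [(0, - 1)]), (([1, 3, 4, 3], 0, 0, 0), [(0, 1)])]),
     ([4, 4, 3], [2], [4, 4], [3, 2], [(- 2, 1), (2, 1)], [4, 3, 4, 2],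
      [(([4, 2, 4, 3], 0, 0, 0), [(0, 1)]), (([3, 4, 2, 4], 0, 0, 0), [(0, 1)]), (([2, 4, 3, 4], 0, 0, 0), [(0, - 1)])]),
     ([5, 4, 4], [2], [5], [4, 4, 2], [(- 2, - 1), (2, - 1)], [5, 4, 2, 4],
      [(([4, 5, 4, 2], 0, 0, 0), [(0, 1)]), (([4, 2, 4, 5], 0, 0, 0), [(0, - 1)]), (([2, 4, 5, 4], 0, 0, 0), [(0, 1)])]),
     ([5, 4, 4], [3], [5], [4, 4, 3], [(- 2, - 1), (2, - 1)], [5, 4, 3, 4],
      [(([4, 5, 4, 3], 0, 0, 0), [(0, 1)]), (([4, 3, 4, 5], 0, 0, 0), [(0, - 1)]), (([3, 4, 5, 4], 0, 0, 0), [(0, 1)])]),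
     ([6, 5, 5], [4], [6], [5, 5, 4], [(- 2, - 1), (2, - 1)], [6, 5, 4, 5],
      [(([5, 6, 5, 4], 0, 0, 0), [(0, 1)]), (([5, 4, 5, 6], 0, 0, 0), [(0, - 1)]), (([4, 5, 6, 5], 0, 0, 0), [(0, 1)])]),
     ([4, 4, 3], [1, 3], [4], [4, 3, 1, 3], [(0, - 1)], [4, 3, 4, 3, 1],
      [(([4, 3, 1, 4, 3], 0, 0, 0), [(- 2, 1), (2, 1)]), (([3, 4, 3, 1, 4], 0, 0, 0), [(0, 1)]), (([3, 1, 4, 3, 4], 0, 0, 0), [(- 2, - 1), (2, - 1)]), (([1, 4, 3, 4, 3], 0, 0, 0), [(0, - 1)]), (([1, 3, 4, 3, 4], 0, 0, 0), [(0, 1)])]),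
     ([5, 5, 4], [2, 4], [5], [5, 4, 2, 4], [(0, - 1)], [5, 4, 5, 4, 2],
      [(([5, 4, 2, 5, 4], 0, 0, 0), [(- 2, 1), (2, 1)]), (([4, 5, 4, 2, 5], 0, 0, 0), [(0, 1)]), (([4, 2, 5, 4, 5], 0, 0, 0), [(- 2, - 1), (2, - 1)]), (([2, 5, 4, 5, 4], 0, 0, 0), [(0, - 1)]), (([2, 4, 5, 4, 5], 0, 0, 0), [(0, 1)])]),
     ([5, 5, 4], [3, 4], [5], [5, 4, 3, 4], [(0, - 1)], [5, 4, 5, 4, 3],
      [(([5, 4, 3, 5, 4], 0, 0, 0), [(- 2, 1), (2, 1)]), (([4, 5, 4, 3, 5], 0, 0, 0), [(0, 1)]), (([4, 3, 5, 4, 5], 0, 0, 0), [(- 2, - 1), (2, - 1)]), (([3, 5, 4, 5, 4], 0, 0, 0), [(0, - 1)]), (([3, 4, 5, 4, 5], 0, 0, 0), [(0, 1)]), (([4, 5, 4], 0, 1, 0), [(- 6, 1), (2, - 2), (6, 1)]), (([4, 5, 4], 0, - 1, 0), [(- 6, 1), (- 2, - 2), (6, 1)]), (([4, 4, 5], 0, 1, 0), [(- 4, - 1), (4, 1)]), (([4, 4, 5], 0, - 1, 0), [(- 4, 1), (4, - 1)]), (([5], 0, 1, 0), [(- 10, - 1), (- 6, 2), (2, - 2), (6, 1)]), (([5], 0, - 1, 0), [(- 10, 1), (- 6, - 2), (2, 2), (6, - 1)])]),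
     ([6, 6, 5], [4, 5], [6], [6, 5, 4, 5], [(0, - 1)], [6, 5, 6, 5, 4],
      [(([6, 5, 4, 6, 5], 0, 0, 0), [(- 2, 1), (2, 1)]), (([5, 6, 5, 4, 6], 0, 0, 0), [(0, 1)]), (([5, 4, 6, 5, 6], 0, 0, 0), [(- 2, - 1), (2, - 1)]), (([4, 6, 5, 6, 5], 0, 0, 0), [(0, - 1)]), (([4, 5, 6, 5, 6], 0, 0, 0), [(0, 1)])]),
     ([4, 3, 4, 2], [2], [4, 3], [4, 2, 2], [(0, 1)], [4, 2, 4, 2, 3],
      [(([4, 2, 3, 4, 2], 0, 0, 0), [(- 2, 1), (2, 1)]), (([3, 4, 2, 4, 2], 0, 0, 0), [(0, - 1)]), (([2, 4, 2, 4, 3], 0, 0, 0), [(0, 1)]), (([2, 4, 2, 3, 4], 0, 0, 0), [(- 2, - 1), (2, - 1)]), (([2, 3, 4, 2, 4], 0, 0, 0), [(0, 1)])]),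
     ([6, 5, 4, 5], [3], [6, 5, 4], [5, 3], [(0, - 1)], [6, 5, 4, 3, 5],
      [(([5, 6, 5, 4, 3], 0, 0, 0), [(0, 1)]), (([5, 4, 3, 5, 6], 0, 0, 0), [(0, - 1)]), (([4, 3, 5, 6, 5], 0, 0, 0), [(0, 1)]), (([6, 5, 4], 0, 1, 0), [(- 2, - 1), (2, 1)]), (([6, 5, 4], 0, - 1, 0), [(- 2, 1), (2, - 1)]), (([5, 4, 6], 0, 1, 0), [(- 4, - 1), (0, 1)]), (([5, 4, 6], 0, - 1, 0), [(0, 1), (4, - 1)]), (([4, 6, 5], 0, 1, 0), [(0, 1), (4, - 1)]), (([4, 6, 5], 0, - 1, 0), [(- 4, - 1), (0, 1)]), (([4, 5, 6], 0, 1, 0), [(- 2, 1), (2, - 1)]), (([4, 5, 6], 0, - 1, 0), [(- 2, - 1), (2, 1)])]),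
     ([5, 4, 5, 4, 3], [2], [5, 4, 5, 4], [3, 2], [(- 2, 1), (2, 1)], [5, 4, 3, 5, 4, 2],
      [(([5, 4, 2, 5, 4, 3], 0, 0, 0), [(0, 1)]), (([4, 3, 5, 4, 2, 5], 0, 0, 0), [(0, 1)]), (([4, 2, 5, 4, 3, 5], 0, 0, 0), [(0, - 1)]), (([3, 5, 4, 2, 5, 4], 0, 0, 0), [(0, 1)]), (([3, 4, 2, 5, 4, 5], 0, 0, 0), [(0, - 1)]), (([2, 5, 4, 3, 5, 4], 0, 0, 0), [(0, - 1)]), (([2, 4, 3, 5, 4, 5], 0, 0, 0), [(0, 1)]), (([4, 5, 4, 2], 0, 1, 0), [(- 4, - 1), (0, 2), (4, - 1)]), (([4, 5, 4, 2], 0, - 1, 0), [(- 4, - 1), (0, 2), (4, - 1)]), (([4, 2, 5, 4], 0, 1, 0), [(- 2, - 1), (2, 1)]), (([4, 2, 5, 4], 0, - 1, 0), [(- 2, 1), (2, - 1)]), (([4, 2, 4, 5], 0, 1, 0), [(- 4, 1), (4, - 1)]), (([4, 2, 4, 5], 0, - 1, 0), [(- 4, - 1), (4, 1)]), (([2, 4, 5, 4], 0, 1, 0), [(- 4, - 1), (0, 2), (4, - 1)]), (([2, 4, 5, 4], 0, - 1, 0), [(- 4, - 1), (0, 2), (4, - 1)]), (([2, 5], 0, 1, 0), [(- 8, 1), (- 4, - 3), (0, 3), (4, - 1)]), (([2, 5], 0, - 1, 0), [(- 8, - 1), (- 4, 3), (0, - 3), (4, 1)])]),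
     ([5, 4, 2, 4], [3, 3], [5, 4, 2], [4, 3, 3], [(- 2, - 1), (2, - 1)], [5, 4, 2, 3, 4, 3],
      [(([4, 3, 5, 4, 2, 3], 0, 0, 0), [(0, 1)]), (([4, 2, 3, 4, 3, 5], 0, 0, 0), [(0, - 1)]), (([3, 5, 4, 2, 3, 4], 0, 0, 0), [(0, 1)]), (([3, 4, 3, 5, 4, 2], 0, 0, 0), [(0, - 1)]), (([3, 4, 2, 3, 4, 5], 0, 0, 0), [(0, 1)]), (([2, 4, 3, 5, 4, 3], 0, 0, 0), [(0, 1)]), (([2, 3, 4, 3, 5, 4], 0, 0, 0), [(0, - 1)]), (([4, 2, 4, 3], 0, 1, 0), [(- 8, 1), (- 4, - 2), (0, 1)]), (([4, 2, 4, 3], 0, - 1, 0), [(0, 1), (4, - 2), (8, 1)]), (([4, 2, 3, 4], 0, 1, 0), [(- 6, 1), (- 2, - 1)]), (([4, 2, 3, 4], 0, - 1, 0), [(2, - 1), (6, 1)]), (([3, 4, 2, 4], 0, 1, 0), [(- 4, - 2), (0, 2)]), (([3, 4, 2, 4], 0, - 1, 0), [(0, 2), (4, - 2)]), (([2, 3], 0, 1, 0), [(- 12, - 1), (- 8, 3), (- 4, - 3), (0, 1)]), (([2, 3], 0, - 1, 0), [(- 4, 1), (0, - 3), (4, 3), (8, - 1)])])]"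

definition ik_letters6 :: "int list" where "ik_letters6 = [1, 2, 3, 4, 5, 6]"

text \<open>The defining relations precede the derived rules, which settles which rule is tried
  earlier; soundness depends only on the set of rules.\<close>

definition ik_all_rules :: rules where
  "ik_all_rules = ik_base @ map (\<lambda>(x, t, s, y, c, u, p). (u, p)) ik_overlaps"

lemma set_new_rules: "set (new_rules os rs) = set rs \<union> (\<lambda>(x, t, s, y, c, u, p). (u, p)) ` set os"
  by (induction os rs rule: new_rules.induct) auto

lemma ik_overlaps_ok: "overlaps_ok ik_wts ik_letters6 ik_base ik_overlaps"
  by code_simp

context nc_model
begin

lemma lead_rule_sound:
  assumes "ev e \<in> I" "(u, p) \<in> set (lead_rule (snd (nrm \<chi> [] id_hom e)))"
  shows "evw u \<bumpeq> evp p"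
proof -
  obtain n z where nz: "nrm \<chi> [] id_hom e = (n, z)" by (cases "nrm \<chi> [] id_hom e")
  have "ncconst (h ^ n) * ev e \<bumpeq> evp z"
    using represents_nrm[OF _ hom_sound_id, of "[]" e] by (simp add: sound_table_def represents_def nz)
  then have z: "evp z \<in> I" using left_mem[OF assms(1)] cong_mem by blast
  obtain t c p' where zc: "z = ((u, t), c) # p'" "t = (0, 0, 0)" "c = [(0, 1)] \<or> c = [(0, - 1)]"
      "p = pscale (lmul [(0, - 1)] c) p'"
    using assms(2) nz by (cases z rule: lead_rule.cases) (auto split: if_splits)
  have "ncconst (evl c) * (evw u * \<kappa> (0, 0, 0) - evp p) = evp z"
    using zc(3) by (auto simp: zc(1,2,4) evm_def evp_pscale evl_lshift ncconst_uminus)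
  then have "ncconst (evl c) * (ncconst (evl c) * (evw u * \<kappa> (0, 0, 0) - evp p)) \<in> I"
    using left_mem[OF z] by simp
  then have "evw u * \<kappa> (0, 0, 0) \<bumpeq> evp p"
    using zc(3) by (auto simp: cong_def ncconst_uminus)
  moreover have "evw u * \<kappa> (0, 0, 0) \<bumpeq> evw u"
    using cong_mult_left[OF \<kappa>_0, of "evw u"] by simp
  ultimately show ?thesis by (blast intro: cong_sym cong_trans)
qed

text \<open>Torus elements commute with each other, so only the words decide the scalar; it is
  common to all terms if the weights agree.\<close>

lemma evp_wt:
  assumes "\<And>w t c. ((w, t), c) \<in> set p \<Longrightarrow> wt \<chi> w s = k"
  shows "\<kappa> s * evp p \<bumpeq> ncconst (r powi k) * (evp p * \<kappa> s)"
  using assms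
proof (induction p)
  case (Cons x p)
  obtain w t c where x: "x = ((w, t), c)" by (metis surj_pair)
  have com: "\<kappa> s * \<kappa> t \<bumpeq> \<kappa> t * \<kappa> s"
  proof -
    have "tadd s t = tadd t s" by (cases s; cases t) simp
    then show ?thesis using \<kappa>_add[of s t] \<kappa>_add[of t s] cong_sym cong_trans by metis
  qed
  have k: "wt \<chi> w s = k" using Cons.prems[of w t c] x by simp
  have IH: "\<kappa> s * evp p \<bumpeq> ncconst (r powi k) * (evp p * \<kappa> s)"
  proof (rule Cons.IH)
    show "wt \<chi> v s = k" if "((v, t'), c') \<in> set p" for v t' c'
      using Cons.prems[of v t' c'] that by simp
  qed
  have "\<kappa> s * (ncconst (evl c) * evm (w, t)) = ncconst (evl c) * (\<kappa> s * evw w * \<kappa> t)"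
    by (simp add: evm_def ncconst_left_commute[of "\<kappa> s"] mult.assoc)
  also have "\<dots> \<bumpeq> ncconst (evl c) * (ncconst (r powi k) * (evw w * \<kappa> s) * \<kappa> t)"
    using \<kappa>_evw[of s w] k by (intro cong_mult_left cong_mult_right) simp
  also have "\<dots> = ncconst (evl c) * (ncconst (r powi k) * evw w * (\<kappa> s * \<kappa> t))"
    by (simp add: mult.assoc)
  also have "\<dots> \<bumpeq> ncconst (evl c) * (ncconst (r powi k) * evw w * (\<kappa> t * \<kappa> s))"
    by (intro cong_mult_left com)
  also have "\<dots> = ncconst (r powi k) * (ncconst (evl c) * evm (w, t) * \<kappa> s)"
    by (simp add: evm_def mult.assoc ncconst_left_commute[of "ncconst (evl c)"])
  finally have "\<kappa> s * (ncconst (evl c) * evm (w, t)) + \<kappa> s * evp p \<bumpeq>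
      ncconst (r powi k) * (ncconst (evl c) * evm (w, t) * \<kappa> s) + ncconst (r powi k) * (evp p * \<kappa> s)"
    by (rule cong_add[OF _ IH])
  then show ?case by (simp add: x distrib_left distrib_right)
qed simp

end

lemma tmap_add: "tadd (tmap M s) (tmap M t) = tmap M (tadd s t)"
proof -
  obtain a1 a2 a3 b1 b2 b3 c1 c2 c3 where "M = ((a1, a2, a3), (b1, b2, b3), (c1, c2, c3))"
    by (metis surj_pair)
  then show ?thesis by (cases s; cases t) (simp add: algebra_simps)
qed

lemma tmap_0: "tmap M (0, 0, 0) = (0, 0, 0)"
proof -
  obtain a1 a2 a3 b1 b2 b3 c1 c2 c3 where "M = ((a1, a2, a3), (b1, b2, b3), (c1, c2, c3))"
    by (metis surj_pair)
  then show ?thesis by simp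
qed

fun tneg :: "tor \<Rightarrow> tor" where
  "tneg (a, b, c) = (- a, - b, - c)"

lemma tneg_tmap: "tneg (tmap M (tneg t)) = tmap M t"
proof -
  obtain a1 a2 a3 b1 b2 b3 c1 c2 c3 where "M = ((a1, a2, a3), (b1, b2, b3), (c1, c2, c3))"
    by (metis surj_pair)
  then show ?thesis by (cases t) simp
qed

lemma tor_of_diagram_aut: "tadd (tor_of i) (tor_of (diagram_aut i)) = (0, 0, 0)"
  by (cases i) simp_all

lemma zpow_one [simp]: "zpow 1 1 n = 1"
  by (simp add: zpow_def)

lemma ik_wts_node: "assoc (0, 0, 0) ik_wts (node_no i) = (2 * ik_wt \<alpha>\<^sub>1 i, 2 * ik_wt \<alpha>\<^sub>3 i, 0)"
  by (cases i) (simp_all add: ik_wts_def ik_wt_def cartan_def e6_edges_def)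

lemma node_cases: "(\<exists>i. l = node_no i) \<or> l \<notin> {1, 2, 3, 4, 5, 6}"
proof (cases "l \<in> {1, 2, 3, 4, 5, 6}")
  case True
  then have "l \<in> node_no ` {\<alpha>\<^sub>1, \<alpha>\<^sub>2, \<alpha>\<^sub>3, \<alpha>\<^sub>4, \<alpha>\<^sub>5, \<alpha>\<^sub>6}" by auto
  then show ?thesis by blast
qed simp

section \<open>The presented algebra as a model of the computation\<close>

context ik
begin

definition letter :: "int \<Rightarrow> ('k, ik_gen) ncpoly" where
  "letter = assoc 0 (map (\<lambda>i. (node_no i, ncconst h * vB i)) e6_nodes)"

text \<open>The torus has rank two; the third coordinate of \<open>tor\<close> is interpreted by
  1.\<close>

definition Ltor :: "tor \<Rightarrow> ('k, ik_gen) ncpoly" where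
  "Ltor = zpow3 (zpow (vL \<alpha>\<^sub>1) (vL \<alpha>\<^sub>6)) (zpow (vL \<alpha>\<^sub>3) (vL \<alpha>\<^sub>5)) (zpow 1 1)"

lemma letter_node: "letter (node_no i) = ncconst h * vB i"
  by (cases i) (simp_all add: letter_def e6_nodes_def)

lemma letter_simps:
  "letter 1 = ncconst h * vB \<alpha>\<^sub>1" "letter 2 = ncconst h * vB \<alpha>\<^sub>2" "letter 3 = ncconst h * vB \<alpha>\<^sub>3"
  "letter 4 = ncconst h * vB \<alpha>\<^sub>4" "letter 5 = ncconst h * vB \<alpha>\<^sub>5" "letter 6 = ncconst h * vB \<alpha>\<^sub>6"
  by (simp_all add: letter_def e6_nodes_def)

lemma letter_other: "l \<notin> {1, 2, 3, 4, 5, 6} \<Longrightarrow> letter l = 0"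
  by (simp add: letter_def e6_nodes_def)

sublocale M: nc_model q r "rel_ideal (ik_relations q)" letter Ltor ik_wts
  unfolding Ltor_def
proof (rule nc_modelI)
  have wt: "vL i * letter l \<bumpeq> ncconst (r powi n) * (letter l * vL i)"
    if "\<And>j. l = node_no j \<Longrightarrow> n = 2 * ik_wt i j" for i l n
  proof (cases "\<exists>j. l = node_no j")
    case True
    then obtain j where j: "l = node_no j" by blast
    have "ncconst h * (vL i * vB j) \<bumpeq> ncconst h * (ncconst (q powi ik_wt i j) * (vB j * vL i))"
      by (intro scal_cong L_B)
    then show ?thesis
      using that[OF j] by (simp add: j letter_node r_powi_two ncvar_scal scal_scal mult.assoc mult.commute)
  next
    case False
    then show ?thesis using node_cases[of l] by (auto simp: letter_other)
  qed
  show "vL \<alpha>\<^sub>1 * letter l \<bumpeq> ncconst (r powi fst (assoc (0, 0, 0) ik_wts l)) * (letter l * vL \<alpha>\<^sub>1)"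
    "vL \<alpha>\<^sub>3 * letter l \<bumpeq> ncconst (r powi fst (snd (assoc (0, 0, 0) ik_wts l))) * (letter l * vL \<alpha>\<^sub>3)" for l
    by (rule wt, simp add: ik_wts_node)+
  show "1 * letter l \<bumpeq> ncconst (r powi snd (snd (assoc (0, 0, 0) ik_wts l))) * (letter l * 1)" for l
    using node_cases[of l] by (auto simp: letter_other ik_wts_node)
qed (use L_16 L_L in \<open>auto simp: q_param_axioms nc_ideal_axioms\<close>)

lemma Ltor_tor_of: "diagram_aut i \<noteq> i \<Longrightarrow> Ltor (tor_of i) = vL i"
  and Ltor_tor_of_cong: "Ltor (tor_of i) \<bumpeq> vL i"
  and Ltor_0: "Ltor (0, 0, 0) = 1"
proof -
  show *: "diagram_aut i \<noteq> i \<Longrightarrow> Ltor (tor_of i) = vL i" and 0: "Ltor (0, 0, 0) = 1"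
    by (cases i; simp add: Ltor_def)+
  show "Ltor (tor_of i) \<bumpeq> vL i"
    using * 0 cong_sym[OF L_fixed[of i]] by (cases i) auto
qed

lemma Ltor_simps: "Ltor (1, 0, 0) = vL \<alpha>\<^sub>1" "Ltor (- 1, 0, 0) = vL \<alpha>\<^sub>6"
    "Ltor (0, 1, 0) = vL \<alpha>\<^sub>3" "Ltor (0, - 1, 0) = vL \<alpha>\<^sub>5"
  by (simp_all add: Ltor_def)

lemma ev_rel:
  "cartan i j = 0 \<Longrightarrow> M.ev (ik_rel_ex i j) = ncconst (h * h) * ik_comm q i j"
  "cartan i j = - 1 \<Longrightarrow> M.ev (ik_rel_ex i j) = ncconst (h * h * h) * ik_serre q i j"
proof -
  assume c: "cartan i j = 0"
  have hh: "h * (h * inverse h) = h" using h_nz by simp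
  have one: "ncconst (evl [(0, 1)]) = (1 :: ('k, ik_gen) ncpoly)" by simp
  show "M.ev (ik_rel_ex i j) = ncconst (h * h) * ik_comm q i j"
  proof (cases "j = diagram_aut i")
    case True
    then have ij: "diagram_aut i \<noteq> i" "diagram_aut j \<noteq> j" using c by (auto simp: cartan_def)
    have "M.ev (ik_rel_ex i j) = ncconst h * vB i * (ncconst h * vB j) - ncconst h * vB j * (ncconst h * vB i)
        - ncconst h * (vL i - vL j)"
      unfolding ik_rel_ex_def if_P[OF c] if_P[OF True] M.ev.simps one
      by (simp only: letter_node Ltor_tor_of[OF ij(1)] Ltor_tor_of[OF ij(2)] evl_hl mult_1_left)
    also have "\<dots> = ncconst (h * h) * ik_comm q i j"
      unfolding ik_comm_def if_P[OF True] h_def[symmetric]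
      by (simp add: ncvar_scal scal_scal right_diff_distrib mult.assoc hh)
    finally show ?thesis .
  next
    case False
    then show ?thesis
      using c by (simp add: ik_rel_ex_def ik_comm_def letter_node ncvar_scal scal_scal right_diff_distrib mult.assoc)
  qed
next
  assume c: "cartan i j = - 1"
  have "r powi (- 6) = inverse q * inverse q * inverse q"
    using r_powi_two[of "- 3"] q_nz by (simp add: power_int_def power3_eq_cube power_inverse)
  then have hq: "evl [(- 6, 1), (- 2, - 2), (2, 1)] = inverse q * (h * h)"
    using q_nz r_powi_two[of "- 1"] by (simp add: h_def field_simps)
  have qq: "q * (inverse q * z) = z" for z using q_nz by simp
  show "M.ev (ik_rel_ex i j) = ncconst (h * h * h) * ik_serre q i j"
    using c by (simp add: ik_rel_ex_def ik_serre_def letter_node hq scal_simps qq del: evl_Cons)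
      (simp add: scal_simps qq r_powi_two[of "- 1", simplified])
qed

lemma ex_mem: "e \<in> set ik_exs \<Longrightarrow> M.ev e \<in> rel_ideal (ik_relations q)"
  using left_mem[OF ik_mem[OF ik_relations.intros(5)]] left_mem[OF ik_mem[OF ik_relations.intros(6)]]
  by (auto simp: ik_exs_def ik_pairs_def ev_rel)

lemma ik_base_sound: "M.sound ik_base"
  using M.lead_rule_sound[OF ex_mem] unfolding M.sound_def ik_base_def by fastforce

lemma ik_rules_sound: "M.sound ik_all_rules"
proof -
  have "set ik_all_rules = set (new_rules ik_overlaps ik_base)"
    by (simp add: ik_all_rules_def set_new_rules)
  then show ?thesis
    using M.overlaps_sound[OF ik_base_sound ik_overlaps_ok] by (simp add: M.sound_def)
qed

end

subsection \<open>Homomorphisms of the presented algebra\<close>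

text \<open>The image of B_j must be homogeneous of the weight prescribed by its commutation with
  the torus. This settles the relations between \<open>GL\<close> and \<open>GB\<close> without any
  rewriting.\<close>

definition wts_ok :: "hom_table \<Rightarrow> bool" where
  "wts_ok H \<longleftrightarrow> list_all (\<lambda>i. list_all (\<lambda>j. list_all (\<lambda>((w, t), c).
     wt ik_wts w (tmap (snd H) (tor_of i)) = 2 * ik_wt i j) (snd (nrm ik_wts [] H (Lt (node_no j))))) e6_nodes) e6_nodes"

context ik
begin

definition ik_hom :: "(('k, ik_gen) ncpoly \<Rightarrow> ('k, ik_gen) ncpoly) \<Rightarrow> bool" where
  "ik_hom f \<longleftrightarrow> (\<forall>x y. f (x + y) = f x + f y) \<and> (\<forall>x y. f (x * y) = f x * f y) \<and>
     (\<forall>c. f (ncconst c) = ncconst c) \<and> (\<forall>x y. x \<bumpeq> y \<longrightarrow> f x \<bumpeq> f y)"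

lemma ik_homD:
  assumes "ik_hom f"
  shows "f (x + y) = f x + f y" "f (x * y) = f x * f y" "f (ncconst c) = ncconst c"
    "x \<bumpeq> y \<Longrightarrow> f x \<bumpeq> f y" "f 0 = 0" "f 1 = 1" "f (x - y) = f x - f y"
proof -
  show *: "f (x + y) = f x + f y" "f (x * y) = f x * f y" "f (ncconst c) = ncconst c"
    "x \<bumpeq> y \<Longrightarrow> f x \<bumpeq> f y" for x y c
    using assms by (simp_all add: ik_hom_def)
  show "f 0 = 0" "f 1 = 1" using *(3)[of 0] *(3)[of 1] by simp_all
  then show "f (x - y) = f x - f y" using *(1)[of "x - y" y] by simp
qed

lemma ik_hom_comp: "ik_hom f \<Longrightarrow> ik_hom g \<Longrightarrow> ik_hom (\<lambda>x. f (g x))"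
  by (simp add: ik_hom_def)

lemma cong_cancel: "ncconst c * x \<bumpeq> ncconst c * y \<Longrightarrow> c \<noteq> 0 \<Longrightarrow> x \<bumpeq> y"
  unfolding cong_def right_diff_distrib[symmetric] by (rule scal_mem_cancel)

lemma ik_hom_agree:
  assumes f: "ik_hom f" and g: "ik_hom g"
    and B: "\<And>i. f (letter (node_no i)) \<bumpeq> g (letter (node_no i))" and L: "\<And>t. f (Ltor t) \<bumpeq> g (Ltor t)"
  shows "f x \<bumpeq> g x"
proof (induction x rule: ncpoly_induct)
  case (var e)
  show ?case
  proof (cases e)
    case (GB i)
    then show ?thesis
      using B[of i] cong_cancel[OF _ h_nz] by (simp add: letter_node ik_homD[OF f] ik_homD[OF g])
  next
    case (GL i)
    have "f (vL i) \<bumpeq> f (Ltor (tor_of i))" by (rule ik_homD(4)[OF f cong_sym[OF Ltor_tor_of_cong]])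
    also have "\<dots> \<bumpeq> g (Ltor (tor_of i))" by (rule L)
    also have "\<dots> \<bumpeq> g (vL i)" by (rule ik_homD(4)[OF g Ltor_tor_of_cong])
    finally show ?thesis using GL by simp
  qed
qed (simp_all add: ik_homD(1-3)[OF f] ik_homD(1-3)[OF g] cong_add cong_mult)

text \<open>Relations among torus generators hold because the exponents transform linearly, mixed
  relations by \<open>wts_ok\<close>, and relations among the B_i by normalisation.\<close>

lemma ik_hom_intro:
  assumes sound: "M.hom_sound f H" and L: "\<And>i. f (vL i) \<bumpeq> Ltor (tmap (snd H) (tor_of i))"
    and wts: "wts_ok H" and van: "vanishes ik_wts ik_letters6 ik_all_rules H ik_exs"
  shows "ik_hom f"
proof -
  have hom: "f (x + y) = f x + f y" "f (x * y) = f x * f y" "f (ncconst c) = ncconst c" for x y c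
    using sound by (simp_all add: M.hom_sound_def)
  note diff = M.hom_sound_diff[OF sound]
  have f1: "f 1 = 1" using hom(3)[of 1] by simp
  let ?I = "rel_ideal (ik_relations q)" and ?t = "\<lambda>i. tmap (snd H) (tor_of i)"
  have LL: "f (vL i) * f (vL j) \<bumpeq> Ltor (tmap (snd H) (tadd (tor_of i) (tor_of j)))" for i j
    using cong_trans[OF cong_mult[OF L L] M.\<kappa>_add, of i j] by (simp add: tmap_add)
  have comm: "f (ik_comm q i j) \<in> ?I" if "(i, j) \<in> set ik_pairs" "cartan i j = 0" for i j
  proof -
    have "f (M.ev (ik_rel_ex i j)) \<in> ?I"
      by (rule M.vanishes_hom[OF van ik_rules_sound sound]) (use that(1) in \<open>auto simp: ik_exs_def\<close>)
    then show ?thesis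
      using scal_mem_cancel[of "h * h"] h_nz by (simp add: ev_rel(1)[OF that(2)] hom)
  qed
  have pairs: "(i, j) \<in> set ik_pairs \<longleftrightarrow> cartan i j = - 1 \<or> cartan i j = 0 \<and> node_no i < node_no j" for i j
    by (auto simp: ik_pairs_def image_iff set_e6_nodes)
  have "f x \<in> ?I" if "x \<in> ?I" for x
  proof -
    have "?I \<subseteq> {x. f x \<in> ?I}"
    proof (rule rel_ideal_least)
      show "two_sided {x. f x \<in> ?I}"
        by (rule two_sided_preimage) (simp_all add: hom two_sided_axioms)
      show "ik_relations q \<subseteq> {x. f x \<in> ?I}"
      proof
        fix p assume "p \<in> ik_relations q"
        then show "p \<in> {x. f x \<in> ?I}"
        proof cases
          case (1 i)
          then show ?thesis
            using LL[of i "diagram_aut i"] by (simp add: hom diff f1 tor_of_diagram_aut tmap_0 Ltor_0 cong_def)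
        next
          case (2 i)
          then have "tor_of i = (0, 0, 0)" by (cases i) auto
          then show ?thesis
            using 2 L[of i] by (simp add: diff f1 tmap_0 Ltor_0 cong_def)
        next
          case (3 i j)
          have "tadd (tor_of i) (tor_of j) = tadd (tor_of j) (tor_of i)" by (cases i; cases j) simp_all
          then have "f (vL i) * f (vL j) \<bumpeq> f (vL j) * f (vL i)"
            using LL[of i j] LL[of j i] cong_sym cong_trans by metis
          then show ?thesis using 3 by (simp add: hom diff cong_def)
        next
          case (4 i j)
          let ?n = "nrm ik_wts [] H (Lt (node_no j))"
          let ?z = "M.evp (snd ?n)" and ?c = "h ^ fst ?n * h"
          have c: "?c \<noteq> 0" using h_nz by simp
          have z: "ncconst ?c * f (vB j) \<bumpeq> ?z"
            using sound unfolding M.hom_sound_def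
            by (metis hom(2,3) letter_node scal_scal(1))
          have "ncconst ?c * (f (vL i) * f (vB j)) = f (vL i) * (ncconst ?c * f (vB j))"
            by (simp add: ncconst_left_commute[of "f (vL i)"])
          also have "\<dots> \<bumpeq> Ltor (?t i) * ?z" by (rule cong_mult[OF L z])
          also have "\<dots> \<bumpeq> ncconst (r powi (2 * ik_wt i j)) * (?z * Ltor (?t i))"
            using wts set_e6_nodes unfolding wts_ok_def list_all_iff by (intro M.evp_wt) fastforce
          also have "\<dots> \<bumpeq> ncconst (r powi (2 * ik_wt i j)) * (ncconst ?c * f (vB j) * f (vL i))"
            by (intro cong_mult_left cong_mult cong_sym[OF L] cong_sym[OF z])
          also have "\<dots> = ncconst ?c * (ncconst (q powi ik_wt i j) * (f (vB j) * f (vL i)))"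
            by (simp add: r_powi_two mult.assoc scal_scal mult.commute)
          finally have "f (vL i) * f (vB j) \<bumpeq> ncconst (q powi ik_wt i j) * (f (vB j) * f (vL i))"
            by (rule cong_cancel[OF _ c])
          then show ?thesis using 4 by (simp add: hom diff cong_def)
        next
          case (5 i j)
          consider "node_no i < node_no j" | "node_no j < node_no i"
            using 5(2) by (cases i; cases j) (auto simp: cartan_def)
          then show ?thesis
          proof cases
            case 1
            then show ?thesis using comm[of i j] 5 pairs by simp
          next
            case 2
            have "ik_comm q i j = ncconst (- 1) * ik_comm q j i"
              by (auto simp: ik_comm_def ncconst_uminus right_diff_distrib)
            moreover have "f (ik_comm q j i) \<in> ?I"
              using comm[of j i] 2 5 pairs cartan_sym[of i j] by simp
            ultimately show ?thesis using 5 by (simp only: hom mem_Collect_eq) (rule left_mem)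
          qed
        next
          case (6 i j)
          have "f (M.ev (ik_rel_ex i j)) \<in> ?I"
            by (rule M.vanishes_hom[OF van ik_rules_sound sound]) (use 6 pairs in \<open>auto simp: ik_exs_def\<close>)
          then show ?thesis
            using scal_mem_cancel[of "h * h * h"] h_nz 6 by (simp add: ev_rel(2)[OF 6(2)] hom)
        qed
      qed
    qed
    then show ?thesis using that by blast
  qed
  then show ?thesis by (simp add: ik_hom_def hom cong_def flip: diff)
qed

lemma torus_hom:
  assumes f: "\<And>x y. f (x * y) = f x * f y" "f 1 = 1"
    and L: "\<And>i. f (vL i) = Ltor (tmap (u, v, 0, 0, 1) (tor_of i))"
    and uv: "snd (snd u) = 0" "snd (snd v) = 0"
  shows "f (Ltor t) \<bumpeq> Ltor (tmap (u, v, 0, 0, 1) t)"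
proof -
  obtain u1 u2 v1 v2 where u: "u = (u1, u2, 0)" and v: "v = (v1, v2, 0)"
    using uv by (metis prod.collapse)
  obtain a b c where t: "t = (a, b, c)" by (metis surj_pair)
  have pow: "zpow (Ltor (x, y, 0)) (Ltor (- x, - y, 0)) n \<bumpeq> Ltor (n * x, n * y, 0)" for x y n
  proof (rule cong_sym, rule zpow_unique)
    show "Ltor (x, y, 0) * Ltor (- x, - y, 0) \<bumpeq> 1" "Ltor (- x, - y, 0) * Ltor (x, y, 0) \<bumpeq> 1"
      using M.\<kappa>_add[of "(x, y, 0)" "(- x, - y, 0)"] M.\<kappa>_add[of "(- x, - y, 0)" "(x, y, 0)"] by (simp_all add: Ltor_0)
    show "Ltor (0 * x, 0 * y, 0) \<bumpeq> 1" by (simp add: Ltor_0)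
    show "Ltor ((n + 1) * x, (n + 1) * y, 0) \<bumpeq> Ltor (x, y, 0) * Ltor (n * x, n * y, 0)" for n
      using cong_sym[OF M.\<kappa>_add[of "(x, y, 0)" "(n * x, n * y, 0)"]] by (simp add: algebra_simps)
    show "Ltor ((n - 1) * x, (n - 1) * y, 0) \<bumpeq> Ltor (- x, - y, 0) * Ltor (n * x, n * y, 0)" for n
      using cong_sym[OF M.\<kappa>_add[of "(- x, - y, 0)" "(n * x, n * y, 0)"]] by (simp add: algebra_simps)
  qed
  have "f (Ltor t) = zpow (Ltor (u1, u2, 0)) (Ltor (- u1, - u2, 0)) a * zpow (Ltor (v1, v2, 0)) (Ltor (- v1, - v2, 0)) b"
    using L[of \<alpha>\<^sub>1] L[of \<alpha>\<^sub>6] L[of \<alpha>\<^sub>3] L[of \<alpha>\<^sub>5]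
    by (simp add: Ltor_def[THEN fun_cong, of "(a, b, c)"] t f zpow_hom[of f, OF f(2,1)] u v)
  also have "\<dots> \<bumpeq> Ltor (a * u1, a * u2, 0) * Ltor (b * v1, b * v2, 0)"
    by (intro cong_mult pow)
  also have "\<dots> \<bumpeq> Ltor (a * u1 + b * v1, a * u2 + b * v2, 0)"
    using M.\<kappa>_add[of "(a * u1, a * u2, 0)" "(b * v1, b * v2, 0)"] by simp
  also have "\<dots> = Ltor (tmap (u, v, 0, 0, 1) t)"
    by (simp add: Ltor_def t u v mult.commute)
  finally show ?thesis .
qed

subsection \<open>The anti-involution fixing the generators \<open>B\<^sub>i\<close>\<close>

fun rho_gen :: "ik_gen \<Rightarrow> ('k, ik_gen) ncpoly" where
  "rho_gen (GB i) = vB i"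
| "rho_gen (GL i) = vL (diagram_aut i)"

abbreviation rho :: "('k, ik_gen) ncpoly \<Rightarrow> ('k, ik_gen) ncpoly" where
  "rho \<equiv> nc_antisubst rho_gen"

lemma rho_rho: "rho (rho x) = x"
proof (induction x rule: ncpoly_induct)
  case (var e)
  then show ?case by (cases e) simp_all
qed (simp_all add: nc_antisubst_hom)

text \<open>Serre relations are palindromic. In a commutator relation both sides change sign, as tau
  exchanges i and j whenever a torus term occurs.\<close>

lemma rho_ideal:
  assumes "x \<in> rel_ideal (ik_relations q)"
  shows "rho x \<in> rel_ideal (ik_relations q)"
proof -
  let ?I = "rel_ideal (ik_relations q)"
  have "?I \<subseteq> {x. rho x \<in> ?I}"
  proof (rule rel_ideal_least)
    show "two_sided {x. rho x \<in> ?I}"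
      by (rule two_sided_antipreimage) (simp_all add: nc_antisubst_hom two_sided_axioms)
    show "ik_relations q \<subseteq> {x. rho x \<in> ?I}"
    proof
      fix p assume "p \<in> ik_relations q"
      then show "p \<in> {x. rho x \<in> ?I}"
      proof cases
        case (1 i)
        then show ?thesis using L_inv[of i] by (simp add: nc_antisubst_hom cong_def)
      next
        case (2 i)
        then show ?thesis using L_fixed[of i] by (simp add: nc_antisubst_hom cong_def)
      next
        case (3 i j)
        then show ?thesis
          using L_L[of "diagram_aut j" "diagram_aut i"] by (simp add: nc_antisubst_hom cong_def)
      next
        case (4 i j)
        have w: "ik_wt (diagram_aut i) j = - ik_wt i j" by (simp add: ik_wt_def)
        have "ncconst (q powi ik_wt i j) * (vL (diagram_aut i) * vB j) \<bumpeq>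
            ncconst (q powi ik_wt i j) * (ncconst (q powi (- ik_wt i j)) * (vB j * vL (diagram_aut i)))"
          using L_B[of "diagram_aut i" j] unfolding w by (rule scal_cong)
        also have "\<dots> = vB j * vL (diagram_aut i)"
          using q_nz by (simp add: scal_scal power_int_minus)
        finally show ?thesis
          using 4 cong_sym unfolding cong_def
          by (simp add: nc_antisubst_hom ncconst_central[of _ "q powi ik_wt i j"] mult.assoc ncvar_scal)
      next
        case (5 i j)
        have "rho (ik_comm q i j) = ncconst (- 1) * ik_comm q i j"
          by (auto simp: ik_comm_def nc_antisubst_hom ncconst_uminus ncvar_scal right_diff_distrib left_diff_distrib)
        then show ?thesis using 5 left_mem[OF ik_mem[OF ik_relations.intros(5)]] by simp
      next
        case (6 i j)
        have "rho (ik_serre q i j) = ik_serre q i j"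
          by (auto simp: ik_serre_def nc_antisubst_hom ncvar_scal mult.assoc)
        then show ?thesis using 6 ik_mem[OF ik_relations.intros(6)] by simp
      qed
    qed
  qed
  then show ?thesis using assms by blast
qed

lemma rho_cong: "x \<bumpeq> y \<Longrightarrow> rho x \<bumpeq> rho y"
  using rho_ideal[of "x - y"] by (simp add: cong_def nc_antisubst_hom)

lemma rho_Ltor: "rho (Ltor t) \<bumpeq> Ltor (tneg t)"
proof -
  obtain a b c where t: "t = (a, b, c)" by (metis surj_pair)
  have z: "rho (zpow x y n) = zpow (rho x) (rho y) n" for x y n
    by (rule zpow_antihom) (simp_all add: nc_antisubst_hom)
  have "rho (Ltor t) = zpow (vL \<alpha>\<^sub>3) (vL \<alpha>\<^sub>5) (- b) * zpow (vL \<alpha>\<^sub>1) (vL \<alpha>\<^sub>6) (- a)"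
    by (simp add: Ltor_def t nc_antisubst_hom z zpow_swap)
  also have "\<dots> \<bumpeq> zpow (vL \<alpha>\<^sub>1) (vL \<alpha>\<^sub>6) (- a) * zpow (vL \<alpha>\<^sub>3) (vL \<alpha>\<^sub>5) (- b)"
    by (rule zpow_zpow_commute) (intro L_16 L_L)+
  also have "\<dots> = Ltor (tneg t)" by (simp add: Ltor_def t)
  finally show ?thesis .
qed

end

text \<open>The anti-involution on the level of expressions; it allows the table of the inverse to
  be obtained from the same expressions as that of tau.\<close>

fun rev_ex :: "ex \<Rightarrow> ex" where
  "rev_ex (Lt x) = Lt x"
| "rev_ex (Tr t) = Tr (tneg t)"
| "rev_ex (Sc c) = Sc c"
| "rev_ex (Add a b) = Add (rev_ex a) (rev_ex b)"
| "rev_ex (Sub a b) = Sub (rev_ex a) (rev_ex b)"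
| "rev_ex (Mul a b) = Mul (rev_ex b) (rev_ex a)"
| "rev_ex (Qc c a b) = Qc c (rev_ex b) (rev_ex a)"

context ik
begin

lemma rho_letter: "rho (letter l) = letter l"
  using node_cases[of l] by (auto simp: letter_node letter_other nc_antisubst_hom ncvar_scal)

lemma rho_ev: "rho (M.ev e) \<bumpeq> M.ev (rev_ex e)"
proof (induction e)
  case (Tr t)
  then show ?case by (simp add: rho_Ltor)
next
  case (Qc c a b)
  then show ?case
    by (simp add: nc_antisubst_hom ncconst_central[of _ "evl c"]) (intro cong_diff cong_mult_left cong_mult; assumption)
qed (simp_all add: nc_antisubst_hom rho_letter cong_add cong_diff cong_mult)

end

subsection \<open>The operators\<close>

text \<open>The action of s_1 s_6, s_3 s_5, s_4 and s_2 on the exponents of K_1 K_6^-1 and K_3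
  K_5^-1, confirmed by \<open>tor_vec_tau\<close>.\<close>

fun tau_mat :: "f4 \<Rightarrow> tor \<times> tor \<times> tor" where
  "tau_mat \<sigma>\<^sub>1 = ((- 1, 0, 0), (1, 1, 0), (0, 0, 1))"
| "tau_mat \<sigma>\<^sub>2 = ((1, 1, 0), (0, - 1, 0), (0, 0, 1))"
| "tau_mat \<sigma>\<^sub>3 = ((1, 0, 0), (0, 1, 0), (0, 0, 1))"
| "tau_mat \<sigma>\<^sub>4 = ((1, 0, 0), (0, 1, 0), (0, 0, 1))"

text \<open>The pair \<open>(n, e)\<close> means that \<open>e\<close> is \<open>h\<^sup>n\<close> times the image of \<open>h B\<^sub>j\<close>.\<close>

fun tau_ex :: "f4 \<Rightarrow> e6 \<Rightarrow> nat \<times> ex" where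
  "tau_ex \<sigma>\<^sub>1 \<alpha>\<^sub>1 = (0, Mul (Sc [(2, 1)]) (Mul (Tr (- 1, 0, 0)) (Lt 6)))"
| "tau_ex \<sigma>\<^sub>1 \<alpha>\<^sub>3 = (1, Mul (Sc [(- 1, 1)]) (Qc [(2, 1)] (Lt 3) (Lt 1)))"
| "tau_ex \<sigma>\<^sub>1 \<alpha>\<^sub>5 = (1, Mul (Sc [(- 1, 1)]) (Qc [(2, 1)] (Lt 5) (Lt 6)))"
| "tau_ex \<sigma>\<^sub>1 \<alpha>\<^sub>6 = (0, Mul (Sc [(2, 1)]) (Mul (Tr (1, 0, 0)) (Lt 1)))"
| "tau_ex \<sigma>\<^sub>2 \<alpha>\<^sub>1 = (1, Mul (Sc [(- 1, 1)]) (Qc [(2, 1)] (Lt 1) (Lt 3)))"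
| "tau_ex \<sigma>\<^sub>2 \<alpha>\<^sub>3 = (0, Mul (Sc [(2, 1)]) (Mul (Tr (0, - 1, 0)) (Lt 5)))"
| "tau_ex \<sigma>\<^sub>2 \<alpha>\<^sub>4 = (2, Add (Mul (Sc [(- 2, 1)]) (Qc [(2, 1)] (Qc [(2, 1)] (Lt 4) (Lt 3)) (Lt 5)))
     (Mul (Mul (Sc (lmul hl hl)) (Lt 4)) (Tr (0, 1, 0))))"
| "tau_ex \<sigma>\<^sub>2 \<alpha>\<^sub>5 = (0, Mul (Sc [(2, 1)]) (Mul (Tr (0, 1, 0)) (Lt 3)))"
| "tau_ex \<sigma>\<^sub>2 \<alpha>\<^sub>6 = (1, Mul (Sc [(- 1, 1)]) (Qc [(2, 1)] (Lt 6) (Lt 5)))"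
| "tau_ex \<sigma>\<^sub>3 \<alpha>\<^sub>2 = (1, Qc [(2, 1)] (Lt 2) (Lt 4))"
| "tau_ex \<sigma>\<^sub>3 \<alpha>\<^sub>3 = (1, Qc [(2, 1)] (Lt 3) (Lt 4))"
| "tau_ex \<sigma>\<^sub>3 \<alpha>\<^sub>5 = (1, Qc [(2, 1)] (Lt 5) (Lt 4))"
| "tau_ex \<sigma>\<^sub>4 \<alpha>\<^sub>4 = (1, Qc [(2, 1)] (Lt 4) (Lt 2))"
| "tau_ex \<sigma> j = (0, Lt (node_no j))"

text \<open>The parameter g is the identity for tau and reversal for its inverse. The matrix is the
  same for both, being an involution that commutes with negation.\<close>

definition ex_tab :: "(nat \<times> ex \<Rightarrow> nat \<times> ex) \<Rightarrow> f4 \<Rightarrow> hom_table" where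
  "ex_tab g \<sigma> = (map (\<lambda>j. (node_no j, case g (tau_ex \<sigma> j) of (n, e) \<Rightarrow> hadd_deg n (nrm ik_wts [] id_hom e)))
     e6_nodes, tau_mat \<sigma>)"

definition tau_tab :: "f4 \<Rightarrow> hom_table" where
  "tau_tab = ex_tab (\<lambda>x. x)"

definition inv_tab :: "f4 \<Rightarrow> hom_table" where
  "inv_tab = ex_tab (map_prod (\<lambda>n. n) rev_ex)"

abbreviation qcom :: "'k::field \<Rightarrow> ('k, ik_gen) ncpoly \<Rightarrow> ('k, ik_gen) ncpoly \<Rightarrow> ('k, ik_gen) ncpoly" where
  "qcom q x y \<equiv> x * y - ncconst q * (y * x)"

fun tau_img :: "'k::field \<Rightarrow> 'k \<Rightarrow> f4 \<Rightarrow> e6 \<Rightarrow> ('k, ik_gen) ncpoly" where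
  "tau_img q r \<sigma>\<^sub>1 \<alpha>\<^sub>1 = ncconst q * (vL \<alpha>\<^sub>6 * vB \<alpha>\<^sub>6)"
| "tau_img q r \<sigma>\<^sub>1 \<alpha>\<^sub>3 = ncconst (inverse r) * qcom q (vB \<alpha>\<^sub>3) (vB \<alpha>\<^sub>1)"
| "tau_img q r \<sigma>\<^sub>1 \<alpha>\<^sub>5 = ncconst (inverse r) * qcom q (vB \<alpha>\<^sub>5) (vB \<alpha>\<^sub>6)"
| "tau_img q r \<sigma>\<^sub>1 \<alpha>\<^sub>6 = ncconst q * (vL \<alpha>\<^sub>1 * vB \<alpha>\<^sub>1)"
| "tau_img q r \<sigma>\<^sub>2 \<alpha>\<^sub>1 = ncconst (inverse r) * qcom q (vB \<alpha>\<^sub>1) (vB \<alpha>\<^sub>3)"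
| "tau_img q r \<sigma>\<^sub>2 \<alpha>\<^sub>3 = ncconst q * (vL \<alpha>\<^sub>5 * vB \<alpha>\<^sub>5)"
| "tau_img q r \<sigma>\<^sub>2 \<alpha>\<^sub>4 = ncconst (inverse q) * qcom q (qcom q (vB \<alpha>\<^sub>4) (vB \<alpha>\<^sub>3)) (vB \<alpha>\<^sub>5) + vB \<alpha>\<^sub>4 * vL \<alpha>\<^sub>3"
| "tau_img q r \<sigma>\<^sub>2 \<alpha>\<^sub>5 = ncconst q * (vL \<alpha>\<^sub>3 * vB \<alpha>\<^sub>3)"
| "tau_img q r \<sigma>\<^sub>2 \<alpha>\<^sub>6 = ncconst (inverse r) * qcom q (vB \<alpha>\<^sub>6) (vB \<alpha>\<^sub>5)"
| "tau_img q r \<sigma>\<^sub>3 \<alpha>\<^sub>2 = qcom q (vB \<alpha>\<^sub>2) (vB \<alpha>\<^sub>4)"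
| "tau_img q r \<sigma>\<^sub>3 \<alpha>\<^sub>3 = qcom q (vB \<alpha>\<^sub>3) (vB \<alpha>\<^sub>4)"
| "tau_img q r \<sigma>\<^sub>3 \<alpha>\<^sub>5 = qcom q (vB \<alpha>\<^sub>5) (vB \<alpha>\<^sub>4)"
| "tau_img q r \<sigma>\<^sub>4 \<alpha>\<^sub>4 = qcom q (vB \<alpha>\<^sub>4) (vB \<alpha>\<^sub>2)"
| "tau_img q r \<sigma> j = vB j"

context ik
begin

fun tau_gen :: "f4 \<Rightarrow> ik_gen \<Rightarrow> ('k, ik_gen) ncpoly" where
  "tau_gen \<sigma> (GB j) = tau_img q r \<sigma> j"
| "tau_gen \<sigma> (GL i) = Ltor (tmap (tau_mat \<sigma>) (tor_of i))"

definition tau_hat :: "f4 \<Rightarrow> ('k, ik_gen) ncpoly \<Rightarrow> ('k, ik_gen) ncpoly" where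
  "tau_hat \<sigma> = nc_subst (tau_gen \<sigma>)"

lemmas tau_hat_hom = nc_subst_hom[of "tau_gen \<sigma>" for \<sigma>, folded tau_hat_def]
  nc_subst_const[of "tau_gen \<sigma>" for \<sigma>, folded tau_hat_def]

lemma evl_units: "evl [(0, 1)] = 1" "evl [(2, 1)] = q" "evl [(- 1, 1)] = inverse r" "evl [(- 2, 1)] = inverse q"
  using r_powi_two[of 1] r_powi_two[of "- 1"] by simp_all

lemma tau_img_ev: "ncconst (h ^ fst (tau_ex \<sigma> j)) * (ncconst h * tau_img q r \<sigma> j) = M.ev (snd (tau_ex \<sigma> j))"
  by (cases \<sigma>; cases j)
    (simp_all add: letter_simps evl_units evl_lmul evl_hl Ltor_simps power2_eq_square scal_simps del: evl_Cons)

lemma hom_sound_ex_tab: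
  assumes hom: "\<And>x y. f (x + y) = f x + f y" "\<And>x y. f (x * y) = f x * f y" "\<And>c. f (ncconst c) = ncconst c"
    and B: "\<And>j. (case g (tau_ex \<sigma> j) of (n, e) \<Rightarrow> ncconst (h ^ n) * f (letter (node_no j)) \<bumpeq> M.ev e)"
    and L: "\<And>t. f (Ltor t) \<bumpeq> Ltor (tmap (tau_mat \<sigma>) t)"
  shows "M.hom_sound f (ex_tab g \<sigma>)"
proof -
  have f0: "f 0 = 0" using hom(1)[of 0 0] by simp
  have node: "nrm ik_wts [] (ex_tab g \<sigma>) (Lt (node_no j)) =
      (case g (tau_ex \<sigma> j) of (n, e) \<Rightarrow> hadd_deg n (nrm ik_wts [] id_hom e))" for j
    by (cases j) (simp_all add: ex_tab_def e6_nodes_def M.nrm_Lt)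
  have other: "nrm ik_wts [] (ex_tab g \<sigma>) (Lt l) = (0, [(([l], 0, 0, 0), [(0, 1)])])" if "l \<notin> {1, 2, 3, 4, 5, 6}" for l
    using that by (simp add: ex_tab_def e6_nodes_def M.nrm_Lt)
  have "ncconst (h ^ fst (nrm ik_wts [] (ex_tab g \<sigma>) (Lt l))) * f (letter l) \<bumpeq> M.evp (snd (nrm ik_wts [] (ex_tab g \<sigma>) (Lt l)))" for l
  proof (cases "\<exists>j. l = node_no j")
    case True
    then obtain j where j: "l = node_no j" by blast
    obtain n e where ne: "g (tau_ex \<sigma> j) = (n, e)" by fastforce
    obtain m p where mp: "nrm ik_wts [] id_hom e = (m, p)" by fastforce
    have "ncconst (h ^ m) * M.ev e \<bumpeq> M.evp p"
      using M.represents_nrm[OF _ M.hom_sound_id, of "[]" e] by (simp add: M.sound_table_def M.represents_def mp)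
    moreover have "ncconst (h ^ m) * (ncconst (h ^ n) * f (letter l)) \<bumpeq> ncconst (h ^ m) * M.ev e"
      using B[of j] ne j by (intro scal_cong) simp
    ultimately have "ncconst (h ^ m) * (ncconst (h ^ n) * f (letter l)) \<bumpeq> M.evp p"
      by (blast intro: cong_trans)
    then show ?thesis by (simp add: j node ne mp scal_scal power_add mult.commute)
  next
    case False
    then show ?thesis using node_cases[of l] by (auto simp: other letter_other f0 M.evm_def)
  qed
  then show ?thesis using L hom unfolding M.hom_sound_def by (simp add: ex_tab_def)
qed

lemma tau_hat_Ltor: "tau_hat \<sigma> (Ltor t) \<bumpeq> Ltor (tmap (tau_mat \<sigma>) t)"
proof -
  have "\<exists>u v. tau_mat \<sigma> = (u, v, 0, 0, 1) \<and> snd (snd u) = 0 \<and> snd (snd v) = 0"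
    by (cases \<sigma>) simp_all
  then obtain u v where uv: "tau_mat \<sigma> = (u, v, 0, 0, 1)" "snd (snd u) = 0" "snd (snd v) = 0" by blast
  show ?thesis
    unfolding uv(1) by (rule torus_hom) (simp_all add: tau_hat_def nc_subst_hom uv)
qed

lemma tau_hat_sound: "M.hom_sound (tau_hat \<sigma>) (tau_tab \<sigma>)"
  unfolding tau_tab_def
  by (rule hom_sound_ex_tab)
    (simp_all add: tau_hat_hom tau_hat_Ltor letter_node case_prod_unfold tau_img_ev[symmetric], simp add: tau_hat_def)

end

section \<open>Evaluation of the inverses and of the braid relations\<close>

fun tab_word :: "rule_table \<Rightarrow> f4 list \<Rightarrow> hom_table" where
  "tab_word tb [] = id_hom"
| "tab_word tb (s # w) = foldl (\<lambda>H s. hcomp ik_wts tb ik_letters6 H (tau_tab s)) (tau_tab s) w"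

definition ik_table :: rule_table where
  "ik_table = mk_table ik_letters6 ik_all_rules"

definition braid_ok :: "rule_table \<Rightarrow> f4 list \<Rightarrow> f4 list \<Rightarrow> bool" where
  "braid_ok tb v w \<longleftrightarrow> hom_eq ik_wts ik_letters6 (tab_word tb v) (tab_word tb w)"

definition inv_ok :: "rule_table \<Rightarrow> f4 \<Rightarrow> bool" where
  "inv_ok tb s \<longleftrightarrow> hom_eq ik_wts ik_letters6 (hcomp ik_wts tb ik_letters6 (inv_tab s) (tau_tab s)) id_hom"

lemma tau_wts_ok: "wts_ok (tau_tab \<sigma>)"
proof -
  have "list_all (\<lambda>\<sigma>. wts_ok (tau_tab \<sigma>)) [\<sigma>\<^sub>1, \<sigma>\<^sub>2, \<sigma>\<^sub>3, \<sigma>\<^sub>4]" by code_simp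
  then show ?thesis by (cases \<sigma>) simp_all
qed

lemma tau_vanishes:
  "vanishes ik_wts ik_letters6 ik_all_rules (tau_tab \<sigma>) ik_exs"
proof -
  have "vanishes ik_wts ik_letters6 ik_all_rules (tau_tab \<sigma>\<^sub>1) ik_exs" by code_simp
  moreover have "vanishes ik_wts ik_letters6 ik_all_rules (tau_tab \<sigma>\<^sub>2) ik_exs" by code_simp
  moreover have "vanishes ik_wts ik_letters6 ik_all_rules (tau_tab \<sigma>\<^sub>3) ik_exs" by code_simp
  moreover have "vanishes ik_wts ik_letters6 ik_all_rules (tau_tab \<sigma>\<^sub>4) ik_exs" by code_simp
  ultimately show ?thesis by (cases \<sigma>) simp_all
qed

lemma tau_inv_ok: "inv_ok ik_table \<sigma>"
proof -
  have "inv_ok ik_table \<sigma>\<^sub>1" by code_simp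
  moreover have "inv_ok ik_table \<sigma>\<^sub>2" by code_simp
  moreover have "inv_ok ik_table \<sigma>\<^sub>3" by code_simp
  moreover have "inv_ok ik_table \<sigma>\<^sub>4" by code_simp
  ultimately show ?thesis by (cases \<sigma>) simp_all
qed

lemma braid_ok:
  "braid_ok ik_table [\<sigma>\<^sub>1, \<sigma>\<^sub>2, \<sigma>\<^sub>1] [\<sigma>\<^sub>2, \<sigma>\<^sub>1, \<sigma>\<^sub>2]"
  "braid_ok ik_table [\<sigma>\<^sub>2, \<sigma>\<^sub>3, \<sigma>\<^sub>2, \<sigma>\<^sub>3] [\<sigma>\<^sub>3, \<sigma>\<^sub>2, \<sigma>\<^sub>3, \<sigma>\<^sub>2]"
  "braid_ok ik_table [\<sigma>\<^sub>3, \<sigma>\<^sub>4, \<sigma>\<^sub>3] [\<sigma>\<^sub>4, \<sigma>\<^sub>3, \<sigma>\<^sub>4]"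
  "braid_ok ik_table [\<sigma>\<^sub>1, \<sigma>\<^sub>3] [\<sigma>\<^sub>3, \<sigma>\<^sub>1]"
  "braid_ok ik_table [\<sigma>\<^sub>1, \<sigma>\<^sub>4] [\<sigma>\<^sub>4, \<sigma>\<^sub>1]"
  "braid_ok ik_table [\<sigma>\<^sub>2, \<sigma>\<^sub>4] [\<sigma>\<^sub>4, \<sigma>\<^sub>2]"
  by code_simp+

section \<open>From tables to congruences in the presented algebra\<close>

context ik
begin

lemma tau_hat_ik_hom: "ik_hom (tau_hat \<sigma>)"
proof (rule ik_hom_intro[OF tau_hat_sound _ tau_wts_ok tau_vanishes])
  show "tau_hat \<sigma> (vL i) \<bumpeq> Ltor (tmap (snd (tau_tab \<sigma>)) (tor_of i))" for i
    by (simp add: tau_hat_def tau_tab_def ex_tab_def)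
qed

definition tau_inv :: "f4 \<Rightarrow> ('k, ik_gen) ncpoly \<Rightarrow> ('k, ik_gen) ncpoly" where
  "tau_inv \<sigma> x = rho (tau_hat \<sigma> (rho x))"

lemma tau_inv_ik_hom: "ik_hom (tau_inv \<sigma>)"
  unfolding ik_hom_def tau_inv_def
  using rho_cong ik_homD(4)[OF tau_hat_ik_hom] by (auto simp: nc_antisubst_hom tau_hat_hom)

lemma tau_inv_sound: "M.hom_sound (tau_inv \<sigma>) (inv_tab \<sigma>)"
  unfolding inv_tab_def
proof (rule hom_sound_ex_tab)
  fix j
  have "ncconst (h ^ fst (tau_ex \<sigma> j)) * tau_inv \<sigma> (letter (node_no j)) = rho (M.ev (snd (tau_ex \<sigma> j)))"
    unfolding tau_img_ev[symmetric] tau_inv_def rho_letter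
    by (simp add: tau_hat_def nc_subst_hom letter_node nc_antisubst_hom ncconst_central[of _ "h ^ _"])
  then show "case map_prod (\<lambda>n. n) rev_ex (tau_ex \<sigma> j) of (n, e) \<Rightarrow>
      ncconst (h ^ n) * tau_inv \<sigma> (letter (node_no j)) \<bumpeq> M.ev e"
    using rho_ev[of "snd (tau_ex \<sigma> j)"] by (simp add: case_prod_unfold)
next
  fix t
  have "tau_inv \<sigma> (Ltor t) \<bumpeq> rho (tau_hat \<sigma> (Ltor (tneg t)))"
    unfolding tau_inv_def by (intro rho_cong ik_homD(4)[OF tau_hat_ik_hom] rho_Ltor)
  also have "\<dots> \<bumpeq> rho (Ltor (tmap (tau_mat \<sigma>) (tneg t)))" by (intro rho_cong tau_hat_Ltor)
  also have "\<dots> \<bumpeq> Ltor (tneg (tmap (tau_mat \<sigma>) (tneg t)))" by (rule rho_Ltor)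
  finally show "tau_inv \<sigma> (Ltor t) \<bumpeq> Ltor (tmap (tau_mat \<sigma>) t)" by (simp only: tneg_tmap)
qed (simp_all add: ik_homD[OF tau_inv_ik_hom])

lemma ik_table_sound: "M.sound_table ik_table"
  unfolding ik_table_def by (rule M.sound_mk_table[OF ik_rules_sound])

lemma hcomp_sound:
  assumes "M.hom_sound f H" "M.hom_sound g G" "ik_hom f" "ik_hom g"
  shows "M.hom_sound (\<lambda>x. f (g x)) (hcomp ik_wts ik_table ik_letters6 H G)"
proof (rule M.hom_sound_hcomp[OF ik_table_sound assms(1,2) ik_homD(4)[OF assms(3)]])
  show "x \<notin> set ik_letters6 \<Longrightarrow> f (g (letter x)) \<bumpeq> letter x" for x
    using assms(3,4) by (simp add: ik_letters6_def letter_other ik_homD)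
qed

lemma hom_eq_agree:
  assumes "M.hom_sound f H" "M.hom_sound g G" "ik_hom f" "ik_hom g" "hom_eq ik_wts ik_letters6 H G"
  shows "f x \<bumpeq> g x"
proof (rule ik_hom_agree[OF assms(3,4)])
  fix i
  have "node_no i \<in> set ik_letters6" by (cases i) (simp_all add: ik_letters6_def)
  then show "f (letter (node_no i)) \<bumpeq> g (letter (node_no i))"
    by (rule M.hom_eq_sound(1)[OF assms(1,2,5)])
qed (rule M.hom_eq_sound(2)[OF assms(1,2,5)])

lemma tau_inv_tau: "tau_inv \<sigma> (tau_hat \<sigma> x) \<bumpeq> x"
proof (rule hom_eq_agree[OF hcomp_sound[OF tau_inv_sound tau_hat_sound tau_inv_ik_hom tau_hat_ik_hom] M.hom_sound_id])
  show "ik_hom (\<lambda>x. tau_inv \<sigma> (tau_hat \<sigma> x))" by (rule ik_hom_comp[OF tau_inv_ik_hom tau_hat_ik_hom])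
  show "ik_hom (\<lambda>x. x)" by (simp add: ik_hom_def)
qed (use tau_inv_ok in \<open>simp add: inv_ok_def\<close>)

text \<open>Conjugating \<open>tau_inv_tau\<close> by the involution \<open>rho\<close> exchanges
  the two factors.\<close>

lemma tau_tau_inv: "tau_hat \<sigma> (tau_inv \<sigma> x) \<bumpeq> x"
proof -
  have "rho (tau_inv \<sigma> (tau_hat \<sigma> (rho x))) \<bumpeq> rho (rho x)" by (intro rho_cong tau_inv_tau)
  then show ?thesis by (simp add: tau_inv_def rho_rho)
qed

definition tau_word :: "f4 list \<Rightarrow> ('k, ik_gen) ncpoly \<Rightarrow> ('k, ik_gen) ncpoly" where
  "tau_word w = foldr tau_hat w"

lemma tau_word_ik_hom: "ik_hom (tau_word w)"
proof (induction w)
  case (Cons s w)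
  then show ?case using ik_hom_comp[OF tau_hat_ik_hom Cons] by (simp add: tau_word_def comp_def)
qed (simp add: tau_word_def ik_hom_def)

lemma tab_word_sound: "M.hom_sound (tau_word w) (tab_word ik_table w)"
proof (cases w)
  case Nil
  then show ?thesis using M.hom_sound_id by (simp add: tau_word_def id_def)
next
  case (Cons s v)
  have "M.hom_sound (tau_word (s # v)) (tab_word ik_table (s # v))"
  proof (induction v rule: rev_induct)
    case Nil
    then show ?case using tau_hat_sound by (simp add: tau_word_def)
  next
    case (snoc t v)
    have "tau_word (s # v @ [t]) = (\<lambda>x. tau_word (s # v) (tau_hat t x))"
      by (simp add: tau_word_def fun_eq_iff)
    then show ?case
      using hcomp_sound[OF snoc tau_hat_sound tau_word_ik_hom tau_hat_ik_hom, of t] by simp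
  qed
  then show ?thesis using Cons by simp
qed

lemma braid_agree: "braid_ok ik_table v w \<Longrightarrow> tau_word v x \<bumpeq> tau_word w x"
  by (rule hom_eq_agree[OF tab_word_sound tab_word_sound tau_word_ik_hom tau_word_ik_hom]) (simp add: braid_ok_def)

end

section \<open>Groups given by generators and relations\<close>

lemma pres_class_eq_iff: "pres_class R u = pres_class R v \<longleftrightarrow> pres_cong R u v"
proof
  assume "pres_class R u = pres_class R v"
  moreover have "v \<in> pres_class R v" by (simp add: pres_class_def pres_cong.refl)
  ultimately show "pres_cong R u v" by (auto simp: pres_class_def)
next
  assume "pres_cong R u v"
  then show "pres_class R u = pres_class R v"
    by (auto simp: pres_class_def intro: pres_cong.trans pres_cong.sym)
qed

lemma presented_group_mult:
  "pres_class R u \<otimes>\<^bsub>presented_group R\<^esub> pres_class R v = pres_class R (u @ v)"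
proof -
  have "pres_class R (u' @ v') = pres_class R (u @ v)" if "u' \<in> pres_class R u" "v' \<in> pres_class R v" for u' v'
    using that by (simp add: pres_class_eq_iff) (simp add: pres_class_def pres_cong.append pres_cong.sym)
  moreover have "u \<in> pres_class R u" "v \<in> pres_class R v"
    by (simp_all add: pres_class_def pres_cong.refl)
  ultimately have "(\<Union>u'\<in>pres_class R u. \<Union>v'\<in>pres_class R v. pres_class R (u' @ v')) = pres_class R (u @ v)"
    by blast
  then show ?thesis by (simp add: presented_group_def)
qed

context group
begin

fun eval_word :: "('g \<Rightarrow> 'a) \<Rightarrow> ('g \<times> bool) list \<Rightarrow> 'a" where
  "eval_word \<phi> [] = \<one>"
| "eval_word \<phi> ((g, b) # w) = (if b then \<phi> g else inv (\<phi> g)) \<otimes> eval_word \<phi> w"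

lemma eval_word_closed: "(\<And>g. \<phi> g \<in> carrier G) \<Longrightarrow> eval_word \<phi> w \<in> carrier G"
  by (induction \<phi> w rule: eval_word.induct) auto

lemma eval_word_append:
  "(\<And>g. \<phi> g \<in> carrier G) \<Longrightarrow> eval_word \<phi> (u @ v) = eval_word \<phi> u \<otimes> eval_word \<phi> v"
  by (induction \<phi> u rule: eval_word.induct) (auto simp: eval_word_closed m_assoc)

lemma eval_word_cong:
  assumes "pres_cong R u v" "\<And>g. \<phi> g \<in> carrier G"
    and "\<And>u v. (u, v) \<in> R \<Longrightarrow> eval_word \<phi> u = eval_word \<phi> v"
  shows "eval_word \<phi> u = eval_word \<phi> v"
  using assms(1) by induction (simp_all add: assms eval_word_append)

text \<open>Words are evaluated in the group. The values on inverse letters are forced by the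
  cancellation rule, and extensionality makes the homomorphism unique as a function.\<close>

theorem presented_group_universal:
  assumes \<phi>: "\<And>g. \<phi> g \<in> carrier G"
    and R: "\<And>u v. (u, v) \<in> R \<Longrightarrow> eval_word \<phi> u = eval_word \<phi> v"
  shows "\<exists>!h. h \<in> hom (presented_group R) G \<inter> extensional (carrier (presented_group R)) \<and>
    (\<forall>g. h (pres_class R [(g, True)]) = \<phi> g)"
proof -
  let ?P = "presented_group R"
  have car: "carrier ?P = range (pres_class R)" by (simp add: presented_group_def)
  define h where "h = restrict (\<lambda>X. eval_word \<phi> (SOME u. u \<in> X)) (carrier ?P)"
  have h: "h (pres_class R u) = eval_word \<phi> u" for u
  proof -
    have "(SOME v. v \<in> pres_class R u) \<in> pres_class R u"
      by (rule someI[of _ u]) (simp add: pres_class_def pres_cong.refl)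
    then have "pres_cong R u (SOME v. v \<in> pres_class R u)" by (simp add: pres_class_def)
    from eval_word_cong[OF this \<phi> R] show ?thesis by (simp add: h_def car)
  qed
  show ?thesis
  proof (rule ex1I[of _ h])
    show "h \<in> hom ?P G \<inter> extensional (carrier ?P) \<and> (\<forall>g. h (pres_class R [(g, True)]) = \<phi> g)"
      using \<phi> by (auto simp: hom_def car h presented_group_mult eval_word_append eval_word_closed)
        (simp add: h_def car)
  next
    fix k assume k: "k \<in> hom ?P G \<inter> extensional (carrier ?P) \<and> (\<forall>g. k (pres_class R [(g, True)]) = \<phi> g)"
    have mult: "k (pres_class R (u @ v)) = k (pres_class R u) \<otimes> k (pres_class R v)" for u v
      using k hom_mult[of k ?P G "pres_class R u" "pres_class R v"] by (simp add: car presented_group_mult)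
    have closed: "k (pres_class R u) \<in> carrier G" for u
      using k by (auto simp: hom_def car)
    have one: "k (pres_class R []) = \<one>"
      using mult[of "[]" "[]"] closed[of "[]"] by simp
    have inv: "k (pres_class R [(g, False)]) = inv (\<phi> g)" for g
    proof -
      have "pres_class R ([(g, True)] @ [(g, False)]) = pres_class R []"
        "pres_class R ([(g, False)] @ [(g, True)]) = pres_class R []"
        using pres_cong.cancel[of R g True] pres_cong.cancel[of R g False] by (simp_all add: pres_class_eq_iff)
      then have "k (pres_class R [(g, False)]) \<otimes> \<phi> g = \<one>"
        using mult[of "[(g, False)]" "[(g, True)]"] one k by simp
      then show ?thesis using inv_equality[OF _ \<phi> closed] by simp
    qed
    have "k (pres_class R u) = eval_word \<phi> u" for u
    proof (induction u)
      case (Cons x u)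
      obtain g b where x: "x = (g, b)" by (cases x)
      have "k (pres_class R (x # u)) = k (pres_class R [x]) \<otimes> k (pres_class R u)"
        using mult[of "[x]" u] by simp
      then show ?case using Cons k inv x by (cases b) simp_all
    qed (simp add: one)
    then show "k = h"
      using k by (intro extensionalityI[of k "carrier ?P" h]) (auto simp: car h, simp add: h_def car)
  qed
qed

end

section \<open>The group of algebra automorphisms\<close>

context nc_quotient
begin

lemma closed: "x \<in> carrier A \<Longrightarrow> y \<in> carrier A \<Longrightarrow> x \<otimes>\<^bsub>A\<^esub> y \<in> carrier A"
  "x \<in> carrier A \<Longrightarrow> y \<in> carrier A \<Longrightarrow> x \<oplus>\<^bsub>A\<^esub> y \<in> carrier A"
  "\<one>\<^bsub>A\<^esub> \<in> carrier A" "x \<in> carrier A \<Longrightarrow> c \<odot>\<^bsub>A\<^esub> x \<in> carrier A"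
  by (auto simp: carrier mult[symmetric] add[symmetric] one[symmetric] smult[symmetric])

lemma algebra_autsD:
  assumes "t \<in> algebra_auts A"
  shows "t \<in> Bij (carrier A)" "x \<in> carrier A \<Longrightarrow> t x \<in> carrier A" "t \<one>\<^bsub>A\<^esub> = \<one>\<^bsub>A\<^esub>"
    "x \<in> carrier A \<Longrightarrow> y \<in> carrier A \<Longrightarrow> t (x \<otimes>\<^bsub>A\<^esub> y) = t x \<otimes>\<^bsub>A\<^esub> t y"
    "x \<in> carrier A \<Longrightarrow> y \<in> carrier A \<Longrightarrow> t (x \<oplus>\<^bsub>A\<^esub> y) = t x \<oplus>\<^bsub>A\<^esub> t y"
    "x \<in> carrier A \<Longrightarrow> t (c \<odot>\<^bsub>A\<^esub> x) = c \<odot>\<^bsub>A\<^esub> t x"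
  using assms by (auto simp: algebra_auts_def ring_hom_def)

lemma algebra_autsI:
  assumes "t \<in> Bij (carrier A)" "t \<one>\<^bsub>A\<^esub> = \<one>\<^bsub>A\<^esub>"
    and "\<And>x y. x \<in> carrier A \<Longrightarrow> y \<in> carrier A \<Longrightarrow> t (x \<otimes>\<^bsub>A\<^esub> y) = t x \<otimes>\<^bsub>A\<^esub> t y"
    and "\<And>x y. x \<in> carrier A \<Longrightarrow> y \<in> carrier A \<Longrightarrow> t (x \<oplus>\<^bsub>A\<^esub> y) = t x \<oplus>\<^bsub>A\<^esub> t y"
    and "\<And>c x. x \<in> carrier A \<Longrightarrow> t (c \<odot>\<^bsub>A\<^esub> x) = c \<odot>\<^bsub>A\<^esub> t x"
  shows "t \<in> algebra_auts A"
  using assms Bij_imp_funcset[OF assms(1)] by (auto simp: algebra_auts_def intro!: ring_hom_memI)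

lemma Aut_alg_group: "group (Aut_alg A)"
proof -
  let ?S = "carrier A"
  interpret BG: group "BijGroup ?S" by (rule group_BijGroup)
  have "subgroup (algebra_auts A) (BijGroup ?S)"
  proof (rule BG.subgroupI)
    show "algebra_auts A \<subseteq> carrier (BijGroup ?S)" by (auto simp: algebra_auts_def BijGroup_def)
    have "\<exists>t\<in>algebra_auts A. \<forall>x. t (\<pi> x) = \<pi> x"
      by (rule ex_aut[of "\<lambda>x. x" "\<lambda>x. x"]) (simp_all add: zero_mem)
    then show "algebra_auts A \<noteq> {}" by blast
  next
    fix t assume t: "t \<in> algebra_auts A"
    note D = algebra_autsD[OF t]
    let ?s = "\<lambda>x\<in>?S. inv_into ?S t x"
    have s: "?s x \<in> ?S" "t (?s x) = x" if "x \<in> ?S" for x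
      using that D(1) Bij_inv_into_mem[OF D(1) that] by (auto simp: Bij_def bij_betw_def f_inv_into_f)
    have eq: "?s x = y" if "x \<in> ?S" "y \<in> ?S" "x = t y" for x y
      using that D(1) by (auto simp: Bij_def bij_betw_def)
    have "?s \<in> algebra_auts A"
      by (rule algebra_autsI[OF restrict_inv_into_Bij[OF D(1)]]; rule eq; simp only: closed s D)
    then show "inv\<^bsub>BijGroup ?S\<^esub> t \<in> algebra_auts A" by (simp only: inv_BijGroup[OF D(1)])
  next
    fix t u assume t: "t \<in> algebra_auts A" and u: "u \<in> algebra_auts A"
    note T = algebra_autsD[OF t] and U = algebra_autsD[OF u]
    have "compose ?S t u \<in> algebra_auts A"
      by (rule algebra_autsI[OF compose_Bij[OF T(1) U(1)]]) (simp_all add: compose_eq closed T U)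
    then show "t \<otimes>\<^bsub>BijGroup ?S\<^esub> u \<in> algebra_auts A" by (simp add: BijGroup_def T(1) U(1))
  qed
  then show ?thesis unfolding Aut_alg_def by (rule subgroup.subgroup_is_group) (rule group_BijGroup)
qed

lemma Aut_alg_simps:
  "carrier (Aut_alg A) = algebra_auts A" "\<one>\<^bsub>Aut_alg A\<^esub> (\<pi> x) = \<pi> x"
  "t \<in> algebra_auts A \<Longrightarrow> u \<in> algebra_auts A \<Longrightarrow> (t \<otimes>\<^bsub>Aut_alg A\<^esub> u) (\<pi> x) = t (u (\<pi> x))"
  by (simp_all add: Aut_alg_def BijGroup_def carrier algebra_autsD(1)[simplified carrier] compose_eq)

end

section \<open>The action of the Lusztig automorphisms on the torus\<close>

text \<open>The simple reflection s_i in coordinates with respect to the simple roots; f is the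
  exponent vector of a product of powers of the K_j.\<close>

definition reflect :: "e6 \<Rightarrow> (e6 \<Rightarrow> int) \<Rightarrow> e6 \<Rightarrow> int" where
  "reflect i f m = f m - (if m = i then \<Sum>j\<leftarrow>e6_nodes. cartan i j * f j else 0)"

fun tau_reflect :: "f4 \<Rightarrow> (e6 \<Rightarrow> int) \<Rightarrow> e6 \<Rightarrow> int" where
  "tau_reflect \<sigma>\<^sub>1 f = reflect \<alpha>\<^sub>1 (reflect \<alpha>\<^sub>6 f)"
| "tau_reflect \<sigma>\<^sub>2 f = reflect \<alpha>\<^sub>3 (reflect \<alpha>\<^sub>5 f)"
| "tau_reflect \<sigma>\<^sub>3 f = reflect \<alpha>\<^sub>4 f"
| "tau_reflect \<sigma>\<^sub>4 f = reflect \<alpha>\<^sub>2 f"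

text \<open>The exponents of K_1^a K_6^-a K_3^b K_5^-b, which place the torus of the subalgebra in
  the root lattice.\<close>

fun tor_vec :: "tor \<Rightarrow> e6 \<Rightarrow> int" where
  "tor_vec (a, b, c) \<alpha>\<^sub>1 = a"
| "tor_vec (a, b, c) \<alpha>\<^sub>3 = b"
| "tor_vec (a, b, c) \<alpha>\<^sub>5 = - b"
| "tor_vec (a, b, c) \<alpha>\<^sub>6 = - a"
| "tor_vec (a, b, c) _ = 0"

lemma tor_vec_tau: "tor_vec (tmap (tau_mat \<sigma>) t) = tau_reflect \<sigma> (tor_vec t)"
proof
  fix m
  obtain a b c where "t = (a, b, c)" by (metis surj_pair)
  then show "tor_vec (tmap (tau_mat \<sigma>) t) m = tau_reflect \<sigma> (tor_vec t) m"
    by (cases \<sigma>; cases m) (simp_all add: reflect_def e6_nodes_def cartan_def e6_edges_def)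
qed

context uq
begin

definition Kpr :: "(e6 \<Rightarrow> int) \<Rightarrow> ('k, uq_gen) ncpoly" where
  "Kpr f = prod_list (map (\<lambda>i. Kp i (f i)) e6_nodes)"

lemma Kpr_mult: "Kpr f * Kpr g \<bumpeq> Kpr (\<lambda>i. f i + g i)"
proof -
  let ?P = "\<lambda>l f. prod_list (map (\<lambda>i. Kp i (f i)) l)"
  have com: "?P l f * Kp j n \<bumpeq> Kp j n * ?P l f" for l f j n
  proof (induction l)
    case (Cons i l)
    have "Kp i (f i) * (?P l f * Kp j n) \<bumpeq> Kp i (f i) * (Kp j n * ?P l f)"
      by (rule cong_mult_left[OF Cons])
    also have "\<dots> = Kp i (f i) * Kp j n * ?P l f" by (simp add: mult.assoc)
    also have "\<dots> \<bumpeq> Kp j n * Kp i (f i) * ?P l f"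
      by (intro cong_mult_right zpow_zpow_commute[OF K_Kinv Kinv_K K_Kinv Kinv_K K_K])
    finally show ?case by (simp add: mult.assoc)
  qed simp
  have "?P l f * ?P l g \<bumpeq> ?P l (\<lambda>i. f i + g i)" for l
  proof (induction l)
    case (Cons i l)
    have "?P (i # l) f * ?P (i # l) g = Kp i (f i) * (?P l f * Kp i (g i)) * ?P l g"
      by (simp add: mult.assoc)
    also have "\<dots> \<bumpeq> Kp i (f i) * (Kp i (g i) * ?P l f) * ?P l g"
      by (intro cong_mult_right cong_mult_left com)
    also have "\<dots> = Kp i (f i) * Kp i (g i) * (?P l f * ?P l g)" by (simp add: mult.assoc)
    also have "\<dots> \<bumpeq> Kp i (f i + g i) * ?P l (\<lambda>i. f i + g i)"
      by (intro cong_mult Cons zpow_add K_Kinv Kinv_K)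
    finally show ?case by simp
  qed simp
  then show ?thesis by (simp add: Kpr_def)
qed

lemma Kp_Kpr: "Kp j n = Kpr (\<lambda>i. if i = j then n else 0)"
  by (cases j) (simp_all add: Kpr_def e6_nodes_def)

lemma Kpr_0: "Kpr (\<lambda>i. 0) = 1"
  by (simp add: Kpr_def e6_nodes_def)

lemma T_Kpr: "T_hat q i (Kpr f) \<bumpeq> Kpr (reflect i f)"
proof -
  let ?d = "\<lambda>j m. (if m = j then f j else 0) + (if m = i then - cartan i j * f j else 0)"
  have main: "T_hat q i (prod_list (map (\<lambda>j. Kp j (f j)) l)) \<bumpeq> Kpr (\<lambda>m. \<Sum>j\<leftarrow>l. ?d j m)" for l
  proof (induction l)
    case (Cons j l)
    have "T_hat q i (Kp j (f j)) \<bumpeq> Kpr (?d j)"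
      using T_hat_Kp[of i j "f j"] Kpr_mult[of "\<lambda>m. if m = j then f j else 0" "\<lambda>m. if m = i then - cartan i j * f j else 0"]
      unfolding Kp_Kpr by (rule cong_trans)
    from cong_trans[OF cong_mult[OF this Cons] Kpr_mult] show ?case by (simp add: nc_subst_hom)
  qed (simp add: Kpr_0)
  have eq: "(\<lambda>m. \<Sum>j\<leftarrow>e6_nodes. ?d j m) = reflect i f"
  proof
    fix m show "(\<Sum>j\<leftarrow>e6_nodes. ?d j m) = reflect i f m"
      by (cases m) (simp_all add: reflect_def e6_nodes_def)
  qed
  show ?thesis using main[of e6_nodes] unfolding eq Kpr_def[of f, symmetric] .
qed

lemma lusztig_T_Kpr: "lusztig_T q i (ucls (Kpr f)) = ucls (Kpr (reflect i f))"
  using T_Kpr by (simp add: lusztig_T_cls Uq.eq_iff cong_def)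

lemma tau_torus_Kpr: "tau_torus q \<sigma> (ucls (Kpr f)) = ucls (Kpr (tau_reflect \<sigma> f))"
  by (cases \<sigma>) (simp_all add: lusztig_T_Kpr)

lemma tau_torus_hom:
  "tau_torus q \<sigma> (ucls x \<otimes>\<^bsub>Uq q\<^esub> ucls y) = tau_torus q \<sigma> (ucls x) \<otimes>\<^bsub>Uq q\<^esub> tau_torus q \<sigma> (ucls y)"
  "tau_torus q \<sigma> (ucls x \<oplus>\<^bsub>Uq q\<^esub> ucls y) = tau_torus q \<sigma> (ucls x) \<oplus>\<^bsub>Uq q\<^esub> tau_torus q \<sigma> (ucls y)"
  "tau_torus q \<sigma> (c \<odot>\<^bsub>Uq q\<^esub> ucls x) = c \<odot>\<^bsub>Uq q\<^esub> tau_torus q \<sigma> (ucls x)"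
  "tau_torus q \<sigma> \<one>\<^bsub>Uq q\<^esub> = \<one>\<^bsub>Uq q\<^esub>"
  by (cases \<sigma>; simp add: Uq.aut_simps[OF lusztig_T_aut] lusztig_T_cls)+

end

section \<open>The automorphisms of the coideal subalgebra\<close>

context ik
begin

interpretation U: uq q r
  by (rule uq_intro) (rule q_param_axioms)

definition pk :: "('k, ik_gen) ncpoly \<Rightarrow> 'k uq" where
  "pk x = U.ucls (Phi x)"

lemma pk_simps:
  "pk x \<otimes>\<^bsub>Uq q\<^esub> pk y = pk (x * y)" "pk x \<oplus>\<^bsub>Uq q\<^esub> pk y = pk (x + y)"
  "c \<odot>\<^bsub>Uq q\<^esub> pk x = pk (ncconst c * x)" "\<ominus>\<^bsub>Uq q\<^esub> pk x = pk (- x)" "\<one>\<^bsub>Uq q\<^esub> = pk 1"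
  "q_commutator (Uq q) c (pk x) (pk y) = pk (x * y - ncconst c * (y * x))"
  using U.Uq.smult[of c "Phi x"]
  by (simp_all add: pk_def nc_subst_hom U.Uq.mult[symmetric] U.Uq.add[symmetric] U.Uq.one[symmetric]
      U.uminus_cls U.q_commutator_cls)

lemma B_pk: "B q i = pk (vB i)"
proof -
  have "U.ucls x \<ominus>\<^bsub>Uq q\<^esub> U.ucls y = U.ucls (x - y)" for x y unfolding Uq_def by simp
  then show ?thesis by (simp add: B_def pk_def U.gens_cls U.Uq.mult[symmetric])
qed

lemma KK_pk: "KK q i (diagram_aut i) = pk (vL i)"
  by (simp add: KK_def pk_def U.gens_cls U.Uq.mult[symmetric])

lemmas KK_pk_simps = KK_pk[of \<alpha>\<^sub>1, simplified] KK_pk[of \<alpha>\<^sub>6, simplified] KK_pk[of \<alpha>\<^sub>3, simplified] KK_pk[of \<alpha>\<^sub>5, simplified]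

text \<open>One direction is that the relations hold in \<open>Uq\<close>, the other that the
  presentation is faithful. Hence the presented algebra is the coideal subalgebra.\<close>

lemma pk_eq_iff: "pk x = pk y \<longleftrightarrow> x \<bumpeq> y"
  using U.Phi_ideal[of "x - y"] Phi_kernel[of "x - y"]
  by (auto simp: pk_def U.Uq.eq_iff cong_def nc_subst_hom)

lemma pk_carrier: "pk x \<in> carrier (Uq q)"
  by (simp add: pk_def U.Uq.carrier)

lemma carrier_Uqk: "carrier (Uqk q) = range pk"
proof -
  interpret ring "Uq q" by (rule U.Uq_ring)
  let ?S = "range (B q) \<union> torus_gens q"
  have "subring (range pk) (Uq q)"
    by (rule subringI) (auto simp: pk_carrier pk_simps)
  then have "range pk \<in> subalgebras (Uq q)" by (auto simp: subalgebras_def pk_simps)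
  moreover have "?S \<subseteq> range pk" by (auto simp: B_pk torus_gens_def KK_pk_simps)
  moreover have "range pk \<subseteq> V" if V: "V \<in> subalgebras (Uq q)" "?S \<subseteq> V" for V
  proof -
    have sub: "subring V (Uq q)" and smult: "\<And>c x. x \<in> V \<Longrightarrow> c \<odot>\<^bsub>Uq q\<^esub> x \<in> V"
      using V(1) by (auto simp: subalgebras_def)
    have one: "pk 1 \<in> V" using subringE(3)[OF sub] by (simp add: pk_simps)
    have "pk x \<in> V" for x
    proof (induction x rule: ncpoly_induct)
      case (const c)
      then show ?case using smult[OF one, of c] by (simp add: pk_simps)
    next
      case (var g)
      show ?case
      proof (cases g)
        case (GB i)
        then show ?thesis using V(2) by (auto simp: B_pk)
      next
        case (GL i)
        \<comment> \<open>The nodes 2 and 4 have no counterpart among the torus generators, but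
          their \<open>GL\<close> is congruent to 1.\<close>
        have "pk (vL \<alpha>\<^sub>2) = pk 1" "pk (vL \<alpha>\<^sub>4) = pk 1"
          by (simp_all only: pk_eq_iff) (rule L_fixed, simp)+
        then show ?thesis using GL V(2) one by (cases i) (auto simp: torus_gens_def KK_pk_simps)
      qed
    next
      case (add x y)
      then show ?case using subringE(7)[OF sub] by (simp add: pk_simps[symmetric])
    next
      case (mult x y)
      then show ?case using subringE(6)[OF sub] by (simp add: pk_simps[symmetric])
    qed
    then show ?thesis by blast
  qed
  ultimately have "subalgebra_generated (Uq q) ?S = range pk"
    unfolding subalgebra_generated_def by (intro equalityI Inter_lower Inter_greatest) simp_all
  then show ?thesis by (simp add: Uqk_def)
qed

sublocale Q: nc_quotient "rel_ideal (ik_relations q)" "Uqk q" pk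
proof unfold_locales
  show "carrier (Uqk q) = range pk" by (rule carrier_Uqk)
  show "pk x = pk y \<longleftrightarrow> x - y \<in> rel_ideal (ik_relations q)" for x y
    by (simp only: pk_eq_iff cong_def)
qed (simp_all add: Uqk_def pk_simps)

lemma tau_B_pk: "tau_B q r \<sigma> j = pk (tau_img q r \<sigma> j)"
  by (cases \<sigma>; cases j) (simp_all add: B_pk KK_pk_simps pk_simps)

text \<open>The Lusztig automorphisms act by reflections on exponent vectors, so the torus condition
  on tau is checked in these coordinates.\<close>

lemma Phi_Ltor: "U.cong (Phi (Ltor t)) (U.Kpr (tor_vec t))"
proof -
  obtain a b c where t: "t = (a, b, c)" by (metis surj_pair)
  have KK: "U.cong (vK i * vKinv j) (U.Kpr (\<lambda>m. (if m = i then 1 else 0) - (if m = j then 1 else 0)))" for i j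
  proof -
    have "vK i * vKinv j = U.Kpr (\<lambda>m. if m = i then 1 else 0) * U.Kpr (\<lambda>m. if m = j then - 1 else 0)"
      by (simp add: U.Kp_Kpr[symmetric])
    also have "U.cong \<dots> (U.Kpr (\<lambda>m. (if m = i then 1 else 0) + (if m = j then - 1 else 0)))"
      by (rule U.Kpr_mult)
    also have "(\<lambda>m. (if m = i then 1 else 0) + (if m = j then - 1 else 0)) =
        (\<lambda>m. (if m = i then 1 else 0) - (if m = j then 1 else (0 :: int)))" by auto
    finally show ?thesis .
  qed
  have pow: "U.cong (zpow (vK i * vKinv j) (vK j * vKinv i) n)
      (U.Kpr (\<lambda>m. n * ((if m = i then 1 else 0) - (if m = j then 1 else 0))))" for i j n
  proof (rule U.cong_sym, rule U.zpow_unique)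
    let ?g = "\<lambda>i j m. (if m = i then 1 else 0) - (if m = j then 1 else 0) :: int"
    show "U.cong (vK i * vKinv j * (vK j * vKinv i)) 1" "U.cong (vK j * vKinv i * (vK i * vKinv j)) 1"
      by (rule U.KK_inverse)+
    show "U.cong (U.Kpr (\<lambda>m. 0 * ?g i j m)) 1" by (simp add: U.Kpr_0)
    have *: "U.cong (U.Kpr (\<lambda>m. ?g i j m + n * ?g i' j' m)) (vK i * vKinv j * U.Kpr (\<lambda>m. n * ?g i' j' m))" for n i j i' j'
      by (rule U.cong_sym, rule U.cong_trans[OF U.cong_mult_right[OF KK] U.Kpr_mult])
    show "U.cong (U.Kpr (\<lambda>m. (n + 1) * ?g i j m)) (vK i * vKinv j * U.Kpr (\<lambda>m. n * ?g i j m))" for n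
      using *[of i j n i j] by (simp add: algebra_simps)
    have "(\<lambda>m. (n - 1) * ?g i j m) = (\<lambda>m. ?g j i m + n * ?g i j m)" for n
      by (auto simp: algebra_simps)
    then show "U.cong (U.Kpr (\<lambda>m. (n - 1) * ?g i j m)) (vK j * vKinv i * U.Kpr (\<lambda>m. n * ?g i j m))" for n
      using *[of j i n i j] by simp
  qed
  have "Phi (Ltor t) = zpow (vK \<alpha>\<^sub>1 * vKinv \<alpha>\<^sub>6) (vK \<alpha>\<^sub>6 * vKinv \<alpha>\<^sub>1) a * zpow (vK \<alpha>\<^sub>3 * vKinv \<alpha>\<^sub>5) (vK \<alpha>\<^sub>5 * vKinv \<alpha>\<^sub>3) b"
    by (simp add: Ltor_def t nc_subst_hom zpow_hom[of Phi])
  also have "U.cong \<dots> (U.Kpr (\<lambda>m. a * ((if m = \<alpha>\<^sub>1 then 1 else 0) - (if m = \<alpha>\<^sub>6 then 1 else 0)) +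
      b * ((if m = \<alpha>\<^sub>3 then 1 else 0) - (if m = \<alpha>\<^sub>5 then 1 else 0))))"
    by (rule U.cong_trans[OF U.cong_mult[OF pow pow] U.Kpr_mult])
  also have "(\<lambda>m. a * ((if m = \<alpha>\<^sub>1 then 1 else 0) - (if m = \<alpha>\<^sub>6 then 1 else 0)) +
      b * ((if m = \<alpha>\<^sub>3 then 1 else 0) - (if m = \<alpha>\<^sub>5 then 1 else 0))) = tor_vec t"
  proof
    show "a * ((if m = \<alpha>\<^sub>1 then 1 else 0) - (if m = \<alpha>\<^sub>6 then 1 else 0)) +
      b * ((if m = \<alpha>\<^sub>3 then 1 else 0) - (if m = \<alpha>\<^sub>5 then 1 else 0)) = tor_vec t m" for m
      by (cases m) (simp_all add: t)
  qed
  finally show ?thesis .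
qed

lemma tau_torus_Ltor: "tau_torus q \<sigma> (pk (Ltor t)) = pk (tau_hat \<sigma> (Ltor t))"
proof -
  have pk: "pk (Ltor t) = U.ucls (U.Kpr (tor_vec t))" for t
    using Phi_Ltor[of t] by (simp add: pk_def U.Uq.eq_iff U.cong_def)
  have "pk (tau_hat \<sigma> (Ltor t)) = pk (Ltor (tmap (tau_mat \<sigma>) t))"
    using tau_hat_Ltor by (simp add: pk_eq_iff)
  then show ?thesis by (simp add: pk U.tau_torus_Kpr tor_vec_tau)
qed

lemma torus_gens_pk: "torus_gens q = (\<lambda>i. pk (Ltor (tor_of i))) ` {\<alpha>\<^sub>1, \<alpha>\<^sub>6, \<alpha>\<^sub>3, \<alpha>\<^sub>5}"
  by (simp add: torus_gens_def KK_pk_simps Ltor_simps)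

lemma torus_gens_subset: "torus_gens q \<subseteq> kT\<theta> q"
  by (auto simp: kT\<theta>_def subalgebra_generated_def)

lemma is_tau_iff: "is_tau q r \<sigma> t \<longleftrightarrow> t \<in> algebra_auts (Uqk q) \<and> (\<forall>x. t (pk x) = pk (tau_hat \<sigma> x))"
proof
  assume t: "is_tau q r \<sigma> t"
  then have aut: "t \<in> algebra_auts (Uqk q)" by (simp add: is_tau_def Q.Aut_alg_simps)
  have "t (pk (ncvar g)) = pk (tau_gen \<sigma> g)" for g
  proof (cases g)
    case (GB j)
    then show ?thesis using t by (simp add: is_tau_def B_pk tau_B_pk)
  next
    case (GL i)
    have eq: "t (pk (Ltor (tor_of i))) = pk (tau_hat \<sigma> (Ltor (tor_of i)))"
    proof (cases "i \<in> {\<alpha>\<^sub>1, \<alpha>\<^sub>6, \<alpha>\<^sub>3, \<alpha>\<^sub>5}")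
      case True
      then have "pk (Ltor (tor_of i)) \<in> kT\<theta> q" using torus_gens_subset torus_gens_pk by blast
      then show ?thesis using t by (simp add: is_tau_def tau_torus_Ltor)
    next
      case False
      then have "tor_of i = (0, 0, 0)" by (cases i) auto
      then show ?thesis using Q.aut_simps(4)[OF aut] by (simp add: Ltor_0 Q.one tau_hat_def)
    qed
    have "pk (vL i) = pk (Ltor (tor_of i))"
      using cong_sym[OF Ltor_tor_of_cong] by (simp add: pk_eq_iff)
    moreover have "pk (tau_hat \<sigma> (Ltor (tor_of i))) = pk (tau_gen \<sigma> (GL i))"
      using tau_hat_Ltor by (simp add: pk_eq_iff)
    ultimately show ?thesis using eq GL by simp
  qed
  from Q.aut_determined[OF aut this] aut
  show "t \<in> algebra_auts (Uqk q) \<and> (\<forall>x. t (pk x) = pk (tau_hat \<sigma> x))" by (simp add: tau_hat_def)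
next
  interpret ring "Uq q" by (rule U.Uq_ring)
  assume t: "t \<in> algebra_auts (Uqk q) \<and> (\<forall>x. t (pk x) = pk (tau_hat \<sigma> x))"
  \<comment> \<open>The set where t agrees with the Lusztig automorphisms is a subalgebra; as it
    contains the torus generators, it contains \<open>kT\<theta> q\<close>.\<close>
  let ?V = "{x \<in> range pk. t x = tau_torus q \<sigma> x}"
  have V: "pk x \<in> ?V \<longleftrightarrow> pk (tau_hat \<sigma> x) = tau_torus q \<sigma> (pk x)" for x using t by auto
  have TT: "tau_torus q \<sigma> (pk (x * y)) = tau_torus q \<sigma> (pk x) \<otimes>\<^bsub>Uq q\<^esub> tau_torus q \<sigma> (pk y)"
    "tau_torus q \<sigma> (pk (x + y)) = tau_torus q \<sigma> (pk x) \<oplus>\<^bsub>Uq q\<^esub> tau_torus q \<sigma> (pk y)"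
    "tau_torus q \<sigma> (pk (ncconst c * x)) = c \<odot>\<^bsub>Uq q\<^esub> tau_torus q \<sigma> (pk x)"
    "tau_torus q \<sigma> (pk 1) = pk 1" for x y c
    using U.tau_torus_hom(1,2)[of \<sigma> "Phi x" "Phi y"] U.tau_torus_hom(3)[of \<sigma> c "Phi x"] U.tau_torus_hom(4)[of \<sigma>]
    by (simp_all add: pk_def[symmetric] pk_simps)
  have one: "tau_hat \<sigma> 1 = 1" by (simp add: tau_hat_def)
  have closed: "pk (x * y) \<in> ?V" "pk (x + y) \<in> ?V" "pk 1 \<in> ?V"
    if "pk x \<in> ?V" "pk y \<in> ?V" for x y
    by (simp_all only: V TT(1,2,4) that[unfolded V, symmetric] tau_hat_hom pk_simps one)
  have closed_smult: "pk (ncconst c * x) \<in> ?V" if "pk x \<in> ?V" for x c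
    by (simp only: V TT(3) that[unfolded V, symmetric] tau_hat_hom pk_simps)
  have "\<one>\<^bsub>Uq q\<^esub> \<in> ?V" by (simp add: pk_simps(5) t TT one)
  have "subring ?V (Uq q)"
  proof (rule subringI)
    show "?V \<subseteq> carrier (Uq q)" by (auto simp: pk_carrier)
    show "\<one>\<^bsub>Uq q\<^esub> \<in> ?V" by fact
    fix X Y assume X: "X \<in> ?V" and Y: "Y \<in> ?V"
    then obtain x y where xy: "X = pk x" "Y = pk y" by blast
    note c = closed[OF X[unfolded xy] Y[unfolded xy]]
    show "X \<otimes>\<^bsub>Uq q\<^esub> Y \<in> ?V" "X \<oplus>\<^bsub>Uq q\<^esub> Y \<in> ?V" using c by (simp_all only: xy pk_simps)
  next
    fix X assume X: "X \<in> ?V"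
    then obtain x where x: "X = pk x" by blast
    show "\<ominus>\<^bsub>Uq q\<^esub> X \<in> ?V"
      using closed_smult[OF X[unfolded x], of "- 1"] by (simp add: x pk_simps ncconst_uminus)
  qed
  moreover have "c \<odot>\<^bsub>Uq q\<^esub> X \<in> ?V" if X: "X \<in> ?V" for c X
  proof -
    obtain x where x: "X = pk x" using X by blast
    show ?thesis using closed_smult[OF X[unfolded x], of c] by (simp only: x pk_simps)
  qed
  ultimately have "?V \<in> subalgebras (Uq q)" unfolding subalgebras_def by blast
  moreover have "torus_gens q \<subseteq> ?V"
    using t by (auto simp: torus_gens_pk tau_torus_Ltor)
  ultimately have "kT\<theta> q \<subseteq> ?V" unfolding kT\<theta>_def subalgebra_generated_def by blast
  then show "is_tau q r \<sigma> t"
    using t by (auto simp: is_tau_def Q.Aut_alg_simps B_pk tau_B_pk tau_hat_def)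
qed

lemma ex1_tau: "\<exists>!t. is_tau q r \<sigma> t"
proof -
  have mem: "f x \<in> rel_ideal (ik_relations q)" if "ik_hom f" "x \<in> rel_ideal (ik_relations q)" for f x
    using ik_homD(4)[OF that(1), of x 0] that(2) by (simp add: cong_def ik_homD(5)[OF that(1)])
  have "\<exists>t\<in>algebra_auts (Uqk q). \<forall>x. t (pk x) = pk (tau_hat \<sigma> x)"
    by (rule Q.ex_aut[of "tau_hat \<sigma>" "tau_inv \<sigma>"])
      (use tau_inv_tau tau_tau_inv in \<open>auto simp: ik_homD(1-3)[OF tau_hat_ik_hom] ik_homD(1)[OF tau_inv_ik_hom]
        mem tau_hat_ik_hom tau_inv_ik_hom cong_def\<close>)
  then show ?thesis unfolding is_tau_iff by (auto intro: Q.aut_eqI)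
qed

text \<open>The relations of the braid group equate positive words, which evaluate to composites of
  the lifts; these agree by \<open>braid_agree\<close>.\<close>

lemma ex1_braid_hom:
  assumes "\<And>i. is_tau q r i (\<tau> i)"
  shows "\<exists>!h. h \<in> hom Br_f4 (Aut_alg (Uqk q)) \<inter> extensional (carrier Br_f4) \<and> (\<forall>i. h (s_bar i) = \<tau> i)"
proof -
  interpret G: group "Aut_alg (Uqk q)" by (rule Q.Aut_alg_group)
  have \<tau>: "\<tau> i \<in> carrier (Aut_alg (Uqk q))" "\<tau> i (pk x) = pk (tau_hat i x)" for i x
    using assms by (simp_all add: is_tau_iff Q.Aut_alg_simps)
  have word: "G.eval_word \<tau> (pos_word w) (pk x) = pk (tau_word w x)" for w x
  proof (induction w)
    case (Cons s w)
    have "(\<tau> s \<otimes>\<^bsub>Aut_alg (Uqk q)\<^esub> G.eval_word \<tau> (pos_word w)) (pk x) = \<tau> s (G.eval_word \<tau> (pos_word w) (pk x))"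
      using \<tau>(1) G.eval_word_closed[of \<tau> "pos_word w"] by (intro Q.Aut_alg_simps(3)) (simp_all add: Q.Aut_alg_simps(1))
    then show ?case by (simp add: Cons \<tau>(2)) (simp add: tau_word_def)
  qed (simp add: Q.Aut_alg_simps tau_word_def)
  have rel: "G.eval_word \<tau> (pos_word v) = G.eval_word \<tau> (pos_word w)" if "braid_ok ik_table v w" for v w
    by (rule Q.aut_eqI)
      (use \<tau>(1) G.eval_word_closed[of \<tau>] braid_agree[OF that] in \<open>simp_all only: Q.Aut_alg_simps(1)[symmetric] word pk_eq_iff\<close>)
  show ?thesis
    unfolding Br_f4_def s_bar_def
  proof (rule G.presented_group_universal[OF \<tau>(1)])
    fix u v assume "(u, v) \<in> f4_relations"
    then show "G.eval_word \<tau> u = G.eval_word \<tau> v"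
      unfolding f4_relations_def using rel[OF braid_ok(1)] rel[OF braid_ok(2)] rel[OF braid_ok(3)]
        rel[OF braid_ok(4)] rel[OF braid_ok(5)] rel[OF braid_ok(6)]
      by (elim insertE emptyE) (simp_all del: G.eval_word.simps list.map)
  qed
qed

end

theorem theorem4p10:
  fixes q r :: "'k::field"
  assumes "q \<noteq> 0"
    and "\<And>n::nat. n > 0 \<Longrightarrow> q ^ n \<noteq> 1"
    and "r ^ 2 = q"
  shows "(\<forall>i. \<exists>!t. is_tau q r i t) \<and>
         (\<forall>\<tau>. (\<forall>i. is_tau q r i (\<tau> i)) \<longrightarrow>
            (\<exists>!h. h \<in> hom Br_f4 (Aut_alg (Uqk q)) \<inter> extensional (carrier Br_f4) \<and>
                  (\<forall>i. h (s_bar i) = \<tau> i)))"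
proof -
  interpret ik q r
    using assms by (intro ik.intro verma_action.intro q_param.intro)
  show ?thesis using ex1_tau ex1_braid_hom by blast
qed

end
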